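(* Let $p,q$ be positive integers. There is a one-to-one correspondence between the $\tau$-equivalence classes of tilting bundles in $\mathrm{coh}\text{-}\mathbb{X}(p,q)$ and the lattice paths from $(0,0)$ to $(p,q)$. Consequently, the number of $\tau$-equivalence classes of tilting bundles in $\mathrm{coh}\text{-}\mathbb{X}(p,q)$ is $$\binom{p+q}{p}.$$
   Context: $\Bbbk$ is an algebraically closed field. $\mathbb{L}=\mathbb{L}(p,q)$ is the abelian group generated by $\vec x_1,\vec x_2$ with relation $p\vec x_1=q\vec x_2=:\vec c$; $\vec\omega=-(\vec x_1+\vec x_2)$. $S=\Bbbk[x_1,x_2]$ is $\mathbb{L}$-graded by $\deg x_i=\vec x_i$. $\mathrm{coh}\text{-}\mathbb{X}(p,q)$, the category of coherent sheaves on the weighted projective line of type $(p,q)$, is the quotient of the category of finitely generated $\mathbb{L}$-graded $S$-modules by the Serre subcategory of finite-dimensional ones; it is a hereditary abelian Hom-finite category whose Grothendieck group has rank $p+q$, and $\tau$ is the auto-equivalence $X\mapsto X(\vec\omega)$ (Auslander–Reiten translation). Vector bundles are the sheaves without simple subobjects; the indecomposable ones are the line bundles $\mathcal{O}(\vec x)$, $\vec x\in\mathbb{L}$. A tilting sheaf is a (multiplicity-free) sheaf $T$ with $\mathrm{Ext}^1(T,T)=0$ having $p+q$ pairwise non-isomorphic indecomposable direct summands; a tilting bundle is a tilting sheaf that is a vector bundle; tilting sheaves are considered up to isomorphism. Two tilting sheaves $T,T'$ are $\tau$-equivalent if $T'=\tau^{-k}T$ (up to isomorphism) for some $k\in\mathbb{Z}$.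 A lattice path from $(x_1,y_1)$ to $(x_k,y_k)$ is a sequence of points $(x_1,y_1),\dots,(x_k,y_k)$ of $\mathbb{Z}^2$ with $(x_{i+1},y_{i+1})\in\{(x_i,y_i+1),(x_i+1,y_i)\}$ for all $1\le i\le k-1$. *)

theory Defs
  imports
    "HOL-Computational_Algebra.Polynomial"
    "HOL-Algebra.Module"
    "HOL-Algebra.Coset"
    "HOL-Algebra.Generated_Groups"
    "HOL-Algebra.Elementary_Groups"
    "HOL-Algebra.Algebraic_Closure_Type"
begin

section \<open>The grading group and the graded polynomial ring\<close>

definition Z2 :: "(int \<times> int) monoid" where
  "Z2 = integer_group \<times>\<times> integer_group"

text \<open>The abelian group on two generators subject to \<open>p x1 = q x2\<close>, in the multiplicative
  notation of HOL-Algebra.\<close>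

definition relators :: "nat \<Rightarrow> nat \<Rightarrow> (int \<times> int) set" where
  "relators p q = generate Z2 {(int p, - int q)}"

type_synonym degree = "(int \<times> int) set"

definition LL :: "nat \<Rightarrow> nat \<Rightarrow> degree monoid" where
  "LL p q = Z2 Mod relators p q"

definition vx1 :: "nat \<Rightarrow> nat \<Rightarrow> degree" where
  "vx1 p q = relators p q #>\<^bsub>Z2\<^esub> (1, 0)"

definition vx2 :: "nat \<Rightarrow> nat \<Rightarrow> degree" where
  "vx2 p q = relators p q #>\<^bsub>Z2\<^esub> (0, 1)"

definition vomega :: "nat \<Rightarrow> nat \<Rightarrow> degree" where
  "vomega p q = inv\<^bsub>LL p q\<^esub> (vx1 p q \<otimes>\<^bsub>LL p q\<^esub> vx2 p q)"

text \<open>\<open>k[x1, x2]\<close> is read as \<open>k[x1][x2]\<close>: the coefficient of \<open>x1^a x2^b\<close> in \<open>P\<close> is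
  \<open>coeff (coeff P b) a\<close>, and the scalar \<open>c\<close> is the polynomial \<open>[:[:c:]:]\<close>.\<close>

definition SS :: "('k::field) poly poly ring" where
  "SS = ring_of_type_algebra"

definition S_grade :: "nat \<Rightarrow> nat \<Rightarrow> degree \<Rightarrow> ('k::field) poly poly set" where
  "S_grade p q x = {P. \<forall>a b. coeff (coeff P b) a \<noteq> 0 \<longrightarrow>
     (vx1 p q [^]\<^bsub>LL p q\<^esub> (a::nat)) \<otimes>\<^bsub>LL p q\<^esub> (vx2 p q [^]\<^bsub>LL p q\<^esub> (b::nat)) = x}"


section \<open>Graded modules\<close>

text \<open>The fields \<open>mult\<close> and \<open>one\<close> which HOL-Algebra's module records inherit from rings
  carry no information, and neither do the values of \<open>grade\<close> outside \<open>carrier (LL p q)\<close>.\<close>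

record ('a, 'b) gmod = "('a, 'b) module" +
  grade :: "degree \<Rightarrow> 'b set"

definition graded_module ::
    "nat \<Rightarrow> nat \<Rightarrow> (('k::field) poly poly, 'b) gmod \<Rightarrow> bool" where
  "graded_module p q M \<longleftrightarrow>
     module SS M \<and>
     (\<forall>x\<in>carrier (LL p q). subgroup (grade M x) (add_monoid M)) \<and>
     (\<forall>x\<in>carrier (LL p q). \<forall>y\<in>carrier (LL p q). \<forall>s\<in>S_grade p q x. \<forall>m\<in>grade M y.
        s \<odot>\<^bsub>M\<^esub> m \<in> grade M (x \<otimes>\<^bsub>LL p q\<^esub> y)) \<and>
     (\<forall>m\<in>carrier M. \<exists>!c. c \<in> (\<Pi>\<^sub>E x\<in>carrier (LL p q). grade M x) \<and>
        finite {x \<in> carrier (LL p q). c x \<noteq> \<zero>\<^bsub>M\<^esub>} \<and>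
        m = finsum M c {x \<in> carrier (LL p q). c x \<noteq> \<zero>\<^bsub>M\<^esub>})"

definition finitely_generated :: "(('k::field) poly poly, 'b) gmod \<Rightarrow> bool" where
  "finitely_generated M \<longleftrightarrow>
     (\<exists>A. finite A \<and> A \<subseteq> carrier M \<and>
        (\<forall>H. submodule H (SS :: 'k poly poly ring) M \<and> A \<subseteq> H \<longrightarrow> H = carrier M))"

definition graded_submodule ::
    "nat \<Rightarrow> nat \<Rightarrow> 'b set \<Rightarrow> (('k::field) poly poly, 'b) gmod \<Rightarrow> bool" where
  "graded_submodule p q N M \<longleftrightarrow>
     submodule N (SS :: 'k poly poly ring) M \<and>
     (\<forall>n\<in>N. \<exists>c. (\<forall>x\<in>carrier (LL p q). c x \<in> N \<inter> grade M x) \<and>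
        finite {x \<in> carrier (LL p q). c x \<noteq> \<zero>\<^bsub>M\<^esub>} \<and>
        n = finsum M c {x \<in> carrier (LL p q). c x \<noteq> \<zero>\<^bsub>M\<^esub>})"

text \<open>\<open>N / N'\<close> is finite-dimensional over \<open>k\<close>.\<close>

definition fin_dim_quot ::
    "(('k::field) poly poly, 'b) gmod \<Rightarrow> 'b set \<Rightarrow> 'b set \<Rightarrow> bool" where
  "fin_dim_quot M N N' \<longleftrightarrow>
     (\<exists>B. finite B \<and> B \<subseteq> N \<and>
        (\<forall>n\<in>N. \<exists>c :: 'b \<Rightarrow> 'k. \<exists>n'\<in>N'.
           n = n' \<oplus>\<^bsub>M\<^esub> finsum M (\<lambda>b. [:[:c b:]:] \<odot>\<^bsub>M\<^esub> b) B))"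

definition gsum ::
    "('a, 'b) gmod \<Rightarrow> ('a, 'c) gmod \<Rightarrow> ('a, 'b \<times> 'c) gmod" where
  "gsum M N =
     \<lparr> carrier = carrier M \<times> carrier N,
       monoid.mult = (\<lambda>_ _. undefined),
       monoid.one = undefined,
       ring.zero = (\<zero>\<^bsub>M\<^esub>, \<zero>\<^bsub>N\<^esub>),
       ring.add = (\<lambda>(m, n) (m', n'). (m \<oplus>\<^bsub>M\<^esub> m', n \<oplus>\<^bsub>N\<^esub> n')),
       module.smult = (\<lambda>s (m, n). (s \<odot>\<^bsub>M\<^esub> m, s \<odot>\<^bsub>N\<^esub> n)),
       grade = (\<lambda>x. grade M x \<times> grade N x) \<rparr>"

text \<open>\<open>M(x)\<close>, with \<open>M(x)_y = M_{x+y}\<close>.\<close>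

definition gshift ::
    "nat \<Rightarrow> nat \<Rightarrow> degree \<Rightarrow> ('a, 'b) gmod \<Rightarrow> ('a, 'b) gmod" where
  "gshift p q x M = M\<lparr>grade := (\<lambda>y. grade M (x \<otimes>\<^bsub>LL p q\<^esub> y))\<rparr>"


section \<open>Notions from category theory\<close>

text \<open>\<open>Cmp C U Y Z g f\<close> is the composite of \<open>f : U \<rightarrow> Y\<close> and \<open>g : Y \<rightarrow> Z\<close>.\<close>

record ('o, 'm) cat =
  Ob :: "'o set"
  Mor :: "'o \<Rightarrow> 'o \<Rightarrow> 'm set"
  Idm :: "'o \<Rightarrow> 'm"
  Cmp :: "'o \<Rightarrow> 'o \<Rightarrow> 'o \<Rightarrow> 'm \<Rightarrow> 'm \<Rightarrow> 'm"

definition iso_mor :: "('o, 'm) cat \<Rightarrow> 'o \<Rightarrow> 'o \<Rightarrow> 'm \<Rightarrow> bool" where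
  "iso_mor C U Y f \<longleftrightarrow> f \<in> Mor C U Y \<and>
     (\<exists>g\<in>Mor C Y U. Cmp C U Y U g f = Idm C U \<and> Cmp C Y U Y f g = Idm C Y)"

definition isomorphic :: "('o, 'm) cat \<Rightarrow> 'o \<Rightarrow> 'o \<Rightarrow> bool" where
  "isomorphic C U Y \<longleftrightarrow> (\<exists>f. iso_mor C U Y f)"

definition mono_mor :: "('o, 'm) cat \<Rightarrow> 'o \<Rightarrow> 'o \<Rightarrow> 'm \<Rightarrow> bool" where
  "mono_mor C U Y f \<longleftrightarrow> f \<in> Mor C U Y \<and>
     (\<forall>W\<in>Ob C. \<forall>g\<in>Mor C W U. \<forall>h\<in>Mor C W U.
        Cmp C W U Y f g = Cmp C W U Y f h \<longrightarrow> g = h)"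

definition zero_object :: "('o, 'm) cat \<Rightarrow> 'o \<Rightarrow> bool" where
  "zero_object C Z \<longleftrightarrow> Z \<in> Ob C \<and>
     (\<forall>U\<in>Ob C. (\<exists>!f. f \<in> Mor C U Z) \<and> (\<exists>!f. f \<in> Mor C Z U))"

definition zero_mor :: "('o, 'm) cat \<Rightarrow> 'o \<Rightarrow> 'o \<Rightarrow> 'm \<Rightarrow> bool" where
  "zero_mor C U Y f \<longleftrightarrow>
     (\<exists>Z. zero_object C Z \<and> (\<exists>g\<in>Mor C U Z. \<exists>h\<in>Mor C Z Y. f = Cmp C U Z Y h g))"

definition is_kernel :: "('o, 'm) cat \<Rightarrow> 'o \<Rightarrow> 'o \<Rightarrow> 'o \<Rightarrow> 'm \<Rightarrow> 'm \<Rightarrow> bool" where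
  "is_kernel C K U Y i f \<longleftrightarrow>
     i \<in> Mor C K U \<and> f \<in> Mor C U Y \<and> zero_mor C K Y (Cmp C K U Y f i) \<and>
     (\<forall>W\<in>Ob C. \<forall>g\<in>Mor C W U. zero_mor C W Y (Cmp C W U Y f g) \<longrightarrow>
        (\<exists>!h. h \<in> Mor C W K \<and> Cmp C W K U i h = g))"

definition is_cokernel :: "('o, 'm) cat \<Rightarrow> 'o \<Rightarrow> 'o \<Rightarrow> 'o \<Rightarrow> 'm \<Rightarrow> 'm \<Rightarrow> bool" where
  "is_cokernel C U Y Q f e \<longleftrightarrow>
     f \<in> Mor C U Y \<and> e \<in> Mor C Y Q \<and> zero_mor C U Q (Cmp C U Y Q e f) \<and>
     (\<forall>W\<in>Ob C. \<forall>g\<in>Mor C Y W. zero_mor C U W (Cmp C U Y W g f) \<longrightarrow>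
        (\<exists>!h. h \<in> Mor C Q W \<and> Cmp C Y Q W h e = g))"

definition short_exact :: "('o, 'm) cat \<Rightarrow> 'o \<Rightarrow> 'o \<Rightarrow> 'o \<Rightarrow> 'm \<Rightarrow> 'm \<Rightarrow> bool" where
  "short_exact C A E B f g \<longleftrightarrow>
     A \<in> Ob C \<and> E \<in> Ob C \<and> B \<in> Ob C \<and> is_kernel C A E B f g \<and> is_cokernel C A E B f g"

text \<open>\<open>Ext^1(B, A) = 0\<close> for the Yoneda Ext group, whose zero element is the class of the
  split extensions of \<open>B\<close> by \<open>A\<close>.\<close>

definition Ext1_zero :: "('o, 'm) cat \<Rightarrow> 'o \<Rightarrow> 'o \<Rightarrow> bool" where
  "Ext1_zero C B A \<longleftrightarrow>
     (\<forall>E f g. short_exact C A E B f g \<longrightarrow>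
        (\<exists>s\<in>Mor C B E. Cmp C B E B g s = Idm C B))"

text \<open>Direct sums are coproducts, as usual in additive categories.\<close>

definition direct_sum :: "('o, 'm) cat \<Rightarrow> 'i set \<Rightarrow> ('i \<Rightarrow> 'o) \<Rightarrow> 'o \<Rightarrow> bool" where
  "direct_sum C I U T \<longleftrightarrow>
     (\<forall>i\<in>I. U i \<in> Ob C) \<and> T \<in> Ob C \<and>
     (\<exists>\<iota>. (\<forall>i\<in>I. \<iota> i \<in> Mor C (U i) T) \<and>
        (\<forall>Y\<in>Ob C. \<forall>\<phi>. (\<forall>i\<in>I. \<phi> i \<in> Mor C (U i) Y) \<longrightarrow>
           (\<exists>!h. h \<in> Mor C T Y \<and> (\<forall>i\<in>I. Cmp C (U i) T Y h (\<iota> i) = \<phi> i))))"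

definition indecomposable :: "('o, 'm) cat \<Rightarrow> 'o \<Rightarrow> bool" where
  "indecomposable C U \<longleftrightarrow> U \<in> Ob C \<and> \<not> zero_object C U \<and>
     (\<forall>Y. direct_sum C {..<2::nat} Y U \<longrightarrow> zero_object C (Y 0) \<or> zero_object C (Y 1))"

definition simple_object :: "('o, 'm) cat \<Rightarrow> 'o \<Rightarrow> bool" where
  "simple_object C U \<longleftrightarrow> U \<in> Ob C \<and> \<not> zero_object C U \<and>
     (\<forall>Y\<in>Ob C. \<forall>f. mono_mor C Y U f \<longrightarrow> zero_object C Y \<or> iso_mor C Y U f)"


section \<open>Coherent sheaves on the weighted projective line of type (p,q)\<close>

text \<open>A morphism \<open>M \<rightarrow> N\<close> in the Serre quotient is an element of the colimit of
  \<open>Hom(M', N/N')\<close> over graded submodules \<open>M'\<close> of \<open>M\<close> and \<open>N'\<close> of \<open>N\<close> with \<open>M/M'\<close> and \<open>N'\<close>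
  finite-dimensional. A graded homomorphism \<open>f : M' \<rightarrow> N/N'\<close> is encoded by its graph
  \<open>{(m, n). m \<in> M', n \<in> f m}\<close>. These graphs are the graded submodules \<open>R\<close> of the direct sum of
  \<open>M\<close> and \<open>N\<close> whose domain \<open>M'\<close> and indeterminacy \<open>N' = {n. (0, n) \<in> R}\<close> are as above.\<close>

definition frac_hom ::
    "nat \<Rightarrow> nat \<Rightarrow> (('k::field) poly poly, 'b) gmod \<Rightarrow> ('k poly poly, 'b) gmod \<Rightarrow>
     ('b \<times> 'b) set set" where
  "frac_hom p q M N = {R. graded_submodule p q R (gsum M N) \<and>
     fin_dim_quot M (carrier M) (Domain R) \<and>
     fin_dim_quot N (R `` {\<zero>\<^bsub>M\<^esub>}) {\<zero>\<^bsub>N\<^esub>}}"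

text \<open>The image of \<open>R\<close> under the transition map to the pair \<open>(M', N')\<close>: restrict to \<open>M'\<close> and
  compose with the projection to \<open>N/N'\<close>.\<close>

definition transition ::
    "('a, 'b) gmod \<Rightarrow> 'b set \<Rightarrow> 'b set \<Rightarrow> ('b \<times> 'b) set \<Rightarrow> ('b \<times> 'b) set" where
  "transition N M' N' R = {(m, n \<oplus>\<^bsub>N\<^esub> n') | m n n'. m \<in> M' \<and> (m, n) \<in> R \<and> n' \<in> N'}"

definition frac_equiv ::
    "nat \<Rightarrow> nat \<Rightarrow> (('k::field) poly poly, 'b) gmod \<Rightarrow> ('k poly poly, 'b) gmod \<Rightarrow>
     (('b \<times> 'b) set \<times> ('b \<times> 'b) set) set" where
  "frac_equiv p q M N = {(R, R'). R \<in> frac_hom p q M N \<and> R' \<in> frac_hom p q M N \<and>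
     (\<exists>M' N'. graded_submodule p q M' M \<and> fin_dim_quot M (carrier M) M' \<and>
        graded_submodule p q N' N \<and> fin_dim_quot N N' {\<zero>\<^bsub>N\<^esub>} \<and>
        M' \<subseteq> Domain R \<inter> Domain R' \<and>
        R `` {\<zero>\<^bsub>M\<^esub>} \<union> R' `` {\<zero>\<^bsub>M\<^esub>} \<subseteq> N' \<and>
        transition N M' N' R = transition N M' N' R')}"

text \<open>The composite of \<open>f : M' \<rightarrow> N/N'\<close> and \<open>g : N'' \<rightarrow> P/P'\<close> in the quotient category is
  represented by \<open>f^{-1}((N'' + N')/N') \<rightarrow> (N'' + N')/N' = N''/(N'' \<inter> N') \<rightarrow> P/g(N'' \<inter> N')\<close>, the
  last term being the quotient of \<open>P/P'\<close> by the image of \<open>N'' \<inter> N'\<close>. Its graph is the relational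
  composite of the graphs.

  The objects are the finitely generated graded modules whose underlying set lies in a
  universe \<open>'b\<close>.\<close>

definition coh ::
    "nat \<Rightarrow> nat \<Rightarrow> ((('k::field) poly poly, 'b) gmod, ('b \<times> 'b) set set) cat" where
  "coh p q =
     \<lparr> Ob = {M. graded_module p q M \<and> finitely_generated M},
       Mor = (\<lambda>M N. frac_hom p q M N // frac_equiv p q M N),
       Idm = (\<lambda>M. frac_equiv p q M M `` {Id_on (carrier M)}),
       Cmp = (\<lambda>M N P G F. \<Union>f\<in>F. \<Union>g\<in>G. frac_equiv p q M P `` {f O g}) \<rparr>"

text \<open>The universe used below contains (the underlying set of) every free module of finite rank
  over \<open>k[x1, x2]\<close>, hence, choosing representatives of cosets, an isomorphic copy of every
  finitely generated graded module.\<close>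

type_synonym 'k sheaf = "('k poly poly, nat \<Rightarrow> 'k poly poly) gmod"

abbreviation cohX ::
    "nat \<Rightarrow> nat \<Rightarrow> (('k::field) sheaf,
       ((nat \<Rightarrow> 'k poly poly) \<times> (nat \<Rightarrow> 'k poly poly)) set set) cat" where
  "cohX p q \<equiv> coh p q"

definition vector_bundle :: "nat \<Rightarrow> nat \<Rightarrow> ('k::field) sheaf \<Rightarrow> bool" where
  "vector_bundle p q U \<longleftrightarrow> U \<in> Ob (cohX p q) \<and>
     \<not> (\<exists>Y f. simple_object (cohX p q) Y \<and> mono_mor (cohX p q) Y U f)"

definition tilting_sheaf :: "nat \<Rightarrow> nat \<Rightarrow> ('k::field) sheaf \<Rightarrow> bool" where
  "tilting_sheaf p q T \<longleftrightarrow> T \<in> Ob (cohX p q) \<and> Ext1_zero (cohX p q) T T \<and>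
     (\<exists>U. direct_sum (cohX p q) {..<p + q} U T \<and>
        (\<forall>i<p + q. indecomposable (cohX p q) (U i)) \<and>
        (\<forall>i<p + q. \<forall>j<p + q. i \<noteq> j \<longrightarrow> \<not> isomorphic (cohX p q) (U i) (U j)))"

definition tilting_bundles :: "nat \<Rightarrow> nat \<Rightarrow> ('k::field) sheaf set" where
  "tilting_bundles p q = {T. tilting_sheaf p q T \<and> vector_bundle p q T}"

definition tau_power :: "nat \<Rightarrow> nat \<Rightarrow> int \<Rightarrow> ('k::field) sheaf \<Rightarrow> 'k sheaf" where
  "tau_power p q k U = gshift p q (vomega p q [^]\<^bsub>LL p q\<^esub> k) U"

definition tau_equiv :: "nat \<Rightarrow> nat \<Rightarrow> (('k::field) sheaf \<times> 'k sheaf) set" where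
  "tau_equiv p q = {(T, T'). T \<in> tilting_bundles p q \<and> T' \<in> tilting_bundles p q \<and>
     (\<exists>k::int. isomorphic (cohX p q) T' (tau_power p q (- k) T))}"

definition tau_classes :: "nat \<Rightarrow> nat \<Rightarrow> ('k::field) sheaf set set" where
  "tau_classes p q = tilting_bundles p q // tau_equiv p q"


section \<open>Lattice paths\<close>

definition lattice_paths :: "int \<times> int \<Rightarrow> int \<times> int \<Rightarrow> (int \<times> int) list set" where
  "lattice_paths a b = {ps. ps \<noteq> [] \<and> hd ps = a \<and> last ps = b \<and>
     (\<forall>i. Suc i < length ps \<longrightarrow>
        ps ! Suc i \<in> {(fst (ps ! i), snd (ps ! i) + 1), (fst (ps ! i) + 1, snd (ps ! i))})}"

end

theory Submission imports Defs "HOL-Library.Product_Plus" begin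

text \<open>Write \<open>x^k\<close> for a power of either variable. A graded subquotient is finite-dimensional iff each of its
elements is killed by powers of both variables, so a morphism of the quotient category is a graded
relation \<open>R\<close> between modules, taken up to such torsion. A sheaf without simple subobjects has no torsion
elements in this sense: over an algebraically closed field a homogeneous annihilator factors into primes
\<open>x1\<close>, \<open>x2\<close>, \<open>x1^p - c x2^q\<close>, and an element killed by one of these generates a simple subobject. Such a
sheaf embeds in a free module as a saturated submodule, which is again free, so vector bundles are sums of
line bundles \<open>O(z)\<close>. Such a sum has no self-extensions iff no two of its degrees differ by \<open>a x1 + b x2\<close>
with \<open>a, b > 0\<close>. On the cover \<open>Z^2\<close> of the degree group, a set of \<open>p + q\<close> degrees with this property is a
bi-infinite lattice path with period \<open>(p, -q)\<close> up to a change of coordinates, \<open>\<tau>\<close> translates it along the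
diagonal, and a period of the path starting at the origin determines it up to translation.\<close>

section \<open>Degrees and the graded polynomial ring\<close>

text \<open>The obstacle is that a morphism is only partially defined, and only up to
  finite-dimensional indeterminacy, so it cannot be evaluated on a given element. Every pointwise
  argument therefore runs after multiplication by a power of a variable, once for each variable, and
  the two conclusions are recombined. On free modules the recombination is effective because powers
  of \<open>X1\<close> and \<open>X2\<close> form a regular sequence: a fraction with denominators
  in both variables is a polynomial. This gives matrices for the morphisms between sums of line
  bundles, freeness of saturated submodules, and both directions of the extension criterion.
  Algebraic closedness enters through the splitting of forms in \<open>x1^p\<close> and
  \<open>x2^q\<close> into linear factors. The number p + q of summands fits the geometry of
  \<open>Z^2\<close> as follows: the relator (p, -q) changes the difference of the coordinates by p
  + q, so p + q distinct degrees with at most one point on each diagonal must meet every diagonal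
  exactly once.\<close>

locale weight_type =
 fixes p q :: nat
 assumes p_pos: "p > 0" and q_pos: "q > 0"
begin

abbreviation L :: "degree monoid" where "L \<equiv> LL p q"

text \<open>The projection of the covering lattice \<open>Z^2\<close> onto the degree group. Degrees
  are represented by points of \<open>Z^2\<close> throughout, with \<open>D_eq_iff\<close> as the
  working criterion for their equality.\<close>

definition D :: "int \<times> int => degree" where
 "D u = relators p q #>\<^bsub>Z2\<^esub> u"

lemma Z2_simps [simp]: "carrier Z2 = UNIV" "u \<otimes>\<^bsub>Z2\<^esub> v = u + v" "\<one>\<^bsub>Z2\<^esub> = 0"
 by (auto simp: Z2_def DirProd_def integer_group_def prod_eq_iff split: prod.splits)

lemma Z2_group: "comm_group Z2"
 by (rule group.group_comm_groupI[OF DirProd_group[of integer_group integer_group, folded Z2_def]])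
   (auto simp: add.commute)

sublocale Z2: comm_group Z2 by (rule Z2_group)

lemma Z2_inv [simp]: "inv\<^bsub>Z2\<^esub> u = - u"
 by (rule Z2.inv_equality) auto

lemma Z2_int_pow: "u [^]\<^bsub>Z2\<^esub> (k::int) = (k * fst u, k * snd u)"
proof -
 have nat: "u [^]\<^bsub>Z2\<^esub> (n::nat) = (int n * fst u, int n * snd u)" for n
  by (induction n) (auto simp: nat_pow_def prod_eq_iff zero_prod_def algebra_simps)
 show ?thesis
 proof (cases k)
  case (neg n)
  show ?thesis
   unfolding neg by (subst Z2.int_pow_neg) (simp_all only: int_pow_int nat Z2_inv Z2_simps UNIV_I, simp add: prod_eq_iff algebra_simps)
 qed (simp add: nat int_pow_int)
qed

lemma relators_eq: "relators p q = range (\<lambda>k. (k * int p, - (k * int q)))"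
 unfolding relators_def by (auto simp: Z2.generate_pow Z2_int_pow)

lemma normal_relators: "relators p q \<lhd> Z2"
proof (rule Z2.normal_invI)
 show "subgroup (relators p q) Z2"
  unfolding relators_def by (rule Z2.generate_is_subgroup) auto
qed auto

lemma D_eq_iff: "D u = D v \<longleftrightarrow> (\<exists>k. u = v + (k * int p, - (k * int q)))"
proof -
 have "subgroup (relators p q) Z2"
  using normal_relators normal_imp_subgroup by blast
 then have "D u = D v \<longleftrightarrow> u \<in> D v"
  unfolding D_def using Z2.repr_independence[of u "relators p q" v] Z2.rcos_self[of u "relators p q"]
  by auto
 then show ?thesis
  by (auto simp: D_def r_coset_def relators_eq add.commute)
qed

lemma carrier_L: "carrier L = range D"
 by (auto simp: LL_def FactGroup_def RCOSETS_def D_def)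

lemma D_in_L [simp]: "D u \<in> carrier L"
 by (simp add: carrier_L)

lemma L_cases: assumes "x \<in> carrier L" obtains u where "x = D u"
 using assms by (auto simp: carrier_L)

lemma L_mult [simp]: "D u \<otimes>\<^bsub>L\<^esub> D v = D (u + v)"
 unfolding D_def LL_def using normal.rcos_sum[OF normal_relators, of u v]
 by (simp add: FactGroup_def)

lemma L_comm_group: "comm_group L"
 unfolding LL_def using normal_relators Z2.abelian_FactGroup normal_imp_subgroup by blast

sublocale L: comm_group L by (rule L_comm_group)

lemma L_one: "\<one>\<^bsub>L\<^esub> = D 0"
 by (metis D_in_L L.one_closed L.l_one L_cases L_mult L.r_one add.right_neutral)

lemma L_inv [simp]: "inv\<^bsub>L\<^esub> D u = D (- u)"
 by (rule L.inv_equality) (auto simp: L_one)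

lemma vx_eq: "vx1 p q = D (1, 0)" "vx2 p q = D (0, 1)"
 by (simp_all add: vx1_def vx2_def D_def)

lemma D_nat_pow: "D u [^]\<^bsub>L\<^esub> (n::nat) = D (int n * fst u, int n * snd u)"
 by (induction n) (auto simp: L_one zero_prod_def algebra_simps plus_prod_def)

lemma D_int_pow: "D u [^]\<^bsub>L\<^esub> (k::int) = D (k * fst u, k * snd u)"
proof (cases k)
 case (neg n)
 then show ?thesis
  by (simp only: neg L.int_pow_neg D_in_L int_pow_int D_nat_pow L_inv) (simp add: algebra_simps)
qed (simp add: int_pow_int D_nat_pow)

lemma vomega_pow: "vomega p q [^]\<^bsub>L\<^esub> (k::int) = D (- k, - k)"
 by (simp add: vomega_def vx_eq D_int_pow)

lemma D_add_cancel: "D (u + v) = D (w + v) \<longleftrightarrow> D u = D w"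
 by (auto simp: D_eq_iff algebra_simps)

lemma D_diff_eq: "D (u - v) = D w \<longleftrightarrow> D u = D (w + v)"
 by (metis D_add_cancel diff_add_cancel)

text \<open>Both coordinates of the relator (p, -q) are non-zero, so moving along one axis never
  returns to the same degree. Hence the powers of one variable have pairwise distinct
  degrees.\<close>

lemma D_axis1: "D (a, b) = D (a', b) \<longleftrightarrow> a = a'"
 using q_pos by (auto simp: D_eq_iff)

lemma D_axis2: "D (a, b) = D (a, b') \<longleftrightarrow> b = b'"
 using p_pos by (auto simp: D_eq_iff)

text \<open>The two coordinates of a multiple of the relator have opposite signs. This makes the
  grading positive: the polynomials of degree 0 are the scalars (\<open>Sg_const\<close>).\<close>

lemma D_nonneg_zero: "D (int a, int b) = D 0 \<longleftrightarrow> a = 0 \<and> b = 0"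
proof
 assume "D (int a, int b) = D 0"
 then obtain k where k: "int a = k * int p" "int b = - (k * int q)"
  by (auto simp: D_eq_iff)
 have "k * int p \<ge> 0" "k * int q \<le> 0"
  using k by (metis of_nat_0_le_iff) (use k in linarith)
 then have "k = 0"
  using p_pos q_pos by (auto simp: zero_le_mult_iff mult_le_0_iff)
 then show "a = 0 \<and> b = 0"
  using k by auto
qed (simp add: zero_prod_def)

end

section \<open>Coefficients, divisibility by the variables, and homogeneous parts of
  polynomials\<close>

definition cf :: "'k::field poly poly => nat => nat => 'k" where
 "cf P a b = coeff (coeff P b) a"

definition X1 :: "'k::field poly poly" where "X1 = [:[:0, 1:]:]"
definition X2 :: "'k::field poly poly" where "X2 = [:0, 1:]"

abbreviation VV :: "'k::field poly poly set" where "VV \<equiv> {X1, X2}"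

definition cst :: "'k::field => 'k poly poly" where "cst c = [:[:c:]:]"

lemma cf_eqI: "(!!a b. cf P a b = cf Q a b) ==> P = Q"
 by (simp add: cf_def poly_eq_iff)

lemma cf_simps [simp]:
 "cf 0 a b = 0" "cf (P + Q) a b = cf P a b + cf Q a b" "cf (P - Q) a b = cf P a b - cf Q a b"
 "cf (- P) a b = - cf P a b" "cf (cst c * P) a b = c * cf P a b"
 by (simp_all add: cf_def cst_def)

lemma cf_cst: "cf (cst c) a b = (if a = 0 \<and> b = 0 then c else 0)"
 by (auto simp: cf_def cst_def coeff_pCons split: nat.splits)

lemma cf_one: "cf 1 a b = (if a = 0 \<and> b = 0 then 1 else 0)"
 using cf_cst[of 1 a b] by (simp add: cst_def one_pCons)

lemma cst_simps: "cst 0 = 0" "cst 1 = 1" "cst (c * d) = cst c * cst d" "cst (c + d) = cst c + cst d"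
 "cst (- c) = - cst c" "cst c = 0 \<longleftrightarrow> c = 0"
 by (auto simp: cst_def one_pCons)

lemma cf_sum [simp]: "cf (\<Sum>i\<in>A. f i) a b = (\<Sum>i\<in>A. cf (f i) a b)"
 by (simp add: cf_def coeff_sum)

lemma X1_pow: "X1 ^ k = [:monom 1 k:]"
 by (induction k) (auto simp: X1_def monom_Suc one_pCons)

lemma X2_pow: "X2 ^ k = monom 1 k"
 by (induction k) (simp_all add: X2_def monom_Suc monom_0 mult_pCons_left one_pCons[symmetric])

lemma cf_X1_pow [simp]: "cf (X1 ^ k * P) a b = (if a < k then 0 else cf P (a - k) b)"
 by (simp add: cf_def X1_pow coeff_monom_mult)

lemma cf_X2_pow [simp]: "cf (X2 ^ k * P) a b = (if b < k then 0 else cf P a (b - k))"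
 by (simp add: cf_def X2_pow coeff_monom_mult)

lemma cf_X [simp]: "cf (X1 * P) a b = (if a = 0 then 0 else cf P (a - 1) b)"
 "cf (X2 * P) a b = (if b = 0 then 0 else cf P a (b - 1))"
 using cf_X1_pow[of 1 P a b] cf_X2_pow[of 1 P a b] by auto

definition mnm :: "'k::field => nat => nat => 'k poly poly" where
 "mnm c a b = cst c * (X1 ^ a * X2 ^ b)"

lemma cf_mon: "cf (mnm c i j) a b = (if a = i \<and> b = j then c else 0)"
proof -
 have "mnm c i j = monom (monom c i) j"
  by (simp add: mnm_def cst_def X1_pow X2_pow smult_monom)
 then show ?thesis
  by (simp add: cf_def)
qed

lemma cf_mult: "cf (P * Q) a b = (\<Sum>j\<le>b. \<Sum>i\<le>a. cf P i j * cf Q (a - i) (b - j))"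
 by (simp add: cf_def coeff_mult coeff_sum)

lemma finite_cf: "finite {(a, b). cf P a b \<noteq> 0}"
proof (rule finite_subset)
 show "{(a, b). cf P a b \<noteq> 0} \<subseteq> (\<Union>b\<le>degree P. {..degree (coeff P b)} \<times> {b})"
  by (auto simp: cf_def le_degree) (metis coeff_0 le_degree)
qed auto

lemma ex_cf:
 assumes "finite {(a, b). f a b \<noteq> 0}"
 shows "\<exists>P. \<forall>a b. cf P a b = f a b"
proof (intro exI allI)
 fix a b
 let ?S = "{(a, b). f a b \<noteq> 0}"
 have "cf (\<Sum>(i, j)\<in>?S. mnm (f i j) i j) a b = (\<Sum>u\<in>?S. if u = (a, b) then f a b else 0)"
  by (auto simp: cf_mon intro!: sum.cong)
 also have "\<dots> = f a b"
  using assms by simp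
 finally show "cf (\<Sum>(i, j)\<in>?S. mnm (f i j) i j) a b = f a b" .
qed

lemma cf_restrict: "\<exists>Q. \<forall>a b. cf Q a b = (if R a b then cf P a b else 0)"
 by (rule ex_cf, rule finite_subset[OF _ finite_cf[of P]]) auto

lemma sum_mon: "P = (\<Sum>(i, j)\<in>{(a, b). cf P a b \<noteq> 0}. mnm (cf P i j) i j)"
proof (rule cf_eqI)
 fix a b
 let ?S = "{(a, b). cf P a b \<noteq> 0}"
 have "(\<Sum>u\<in>?S. if u = (a, b) then cf P a b else 0) = cf P a b"
  by (subst sum.delta[OF finite_cf]) auto
 moreover have "cf (\<Sum>(i, j)\<in>?S. mnm (cf P i j) i j) a b = (\<Sum>u\<in>?S. if u = (a, b) then cf P a b else 0)"
  by (auto simp: cf_mon intro!: sum.cong)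
 ultimately show "cf P a b = cf (\<Sum>(i, j)\<in>?S. mnm (cf P i j) i j) a b" by simp
qed

lemma mon_induct:
 assumes "T 0" and "!!P Q. T P ==> T Q ==> T (P + Q)" and "!!c a b. T (mnm c a b)"
 shows "T P"
proof -
 have "T (\<Sum>(i, j)\<in>A. mnm (f i j) i j)" if "finite A" for A and f :: "nat => nat => 'a"
  using that by induction (auto simp: assms)
 from this[OF finite_cf[of P], of "cf P"] show ?thesis
  by (simp flip: sum_mon)
qed

text \<open>The quotient is obtained by shifting the table of coefficients.\<close>

lemma X1_pow_dvd:
 assumes "!!a b. a < k ==> cf P a b = 0"
 shows "\<exists>Q. P = X1 ^ k * Q"
proof -
 have "finite {(a, b). cf P (a + k) b \<noteq> 0}"
  using finite_vimageI[OF finite_cf[of P], of "\<lambda>(a, b). (a + k, b)"]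
  by (auto simp: inj_on_def vimage_def case_prod_unfold)
 from ex_cf[OF this] obtain Q where "!!a b. cf Q a b = cf P (a + k) b"
  by blast
 then have "P = X1 ^ k * Q"
  using assms by (intro cf_eqI) auto
 then show ?thesis ..
qed

lemma X2_pow_dvd:
 assumes "!!a b. b < k ==> cf P a b = 0"
 shows "\<exists>Q. P = X2 ^ k * Q"
proof -
 have "finite {(a, b). cf P a (b + k) \<noteq> 0}"
  using finite_vimageI[OF finite_cf[of P], of "\<lambda>(a, b). (a, b + k)"]
  by (auto simp: inj_on_def vimage_def case_prod_unfold)
 from ex_cf[OF this] obtain Q where "!!a b. cf Q a b = cf P a (b + k)"
  by blast
 then have "P = X2 ^ k * Q"
  using assms by (intro cf_eqI) auto
 then show ?thesis ..
qed

lemma X_nonzero [simp]: "X1 \<noteq> 0" "X2 \<noteq> 0"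
 by (auto simp: X1_def X2_def)

text \<open>Powers of the two variables form a regular sequence. Equal fractions
  \<open>A / X1 ^ n = B / X2 ^ m\<close> thus have a polynomial value \<open>U\<close>, which is how
  data on the two charts are glued below.\<close>

lemma X_regular:
 assumes "X2 ^ m * A = X1 ^ n * B"
 shows "\<exists>U. A = X1 ^ n * U \<and> B = X2 ^ m * U"
proof -
 have "cf A a b = 0" if "a < n" for a b
  using arg_cong[OF assms, of "\<lambda>P. cf P a (b + m)"] that by simp
 from X1_pow_dvd[OF this] obtain U where U: "A = X1 ^ n * U"
  by auto
 then have "X1 ^ n * (X2 ^ m * U) = X1 ^ n * B"
  using assms by (simp add: algebra_simps)
 then show ?thesis
  using U by auto
qed

context weight_type
begin

definition Sg :: "int \<times> int => 'k::field poly poly set" where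
 "Sg u = {P. \<forall>a b. cf P a b \<noteq> 0 --> D (int a, int b) = D u}"

lemma Sg_eq: "S_grade p q (D u) = Sg u"
 by (simp add: S_grade_def Sg_def cf_def vx_eq D_nat_pow)

lemma Sg_cong: "D u = D v ==> Sg u = Sg v"
 by (simp add: Sg_def)

lemma SgD: "P \<in> Sg u ==> cf P a b \<noteq> 0 ==> D (int a, int b) = D u"
 by (simp add: Sg_def)

lemma Sg_0 [simp]: "0 \<in> Sg u"
 by (simp add: Sg_def)

lemma Sg_add: "P \<in> Sg u ==> Q \<in> Sg u ==> P + Q \<in> Sg u"
 unfolding Sg_def mem_Collect_eq cf_simps by (metis add.right_neutral)

lemma Sg_minus [simp]: "- P \<in> Sg u \<longleftrightarrow> P \<in> Sg u"
 by (auto simp: Sg_def)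

lemma Sg_sum: "(!!i. i \<in> A ==> f i \<in> Sg u) ==> (\<Sum>i\<in>A. f i) \<in> Sg u"
 by (induction A rule: infinite_finite_induct) (auto intro: Sg_add)

lemma Sg_cst: "cst c \<in> Sg 0"
 by (auto simp: Sg_def cf_cst zero_prod_def)

lemma Sg_one: "1 \<in> Sg 0"
 using Sg_cst[of 1] by (simp add: cst_simps)

lemma Sg_mult:
 assumes "P \<in> Sg u" "Q \<in> Sg v" shows "P * Q \<in> Sg (u + v)"
 unfolding Sg_def
proof (intro CollectI allI impI)
 fix a b
 assume "cf (P * Q) a b \<noteq> 0"
 then obtain i j where ij: "i \<le> a" "j \<le> b" "cf P i j \<noteq> 0" "cf Q (a - i) (b - j) \<noteq> 0"
  unfolding cf_mult
  by (metis (no_types, lifting) atMost_iff mult_not_zero sum.not_neutral_contains_not_neutral)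
 then have "D ((int i, int j) + (int (a - i), int (b - j))) = D (u + v)"
  using assms by (metis L_mult SgD)
 then show "D (int a, int b) = D (u + v)"
  using ij by (simp add: of_nat_diff)
qed

lemma Sg_mon: "mnm c a b \<in> Sg (int a, int b)"
 by (auto simp: Sg_def cf_mon)

lemma Sg_X [simp]: "X1 ^ k \<in> Sg (int k, 0)" "X2 ^ k \<in> Sg (0, int k)"
 using Sg_mon[of 1 k 0] Sg_mon[of 1 0 k] by (simp_all add: mnm_def cst_simps)

lemma Sg_X1_mult: "X1 ^ k * Q \<in> Sg u \<longleftrightarrow> Q \<in> Sg (u - (int k, 0))"
proof
 assume *: "X1 ^ k * Q \<in> Sg u"
 show "Q \<in> Sg (u - (int k, 0))"
  unfolding Sg_def
 proof (intro CollectI allI impI)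
  fix a b assume "cf Q a b \<noteq> 0"
  then have "D (int (a + k), int b) = D u"
   using SgD[OF *, of "a + k" b] by simp
  then show "D (int a, int b) = D (u - (int k, 0))"
   using D_diff_eq[of u "(int k, 0)" "(int a, int b)"] by (simp add: eq_commute)
 qed
next
 assume "Q \<in> Sg (u - (int k, 0))"
 from Sg_mult[OF Sg_X(1) this, of k] show "X1 ^ k * Q \<in> Sg u"
  by simp
qed

lemma Sg_X2_mult: "X2 ^ k * Q \<in> Sg u \<longleftrightarrow> Q \<in> Sg (u - (0, int k))"
proof
 assume *: "X2 ^ k * Q \<in> Sg u"
 show "Q \<in> Sg (u - (0, int k))"
  unfolding Sg_def
 proof (intro CollectI allI impI)
  fix a b assume "cf Q a b \<noteq> 0"
  then have "D (int a, int (b + k)) = D u"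
   using SgD[OF *, of a "b + k"] by simp
  then show "D (int a, int b) = D (u - (0, int k))"
   using D_diff_eq[of u "(0, int k)" "(int a, int b)"] by (simp add: eq_commute)
 qed
next
 assume "Q \<in> Sg (u - (0, int k))"
 from Sg_mult[OF Sg_X(2) this, of k] show "X2 ^ k * Q \<in> Sg u"
  by simp
qed

lemma Sg_one_iff: "1 \<in> Sg u \<longleftrightarrow> D u = D 0"
 by (auto simp: Sg_def cf_one zero_prod_def)

lemma Sg_const:
 assumes "P \<in> Sg u" "D u = D 0" shows "P = cst (cf P 0 0)"
proof (rule cf_eqI)
 fix a b
 show "cf P a b = cf (cst (cf P 0 0)) a b"
  using SgD[OF assms(1), of a b] assms(2) D_nonneg_zero[of a b] by (auto simp: cf_cst)
qed

text \<open>The homogeneous part of degree \<open>x\<close>. The choice is legitimate because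
  \<open>cf_restrict\<close> provides a polynomial with these coefficients, and the coefficients
  determine it.\<close>

definition pt :: "degree => 'k::field poly poly => 'k poly poly" where
 "pt x P = (SOME Q. \<forall>a b. cf Q a b = (if D (int a, int b) = x then cf P a b else 0))"

lemma cf_pt [simp]: "cf (pt x P) a b = (if D (int a, int b) = x then cf P a b else 0)"
proof -
 have "\<forall>a b. cf (pt x P) a b = (if D (int a, int b) = x then cf P a b else 0)"
  unfolding pt_def by (rule someI_ex) (rule cf_restrict)
 then show ?thesis by blast
qed

lemma pt_Sg: "pt (D u) P \<in> Sg u"
 by (auto simp: Sg_def)

lemma pt_0 [simp]: "pt x 0 = 0"
 by (auto intro: cf_eqI)

lemma pt_add: "pt x (P + Q) = pt x P + pt x Q"
 by (auto intro: cf_eqI)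

lemma pt_same: "P \<in> Sg u ==> pt (D u) P = P"
 by (intro cf_eqI) (use SgD[of P u] in force)

lemma pt_other: "P \<in> Sg u ==> x \<noteq> D u ==> pt x P = 0"
 by (intro cf_eqI) (use SgD[of P u] in force)

definition dgs :: "'k::field poly poly => degree set" where
 "dgs P = {D (int a, int b) | a b. cf P a b \<noteq> 0}"

lemma finite_dgs: "finite (dgs P)"
proof -
 have "dgs P = (\<lambda>(a, b). D (int a, int b)) ` {(a, b). cf P a b \<noteq> 0}"
  by (auto simp: dgs_def)
 then show ?thesis
  using finite_cf[of P] by simp
qed

lemma dgs_L: "dgs P \<subseteq> carrier L"
 by (auto simp: dgs_def)

lemma pt_nonzero: "pt x P \<noteq> 0 \<longleftrightarrow> x \<in> dgs P"
proof
 assume "pt x P \<noteq> 0"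
 then have "\<exists>a b. cf (pt x P) a b \<noteq> 0"
  by (metis cf_eqI cf_simps(1))
 then show "x \<in> dgs P"
  by (auto simp: dgs_def split: if_splits)
next
 assume "x \<in> dgs P"
 then obtain a b where "x = D (int a, int b)" "cf P a b \<noteq> 0"
  by (auto simp: dgs_def)
 then have "cf (pt x P) a b \<noteq> 0" by simp
 then show "pt x P \<noteq> 0" by (metis cf_simps(1))
qed

lemma sum_pt:
 assumes "finite F" "dgs P \<subseteq> F"
 shows "(\<Sum>x\<in>F. pt x P) = P"
proof (rule cf_eqI)
 fix a b
 have "(\<Sum>x\<in>F. if D (int a, int b) = x then cf P a b else 0) = cf P a b"
  using assms by (auto simp: dgs_def)
 then show "cf (\<Sum>x\<in>F. pt x P) a b = cf P a b"
  by simp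
qed

text \<open>Membership in the ideal of \<open>X1 ^ m\<close> and \<open>X2 ^ n\<close> can be tested
  on monomials: those with \<open>b \<ge> n\<close> form a multiple of \<open>X2 ^ n\<close>, and
  all others have \<open>a \<ge> m\<close>. The difference, instead of a sum, matches the
  discrepancy of two lifts in the extension argument.\<close>

lemma Sg_split:
 assumes P: "P \<in> Sg u"
  and big: "!!a b. cf P a b \<noteq> 0 ==> a \<ge> m \<or> b \<ge> n"
 shows "\<exists>A\<in>Sg (u - (0, int n)). \<exists>B\<in>Sg (u - (int m, 0)). P = X2 ^ n * A - X1 ^ m * B"
proof -
 obtain P1 where P1: "!!a b. cf P1 a b = (if b \<ge> n then cf P a b else 0)"
  using cf_restrict[of "\<lambda>a b. b \<ge> n" P] by auto
 obtain P2 where P2: "!!a b. cf P2 a b = (if \<not> b \<ge> n then cf P a b else 0)"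
  using cf_restrict[of "\<lambda>a b. \<not> b \<ge> n" P] by metis
 obtain A where A: "P1 = X2 ^ n * A"
  using X2_pow_dvd[of n P1] P1 by auto
 obtain B where B: "P2 = X1 ^ m * B"
  using X1_pow_dvd[of m P2] P2 big by (metis not_less)
 have "P1 \<in> Sg u" "P2 \<in> Sg u"
  using P by (auto simp: Sg_def P1 P2)
 then have "A \<in> Sg (u - (0, int n))" "B \<in> Sg (u - (int m, 0))"
  by (simp_all add: A B Sg_X1_mult Sg_X2_mult)
 moreover have "P = P1 + P2"
  by (rule cf_eqI) (simp add: P1 P2)
 ultimately show ?thesis
  using A B Sg_minus[of B] by (intro bexI[of _ A] bexI[of _ "- B"]) auto
qed

end

section \<open>Graded modules\<close>

lemma SS_simps [simp]:
 "carrier (SS :: 'k::field poly poly ring) = UNIV" "a \<otimes>\<^bsub>SS\<^esub> b = a * b" "a \<oplus>\<^bsub>SS\<^esub> b = a + b"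
 "\<one>\<^bsub>SS\<^esub> = 1" "\<zero>\<^bsub>SS\<^esub> = 0"
 by (simp_all add: SS_def ring_of_type_algebra_def)

lemma SS_cring: "cring (SS :: 'k::field poly poly ring)"
 unfolding SS_def by (rule cring_from_type_algebra)

lemma SS_minus: "\<ominus>\<^bsub>SS\<^esub> a = - (a :: 'k::field poly poly)"
proof -
 interpret cring "SS :: 'k poly poly ring" by (rule SS_cring)
 show ?thesis by (rule minus_equality) auto
qed

locale graded_mod = weight_type p q for p q +
 fixes M :: "('k::field poly poly, 'b) gmod" (structure)
 assumes gm: "graded_module p q M"
begin

sublocale module "SS :: 'k poly poly ring" M
 using gm by (simp add: graded_module_def)

lemma sm_closed [simp]: "m \<in> carrier M ==> s \<odot> m \<in> carrier M"
 using smult_closed[of s m] by simp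

lemma sm_ladd: "m \<in> carrier M ==> (s + t) \<odot> m = s \<odot> m \<oplus> t \<odot> m"
 using smult_l_distr[of s t m] by simp

lemma sm_radd: "m \<in> carrier M ==> n \<in> carrier M ==> s \<odot> (m \<oplus> n) = s \<odot> m \<oplus> s \<odot> n"
 using smult_r_distr[of s m n] by simp

lemma sm_assoc: "m \<in> carrier M ==> (s * t) \<odot> m = s \<odot> (t \<odot> m)"
 using smult_assoc1[of s t m] by simp

lemma sm_commute: "m \<in> carrier M ==> s \<odot> (t \<odot> m) = t \<odot> (s \<odot> m)"
 using sm_assoc[of m s t] sm_assoc[of m t s] by (simp add: mult.commute)

lemma sm_one [simp]: "m \<in> carrier M ==> 1 \<odot> m = m"
 using smult_one[of m] by simp

lemma sm_0 [simp]: "m \<in> carrier M ==> 0 \<odot> m = \<zero>" "s \<odot> \<zero> = \<zero>"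
 using smult_l_null[of m] smult_r_null[of s] by simp_all

lemma sm_minus: "m \<in> carrier M ==> (- s) \<odot> m = \<ominus> (s \<odot> m)"
 "m \<in> carrier M ==> s \<odot> (\<ominus> m) = \<ominus> (s \<odot> m)"
 using smult_l_minus[of s m] smult_r_minus[of s m] by (simp_all add: SS_minus)

lemma sm_rdiff: "m \<in> carrier M ==> n \<in> carrier M ==>
  s \<odot> (m \<ominus> n) = s \<odot> m \<ominus> s \<odot> n"
 by (simp add: a_minus_def sm_radd sm_minus)

lemma add_diff_assoc: "m \<in> carrier M ==> n \<in> carrier M ==> (m \<oplus> n) \<ominus> n = m"
 by (simp add: a_minus_def M.a_assoc M.r_neg)

lemma diff_add_cancel': "m \<in> carrier M ==> n \<in> carrier M ==> (m \<ominus> n) \<oplus> n = m"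
 by (simp add: a_minus_def M.a_assoc M.l_neg)

lemma diff_zero_iff: "m \<in> carrier M ==> n \<in> carrier M ==> m \<ominus> n = \<zero> \<longleftrightarrow> m = n"
 using diff_add_cancel'[of m n] by (auto simp: a_minus_def M.r_neg)

definition subm :: "'b set => bool" where
 "subm N \<longleftrightarrow> N \<subseteq> carrier M \<and> \<zero> \<in> N \<and> (\<forall>m\<in>N. \<forall>n\<in>N. m \<oplus> n \<in> N) \<and> (\<forall>s. \<forall>n\<in>N. s \<odot> n \<in> N)"

lemma submD:
 assumes "subm N"
 shows "n \<in> N ==> n \<in> carrier M" "\<zero> \<in> N" "m \<in> N ==> n \<in> N ==> m \<oplus> n \<in> N"
  "n \<in> N ==> s \<odot> n \<in> N" "n \<in> N ==> \<ominus> n \<in> N" "m \<in> N ==> n \<in> N ==> m \<ominus> n \<in> N"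
proof -
 show *: "n \<in> N ==> n \<in> carrier M" "\<zero> \<in> N" "m \<in> N ==> n \<in> N ==> m \<oplus> n \<in> N"
  "n \<in> N ==> s \<odot> n \<in> N" for m n s
  using assms by (auto simp: subm_def)
 show m: "n \<in> N ==> \<ominus> n \<in> N" for n
  using *(4)[of n "-1"] *(1)[of n] by (simp add: sm_minus)
 show "m \<in> N ==> n \<in> N ==> m \<ominus> n \<in> N"
  using *(3)[OF _ m] by (simp add: a_minus_def)
qed

lemma submodule_iff: "submodule N (SS :: 'k poly poly ring) M \<longleftrightarrow> subm N"
proof
 assume "submodule N (SS :: 'k poly poly ring) M"
 from submoduleE[OF this] show "subm N"
  unfolding subm_def using sm_0(1) by (metis (no_types, lifting) SS_simps(1) UNIV_I ex_in_conv subsetD)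
next
 assume "subm N"
 from submD[OF this] show "submodule N (SS :: 'k poly poly ring) M"
  by (intro submoduleI) auto
qed

lemma subm_zero: "subm {\<zero>}" and subm_carrier: "subm (carrier M)"
 by (auto simp: subm_def)

definition gr :: "int \<times> int => 'b set" where "gr u = grade M (D u)"

lemma gr_cong: "D u = D v ==> gr u = gr v"
 by (simp add: gr_def)

lemma gr_subgroup: "subgroup (gr u) (add_monoid M)"
 using gm by (simp add: graded_module_def gr_def)

lemma gr_closed [simp]: "m \<in> gr u ==> m \<in> carrier M" "\<zero> \<in> gr u"
  "m \<in> gr u ==> n \<in> gr u ==> m \<oplus> n \<in> gr u"
 using subgroup.mem_carrier[OF gr_subgroup] subgroup.one_closed[OF gr_subgroup]
  subgroup.m_closed[OF gr_subgroup, of m u n] by auto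

lemma gr_smult: "s \<in> Sg d ==> m \<in> gr u ==> s \<odot> m \<in> gr (d + u)"
proof -
 have "\<forall>x\<in>carrier L. \<forall>y\<in>carrier L. \<forall>s\<in>S_grade p q x. \<forall>m\<in>grade M y. s \<odot> m \<in> grade M (x \<otimes>\<^bsub>L\<^esub> y)"
  using gm by (simp add: graded_module_def)
 from bspec[OF bspec[OF this D_in_L[of d]] D_in_L[of u]]
 show "s \<in> Sg d ==> m \<in> gr u ==> s \<odot> m \<in> gr (d + u)"
  by (simp add: Sg_eq gr_def)
qed

lemma gr_minus [simp]: "m \<in> gr u ==> \<ominus> m \<in> gr u" "m \<in> gr u ==> n \<in> gr u ==> m \<ominus> n \<in> gr u"
proof -
 show *: "m \<in> gr u ==> \<ominus> m \<in> gr u" for m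
  using subgroup.m_inv_closed[OF gr_subgroup, of m u] by (simp add: a_inv_def)
 show "m \<in> gr u ==> n \<in> gr u ==> m \<ominus> n \<in> gr u"
  using * by (simp add: a_minus_def)
qed

text \<open>The homogeneous component, read off from the unique decomposition that
  \<open>graded_module\<close> demands. The decomposition is an extensional function on the degree
  group, so the facts about it assume a degree in \<open>carrier L\<close>.\<close>

definition comp :: "degree => 'b => 'b" where
 "comp x m = (THE c. c \<in> (\<Pi>\<^sub>E x\<in>carrier L. grade M x) \<and> finite {x \<in> carrier L. c x \<noteq> \<zero>} \<and>
    m = finsum M c {x \<in> carrier L. c x \<noteq> \<zero>}) x"

abbreviation supp :: "'b => degree set" where "supp m \<equiv> {x \<in> carrier L. comp x m \<noteq> \<zero>}"

lemma comp_all: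
 assumes "m \<in> carrier M"
 shows "(\<lambda>x. comp x m) \<in> (\<Pi>\<^sub>E x\<in>carrier L. grade M x) \<and> finite (supp m) \<and>
  m = finsum M (\<lambda>x. comp x m) (supp m)"
proof -
 let ?P = "\<lambda>c. c \<in> (\<Pi>\<^sub>E x\<in>carrier L. grade M x) \<and> finite {x \<in> carrier L. c x \<noteq> \<zero>} \<and>
    m = finsum M c {x \<in> carrier L. c x \<noteq> \<zero>}"
 have "\<exists>!c. ?P c"
  using gm assms by (simp add: graded_module_def)
 then have "?P (THE c. ?P c)" by (rule theI')
 then show ?thesis unfolding comp_def by simp
qed

lemma comp_gr: "m \<in> carrier M ==> comp (D u) m \<in> gr u"
 using comp_all[of m] by (auto simp: gr_def)

lemma comp_closed [simp]: "m \<in> carrier M ==> x \<in> carrier L ==> comp x m \<in> carrier M"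
 by (metis L_cases comp_gr gr_closed(1))

lemma finite_supp: "m \<in> carrier M ==> finite (supp m)"
 using comp_all[of m] by blast

lemma finsum_comp: "m \<in> carrier M ==> finite F ==> supp m \<subseteq> F ==> F \<subseteq> carrier L ==>
  finsum M (\<lambda>x. comp x m) F = m"
 by (subst comp_all[THEN conjunct2, THEN conjunct2, of m], assumption,
   rule M.add.finprod_mono_neutral_cong_right) auto

lemma comp_unique:
 assumes c: "!!u. c (D u) \<in> gr u" and F: "finite F" "F \<subseteq> carrier L"
  "!!x. x \<in> carrier L ==> x \<notin> F ==> c x = \<zero>"
  and m: "m = finsum M c F" and x: "x \<in> carrier L"
 shows "comp x m = c x"
proof -
 let ?c = "restrict c (carrier L)"
 let ?P = "\<lambda>c. c \<in> (\<Pi>\<^sub>E x\<in>carrier L. grade M x) \<and> finite {x \<in> carrier L. c x \<noteq> \<zero>} \<and>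
    m = finsum M c {x \<in> carrier L. c x \<noteq> \<zero>}"
 have cg: "y \<in> carrier L ==> c y \<in> grade M y" for y
  using c by (auto simp: gr_def elim!: L_cases)
 have cc: "y \<in> carrier L ==> c y \<in> carrier M" for y
  using c gr_closed(1) L_cases by metis
 have S: "{x \<in> carrier L. ?c x \<noteq> \<zero>} \<subseteq> F"
  using F(3) by auto
 have "finsum M ?c {x \<in> carrier L. ?c x \<noteq> \<zero>} = finsum M c F"
  by (rule M.add.finprod_mono_neutral_cong_left) (use S F cc in auto)
 then have "?P ?c"
  using cg m finite_subset[OF S F(1)] by auto
 moreover have "m \<in> carrier M"
  unfolding m by (rule M.finsum_closed) (use F(2) cc in auto)
 then have "\<exists>!c. ?P c"
  using gm by (simp add: graded_module_def)
 ultimately have "(THE c. ?P c) = ?c"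
  by (rule the1_equality[rotated])
 then show ?thesis
  using x by (simp add: comp_def)
qed

lemma comp_hom:
 assumes "m \<in> gr u" "x \<in> carrier L" shows "comp x m = (if x = D u then m else \<zero>)"
proof (rule comp_unique[where F = "{D u}"])
 show "(if D v = D u then m else \<zero>) \<in> gr v" for v
  using assms gr_cong[of u v] by auto
 show "m = (\<Oplus>\<^bsub>M\<^esub>x\<in>{D u}. if x = D u then m else \<zero>)"
  using assms by (simp add: M.add.finprod_insert M.finsum_empty)
qed (use assms in auto)

lemma comp_zero [simp]: "x \<in> carrier L ==> comp x \<zero> = \<zero>"
 using comp_hom[OF gr_closed(2)] by metis

lemma comp_add:
 assumes "m \<in> carrier M" "n \<in> carrier M" "x \<in> carrier L"
 shows "comp x (m \<oplus> n) = comp x m \<oplus> comp x n"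
proof (rule comp_unique[where F = "supp m \<union> supp n"])
 show "comp (D u) m \<oplus> comp (D u) n \<in> gr u" for u
  using comp_gr assms by auto
 have "m \<oplus> n = finsum M (\<lambda>x. comp x m) (supp m \<union> supp n) \<oplus> finsum M (\<lambda>x. comp x n) (supp m \<union> supp n)"
  using assms by (subst (1 2) finsum_comp) (auto simp: finite_supp)
 also have "\<dots> = (\<Oplus>\<^bsub>M\<^esub>x\<in>supp m \<union> supp n. comp x m \<oplus> comp x n)"
  using assms by (subst M.finsum_addf) auto
 finally show "m \<oplus> n = (\<Oplus>\<^bsub>M\<^esub>x\<in>supp m \<union> supp n. comp x m \<oplus> comp x n)" .
qed (use assms finite_supp in auto)

lemma finsum_induct:
 assumes "finite F" "!!x. x \<in> F ==> c x \<in> carrier M \<and> T (c x)" "T \<zero>"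
  "!!a b. a \<in> carrier M ==> b \<in> carrier M ==> T a ==> T b ==> T (a \<oplus> b)"
 shows "T (finsum M c F)"
 using assms
proof (induction F)
 case (insert x F)
 then have "c \<in> F \<rightarrow> carrier M" by auto
 then show ?case
  using insert by (subst M.finsum_insert) auto
qed (simp add: M.finsum_empty)

lemma hom_induct:
 assumes "m \<in> carrier M" "!!u h. h \<in> gr u ==> T h"
  "!!a b. a \<in> carrier M ==> b \<in> carrier M ==> T a ==> T b ==> T (a \<oplus> b)"
 shows "T m"
proof -
 have "T (finsum M (\<lambda>x. comp x m) (supp m))"
 proof (rule finsum_induct)
  fix x assume "x \<in> supp m"
  then obtain u where "x = D u" by (auto simp: carrier_L)
  then show "comp x m \<in> carrier M \<and> T (comp x m)"
   using comp_gr[OF assms(1), of u] assms(2) by simp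
 qed (use assms finite_supp in auto)
 then show ?thesis
  by (subst (asm) finsum_comp) (use assms(1) finite_supp in auto)
qed

lemma comp_induct:
 assumes "m \<in> carrier M" "!!x. x \<in> carrier L ==> T (comp x m)" "T \<zero>"
  "!!a b. a \<in> carrier M ==> b \<in> carrier M ==> T a ==> T b ==> T (a \<oplus> b)"
 shows "T m"
proof -
 have "T (finsum M (\<lambda>x. comp x m) (supp m))"
  by (rule finsum_induct) (use assms finite_supp in auto)
 then show ?thesis
  by (subst (asm) finsum_comp) (use assms(1) finite_supp in auto)
qed

lemma comp_smult:
 assumes "s \<in> Sg d" "m \<in> carrier M"
 shows "comp (D (d + u)) (s \<odot> m) = s \<odot> comp (D u) m"
 using assms(2)
proof (induction m rule: hom_induct)
 case (2 v h)
 have "D (d + u) = D (d + v) \<longleftrightarrow> D u = D v"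
  using D_add_cancel[of u d v] by (simp add: add.commute)
 then show ?case
  using 2(1) comp_hom[OF gr_smult[OF assms(1) 2(1)], of "D (d + u)"] comp_hom[OF 2(1), of "D u"] by simp
qed (use assms(2) in \<open>auto simp: sm_radd comp_add\<close>)

text \<open>For a monomial both sides are either the whole product or zero; additivity in
  \<open>s\<close> does the rest.\<close>

lemma comp_smult_hom:
 assumes "m \<in> gr u"
 shows "comp (D v) (s \<odot> m) = pt (D (v - u)) s \<odot> m"
proof (induction s rule: mon_induct)
 case (3 c a b)
 have *: "comp (D v) (mnm c a b \<odot> m) =
  (if D v = D ((int a, int b) + u) then mnm c a b \<odot> m else \<zero>)"
  by (rule comp_hom) (auto intro: gr_smult[OF Sg_mon assms])
 have m: "m \<in> carrier M" using assms by (rule gr_closed)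
 show ?case
 proof (cases "D v = D ((int a, int b) + u)")
  case True
  then have "D (v - u) = D (int a, int b)" by (simp add: D_diff_eq)
  then show ?thesis unfolding * using True pt_same[OF Sg_mon[of c a b]] by simp
 next
  case False
  then have "D (v - u) \<noteq> D (int a, int b)" by (simp add: D_diff_eq)
  then show ?thesis unfolding * using False m pt_other[OF Sg_mon[of c a b], of "D (v - u)"] by simp
 qed
qed (use assms in \<open>auto simp: pt_add sm_ladd comp_add\<close>)

section \<open>Graded submodules, saturation, and torsion\<close>

definition gsub :: "'b set => bool" where
 "gsub N \<longleftrightarrow> subm N \<and> (\<forall>n\<in>N. \<forall>x\<in>carrier L. comp x n \<in> N)"

lemma graded_submodule_iff: "graded_submodule p q N M \<longleftrightarrow> gsub N"
proof
 assume N: "graded_submodule p q N M"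
 have "comp x n \<in> N" if n: "n \<in> N" and x: "x \<in> carrier L" for n x
 proof -
  from N n obtain c where c: "\<forall>x\<in>carrier L. c x \<in> N \<inter> grade M x"
   "finite {x \<in> carrier L. c x \<noteq> \<zero>}" "n = finsum M c {x \<in> carrier L. c x \<noteq> \<zero>}"
   unfolding graded_submodule_def by blast
  have "comp x n = c x"
   by (rule comp_unique[OF _ c(2) _ _ c(3) x]) (use c in \<open>auto simp: gr_def\<close>)
  then show ?thesis
   using c(1) x by auto
 qed
 then show "gsub N"
  using N by (auto simp: gsub_def graded_submodule_def submodule_iff)
next
 assume N: "gsub N"
 then have "subm N" by (simp add: gsub_def)
 have "\<exists>c. (\<forall>x\<in>carrier L. c x \<in> N \<inter> grade M x) \<and>
    finite {x \<in> carrier L. c x \<noteq> \<zero>} \<and> n = finsum M c {x \<in> carrier L. c x \<noteq> \<zero>}" if n: "n \<in> N" for n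
 proof -
  have "n \<in> carrier M"
   using \<open>subm N\<close> n submD(1) by blast
  from comp_all[OF this] show ?thesis
   using N n by (intro exI[of _ "\<lambda>x. comp x n"]) (auto simp: gsub_def)
 qed
 then show "graded_submodule p q N M"
  using \<open>subm N\<close> by (simp add: graded_submodule_def submodule_iff)
qed

text \<open>Elements that are moved into \<open>N\<close> by some power of each variable, that is,
  whose class modulo \<open>N\<close> is supported at the origin. For finitely generated modules
  this replaces finite-dimensionality of quotients (\<open>fin_dim_iff\<close>), and
  \<open>tors\<close> is the part that the quotient category kills.\<close>

definition sat :: "'b set => 'b set" where
 "sat N = {m \<in> carrier M. \<forall>x\<in>VV. \<exists>k::nat. x ^ k \<odot> m \<in> N}"

definition tors :: "'b set" where "tors = sat {\<zero>}"

lemma pow_mono: "subm N ==> m \<in> carrier M ==> x ^ k \<odot> m \<in> N ==> k \<le> l ==> x ^ l \<odot> m \<in> N"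
 using submD(4)[of N "x ^ k \<odot> m" "x ^ (l - k)"]
 by (simp add: sm_assoc[symmetric] power_add[symmetric])

lemma sat_carrier: "sat N \<subseteq> carrier M"
 by (auto simp: sat_def)

lemma sat_incl: "subm N ==> N \<subseteq> sat N"
 unfolding sat_def using submD(1) by (auto intro!: exI[of _ 0])

lemma sat_mono: "N \<subseteq> N' ==> sat N \<subseteq> sat N'"
 by (auto simp: sat_def)

lemma subm_sat:
 assumes N: "subm N" shows "subm (sat N)"
 unfolding subm_def
proof (intro conjI ballI allI)
 show "\<zero> \<in> sat N"
  using sat_incl[OF N] submD(2)[OF N] by auto
next
 fix m n assume m: "m \<in> sat N" and n: "n \<in> sat N"
 then have c: "m \<in> carrier M" "n \<in> carrier M"
  using sat_carrier by auto
 have "\<exists>k. x ^ k \<odot> (m \<oplus> n) \<in> N" if x: "x \<in> VV" for x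
 proof -
  obtain k l where "x ^ k \<odot> m \<in> N" "x ^ l \<odot> n \<in> N"
   using x m n unfolding sat_def by blast
  then have "x ^ (k + l) \<odot> m \<in> N" "x ^ (k + l) \<odot> n \<in> N"
   using pow_mono[OF N] c by (metis le_add1, metis le_add2)
  then show ?thesis
   using submD(3)[OF N] c by (metis sm_radd)
 qed
 then show "m \<oplus> n \<in> sat N"
  using c by (auto simp: sat_def)
next
 fix s n assume n: "n \<in> sat N"
 then show "s \<odot> n \<in> sat N"
  unfolding sat_def using submD(4)[OF N] by (fastforce simp: sm_commute[of n _ s])
qed (rule sat_carrier)

lemma X_hom: "x \<in> VV ==> \<exists>d. x ^ k \<in> Sg d"
 using Sg_X by blast

lemma comp_pow: "x \<in> VV ==> m \<in> carrier M ==> y \<in> carrier L ==>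
  \<exists>z\<in>carrier L. x ^ k \<odot> comp y m = comp z (x ^ k \<odot> m)"
 by (metis D_in_L L_cases X_hom comp_smult)

lemma gsub_sat:
 assumes N: "gsub N" shows "gsub (sat N)"
 unfolding gsub_def
proof (intro conjI ballI)
 show "subm (sat N)" using N subm_sat by (simp add: gsub_def)
 fix n y assume n: "n \<in> sat N" and y: "y \<in> carrier L"
 have "\<exists>k. x ^ k \<odot> comp y n \<in> N" if x: "x \<in> VV" for x
 proof -
  have nc: "n \<in> carrier M" using n sat_carrier by auto
  obtain k where k: "x ^ k \<odot> n \<in> N"
   using n x unfolding sat_def by blast
  obtain z where "z \<in> carrier L" "x ^ k \<odot> comp y n = comp z (x ^ k \<odot> n)"
   using comp_pow[OF x nc y] by blast
  then show ?thesis using N k unfolding gsub_def by metis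
 qed
 then show "comp y n \<in> sat N"
  using n y by (auto simp: sat_def)
qed

lemma gsub_zero: "gsub {\<zero>}" and gsub_carrier: "gsub (carrier M)"
 using subm_zero subm_carrier by (auto simp: gsub_def)

lemma tors_gsub: "gsub tors" and tors_subm: "subm tors"
 using gsub_sat[OF gsub_zero] by (simp_all add: tors_def gsub_def)

lemmas torsD = submD[OF tors_subm]

lemma torsE: "m \<in> tors ==> x \<in> VV ==> \<exists>k. x ^ k \<odot> m = \<zero>"
 by (auto simp: tors_def sat_def)

lemma satI: "m \<in> carrier M ==> (!!x. x \<in> VV ==> \<exists>k. x ^ k \<odot> m \<in> N) ==> m \<in> sat N"
 by (auto simp: sat_def)

lemma satE: "m \<in> sat N ==> x \<in> VV ==> \<exists>k. x ^ k \<odot> m \<in> N"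
 by (auto simp: sat_def)

text \<open>Exponents add up, so saturation is idempotent. In proofs of torsion this permits a
  preliminary multiplication by a power that moves an element into the domain of a relation.\<close>

lemma sat_sat:
 assumes "m \<in> carrier M" "!!x. x \<in> VV ==> \<exists>k. x ^ k \<odot> m \<in> sat N"
 shows "m \<in> sat N"
proof (rule satI)
 fix x :: "'k poly poly" assume x: "x \<in> VV"
 obtain k where "x ^ k \<odot> m \<in> sat N" using assms(2)[OF x] ..
 then obtain l where "x ^ l \<odot> (x ^ k \<odot> m) \<in> N" using satE x by blast
 then show "\<exists>k. x ^ k \<odot> m \<in> N"
  using assms(1) by (metis power_add sm_assoc)
qed (rule assms)

lemma tors_tors: "m \<in> carrier M ==> (!!x. x \<in> VV ==> \<exists>k. x ^ k \<odot> m \<in> tors) ==> m \<in> tors"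
 unfolding tors_def by (rule sat_sat)

text \<open>Linear combinations over an initial segment of the naturals. Families of coefficients
  have the type of the vectors in the free modules below, so a coefficient family is itself an
  element of a sheaf.\<close>

primrec lc :: "(nat => 'b) => nat => (nat => 'k poly poly) => 'b" where
 "lc g 0 v = \<zero>"
| "lc g (Suc n) v = lc g n v \<oplus> v n \<odot> g n"

lemma lc_closed [simp]: "(!!i. i < n ==> g i \<in> carrier M) ==> lc g n v \<in> carrier M"
 by (induction n) auto

lemma lc_subm: "subm N ==> (!!i. i < n ==> g i \<in> N) ==> lc g n v \<in> N"
 by (induction n) (auto simp: submD)

lemma lc_subm': "subm N ==> (!!i. i < n ==> v i \<odot> g i \<in> N) ==> lc g n v \<in> N"
 by (induction n) (auto simp: submD)

lemma lc_cong: "(!!i. i < n ==> v i = w i) ==> (!!i. i < n ==> g i = h i) ==> lc g n v = lc h n w"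
 by (induction n) auto

lemma lc_add: "(!!i. i < n ==> g i \<in> carrier M) ==> lc g n (\<lambda>i. v i + w i) = lc g n v \<oplus> lc g n w"
 by (induction n) (auto simp: sm_ladd M.a_ac)

lemma lc_smult: "(!!i. i < n ==> g i \<in> carrier M) ==> lc g n (\<lambda>i. s * v i) = s \<odot> lc g n v"
 by (induction n) (auto simp: sm_radd sm_assoc)

lemma lc_minus: "(!!i. i < n ==> g i \<in> carrier M) ==> lc g n (\<lambda>i. - v i) = \<ominus> lc g n v"
 using lc_smult[of n g "-1" v] by (simp add: sm_minus)

lemma lc_zero: "(!!i. i < n ==> g i \<in> carrier M) ==> (!!i. i < n ==> v i = 0) ==> lc g n v = \<zero>"
 by (induction n) auto

lemma lc_unit:
 "(!!i. i < n ==> g i \<in> carrier M) ==> j < n ==> lc g n (\<lambda>i. if i = j then s else 0) = s \<odot> g j"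
proof (induction n)
 case (Suc n)
 show ?case
 proof (cases "j = n")
  case True
  have "lc g n (\<lambda>i. if i = j then s else 0) = \<zero>"
   by (rule lc_zero) (use Suc True in auto)
  then show ?thesis using Suc True by simp
 qed (use Suc in auto)
qed simp

lemma lc_gr: "(!!i. i < n ==> g i \<in> gr (d i)) ==> (!!i. i < n ==> v i \<in> Sg (u - d i)) ==> lc g n v \<in> gr u"
proof (induction n)
 case (Suc n)
 have "v n \<odot> g n \<in> gr (u - d n + d n)"
  by (rule gr_smult) (use Suc in auto)
 then show ?case using Suc by simp
qed simp

lemma lc_comp: "(!!i. i < n ==> g i \<in> gr (d i)) ==>
  comp (D u) (lc g n v) = lc g n (\<lambda>i. pt (D (u - d i)) (v i))"
proof (induction n)
 case (Suc n)
 have "lc g n v \<in> carrier M"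
  by (rule lc_closed) (use Suc(2) gr_closed(1) less_SucI in blast)
 moreover have "g n \<in> gr (d n)" using Suc by auto
 moreover from this have "g n \<in> carrier M" by (rule gr_closed)
 ultimately show ?case
  using Suc comp_smult_hom[of "g n" "d n" u "v n"] by (simp add: comp_add)
qed simp

lemma subm_range_lc:
 assumes "!!i. i < n ==> g i \<in> carrier M" shows "subm (range (lc g n))"
 unfolding subm_def
proof (intro conjI ballI allI)
 show "\<zero> \<in> range (lc g n)" using lc_zero[of n g "\<lambda>_. 0"] assms by (metis rangeI)
next
 show "range (lc g n) \<subseteq> carrier M" using assms by auto
next
 fix m m' assume "m \<in> range (lc g n)" "m' \<in> range (lc g n)"
 then obtain v w where "m = lc g n v" "m' = lc g n w" by blast
 then have "m \<oplus> m' = lc g n (\<lambda>i. v i + w i)"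
  using lc_add[of n g v w] assms by simp
 then show "m \<oplus> m' \<in> range (lc g n)" by simp
next
 fix s m assume "m \<in> range (lc g n)"
 then obtain v where "m = lc g n v" by blast
 then have "s \<odot> m = lc g n (\<lambda>i. s * v i)"
  using lc_smult[of n g s v] assms by simp
 then show "s \<odot> m \<in> range (lc g n)" by simp
qed

text \<open>Each generator is the sum of its homogeneous components, so these finitely many
  components generate as well.\<close>

lemma fg_lc:
 assumes "finitely_generated M"
 shows "\<exists>n g d. (\<forall>i<n. g i \<in> gr (d i)) \<and> carrier M = range (lc g n)"
proof -
 from assms obtain A where A: "finite A" "A \<subseteq> carrier M"
  and gen: "!!H. subm H ==> A \<subseteq> H ==> H = carrier M"
  unfolding finitely_generated_def submodule_iff by blast
 define B where "B = (\<Union>a\<in>A. (\<lambda>x. comp x a) ` supp a)"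
 have "finite B"
  unfolding B_def using A finite_supp by blast
 then obtain g n where g: "B = g ` {i::nat. i < n}"
  using finite_imp_nat_seg_image_inj_on by metis
 have "\<exists>d. g i \<in> gr d" if "i < n" for i
 proof -
  have "g i \<in> B" using g that by auto
  then obtain a u where "a \<in> A" "g i = comp (D u) a"
   unfolding B_def carrier_L by blast
  then have "g i \<in> gr u" using comp_gr[of a u] A by auto
  then show ?thesis ..
 qed
 then obtain d where d: "!!i. i < n ==> g i \<in> gr (d i)"
  by metis
 have gc: "g i \<in> carrier M" if "i < n" for i
  by (rule gr_closed(1)[OF d[OF that]])
 have sub: "subm (range (lc g n))"
  by (rule subm_range_lc) (rule gc)
 have "B \<subseteq> range (lc g n)"
 proof
  fix b assume "b \<in> B"
  then obtain j where "j < n" "b = g j" using g by auto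
  then show "b \<in> range (lc g n)"
   using lc_unit[of n g j 1, OF gc] gc[of j] by (metis rangeI sm_one)
 qed
 have "a \<in> range (lc g n)" if a: "a \<in> A" for a
 proof (rule comp_induct)
  show "a \<in> carrier M" using a A by auto
  fix x assume x: "x \<in> carrier L"
  show "comp x a \<in> range (lc g n)"
  proof (cases "comp x a = \<zero>")
   case False
   then have "comp x a \<in> B" using a x by (auto simp: B_def)
   then show ?thesis using \<open>B \<subseteq> _\<close> by blast
  qed (use sub in \<open>simp add: submD(2)\<close>)
 qed (use sub in \<open>auto simp: submD\<close>)
 then have "carrier M = range (lc g n)"
  using gen[OF sub] by blast
 then show ?thesis using d by blast
qed

lemma lc_fg:
 assumes "!!i. i < n ==> g i \<in> carrier M" "carrier M = range (lc g n)"
 shows "finitely_generated M"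
 unfolding finitely_generated_def submodule_iff
proof (intro exI[of _ "g ` {..<n}"] conjI allI impI)
 fix H assume "subm H \<and> g ` {..<n} \<subseteq> H"
 then have H: "subm H" "!!i. i < n ==> g i \<in> H" by auto
 then have "range (lc g n) \<subseteq> H" using lc_subm[OF H(1), of n g] by (simp add: image_subset_iff)
 then show "H = carrier M" using assms(2) submD(1)[OF H(1)] by blast
next
 show "g ` {..<n} \<subseteq> carrier M" using assms(1) by blast
qed simp

end

section \<open>Noetherianity of free modules over the polynomial ring\<close>

lemma dickson:
 fixes A :: "(nat \<times> nat) set"
 shows "\<exists>F\<subseteq>A. finite F \<and> (\<forall>(b, a)\<in>A. \<exists>(b', a')\<in>F. b' \<le> b \<and> a' \<le> a)"
proof (cases "A = {}")
 case False
 \<comment> \<open>A pair \<open>(b0, a0)\<close> with least second coordinate takes care of all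
   pairs with \<open>b \<ge> b0\<close>; for each of the finitely many smaller \<open>b\<close> the
   least possible \<open>a\<close> is kept.\<close>
 define a0 where "a0 = (LEAST a. \<exists>b. (b, a) \<in> A)"
 have "\<exists>a b. (b, a) \<in> A"
  using False by auto
 then have "\<exists>b. (b, a0) \<in> A"
  unfolding a0_def by (rule LeastI_ex)
 then obtain b0 where b0: "(b0, a0) \<in> A" ..
 have a0: "a0 \<le> a" if "(b, a) \<in> A" for a b
  unfolding a0_def by (rule Least_le) (use that in blast)
 define m where "m b = (LEAST a. (b, a) \<in> A)" for b
 have m: "(b, m b) \<in> A" "m b \<le> a" if "(b, a) \<in> A" for a b
  unfolding m_def using that by (auto intro: LeastI Least_le)
 let ?F = "insert (b0, a0) {(b, m b) | b. b < b0 \<and> (b, m b) \<in> A}"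
 have "finite ?F"
  by (auto intro: finite_subset[of _ "(\<lambda>b. (b, m b)) ` {..<b0}"])
 moreover have "\<exists>(b', a')\<in>?F. b' \<le> b \<and> a' \<le> a" if ba: "(b, a) \<in> A" for a b
 proof (cases "b < b0")
  case True
  then show ?thesis using m[OF ba] by (intro bexI[of _ "(b, m b)"]) auto
 next
  case False
  then show ?thesis using a0[OF ba] by (intro bexI[of _ "(b0, a0)"]) auto
 qed
 ultimately show ?thesis
  using b0 by (intro exI[of _ ?F]) auto
qed auto

lemma cf_mnm_mult: "cf (mnm c k l * P) a b = (if a < k \<or> b < l then 0 else c * cf P (a - k) (b - l))"
proof -
 have "mnm c k l * P = cst c * (X1 ^ k * (X2 ^ l * P))"
  by (simp add: mnm_def algebra_simps)
 then show ?thesis by (simp only: cf_simps cf_X1_pow cf_X2_pow) simp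
qed

definition fs :: "nat => (nat => 'k::field poly poly) set" where
 "fs n = {v. \<forall>i\<ge>n. v i = 0}"

definition vclosed :: "(nat => 'k::field poly poly) set => bool" where
 "vclosed N \<longleftrightarrow> (\<lambda>_. 0) \<in> N \<and> (\<forall>v\<in>N. \<forall>w\<in>N. (\<lambda>i. v i + w i) \<in> N) \<and> (\<forall>s. \<forall>v\<in>N. (\<lambda>i. s * v i) \<in> N)"

lemma vclosedD:
 assumes "vclosed N"
 shows "(\<lambda>_. 0) \<in> N" "v \<in> N ==> w \<in> N ==> (\<lambda>i. v i + w i) \<in> N" "v \<in> N ==> (\<lambda>i. s * v i) \<in> N"
 using assms by (simp_all add: vclosed_def)

text \<open>The leading term in a position-over-term order: the last non-zero entry
  \<open>i\<close>, then the largest exponent \<open>b\<close> of \<open>x2\<close>, then the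
  largest exponent \<open>a\<close> of \<open>x1\<close>.\<close>

definition lead :: "(nat => 'k::field poly poly) => nat => nat => nat => bool" where
 "lead v i b a \<longleftrightarrow> cf (v i) a b \<noteq> 0 \<and> (\<forall>j>i. v j = 0) \<and>
   (\<forall>a' b'. cf (v i) a' b' \<noteq> 0 --> b' < b \<or> b' = b \<and> a' \<le> a)"

lemma ex_lead:
 assumes "v \<in> fs n" "v \<noteq> (\<lambda>_. 0)"
 shows "\<exists>i<n. \<exists>b a. lead v i b a"
proof -
 let ?I = "{i. v i \<noteq> 0}"
 have fin: "finite ?I"
  by (rule finite_subset[of _ "{..<n}"]) (use assms in \<open>auto simp: fs_def not_le[symmetric]\<close>)
 have ne: "?I \<noteq> {}" using assms by auto
 define i where "i = Max ?I"
 have i: "v i \<noteq> 0" using Max_in[OF fin ne] by (simp add: i_def)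
 have gt: "v j = 0" if "j > i" for j
  using Max_ge[OF fin, of j] that by (auto simp: i_def)
 define b where "b = degree (v i)"
 define a where "a = degree (coeff (v i) b)"
 have "coeff (v i) b \<noteq> 0" using i by (simp add: b_def)
 then have "cf (v i) a b \<noteq> 0" by (simp add: cf_def a_def)
 moreover have "b' < b \<or> b' = b \<and> a' \<le> a" if "cf (v i) a' b' \<noteq> 0" for a' b'
 proof -
  have "coeff (v i) b' \<noteq> 0" using that by (auto simp: cf_def)
  then have "b' \<le> b" by (simp add: b_def le_degree)
  then show ?thesis using that le_degree by (auto simp: cf_def a_def)
 qed
 moreover have "i < n" using i assms(1) by (auto simp: fs_def not_le[symmetric])
 ultimately show ?thesis using gt by (auto simp: lead_def)
qed

text \<open>One division step: the quotient of the leading coefficients makes the two leading terms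
  cancel, and no larger term is created.\<close>

lemma lead_reduce:
 assumes v: "v \<in> fs n" "lead v i b a" and g: "g \<in> fs n" "lead g i b' a'" "b' \<le> b" "a' \<le> a"
 defines "c \<equiv> cf (v i) a b / cf (g i) a' b'"
 defines "w \<equiv> \<lambda>j. v j - mnm c (a - a') (b - b') * g j"
 assumes "w \<noteq> (\<lambda>_. 0)"
 shows "\<exists>i2 b2 a2. lead w i2 b2 a2 \<and> ((i2, b2, a2), (i, b, a)) \<in> less_than <*lex*> less_than <*lex*> less_than"
proof -
 have "w \<in> fs n" using v(1) g(1) by (simp add: w_def fs_def)
 from ex_lead[OF this assms(9)] obtain i2 b2 a2 where l: "lead w i2 b2 a2" by blast
 have "w j = 0" if "j > i" for j
  using that v(2) g(2) by (simp add: w_def lead_def)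
 then have "i2 \<le> i" using l by (metis cf_simps(1) lead_def not_le)
 moreover have "b2 < b \<or> b2 = b \<and> a2 < a" if i2: "i2 = i"
 proof -
  have "cf (g i) a' b' \<noteq> 0" using g by (simp add: lead_def)
  moreover have "\<not> a < a - a'" "\<not> b < b - b'" by auto
  ultimately have "cf (w i) a b = 0" using g(3,4) by (simp add: w_def cf_mnm_mult c_def)
  then have ne: "(b2, a2) \<noteq> (b, a)" using l i2 by (auto simp: lead_def)
  have "cf (w i) a2 b2 \<noteq> 0" using l i2 by (simp add: lead_def)
  then consider "cf (v i) a2 b2 \<noteq> 0"
   | "a2 \<ge> a - a'" "b2 \<ge> b - b'" "cf (g i) (a2 - (a - a')) (b2 - (b - b')) \<noteq> 0"
   by (auto simp: w_def cf_mnm_mult split: if_splits) (metis mult_zero_right)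
  then have "b2 < b \<or> b2 = b \<and> a2 \<le> a"
  proof cases
   case 1 then show ?thesis using v(2) by (simp add: lead_def)
  next
   case 2
   then have "b2 - (b - b') < b' \<or> b2 - (b - b') = b' \<and> a2 - (a - a') \<le> a'"
    using g(2) by (simp add: lead_def)
   then show ?thesis using 2 g(3,4) by auto
  qed
  then show ?thesis using ne by auto
 qed
 ultimately show ?thesis using l by (intro exI[of _ i2] exI[of _ b2] exI[of _ a2]) auto
qed

text \<open>A Groebner basis argument. By \<open>dickson\<close> finitely many elements of
  \<open>N\<close> have leading exponents that divide all others in the same position, and division
  by these elements terminates because the order on leading terms is well-founded.\<close>

lemma vectors_noetherian:
 assumes N: "N \<subseteq> fs n" "vclosed N"
 shows "\<exists>G. finite G \<and> G \<subseteq> N \<and> (\<forall>S. vclosed S --> G \<subseteq> S --> N \<subseteq> S)"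
proof -
 define \<Lambda> where "\<Lambda> i = {(b, a). \<exists>v\<in>N. lead v i b a}" for i
 have "\<forall>i. \<exists>Fi. Fi \<subseteq> \<Lambda> i \<and> finite Fi \<and> (\<forall>(b, a)\<in>\<Lambda> i. \<exists>(b', a')\<in>Fi. b' \<le> b \<and> a' \<le> a)"
  by (intro allI dickson)
 then have "\<exists>F. \<forall>i. F i \<subseteq> \<Lambda> i \<and> finite (F i) \<and> (\<forall>(b, a)\<in>\<Lambda> i. \<exists>(b', a')\<in>F i. b' \<le> b \<and> a' \<le> a)"
  by (rule choice)
 then obtain F where F0: "\<forall>i. F i \<subseteq> \<Lambda> i \<and> finite (F i) \<and> (\<forall>(b, a)\<in>\<Lambda> i. \<exists>(b', a')\<in>F i. b' \<le> b \<and> a' \<le> a)" ..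
 have F: "F i \<subseteq> \<Lambda> i" "finite (F i)" "(b, a) \<in> \<Lambda> i ==> \<exists>b' a'. (b', a') \<in> F i \<and> b' \<le> b \<and> a' \<le> a" for i b a
  using spec[OF F0, of i] by fastforce+
 define h where "h i b a = (SOME v. v \<in> N \<and> lead v i b a)" for i b a
 have h: "h i b a \<in> N \<and> lead (h i b a) i b a" if "(b, a) \<in> \<Lambda> i" for i b a
 proof -
  have "\<exists>v. v \<in> N \<and> lead v i b a" using that by (auto simp: \<Lambda>_def)
  then show ?thesis unfolding h_def by (rule someI_ex)
 qed
 define G where "G = (\<Union>i<n. (\<lambda>(b, a). h i b a) ` F i)"
 have "finite G" using F(2) by (simp add: G_def)
 moreover have "G \<subseteq> N" using F(1) h by (fastforce simp: G_def)
 moreover have "N \<subseteq> S" if S: "vclosed S" "G \<subseteq> S" for S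
 proof
  have wf: "wf (less_than <*lex*> less_than <*lex*> less_than)" by auto
  have red: "t = (i, b, a) ==> lead v i b a ==> v \<in> N ==> v \<in> S" for t i b a v
   using wf
  proof (induction t arbitrary: v i b a rule: wf_induct_rule)
   case (less t)
   note 2 = less.IH[unfolded less.prems(1)] less.prems(2,3)
   then have "(b, a) \<in> \<Lambda> i" by (auto simp: \<Lambda>_def)
   from F(3)[OF this] obtain b' a' where ba: "(b', a') \<in> F i" "b' \<le> b" "a' \<le> a" by blast
   have "v i \<noteq> 0" using 2(2) by (auto simp: lead_def)
   then have "i < n" using N 2(3) by (auto simp: fs_def not_le[symmetric])
   define g where "g = h i b' a'"
   have "g \<in> G" using ba(1) \<open>i < n\<close> by (force simp: G_def g_def)
   have "(b', a') \<in> \<Lambda> i" using F(1) ba(1) by auto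
   from h[OF this] have g: "g \<in> N" "lead g i b' a'" by (simp_all add: g_def)
   define s where "s = mnm (cf (v i) a b / cf (g i) a' b') (a - a') (b - b')"
   define w where "w = (\<lambda>j. v j - s * g j)"
   have "(\<lambda>j. (- s) * g j) \<in> N" by (rule vclosedD(3)[OF N(2) g(1)])
   then have "(\<lambda>j. v j + (- s) * g j) \<in> N" by (rule vclosedD(2)[OF N(2) 2(3)])
   then have "w \<in> N" by (simp add: w_def)
   have "w \<in> S"
   proof (cases "w = (\<lambda>_. 0)")
    case True then show ?thesis using S(1) by (simp add: vclosed_def)
   next
    case False
    have "\<exists>i2 b2 a2. lead w i2 b2 a2 \<and> ((i2, b2, a2), (i, b, a)) \<in> less_than <*lex*> less_than <*lex*> less_than"
     unfolding w_def s_def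
     by (rule lead_reduce[of _ n]) (use False 2 N g ba in \<open>auto simp: w_def s_def\<close>)
    then show ?thesis using 2(1) \<open>w \<in> N\<close> by blast
   qed
   moreover have "(\<lambda>j. s * g j) \<in> S" by (rule vclosedD(3)[OF S(1)]) (use S \<open>g \<in> G\<close> in blast)
   ultimately have "(\<lambda>j. w j + s * g j) \<in> S" by (rule vclosedD(2)[OF S(1)])
   then show "v \<in> S" by (simp add: w_def)
  qed
  fix v assume v: "v \<in> N"
  show "v \<in> S"
  proof (cases "v = (\<lambda>_. 0)")
   case True then show ?thesis using S(1) by (simp add: vclosed_def)
  next
   case False
   then show ?thesis using ex_lead[of v n] v N(1) red by blast
  qed
 qed
 ultimately show ?thesis by blast
qed

text \<open>Gaussian elimination: the equation \<open>b0\<close> is used to eliminate an unknown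
  \<open>k0\<close>, and the value of the solution at \<open>k0\<close> is recovered from that
  equation at the end.\<close>

lemma linear_dependence:
 fixes c :: "'i => 'b => 'k::field"
 assumes "finite B" "finite I" "card I > card B"
 shows "\<exists>d. (\<exists>j\<in>I. d j \<noteq> 0) \<and> (\<forall>b\<in>B. (\<Sum>k\<in>I. d k * c k b) = 0)"
 using assms
proof (induction B arbitrary: I c rule: finite_induct)
 case empty
 then have "I \<noteq> {}" by auto
 then show ?case by (intro exI[of _ "\<lambda>_. 1"]) auto
next
 case (insert b0 B)
 show ?case
 proof (cases "\<forall>k\<in>I. c k b0 = 0")
  case True
  have "card I > card B" using insert by simp
  from insert.IH[OF insert.prems(1) this, of c] obtain d where
   "\<exists>j\<in>I. d j \<noteq> 0" "\<forall>b\<in>B. (\<Sum>k\<in>I. d k * c k b) = 0" by blast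
  then show ?thesis using True by (intro exI[of _ d]) auto
 next
  case False
  then obtain k0 where k0: "k0 \<in> I" "c k0 b0 \<noteq> 0" by auto
  let ?I = "I - {k0}"
  have "card ?I > card B" using insert k0 by simp
  from insert.IH[OF _ this, of "\<lambda>k b. c k b - c k b0 / c k0 b0 * c k0 b"] insert.prems(1)
  obtain d where d: "\<exists>j\<in>?I. d j \<noteq> 0"
   "!!b. b \<in> B ==> (\<Sum>k\<in>?I. d k * (c k b - c k b0 / c k0 b0 * c k0 b)) = 0" by auto
  define d' where "d' = d(k0 := - (\<Sum>k\<in>?I. d k * c k b0) / c k0 b0)"
  have *: "(\<Sum>k\<in>I. d' k * c k b) = (\<Sum>k\<in>?I. d k * c k b) - (\<Sum>k\<in>?I. d k * c k b0) / c k0 b0 * c k0 b" for b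
  proof -
   have "(\<Sum>k\<in>I. d' k * c k b) = d' k0 * c k0 b + (\<Sum>k\<in>?I. d' k * c k b)"
    using insert.prems(1) k0(1) by (rule sum.remove)
   moreover have "(\<Sum>k\<in>?I. d' k * c k b) = (\<Sum>k\<in>?I. d k * c k b)"
    by (rule sum.cong) (auto simp: d'_def)
   ultimately show ?thesis by (simp add: d'_def)
  qed
  have "(\<Sum>k\<in>I. d' k * c k b) = 0" if "b \<in> insert b0 B" for b
  proof (cases "b = b0")
   case True then show ?thesis using * k0 by simp
  next
   case False
   then have "(\<Sum>k\<in>?I. d k * (c k b - c k b0 / c k0 b0 * c k0 b)) = 0" using d(2) that by simp
   moreover have "(\<Sum>k\<in>?I. d k * (c k b - c k b0 / c k0 b0 * c k0 b)) =
    (\<Sum>k\<in>?I. d k * c k b) - (\<Sum>k\<in>?I. d k * c k b0) / c k0 b0 * c k0 b"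
    by (simp add: right_diff_distrib sum_subtractf sum_divide_distrib sum_distrib_right mult.assoc)
   ultimately show ?thesis using * by simp
  qed
  moreover have "\<exists>j\<in>I. d' j \<noteq> 0" using d(1) by (auto simp: d'_def)
  ultimately show ?thesis by blast
 qed
qed

context graded_mod
begin

text \<open>Submodules of \<open>M\<close> are pulled back along the surjection
  \<open>lc g n\<close> from a free module.\<close>

lemma noetherian:
 assumes fg: "finitely_generated M" and N: "subm N"
 shows "\<exists>A. finite A \<and> A \<subseteq> N \<and> (\<forall>H. subm H --> A \<subseteq> H --> N \<subseteq> H)"
proof -
 from fg_lc[OF fg] obtain n g d where g: "!!i. i < n ==> g i \<in> gr (d i)" "carrier M = range (lc g n)"
  by blast
 have gc: "g i \<in> carrier M" if "i < n" for i by (rule gr_closed(1)[OF g(1)[OF that]])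
 define P where "P H = {v \<in> fs n. lc g n v \<in> H}" for H
 have P: "vclosed (P H)" if H: "subm H" for H
  unfolding vclosed_def P_def
  using lc_add[of n g, OF gc] lc_smult[of n g, OF gc] lc_zero[of n g "\<lambda>_. 0", OF gc] submD[OF H]
  by (auto simp: fs_def)
 have "P N \<subseteq> fs n" by (auto simp: P_def)
 from vectors_noetherian[OF this P[OF N]] obtain G where
  G: "finite G" "G \<subseteq> P N" "!!S. vclosed S ==> G \<subseteq> S ==> P N \<subseteq> S" by blast
 have "N \<subseteq> H" if H: "subm H" "lc g n ` G \<subseteq> H" for H
 proof
  fix m assume m: "m \<in> N"
  then have "m \<in> range (lc g n)" using submD(1)[OF N] g(2) by blast
  then obtain v where v: "m = lc g n v" by blast
  let ?v = "\<lambda>i. if i < n then v i else 0"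
  have v': "lc g n ?v = m" unfolding v by (rule lc_cong) auto
  then have "?v \<in> P N" using m by (auto simp: P_def fs_def)
  moreover have "G \<subseteq> P H" using G(2) H(2) by (auto simp: P_def)
  ultimately have "?v \<in> P H" using G(3)[OF P[OF H(1)]] by blast
  then show "m \<in> H" using v' by (auto simp: P_def)
 qed
 then show ?thesis using G(1,2) by (intro exI[of _ "lc g n ` G"]) (auto simp: P_def)
qed

end

section \<open>Finite-dimensional subquotients and torsion\<close>

lemma (in weight_type) X_degrees:
 assumes "x \<in> VV"
 shows "\<exists>e. (\<forall>k. x ^ k \<in> Sg (e k)) \<and> (\<forall>j k. D (e j - e k) = D 0 --> j = (k::nat))"
proof -
 consider "x = X1" | "x = X2" using assms by blast
 then show ?thesis
 proof cases
  case 1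
  have "D ((int j, 0) - (int k, 0)) = D 0 --> j = k" for j k :: nat
   using D_axis1[of "int j - int k" 0 0] by (simp add: zero_prod_def)
  then show ?thesis unfolding 1 using Sg_X(1) by (intro exI[of _ "\<lambda>k. (int k, 0)"]) blast
 next
  case 2
  have "D ((0, int j) - (0, int k)) = D 0 --> j = k" for j k :: nat
   using D_axis2[of 0 "int j - int k" 0] by (simp add: zero_prod_def)
  then show ?thesis unfolding 2 using Sg_X(2) by (intro exI[of _ "\<lambda>k. (0, int k)"]) blast
 qed
qed

context graded_mod
begin

definition lin :: "'b set => ('b => 'k) => 'b" where
 "lin B c = finsum M (\<lambda>b. cst (c b) \<odot> b) B"

lemma fin_dim_quot_alt: "fin_dim_quot M N N' \<longleftrightarrow>
  (\<exists>B. finite B \<and> B \<subseteq> N \<and> (\<forall>n\<in>N. \<exists>c. \<exists>n'\<in>N'. n = n' \<oplus> lin B c))"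
 by (simp add: fin_dim_quot_def lin_def cst_def)

lemma lin_closed [simp]: "B \<subseteq> carrier M ==> lin B c \<in> carrier M"
 unfolding lin_def by (rule M.finsum_closed) auto

lemma lin_add: "B \<subseteq> carrier M ==> lin B (\<lambda>b. c b + d b) = lin B c \<oplus> lin B d"
proof -
 assume B: "B \<subseteq> carrier M"
 have "lin B (\<lambda>b. c b + d b) = finsum M (\<lambda>b. cst (c b) \<odot> b \<oplus> cst (d b) \<odot> b) B"
  unfolding lin_def by (rule M.finsum_cong') (use B in \<open>auto simp: cst_simps sm_ladd\<close>)
 also have "\<dots> = lin B c \<oplus> lin B d"
  unfolding lin_def by (rule M.finsum_addf) (use B in auto)
 finally show ?thesis .
qed

lemma lin_smult: "finite B ==> B \<subseteq> carrier M ==> lin B (\<lambda>b. e * c b) = cst e \<odot> lin B c"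
proof -
 assume B: "finite B" "B \<subseteq> carrier M"
 have "lin B (\<lambda>b. e * c b) = finsum M (\<lambda>b. cst e \<odot> (cst (c b) \<odot> b)) B"
  unfolding lin_def by (rule M.finsum_cong') (use B in \<open>auto simp: cst_simps sm_assoc\<close>)
 also have "\<dots> = cst e \<odot> lin B c"
  unfolding lin_def by (rule finsum_smult_ldistr[symmetric]) (use B in auto)
 finally show ?thesis .
qed

lemma lin_zero: "B \<subseteq> carrier M ==> (!!b. b \<in> B ==> c b = 0) ==> lin B c = \<zero>"
 unfolding lin_def by (rule M.add.finprod_one_eqI) (auto simp: cst_simps)

lemma lin_unit:
 assumes "finite B" "B \<subseteq> carrier M" "b \<in> B"
 shows "lin B (\<lambda>b'. if b' = b then e else 0) = cst e \<odot> b"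
proof -
 have "lin B (\<lambda>b'. if b' = b then e else 0) = (\<Oplus>\<^bsub>M\<^esub>b'\<in>B. if b = b' then cst e \<odot> b' else \<zero>)"
  unfolding lin_def by (rule M.finsum_cong') (use assms in \<open>auto simp: cst_simps\<close>)
 also have "\<dots> = cst e \<odot> b"
  by (rule M.finsum_singleton) (use assms in auto)
 finally show ?thesis .
qed

lemma lc_lin:
 assumes B: "finite B" "B \<subseteq> carrier M" and N': "subm N'"
  and n': "!!k. n' k \<in> N'" and e: "!!k. e k = n' k \<oplus> lin B (c k)"
 shows "\<exists>m\<in>N'. lc e K (\<lambda>k. cst (d k)) = m \<oplus> lin B (\<lambda>b. \<Sum>k<K. d k * c k b)"
proof (induction K)
 case 0
 have "lin B (\<lambda>b. \<Sum>k<(0::nat). d k * c k b) = \<zero>"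
  using B by (intro lin_zero) auto
 then show ?case using submD(2)[OF N'] by (intro bexI[of _ "\<zero>"]) auto
next
 case (Suc K)
 then obtain m where m: "m \<in> N'" "lc e K (\<lambda>k. cst (d k)) = m \<oplus> lin B (\<lambda>b. \<Sum>k<K. d k * c k b)" by blast
 have c: "m \<in> carrier M" "n' K \<in> carrier M" using submD(1)[OF N'] m n' by auto
 have "lc e (Suc K) (\<lambda>k. cst (d k)) = (m \<oplus> lin B (\<lambda>b. \<Sum>k<K. d k * c k b)) \<oplus>
   (cst (d K) \<odot> n' K \<oplus> lin B (\<lambda>b. d K * c K b))"
  using B c by (simp add: m e sm_radd lin_smult)
 also have "\<dots> = (m \<oplus> cst (d K) \<odot> n' K) \<oplus> (lin B (\<lambda>b. \<Sum>k<K. d k * c k b) \<oplus> lin B (\<lambda>b. d K * c K b))"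
  using B c by (simp add: M.a_ac)
 also have "\<dots> = (m \<oplus> cst (d K) \<odot> n' K) \<oplus> lin B (\<lambda>b. \<Sum>k<Suc K. d k * c k b)"
  using B by (simp add: lin_add)
 finally show ?case
  using submD(3,4)[OF N'] m(1) n' by blast
qed

text \<open>For homogeneous \<open>h\<close> the elements \<open>x ^ k \<odot> h\<close> have
  pairwise distinct degrees. If one more of them is taken than the number of spanning elements, they
  are dependent modulo \<open>N'\<close>, and since \<open>N'\<close> is graded each homogeneous
  term of the dependence lies in \<open>N'\<close>.\<close>

lemma fin_dim_imp_sat:
 assumes fd: "fin_dim_quot M N N'" and N: "gsub N" and N': "gsub N'"
 shows "N \<subseteq> sat N'"
proof
 have sN: "subm N" and sN': "subm N'" using N N' by (auto simp: gsub_def)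
 from fd obtain B where B: "finite B" "B \<subseteq> N" "!!n. n \<in> N ==> \<exists>c. \<exists>n'\<in>N'. n = n' \<oplus> lin B c"
  unfolding fin_dim_quot_alt by blast
 have Bc: "B \<subseteq> carrier M" using B(2) submD(1)[OF sN] by auto
 have hom: "h \<in> sat N'" if h: "h \<in> N" "h \<in> gr u" for h u
 proof (rule satI)
  show hc: "h \<in> carrier M" using submD(1)[OF sN] h by blast
  fix x :: "'k poly poly" assume x: "x \<in> VV"
  define e where "e k = x ^ k \<odot> h" for k :: nat
  have eN: "e k \<in> N" and ec: "e k \<in> carrier M" for k
   using submD(4)[OF sN h(1)] hc by (auto simp: e_def)
  have "\<forall>k. \<exists>c n'. n' \<in> N' \<and> e k = n' \<oplus> lin B c" using B(3)[OF eN] by blast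
  then obtain c n' where cn: "!!k. n' k \<in> N'" "!!k. e k = n' k \<oplus> lin B (c k)" by metis
  let ?K = "Suc (card B)"
  obtain d where d: "\<exists>j\<in>{..<?K}. d j \<noteq> 0" "!!b. b \<in> B ==> (\<Sum>k<?K. d k * c k b) = 0"
   using linear_dependence[OF B(1), of "{..<?K}" c] by auto
  from lc_lin[OF B(1) Bc sN' cn, where K = ?K and d = d] obtain m where
   m: "m \<in> N'" "lc e ?K (\<lambda>k. cst (d k)) = m \<oplus> lin B (\<lambda>b. \<Sum>k<?K. d k * c k b)" by (rule bexE)
  have "lin B (\<lambda>b. \<Sum>k<?K. d k * c k b) = \<zero>" using Bc d(2) by (rule lin_zero)
  then have mN': "lc e ?K (\<lambda>k. cst (d k)) \<in> N'" using m submD(1)[OF sN'] by simp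
  from d(1) obtain j where j: "j < ?K" "d j \<noteq> 0" by auto
  from X_degrees[OF x] obtain f where f: "!!k. x ^ k \<in> Sg (f k)" "!!j k. D (f j - f k) = D 0 ==> j = (k::nat)"
   by blast
  have "comp (D (f j + u)) (lc e ?K (\<lambda>k. cst (d k))) =
   lc e ?K (\<lambda>k. pt (D ((f j + u) - (f k + u))) (cst (d k)))"
   by (rule lc_comp) (use gr_smult[OF f(1) h(2)] in \<open>simp add: e_def\<close>)
  also have "\<dots> = lc e ?K (\<lambda>k. if k = j then cst (d j) else 0)"
  proof (rule lc_cong)
   fix k assume "k < ?K"
   have "(f j + u) - (f k + u) = f j - f k" by simp
   moreover have "D (f j - f k) \<noteq> D 0" if "k \<noteq> j" using f(2)[of j k] that by blast
   ultimately show "pt (D ((f j + u) - (f k + u))) (cst (d k)) = (if k = j then cst (d j) else 0)"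
    using pt_same[OF Sg_cst[of "d k"]] pt_other[OF Sg_cst[of "d k"], of "D (f j - f k)"] by auto
  qed simp
  also have "\<dots> = cst (d j) \<odot> e j"
   using ec j by (intro lc_unit) auto
  finally have "cst (d j) \<odot> e j \<in> N'"
   using mN' N' D_in_L unfolding gsub_def by metis
  then have "cst (1 / d j) \<odot> (cst (d j) \<odot> e j) \<in> N'" by (rule submD(4)[OF sN'])
  then have "e j \<in> N'"
   using ec[of j] j by (simp add: sm_assoc[symmetric] cst_simps(3)[symmetric] cst_simps(2))
  then show "\<exists>k. x ^ k \<odot> h \<in> N'" by (auto simp: e_def)
 qed
 fix n assume n: "n \<in> N"
 then have nc: "n \<in> carrier M" using submD(1)[OF sN] by auto
 note ss = subm_sat[OF sN']
 show "n \<in> sat N'"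
  using nc
 proof (rule comp_induct)
  fix x assume x: "x \<in> carrier L"
  then obtain u where u: "x = D u" by (rule L_cases)
  have "comp x n \<in> N" using N n x by (auto simp: gsub_def)
  moreover have "comp x n \<in> gr u" unfolding u by (rule comp_gr[OF nc])
  ultimately show "comp x n \<in> sat N'" by (rule hom)
 qed (use submD[OF ss] in auto)
qed

text \<open>With one exponent \<open>K\<close> for all generators and both variables, a monomial
  multiple of a generator lies in \<open>N'\<close> as soon as one of its exponents reaches
  \<open>K\<close>; the finitely many other multiples span modulo \<open>N'\<close>.\<close>

lemma sat_imp_fin_dim:
 assumes fg: "finitely_generated M" and N: "subm N" and N': "subm N'" and sat: "N \<subseteq> sat N'"
 shows "fin_dim_quot M N N'"
proof -
 from noetherian[OF fg N] obtain A where A: "finite A" "A \<subseteq> N" "!!H. subm H ==> A \<subseteq> H ==> N \<subseteq> H" by blast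
 have Nc: "n \<in> N ==> n \<in> carrier M" for n using submD(1)[OF N] by blast
 have "\<forall>a\<in>A. \<exists>k. X1 ^ k \<odot> a \<in> N' \<and> X2 ^ k \<odot> a \<in> N'"
 proof
  fix a assume "a \<in> A"
  then have a: "a \<in> sat N'" "a \<in> carrier M" using A(2) sat Nc by auto
  from satE[OF a(1), of X1] satE[OF a(1), of X2] obtain k l where
   "X1 ^ k \<odot> a \<in> N'" "X2 ^ l \<odot> a \<in> N'" by auto
  then show "\<exists>k. X1 ^ k \<odot> a \<in> N' \<and> X2 ^ k \<odot> a \<in> N'"
   using pow_mono[OF N' a(2), of X1 k "k + l"] pow_mono[OF N' a(2), of X2 l "k + l"] by auto
 qed
 from bchoice[OF this] obtain \<kappa> where \<kappa>: "!!a. a \<in> A ==> X1 ^ \<kappa> a \<odot> a \<in> N' \<and> X2 ^ \<kappa> a \<odot> a \<in> N'" by blast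
 \<comment> \<open>The sum is a crude upper bound for all the exponents
   \<open>\<kappa> a\<close>.\<close>
 define K where "K = (\<Sum>a\<in>A. \<kappa> a)"
 have K: "X1 ^ k \<odot> a \<in> N'" "X2 ^ k \<odot> a \<in> N'" if "a \<in> A" "k \<ge> K" for a k
 proof -
  have "\<kappa> a \<le> k" using member_le_sum[OF that(1), of \<kappa>] A(1) that(2) by (simp add: K_def)
  moreover have "a \<in> carrier M" using that A(2) Nc by auto
  ultimately show "X1 ^ k \<odot> a \<in> N'" "X2 ^ k \<odot> a \<in> N'"
   using \<kappa>[OF that(1)] pow_mono[OF N'] by blast+
 qed
 define B where "B = (\<lambda>(i, j, a). mnm 1 i j \<odot> a) ` ({..<K} \<times> {..<K} \<times> A)"
 have B: "finite B" "B \<subseteq> N"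
  using A(1,2) submD(4)[OF N] by (auto simp: B_def)
 have Bc: "B \<subseteq> carrier M" using B(2) Nc by auto
 define T where "T = {n. \<exists>c. \<exists>n'\<in>N'. n = n' \<oplus> lin B c}"
 have T_add: "m \<oplus> n \<in> T" if "m \<in> T" "n \<in> T" for m n
 proof -
  from that obtain c d m' n' where e: "m' \<in> N'" "n' \<in> N'" "m = m' \<oplus> lin B c" "n = n' \<oplus> lin B d"
   unfolding T_def by blast
  have "m' \<in> carrier M" "n' \<in> carrier M" using e submD(1)[OF N'] by auto
  then have "m \<oplus> n = (m' \<oplus> n') \<oplus> lin B (\<lambda>b. c b + d b)"
   using Bc by (simp add: e lin_add M.a_ac)
  then show ?thesis unfolding T_def using e submD(3)[OF N'] by blast
 qed
 have T_N': "n \<in> T" if "n \<in> N'" for n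
 proof -
  have "n = n \<oplus> lin B (\<lambda>_. 0)" using lin_zero[OF Bc, of "\<lambda>_. 0"] submD(1)[OF N' that] by simp
  then show ?thesis unfolding T_def using that by blast
 qed
 have T_B: "cst e \<odot> b \<in> T" if "b \<in> B" for e b
 proof -
  have "b \<in> carrier M" using that Bc by auto
  then have "cst e \<odot> b = \<zero> \<oplus> lin B (\<lambda>b'. if b' = b then e else 0)"
   using lin_unit[OF B(1) Bc that, of e] by simp
  then show ?thesis unfolding T_def using submD(2)[OF N'] by blast
 qed
 define S where "S = {m \<in> carrier M. \<forall>s. s \<odot> m \<in> T}"
 have "subm S"
  unfolding subm_def S_def using T_add T_N'[OF submD(2)[OF N']]
  by (auto simp: sm_radd sm_assoc[symmetric])
 moreover have "A \<subseteq> S"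
 proof
  fix a assume a: "a \<in> A"
  then have ac: "a \<in> carrier M" using A(2) Nc by auto
  have "s \<odot> a \<in> T" for s
  proof (induction s rule: mon_induct)
   case 1 then show ?case using ac T_N'[OF submD(2)[OF N']] by simp
  next
   case (2 P Q) then show ?case using ac T_add by (simp add: sm_ladd)
  next
   case (3 c i j)
   have eq: "mnm c i j \<odot> a = cst c \<odot> (mnm 1 i j \<odot> a)"
    using ac by (simp add: mnm_def cst_simps sm_assoc)
   have eq1: "mnm c i j \<odot> a = (cst c * X2 ^ j) \<odot> (X1 ^ i \<odot> a)"
    and eq2: "mnm c i j \<odot> a = (cst c * X1 ^ i) \<odot> (X2 ^ j \<odot> a)"
    using ac by (simp_all add: mnm_def sm_assoc[symmetric] mult_ac)
   show ?case
   proof (cases "i \<ge> K \<or> j \<ge> K")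
    case True
    then have "mnm c i j \<odot> a \<in> N'"
     using K[OF a] submD(4)[OF N'] eq1 eq2 by metis
    then show ?thesis by (rule T_N')
   next
    case False
    then have "mnm 1 i j \<odot> a \<in> B" using a by (auto simp: B_def intro!: image_eqI[of _ _ "(i, j, a)"])
    then show ?thesis unfolding eq by (rule T_B)
   qed
  qed
  then show "a \<in> S" using ac by (simp add: S_def)
 qed
 ultimately have "N \<subseteq> S" by (rule A(3))
 have "n \<in> T" if "n \<in> N" for n
 proof -
  have "n \<in> S" using \<open>N \<subseteq> S\<close> that by auto
  then have "n \<in> carrier M" "1 \<odot> n \<in> T" by (auto simp only: S_def mem_Collect_eq)
  then show ?thesis by simp
 qed
 then show ?thesis
  unfolding fin_dim_quot_alt T_def using B by (intro exI[of _ B]) blast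
qed

lemma fin_dim_iff:
 assumes "finitely_generated M" "gsub N" "gsub N'"
 shows "fin_dim_quot M N N' \<longleftrightarrow> N \<subseteq> sat N'"
 using fin_dim_imp_sat sat_imp_fin_dim assms by (auto simp: gsub_def)

section \<open>Graded submodules as objects in their own right\<close>

definition subo :: "'b set => ('k poly poly, 'b) gmod" where
 "subo N = M\<lparr>carrier := N, grade := \<lambda>x. N \<inter> grade M x\<rparr>"

lemma subo_simps [simp]: "carrier (subo N) = N" "ring.add (subo N) = ring.add M" "ring.zero (subo N) = \<zero>"
 "module.smult (subo N) = module.smult M" "grade (subo N) x = N \<inter> grade M x"
 by (simp_all add: subo_def)

lemma subo_module:
 assumes N: "subm N"
 shows "module (SS :: 'k poly poly ring) (subo N)"
proof (rule moduleI)
 note c = submD(1)[OF N]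
 show "abelian_group (subo N)"
 proof (rule abelian_groupI)
  fix x assume x: "x \<in> carrier (subo N)"
  then show "\<exists>y\<in>carrier (subo N). y \<oplus>\<^bsub>subo N\<^esub> x = \<zero>\<^bsub>subo N\<^esub>"
   using submD(5)[OF N, of x] c[of x] by (intro bexI[of _ "\<ominus> x"]) (auto simp: M.l_neg)
 qed (use submD[OF N] c in \<open>auto simp: M.a_ac\<close>)
qed (use submD[OF N] in \<open>auto simp: SS_cring sm_ladd sm_radd sm_assoc\<close>)

lemma subo_finsum:
 assumes N: "subm N" and "finite A" "!!a. a \<in> A ==> f a \<in> N"
 shows "finsum (subo N) f A = finsum M f A"
proof -
 interpret S: module "SS :: 'k poly poly ring" "subo N" by (rule subo_module[OF N])
 show ?thesis
  using assms(2,3)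
 proof (induction A)
  case empty show ?case by (simp add: M.finsum_empty S.finsum_empty)
 next
  case (insert a A)
  have "f \<in> A \<rightarrow> carrier M" "f a \<in> carrier M" using insert submD(1)[OF N] by auto
  moreover have "f \<in> A \<rightarrow> carrier (subo N)" using insert by auto
  ultimately show ?case using insert by (simp add: M.finsum_insert S.finsum_insert)
 qed
qed

lemma subo_graded:
 assumes N: "gsub N" shows "graded_module p q (subo N)"
proof -
 have sN: "subm N" using N by (simp add: gsub_def)
 interpret S: module "SS :: 'k poly poly ring" "subo N" by (rule subo_module[OF sN])
 show ?thesis
  unfolding graded_module_def
 proof (intro conjI ballI)
  show "module (SS :: 'k poly poly ring) (subo N)" by (rule subo_module[OF sN])
 next
  fix x assume "x \<in> carrier L"
  then obtain u where u: "x = D u" by (rule L_cases)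
  have gx: "grade M x = gr u" by (simp add: gr_def u)
  show "subgroup (grade (subo N) x) (add_monoid (subo N))"
  proof (rule S.add.subgroupI)
   show "grade (subo N) x \<noteq> {}" using submD(2)[OF sN] gx by auto
   fix a assume a: "a \<in> grade (subo N) x"
   then have ac: "a \<in> N" "a \<in> gr u" using gx by auto
   have m: "\<ominus> a \<in> N \<inter> gr u" using submD(5)[OF sN ac(1)] gr_minus(1)[OF ac(2)] by auto
   have "\<ominus>\<^bsub>subo N\<^esub> a = \<ominus> a"
    by (rule S.minus_equality) (use ac m submD(1)[OF sN ac(1)] in \<open>auto simp: M.l_neg\<close>)
   then show "\<ominus>\<^bsub>subo N\<^esub> a \<in> grade (subo N) x"
    using m gx by simp
  qed (use submD[OF sN] gx in auto)
 next
  fix x y m and s :: "'k poly poly" assume x: "x \<in> carrier L" and y: "y \<in> carrier L" and s: "s \<in> S_grade p q x" and m: "m \<in> grade (subo N) y"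
  then show "s \<odot>\<^bsub>subo N\<^esub> m \<in> grade (subo N) (x \<otimes>\<^bsub>L\<^esub> y)"
   using gm submD(4)[OF sN] by (auto simp: graded_module_def)
 next
 fix m assume m: "m \<in> carrier (subo N)"
 then have mN: "m \<in> N" and mc: "m \<in> carrier M" using submD(1)[OF sN] by auto
 let ?P = "\<lambda>c. c \<in> (\<Pi>\<^sub>E x\<in>carrier L. grade (subo N) x) \<and> finite {x \<in> carrier L. c x \<noteq> \<zero>\<^bsub>subo N\<^esub>} \<and>
    m = finsum (subo N) c {x \<in> carrier L. c x \<noteq> \<zero>\<^bsub>subo N\<^esub>}"
 show "\<exists>!c. ?P c"
 proof (rule ex1I)
  let ?c = "restrict (\<lambda>x. comp x m) (carrier L)"
  have S: "{x \<in> carrier L. ?c x \<noteq> \<zero>\<^bsub>subo N\<^esub>} = supp m" by auto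
  have cN: "comp x m \<in> N" if "x \<in> carrier L" for x using N mN that by (auto simp: gsub_def)
  have "finsum (subo N) ?c (supp m) = finsum M ?c (supp m)"
   by (rule subo_finsum[OF sN finite_supp[OF mc]]) (use cN in auto)
  also have "\<dots> = finsum M (\<lambda>x. comp x m) (supp m)"
   by (rule M.finsum_cong') (use mc in auto)
  also have "\<dots> = m" by (rule finsum_comp) (use mc finite_supp in auto)
  finally show "?P ?c"
   unfolding S using finite_supp[OF mc] cN comp_all[OF mc] by auto
 next
  fix c assume c: "?P c"
  have cx: "c x \<in> N" "c x \<in> grade M x" if "x \<in> carrier L" for x using c that by auto
  let ?F = "{x \<in> carrier L. c x \<noteq> \<zero>}"
  have fin: "finite ?F" and sm: "m = finsum M c ?F"
   using c subo_finsum[OF sN, of ?F c] cx by auto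
  have "comp x m = c x" if "x \<in> carrier L" for x
   by (rule comp_unique[OF _ fin _ _ sm that]) (use cx in \<open>auto simp: gr_def\<close>)
  then show "c = restrict (\<lambda>x. comp x m) (carrier L)"
   using c by (intro ext) (auto simp: PiE_def extensional_def)
 qed
 qed
qed

lemma subo_fg:
 assumes fg: "finitely_generated M" and N: "gsub N" shows "finitely_generated (subo N)"
proof -
 interpret S: graded_mod p q "subo N" using subo_graded[OF N] by unfold_locales
 have sN: "subm N" using N by (simp add: gsub_def)
 from noetherian[OF fg sN] obtain A where A: "finite A" "A \<subseteq> N" "!!H. subm H ==> A \<subseteq> H ==> N \<subseteq> H" by blast
 show ?thesis
  unfolding finitely_generated_def S.submodule_iff
 proof (intro exI[of _ A] conjI allI impI)
  fix H assume H: "S.subm H \<and> A \<subseteq> H"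
  then have "subm H" unfolding S.subm_def subm_def using submD(1)[OF sN] by auto
  then have "N \<subseteq> H" using A(3) H by blast
  then show "H = carrier (subo N)" using H by (auto simp: S.subm_def)
 qed (use A in auto)
qed

end

section \<open>Morphisms of the quotient category as relations\<close>

locale obj = graded_mod p q M for p q and M :: "('k::field poly poly, 'b) gmod" (structure) +
 assumes fg: "finitely_generated M"

locale two = M: obj p q M + N: obj p q N
 for p q :: nat and M N :: "('k::field poly poly, 'b) gmod"
begin

lemma gsum_simps [simp]: "carrier (gsum M N) = carrier M \<times> carrier N"
 "ring.zero (gsum M N) = (\<zero>\<^bsub>M\<^esub>, \<zero>\<^bsub>N\<^esub>)"
 "(m, n) \<oplus>\<^bsub>gsum M N\<^esub> (m', n') = (m \<oplus>\<^bsub>M\<^esub> m', n \<oplus>\<^bsub>N\<^esub> n')"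
 "s \<odot>\<^bsub>gsum M N\<^esub> (m, n) = (s \<odot>\<^bsub>M\<^esub> m, s \<odot>\<^bsub>N\<^esub> n)"
 "grade (gsum M N) x = grade M x \<times> grade N x"
 by (simp_all add: gsum_def)

lemma gsum_module: "module (SS :: 'k poly poly ring) (gsum M N)"
proof (rule moduleI)
 show "abelian_group (gsum M N)"
 proof (rule abelian_groupI)
  fix x assume x: "x \<in> carrier (gsum M N)"
  then show "\<exists>y\<in>carrier (gsum M N). y \<oplus>\<^bsub>gsum M N\<^esub> x = \<zero>\<^bsub>gsum M N\<^esub>"
   by (intro bexI[of _ "(\<ominus>\<^bsub>M\<^esub> fst x, \<ominus>\<^bsub>N\<^esub> snd x)"]) (auto simp: M.M.l_neg N.M.l_neg)
 qed (auto simp: M.M.a_ac N.M.a_ac)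
qed (auto simp: SS_cring M.sm_ladd M.sm_radd M.sm_assoc N.sm_ladd N.sm_radd N.sm_assoc)

lemma gsum_finsum:
 assumes "finite A" "!!a. a \<in> A ==> f a \<in> carrier M \<times> carrier N"
 shows "finsum (gsum M N) f A = (finsum M (\<lambda>a. fst (f a)) A, finsum N (\<lambda>a. snd (f a)) A)"
proof -
 interpret S: module "SS :: 'k poly poly ring" "gsum M N" by (rule gsum_module)
 show ?thesis
  using assms
 proof (induction A)
  case empty show ?case by (simp add: M.M.finsum_empty N.M.finsum_empty S.finsum_empty)
 next
  case (insert a A)
  have "(\<lambda>a. fst (f a)) \<in> A \<rightarrow> carrier M" "(\<lambda>a. snd (f a)) \<in> A \<rightarrow> carrier N" "f \<in> A \<rightarrow> carrier (gsum M N)"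
   "fst (f a) \<in> carrier M" "snd (f a) \<in> carrier N" "f a \<in> carrier (gsum M N)"
   using insert.prems by (force simp: mem_Times_iff)+
  then show ?case using insert
   by (simp add: M.M.finsum_insert N.M.finsum_insert S.finsum_insert) (metis gsum_simps(3) prod.collapse)
 qed
qed

lemma gsum_graded: "graded_module p q (gsum M N)"
proof -
 interpret S: module "SS :: 'k poly poly ring" "gsum M N" by (rule gsum_module)
 show ?thesis
  unfolding graded_module_def
 proof (intro conjI ballI)
  show "module (SS :: 'k poly poly ring) (gsum M N)" by (rule gsum_module)
 next
  fix x assume "x \<in> carrier M.L"
  then obtain u where u: "x = M.D u" by (rule M.L_cases)
  have gx: "grade (gsum M N) x = M.gr u \<times> N.gr u" by (simp add: M.gr_def N.gr_def u)
  show "subgroup (grade (gsum M N) x) (add_monoid (gsum M N))"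
  proof (rule S.add.subgroupI)
   show "grade (gsum M N) x \<noteq> {}" unfolding gx using M.gr_closed(2)[of u] N.gr_closed(2)[of u] by blast
   fix a assume a: "a \<in> grade (gsum M N) x"
   then obtain m n where mn: "a = (m, n)" "m \<in> M.gr u" "n \<in> N.gr u" using gx by auto
   have "\<ominus>\<^bsub>gsum M N\<^esub> a = (\<ominus>\<^bsub>M\<^esub> m, \<ominus>\<^bsub>N\<^esub> n)"
    by (rule S.minus_equality) (use mn M.gr_closed(1)[OF mn(2)] N.gr_closed(1)[OF mn(3)] in \<open>auto simp: M.M.l_neg N.M.l_neg\<close>)
   then show "\<ominus>\<^bsub>gsum M N\<^esub> a \<in> grade (gsum M N) x"
    using gx mn by simp
  qed (use gx in auto)
 next
  fix x y m and s :: "'k poly poly" assume x: "x \<in> carrier M.L" and y: "y \<in> carrier M.L"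
   and s: "s \<in> S_grade p q x" and m: "m \<in> grade (gsum M N) y"
  then show "s \<odot>\<^bsub>gsum M N\<^esub> m \<in> grade (gsum M N) (x \<otimes>\<^bsub>M.L\<^esub> y)"
   using M.gm N.gm by (cases m) (simp add: graded_module_def)
 next
  fix m assume "m \<in> carrier (gsum M N)"
  then obtain a b where ab: "m = (a, b)" "a \<in> carrier M" "b \<in> carrier N" by auto
  let ?P = "\<lambda>c. c \<in> (\<Pi>\<^sub>E x\<in>carrier M.L. grade (gsum M N) x) \<and> finite {x \<in> carrier M.L. c x \<noteq> \<zero>\<^bsub>gsum M N\<^esub>} \<and>
     m = finsum (gsum M N) c {x \<in> carrier M.L. c x \<noteq> \<zero>\<^bsub>gsum M N\<^esub>}"
  show "\<exists>!c. ?P c"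
  proof (rule ex1I)
   let ?c = "restrict (\<lambda>x. (M.comp x a, N.comp x b)) (carrier M.L)"
   let ?F = "{x \<in> carrier M.L. ?c x \<noteq> \<zero>\<^bsub>gsum M N\<^esub>}"
   have F: "?F = M.supp a \<union> N.supp b" by auto
   have fin: "finite ?F" unfolding F using ab M.finite_supp N.finite_supp by auto
   have "finsum (gsum M N) ?c ?F = (finsum M (\<lambda>x. fst (?c x)) ?F, finsum N (\<lambda>x. snd (?c x)) ?F)"
    by (rule gsum_finsum[OF fin]) (use ab in auto)
   also have "finsum M (\<lambda>x. fst (?c x)) ?F = finsum M (\<lambda>x. M.comp x a) ?F"
    by (rule M.M.finsum_cong') (use ab in auto)
   also have "\<dots> = a" by (rule M.finsum_comp[OF ab(2) fin]) (auto simp: F)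
   also have "finsum N (\<lambda>x. snd (?c x)) ?F = finsum N (\<lambda>x. N.comp x b) ?F"
    by (rule N.M.finsum_cong') (use ab in auto)
   also have "\<dots> = b" by (rule N.finsum_comp[OF ab(3) fin]) (auto simp: F)
   finally have s: "finsum (gsum M N) ?c ?F = (a, b)" .
   have pi: "?c \<in> (\<Pi>\<^sub>E x\<in>carrier M.L. grade (gsum M N) x)"
    using M.comp_all[OF ab(2)] N.comp_all[OF ab(3)] by auto
   show "?P ?c" unfolding ab(1) by (intro conjI pi fin s[symmetric])
  next
   fix c assume c: "?P c"
   have cx: "c x \<in> grade M x \<times> grade N x" if "x \<in> carrier M.L" for x using c that by auto
   let ?F = "{x \<in> carrier M.L. c x \<noteq> \<zero>\<^bsub>gsum M N\<^esub>}"
   have fin: "finite ?F" using c by auto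
   have cu: "c (M.D u) \<in> M.gr u \<times> N.gr u" for u using cx[of "M.D u"] by (simp add: M.gr_def N.gr_def)
   have cc: "c x \<in> carrier M \<times> carrier N" if "x \<in> carrier M.L" for x
    using that
   proof (rule M.L_cases)
    fix u assume "x = M.D u"
    then show ?thesis using cu[of u] M.gr_closed(1) N.gr_closed(1) by (metis mem_Times_iff)
   qed
   have "m = (finsum M (\<lambda>x. fst (c x)) ?F, finsum N (\<lambda>x. snd (c x)) ?F)"
    using c gsum_finsum[OF fin, of c] cc by auto
   then have sm: "a = finsum M (\<lambda>x. fst (c x)) ?F" "b = finsum N (\<lambda>x. snd (c x)) ?F" using ab(1) by auto
   have "M.comp x a = fst (c x)" if "x \<in> carrier M.L" for x
    by (rule M.comp_unique[OF _ fin _ _ sm(1) that]) (use cu in \<open>auto simp: mem_Times_iff\<close>)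
   moreover have "N.comp x b = snd (c x)" if "x \<in> carrier M.L" for x
    by (rule N.comp_unique[OF _ fin _ _ sm(2) that]) (use cu in \<open>auto simp: mem_Times_iff\<close>)
   ultimately have "c x = restrict (\<lambda>x. (M.comp x a, N.comp x b)) (carrier M.L) x" for x
    using c by (cases "x \<in> carrier M.L") (auto simp: PiE_def extensional_def)
   then show "c = restrict (\<lambda>x. (M.comp x a, N.comp x b)) (carrier M.L)" by (rule ext)
  qed
 qed
qed

interpretation S: graded_mod p q "gsum M N"
 using gsum_graded by unfold_locales

lemma gsum_comp:
 assumes "m \<in> carrier M" "n \<in> carrier N" "x \<in> carrier M.L"
 shows "S.comp x (m, n) = (M.comp x m, N.comp x n)"
proof (rule S.comp_unique[where F = "M.supp m \<union> N.supp n"])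
 let ?F = "M.supp m \<union> N.supp n"
 show "(M.comp (M.D u) m, N.comp (M.D u) n) \<in> S.gr u" for u
  using M.comp_gr[OF assms(1)] N.comp_gr[OF assms(2)] by (simp add: S.gr_def M.gr_def N.gr_def)
 show fin: "finite ?F" using assms M.finite_supp N.finite_supp by auto
 have "finsum M (\<lambda>x. M.comp x m) ?F = m" by (rule M.finsum_comp[OF assms(1) fin]) auto
 moreover have "finsum N (\<lambda>x. N.comp x n) ?F = n" by (rule N.finsum_comp[OF assms(2) fin]) auto
 ultimately show "(m, n) = finsum (gsum M N) (\<lambda>x. (M.comp x m, N.comp x n)) ?F"
  by (subst gsum_finsum[OF fin]) (use assms in auto)
qed (use assms in auto)

text \<open>A graded submodule of the direct sum, spelled out on pairs so that relations can be
  composed and inverted without going through \<open>gsum\<close>.\<close>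

definition rsub :: "('b \<times> 'b) set => bool" where
 "rsub R \<longleftrightarrow> R \<subseteq> carrier M \<times> carrier N \<and> (\<zero>\<^bsub>M\<^esub>, \<zero>\<^bsub>N\<^esub>) \<in> R \<and>
   (\<forall>m n m' n'. (m, n) \<in> R --> (m', n') \<in> R --> (m \<oplus>\<^bsub>M\<^esub> m', n \<oplus>\<^bsub>N\<^esub> n') \<in> R) \<and>
   (\<forall>s m n. (m, n) \<in> R --> (s \<odot>\<^bsub>M\<^esub> m, s \<odot>\<^bsub>N\<^esub> n) \<in> R) \<and>
   (\<forall>m n u. (m, n) \<in> R --> (M.comp (M.D u) m, N.comp (M.D u) n) \<in> R)"

lemma rsub_iff: "graded_submodule p q R (gsum M N) \<longleftrightarrow> rsub R"
proof
 assume "graded_submodule p q R (gsum M N)"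
 then have R: "S.subm R" and cp: "!!r x. r \<in> R ==> x \<in> carrier M.L ==> S.comp x r \<in> R"
  by (auto simp: S.graded_submodule_iff S.gsub_def)
 have sub: "R \<subseteq> carrier M \<times> carrier N" using S.submD(1)[OF R] by auto
 have "(M.comp (M.D u) m, N.comp (M.D u) n) \<in> R" if "(m, n) \<in> R" for m n u
  using cp[OF that, of "M.D u"] gsum_comp[of m n "M.D u"] sub that by auto
 then show "rsub R"
  using S.submD(2)[OF R] S.submD(3)[OF R, of "(m, n)" "(m', n')" for m n m' n'] S.submD(4)[OF R, of "(m, n)" for m n] sub
  by (auto simp: rsub_def)
next
 assume R: "rsub R"
 have sub: "R \<subseteq> carrier M \<times> carrier N" using R by (simp add: rsub_def)
 have "S.subm R"
  unfolding S.subm_def using R by (auto simp: rsub_def)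
 moreover have "S.comp x r \<in> R" if r: "r \<in> R" and x: "x \<in> carrier M.L" for r x
 proof -
  obtain m n where mn: "r = (m, n)" by (cases r)
  obtain u where "x = M.D u" using x by (rule M.L_cases)
  moreover have "(M.comp (M.D u) m, N.comp (M.D u) n) \<in> R"
   using R r unfolding rsub_def mn by blast
  ultimately show ?thesis using r gsum_comp[of m n x] sub x by (auto simp: mn)
 qed
 ultimately show "graded_submodule p q R (gsum M N)"
  by (simp add: S.graded_submodule_iff S.gsub_def)
qed

text \<open>Representatives of morphisms: total up to torsion and single-valued up to torsion.
  Through \<open>fin_dim_iff\<close> these are exactly the members of
  \<open>frac_hom\<close>.\<close>

definition rel :: "('b \<times> 'b) set => bool" where
 "rel R \<longleftrightarrow> rsub R \<and> carrier M \<subseteq> M.sat (Domain R) \<and> (\<forall>n. (\<zero>\<^bsub>M\<^esub>, n) \<in> R --> n \<in> N.tors)"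

lemma rsubD:
 assumes "rsub R"
 shows "(m, n) \<in> R ==> m \<in> carrier M" "(m, n) \<in> R ==> n \<in> carrier N" "(\<zero>\<^bsub>M\<^esub>, \<zero>\<^bsub>N\<^esub>) \<in> R"
  "(m, n) \<in> R ==> (m', n') \<in> R ==> (m \<oplus>\<^bsub>M\<^esub> m', n \<oplus>\<^bsub>N\<^esub> n') \<in> R"
  "(m, n) \<in> R ==> (s \<odot>\<^bsub>M\<^esub> m, s \<odot>\<^bsub>N\<^esub> n) \<in> R"
  "(m, n) \<in> R ==> x \<in> carrier M.L ==> (M.comp x m, N.comp x n) \<in> R"
  "(m, n) \<in> R ==> (m', n') \<in> R ==> (m \<ominus>\<^bsub>M\<^esub> m', n \<ominus>\<^bsub>N\<^esub> n') \<in> R"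
proof -
 show *: "(m, n) \<in> R ==> m \<in> carrier M" "(m, n) \<in> R ==> n \<in> carrier N" "(\<zero>\<^bsub>M\<^esub>, \<zero>\<^bsub>N\<^esub>) \<in> R"
  "(m, n) \<in> R ==> (m', n') \<in> R ==> (m \<oplus>\<^bsub>M\<^esub> m', n \<oplus>\<^bsub>N\<^esub> n') \<in> R"
  "(m, n) \<in> R ==> (s \<odot>\<^bsub>M\<^esub> m, s \<odot>\<^bsub>N\<^esub> n) \<in> R" for m n m' n' s
  using assms by (auto simp: rsub_def)
 show "(m, n) \<in> R ==> x \<in> carrier M.L ==> (M.comp x m, N.comp x n) \<in> R"
  using assms by (metis M.L_cases rsub_def)
 assume r: "(m, n) \<in> R" "(m', n') \<in> R"
 have "((-1) \<odot>\<^bsub>M\<^esub> m', (-1) \<odot>\<^bsub>N\<^esub> n') \<in> R" by (rule *(5)[OF r(2)])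
 from *(4)[OF r(1) this] show "(m \<ominus>\<^bsub>M\<^esub> m', n \<ominus>\<^bsub>N\<^esub> n') \<in> R"
  using *(1,2)[OF r(2)] by (simp add: M.sm_minus N.sm_minus a_minus_def)
qed

lemma rsub_Domain: "rsub R ==> M.gsub (Domain R)"
proof -
 assume R: "rsub R"
 show ?thesis
  unfolding M.gsub_def M.subm_def
 proof (intro conjI ballI allI subsetI)
  show "\<zero>\<^bsub>M\<^esub> \<in> Domain R" using rsubD(3)[OF R] by (rule DomainI)
 next
  fix m assume "m \<in> Domain R" then show "m \<in> carrier M" using rsubD(1)[OF R] by (elim DomainE)
 next
  fix m m' assume "m \<in> Domain R" "m' \<in> Domain R"
  then show "m \<oplus>\<^bsub>M\<^esub> m' \<in> Domain R" by (elim DomainE) (rule DomainI[OF rsubD(4)[OF R]])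
 next
  fix s m assume "m \<in> Domain R"
  then show "s \<odot>\<^bsub>M\<^esub> m \<in> Domain R" by (elim DomainE) (rule DomainI[OF rsubD(5)[OF R]])
 next
  fix x m assume "m \<in> Domain R" "x \<in> carrier M.L"
  then show "M.comp x m \<in> Domain R" by (elim DomainE) (rule DomainI[OF rsubD(6)[OF R]])
 qed
qed

lemma rsub_image: "rsub R ==> N.gsub (R `` {\<zero>\<^bsub>M\<^esub>})"
proof -
 assume R: "rsub R"
 have "(\<zero>\<^bsub>M\<^esub>, n \<oplus>\<^bsub>N\<^esub> n') \<in> R" if "(\<zero>\<^bsub>M\<^esub>, n) \<in> R" "(\<zero>\<^bsub>M\<^esub>, n') \<in> R" for n n'
  using rsubD(4)[OF R that] by simp
 moreover have "(\<zero>\<^bsub>M\<^esub>, s \<odot>\<^bsub>N\<^esub> n) \<in> R" if "(\<zero>\<^bsub>M\<^esub>, n) \<in> R" for s n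
  using rsubD(5)[OF R that, of s] by simp
 moreover have "(\<zero>\<^bsub>M\<^esub>, N.comp x n) \<in> R" if "(\<zero>\<^bsub>M\<^esub>, n) \<in> R" "x \<in> carrier M.L" for x n
  using rsubD(6)[OF R that] that by simp
 ultimately show ?thesis
  unfolding N.gsub_def N.subm_def using rsubD(2,3)[OF R] by auto
qed

lemma frac_hom_iff: "R \<in> frac_hom p q M N \<longleftrightarrow> rel R"
proof (cases "rsub R")
 case True
 have "fin_dim_quot N (R `` {\<zero>\<^bsub>M\<^esub>}) {\<zero>\<^bsub>N\<^esub>} \<longleftrightarrow> R `` {\<zero>\<^bsub>M\<^esub>} \<subseteq> N.tors"
  unfolding N.tors_def by (rule N.fin_dim_iff[OF N.fg rsub_image[OF True] N.gsub_zero])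
 then show ?thesis
  using True M.fin_dim_iff[OF M.fg M.gsub_carrier rsub_Domain[OF True]]
  by (auto simp: frac_hom_def rsub_iff rel_def)
qed (simp add: frac_hom_def rsub_iff rel_def)

lemma rel_rsub: "rel R ==> rsub R"
 by (simp add: rel_def)

lemma rel_dom: "rel R ==> m \<in> carrier M ==> x \<in> VV ==> \<exists>k n. (x ^ k \<odot>\<^bsub>M\<^esub> m, n) \<in> R"
 using M.satE unfolding rel_def by blast

lemma rsub_pow_mono: "rsub R ==> m \<in> carrier M ==> (x ^ k \<odot>\<^bsub>M\<^esub> m, n) \<in> R ==> (x ^ (l + k) \<odot>\<^bsub>M\<^esub> m, x ^ l \<odot>\<^bsub>N\<^esub> n) \<in> R"
 using rsubD(5)[of R "x ^ k \<odot>\<^bsub>M\<^esub> m" n "x ^ l"] by (simp add: power_add M.sm_assoc)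

text \<open>A power of \<open>x\<close> that kills \<open>m\<close> moves \<open>n\<close> into the
  indeterminacy, which is torsion.\<close>

lemma rel_tors:
 assumes R: "rel R" and mn: "(m, n) \<in> R" and m: "m \<in> M.tors" shows "n \<in> N.tors"
proof (rule N.tors_tors)
 note s = rel_rsub[OF R]
 show "n \<in> carrier N" using rsubD(2)[OF s mn] .
 fix x :: "'k poly poly" assume "x \<in> VV"
 then obtain k where "x ^ k \<odot>\<^bsub>M\<^esub> m = \<zero>\<^bsub>M\<^esub>" using M.torsE[OF m] by blast
 then have "(\<zero>\<^bsub>M\<^esub>, x ^ k \<odot>\<^bsub>N\<^esub> n) \<in> R" using rsubD(5)[OF s mn, of "x ^ k"] by simp
 then show "\<exists>k. x ^ k \<odot>\<^bsub>N\<^esub> n \<in> N.tors" using R by (auto simp: rel_def)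
qed

text \<open>Equality in the colimit, tested on common arguments only. The auxiliary submodules of
  \<open>frac_equiv\<close> disappear because the indeterminacy can be enlarged to
  \<open>tors\<close> and the domains can be cut down to their intersection.\<close>

definition eqv :: "('b \<times> 'b) set => ('b \<times> 'b) set => bool" where
 "eqv R R' \<longleftrightarrow> (\<forall>m n n'. (m, n) \<in> R --> (m, n') \<in> R' --> n \<ominus>\<^bsub>N\<^esub> n' \<in> N.tors)"

lemma eqvD: "eqv R R' ==> (m, n) \<in> R ==> (m, n') \<in> R' ==> n \<ominus>\<^bsub>N\<^esub> n' \<in> N.tors"
 by (auto simp: eqv_def)

lemma eqv_subset: "rel R' ==> R \<subseteq> R' ==> eqv R R'"
 unfolding eqv_def
proof (intro allI impI)
 fix m n n' assume R: "rel R'" "R \<subseteq> R'" and mn: "(m, n) \<in> R" "(m, n') \<in> R'"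
 note s = rel_rsub[OF R(1)]
 have "(m \<ominus>\<^bsub>M\<^esub> m, n \<ominus>\<^bsub>N\<^esub> n') \<in> R'" using rsubD(7)[OF s] mn R(2) by blast
 moreover have "m \<ominus>\<^bsub>M\<^esub> m = \<zero>\<^bsub>M\<^esub>" using rsubD(1)[OF s mn(2)] M.diff_zero_iff by blast
 ultimately show "n \<ominus>\<^bsub>N\<^esub> n' \<in> N.tors" using R(1) by (simp add: rel_def)
qed

lemma eqv_refl: "rel R ==> eqv R R"
 by (rule eqv_subset) auto

lemma eqv_sym: "rel R ==> rel R' ==> eqv R R' ==> eqv R' R"
 unfolding eqv_def
proof (intro allI impI)
 fix m n n' assume R: "rel R" "rel R'" and e: "\<forall>m n n'. (m, n) \<in> R --> (m, n') \<in> R' --> n \<ominus>\<^bsub>N\<^esub> n' \<in> N.tors"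
  and mn: "(m, n) \<in> R'" "(m, n') \<in> R"
 have c: "n \<in> carrier N" "n' \<in> carrier N" using rsubD(2) rel_rsub R mn by blast+
 have "n' \<ominus>\<^bsub>N\<^esub> n \<in> N.tors" using e mn by blast
 then have "\<ominus>\<^bsub>N\<^esub> (n' \<ominus>\<^bsub>N\<^esub> n) \<in> N.tors" by (rule N.torsD(5))
 also have "\<ominus>\<^bsub>N\<^esub> (n' \<ominus>\<^bsub>N\<^esub> n) = n \<ominus>\<^bsub>N\<^esub> n'"
  using c by (simp add: a_minus_def N.M.minus_add N.M.a_comm)
 finally show "n \<ominus>\<^bsub>N\<^esub> n' \<in> N.tors" .
qed

lemma tors_triangle:
 assumes "a \<in> carrier N" "b \<in> carrier N" "c \<in> carrier N" "a \<ominus>\<^bsub>N\<^esub> b \<in> N.tors" "b \<ominus>\<^bsub>N\<^esub> c \<in> N.tors"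
 shows "a \<ominus>\<^bsub>N\<^esub> c \<in> N.tors"
proof -
 have "(a \<ominus>\<^bsub>N\<^esub> b) \<oplus>\<^bsub>N\<^esub> (b \<ominus>\<^bsub>N\<^esub> c) = ((a \<ominus>\<^bsub>N\<^esub> b) \<oplus>\<^bsub>N\<^esub> b) \<ominus>\<^bsub>N\<^esub> c"
  using assms(1-3) by (simp add: a_minus_def N.M.a_assoc)
 also have "\<dots> = a \<ominus>\<^bsub>N\<^esub> c" using assms by (simp add: N.diff_add_cancel')
 finally show ?thesis using N.torsD(3)[OF assms(4,5)] by simp
qed

text \<open>The middle relation need not be defined at \<open>m\<close>. A power of \<open>x\<close>
  moves \<open>m\<close> into its domain, and \<open>tors_tors\<close> removes the power
  afterwards.\<close>

lemma eqv_trans: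
 assumes R: "rel R" "rel R'" "rel R''" and e: "eqv R R'" "eqv R' R''" shows "eqv R R''"
 unfolding eqv_def
proof (intro allI impI)
 fix m n n'' assume mn: "(m, n) \<in> R" "(m, n'') \<in> R''"
 note s = rel_rsub[OF R(1)] rel_rsub[OF R(2)] rel_rsub[OF R(3)]
 have c: "m \<in> carrier M" "n \<in> carrier N" "n'' \<in> carrier N"
  using rsubD(1,2)[OF s(1) mn(1)] rsubD(2)[OF s(3) mn(2)] by auto
 show "n \<ominus>\<^bsub>N\<^esub> n'' \<in> N.tors"
 proof (rule N.tors_tors)
  show "n \<ominus>\<^bsub>N\<^esub> n'' \<in> carrier N" using c by simp
  fix x :: "'k poly poly" assume "x \<in> VV"
  from rel_dom[OF R(2) c(1) this] obtain k n' where n': "(x ^ k \<odot>\<^bsub>M\<^esub> m, n') \<in> R'" by blast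
  have "x ^ k \<odot>\<^bsub>N\<^esub> n \<ominus>\<^bsub>N\<^esub> n' \<in> N.tors" by (rule eqvD[OF e(1) rsubD(5)[OF s(1) mn(1)] n'])
  moreover have "n' \<ominus>\<^bsub>N\<^esub> x ^ k \<odot>\<^bsub>N\<^esub> n'' \<in> N.tors" by (rule eqvD[OF e(2) n' rsubD(5)[OF s(3) mn(2)]])
  ultimately have "x ^ k \<odot>\<^bsub>N\<^esub> n \<ominus>\<^bsub>N\<^esub> x ^ k \<odot>\<^bsub>N\<^esub> n'' \<in> N.tors"
   by (rule tors_triangle[rotated 3]) (use c rsubD(2)[OF s(2) n'] in auto)
  then show "\<exists>k. x ^ k \<odot>\<^bsub>N\<^esub> (n \<ominus>\<^bsub>N\<^esub> n'') \<in> N.tors" using c by (auto simp: N.sm_rdiff)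
 qed
qed

lemma transition_eqv:
 assumes R: "rel R" "rel R'" and M': "carrier M \<subseteq> M.sat M'" and N': "N' \<subseteq> N.tors" "\<zero>\<^bsub>N\<^esub> \<in> N'"
  and tr: "transition N M' N' R = transition N M' N' R'" and dm: "R' `` {\<zero>\<^bsub>M\<^esub>} \<subseteq> N'"
 shows "eqv R R'"
 unfolding eqv_def
proof (intro allI impI)
 fix m n n' assume mn: "(m, n) \<in> R" "(m, n') \<in> R'"
 note s = rel_rsub[OF R(1)] rel_rsub[OF R(2)]
 have c: "m \<in> carrier M" "n \<in> carrier N" "n' \<in> carrier N"
  using rsubD(1,2)[OF s(1) mn(1)] rsubD(2)[OF s(2) mn(2)] by auto
 show "n \<ominus>\<^bsub>N\<^esub> n' \<in> N.tors"
 proof (rule N.tors_tors)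
  show "n \<ominus>\<^bsub>N\<^esub> n' \<in> carrier N" using c by simp
  fix x :: "'k poly poly" assume x: "x \<in> VV"
  have "m \<in> M.sat M'" using M' c by auto
  then obtain k where k: "x ^ k \<odot>\<^bsub>M\<^esub> m \<in> M'" using M.satE x by blast
  let ?m = "x ^ k \<odot>\<^bsub>M\<^esub> m"
  have r: "(?m, x ^ k \<odot>\<^bsub>N\<^esub> n) \<in> R" "(?m, x ^ k \<odot>\<^bsub>N\<^esub> n') \<in> R'"
   using rsubD(5)[OF s(1) mn(1)] rsubD(5)[OF s(2) mn(2)] by auto
  have "(?m, x ^ k \<odot>\<^bsub>N\<^esub> n \<oplus>\<^bsub>N\<^esub> \<zero>\<^bsub>N\<^esub>) \<in> transition N M' N' R"
   unfolding transition_def using k r(1) N'(2) by blast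
  then have "(?m, x ^ k \<odot>\<^bsub>N\<^esub> n) \<in> transition N M' N' R'" using tr c by simp
  then obtain l t where lt: "(?m, l) \<in> R'" "t \<in> N'" "x ^ k \<odot>\<^bsub>N\<^esub> n = l \<oplus>\<^bsub>N\<^esub> t"
   unfolding transition_def by blast
  have lc: "l \<in> carrier N" "t \<in> N.tors" using rsubD(2)[OF s(2) lt(1)] lt(2) N' by auto
  then have tc: "t \<in> carrier N" using N.torsD(1) by blast
  have 1: "l \<ominus>\<^bsub>N\<^esub> x ^ k \<odot>\<^bsub>N\<^esub> n' \<in> N.tors" by (rule eqvD[OF eqv_refl[OF R(2)] lt(1) r(2)])
  have "x ^ k \<odot>\<^bsub>N\<^esub> n \<ominus>\<^bsub>N\<^esub> l = t" unfolding lt(3)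
   using N.add_diff_assoc[of t l] lc tc by (simp add: N.M.a_comm)
  then have "x ^ k \<odot>\<^bsub>N\<^esub> n \<ominus>\<^bsub>N\<^esub> l \<in> N.tors" using lc by simp
  moreover note 1
  ultimately have "x ^ k \<odot>\<^bsub>N\<^esub> n \<ominus>\<^bsub>N\<^esub> x ^ k \<odot>\<^bsub>N\<^esub> n' \<in> N.tors"
   by (rule tors_triangle[rotated 3]) (use c lc in auto)
  then show "\<exists>k. x ^ k \<odot>\<^bsub>N\<^esub> (n \<ominus>\<^bsub>N\<^esub> n') \<in> N.tors" using c by (auto simp: N.sm_rdiff)
 qed
qed

lemma frac_equiv_iff: "(R, R') \<in> frac_equiv p q M N \<longleftrightarrow> rel R \<and> rel R' \<and> eqv R R'"
proof
 assume "(R, R') \<in> frac_equiv p q M N"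
 then obtain M' N' where R: "rel R" "rel R'" and g: "M.gsub M'" "N.gsub N'"
  and fd: "fin_dim_quot M (carrier M) M'" "fin_dim_quot N N' {\<zero>\<^bsub>N\<^esub>}"
  and d: "R' `` {\<zero>\<^bsub>M\<^esub>} \<subseteq> N'" and tr: "transition N M' N' R = transition N M' N' R'"
  by (auto simp: frac_equiv_def frac_hom_iff M.graded_submodule_iff N.graded_submodule_iff)
 have "eqv R R'"
 proof (rule transition_eqv[OF R _ _ _ tr d])
  show "carrier M \<subseteq> M.sat M'" using fd(1) M.fin_dim_iff[OF M.fg M.gsub_carrier g(1)] by simp
  show "N' \<subseteq> N.tors" using fd(2) N.fin_dim_iff[OF N.fg g(2) N.gsub_zero] by (simp add: N.tors_def)
  show "\<zero>\<^bsub>N\<^esub> \<in> N'" using g(2) by (simp add: N.gsub_def N.subm_def)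
 qed
 then show "rel R \<and> rel R' \<and> eqv R R'" using R by simp
next
 assume "rel R \<and> rel R' \<and> eqv R R'"
 then have R: "rel R" "rel R'" and e: "eqv R R'" by auto
 note s = rel_rsub[OF R(1)] rel_rsub[OF R(2)]
 let ?M = "Domain R \<inter> Domain R'"
 have gM: "M.gsub ?M" using rsub_Domain[OF s(1)] rsub_Domain[OF s(2)] by (auto simp: M.gsub_def M.subm_def)
 have "carrier M \<subseteq> M.sat ?M"
 proof
  fix m assume m: "m \<in> carrier M"
  show "m \<in> M.sat ?M"
  proof (rule M.satI[OF m])
   fix x :: "'k poly poly" assume x: "x \<in> VV"
   from rel_dom[OF R(1) m x] rel_dom[OF R(2) m x] obtain k n l n' where
    "(x ^ k \<odot>\<^bsub>M\<^esub> m, n) \<in> R" "(x ^ l \<odot>\<^bsub>M\<^esub> m, n') \<in> R'" by blast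
   from rsub_pow_mono[OF s(1) m this(1), of l] rsub_pow_mono[OF s(2) m this(2), of k]
   have "x ^ (k + l) \<odot>\<^bsub>M\<^esub> m \<in> ?M" by (auto simp: add.commute)
   then show "\<exists>k. x ^ k \<odot>\<^bsub>M\<^esub> m \<in> ?M" ..
  qed
 qed
 then have fM: "fin_dim_quot M (carrier M) ?M" using M.fin_dim_iff[OF M.fg M.gsub_carrier gM] by simp
 have fN: "fin_dim_quot N N.tors {\<zero>\<^bsub>N\<^esub>}"
  using N.fin_dim_iff[OF N.fg N.tors_gsub N.gsub_zero] by (simp add: N.tors_def)
 \<comment> \<open>By symmetry one inclusion suffices; the difference of two equivalent values is
   absorbed into the torsion summand.\<close>
 have half: "transition N ?M N.tors A \<subseteq> transition N ?M N.tors B"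
  if A: "rel A" and B: "rel B" and e: "eqv A B" and AB: "Domain A \<inter> Domain B = ?M" for A B
 proof
  fix z assume "z \<in> transition N ?M N.tors A"
  then obtain m n t where z: "z = (m, n \<oplus>\<^bsub>N\<^esub> t)" "m \<in> ?M" "(m, n) \<in> A" "t \<in> N.tors"
   unfolding transition_def by blast
  then obtain n' where n': "(m, n') \<in> B" using AB by blast
  have c: "n \<in> carrier N" "n' \<in> carrier N" "t \<in> carrier N"
   using rsubD(2)[OF rel_rsub[OF A] z(3)] rsubD(2)[OF rel_rsub[OF B] n'] N.torsD(1)[OF z(4)] by auto
  have "n \<ominus>\<^bsub>N\<^esub> n' \<in> N.tors" by (rule eqvD[OF e z(3) n'])
  then have t: "(n \<ominus>\<^bsub>N\<^esub> n') \<oplus>\<^bsub>N\<^esub> t \<in> N.tors" using z(4) by (rule N.torsD(3))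
  have "n' \<oplus>\<^bsub>N\<^esub> ((n \<ominus>\<^bsub>N\<^esub> n') \<oplus>\<^bsub>N\<^esub> t) = ((n \<ominus>\<^bsub>N\<^esub> n') \<oplus>\<^bsub>N\<^esub> n') \<oplus>\<^bsub>N\<^esub> t"
   using c by (simp add: N.M.a_ac)
  also have "\<dots> = n \<oplus>\<^bsub>N\<^esub> t" using c by (simp add: N.diff_add_cancel')
  finally have "z = (m, n' \<oplus>\<^bsub>N\<^esub> ((n \<ominus>\<^bsub>N\<^esub> n') \<oplus>\<^bsub>N\<^esub> t))" using z(1) by simp
  then show "z \<in> transition N ?M N.tors B"
   unfolding transition_def using z(2) n' t by blast
 qed
 have "transition N ?M N.tors R = transition N ?M N.tors R'"
  using half[OF R e] half[OF R(2,1) eqv_sym[OF R e]] by blast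
 then show "(R, R') \<in> frac_equiv p q M N"
  unfolding frac_equiv_def frac_hom_iff mem_Collect_eq case_prod_conv
  using R gM fM fN N.tors_gsub
  by (intro conjI exI[of _ ?M] exI[of _ N.tors]) (auto simp: M.graded_submodule_iff N.graded_submodule_iff rel_def)
qed

lemma equiv_frac: "equiv (frac_hom p q M N) (frac_equiv p q M N)"
proof (rule equivI)
 show "frac_equiv p q M N \<subseteq> frac_hom p q M N \<times> frac_hom p q M N"
  by (auto simp: frac_equiv_iff frac_hom_iff)
 show "refl_on (frac_hom p q M N) (frac_equiv p q M N)"
  by (auto simp: refl_on_def frac_equiv_iff frac_hom_iff eqv_refl)
 show "sym (frac_equiv p q M N)"
  by (auto simp: sym_def frac_equiv_iff eqv_sym)
 show "trans (frac_equiv p q M N)"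
  by (rule transI) (auto simp: frac_equiv_iff intro: eqv_trans)
qed

definition cls :: "('b \<times> 'b) set => ('b \<times> 'b) set set" where
 "cls R = frac_equiv p q M N `` {R}"

lemma cls_eq_iff: "rel R ==> rel R' ==> cls R = cls R' \<longleftrightarrow> eqv R R'"
 unfolding cls_def by (subst eq_equiv_class_iff[OF equiv_frac]) (auto simp: frac_hom_iff frac_equiv_iff)

lemma in_cls: "R' \<in> cls R \<longleftrightarrow> rel R \<and> rel R' \<and> eqv R R'"
 by (auto simp: cls_def frac_equiv_iff)

lemma Mor_iff: "F \<in> Mor (coh p q) M N \<longleftrightarrow> (\<exists>R. rel R \<and> F = cls R)"
 by (auto simp: coh_def quotient_def cls_def frac_hom_iff)

end

lemma (in graded_mod) diff_zero: "m \<in> carrier M ==> m \<ominus> \<zero> = m"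
 using add_diff_assoc[of m "\<zero>"] by simp

section \<open>The quotient category, its composition, and its zero objects\<close>

locale category =
 fixes C :: "('o, 'm) cat"
 assumes Idm_Mor: "V \<in> Ob C ==> Idm C V \<in> Mor C V V"
  and Cmp_Mor: "V \<in> Ob C ==> Y \<in> Ob C ==> Z \<in> Ob C ==> f \<in> Mor C V Y ==> g \<in> Mor C Y Z ==> Cmp C V Y Z g f \<in> Mor C V Z"
  and Cmp_assoc: "W \<in> Ob C ==> V \<in> Ob C ==> Y \<in> Ob C ==> Z \<in> Ob C ==>
   f \<in> Mor C W V ==> g \<in> Mor C V Y ==> h \<in> Mor C Y Z ==>
   Cmp C W V Z (Cmp C V Y Z h g) f = Cmp C W Y Z h (Cmp C W V Y g f)"
  and Idm_left: "V \<in> Ob C ==> Y \<in> Ob C ==> f \<in> Mor C V Y ==> Cmp C V Y Y (Idm C Y) f = f"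
  and Idm_right: "V \<in> Ob C ==> Y \<in> Ob C ==> f \<in> Mor C V Y ==> Cmp C V V Y f (Idm C V) = f"

locale three = M: obj p q M + N: obj p q N + P: obj p q P
 for p q :: nat and M N P :: "('k::field poly poly, 'b) gmod"
begin

sublocale MN: two p q M N ..
sublocale NP: two p q N P ..
sublocale MP: two p q M P ..

lemma comp_rsub:
 assumes f: "MN.rsub f" and g: "NP.rsub g" shows "MP.rsub (f O g)"
 unfolding MP.rsub_def
proof (intro conjI allI impI)
 show "f O g \<subseteq> carrier M \<times> carrier P"
  using MN.rsubD(1)[OF f] NP.rsubD(2)[OF g] by auto
 show "(\<zero>\<^bsub>M\<^esub>, \<zero>\<^bsub>P\<^esub>) \<in> f O g" by (rule relcompI[OF MN.rsubD(3)[OF f] NP.rsubD(3)[OF g]])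
next
 fix m r m' r' assume "(m, r) \<in> f O g" "(m', r') \<in> f O g"
 then show "(m \<oplus>\<^bsub>M\<^esub> m', r \<oplus>\<^bsub>P\<^esub> r') \<in> f O g"
  by (elim relcompEpair) (rule relcompI[OF MN.rsubD(4)[OF f] NP.rsubD(4)[OF g]])
next
 fix s m r assume "(m, r) \<in> f O g"
 then show "(s \<odot>\<^bsub>M\<^esub> m, s \<odot>\<^bsub>P\<^esub> r) \<in> f O g"
  by (elim relcompEpair) (rule relcompI[OF MN.rsubD(5)[OF f] NP.rsubD(5)[OF g]])
next
 fix m r u assume "(m, r) \<in> f O g"
 then show "(M.comp (M.D u) m, P.comp (M.D u) r) \<in> f O g"
  by (elim relcompEpair) (rule relcompI[OF MN.rsubD(6)[OF f] NP.rsubD(6)[OF g]], auto)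
qed

text \<open>One power of \<open>x\<close> moves \<open>m\<close> into the domain of
  \<open>f\<close>, a second one moves the value into the domain of \<open>g\<close>.\<close>

lemma comp_rel:
 assumes f: "MN.rel f" and g: "NP.rel g" shows "MP.rel (f O g)"
 unfolding MP.rel_def
proof (intro conjI allI impI subsetI)
 note sf = MN.rel_rsub[OF f] and sg = NP.rel_rsub[OF g]
 show "MP.rsub (f O g)" by (rule comp_rsub[OF sf sg])
 fix m assume m: "m \<in> carrier M"
 show "m \<in> M.sat (Domain (f O g))"
 proof (rule M.satI[OF m])
  fix x :: "'k poly poly" assume x: "x \<in> VV"
  from MN.rel_dom[OF f m x] obtain k n where n: "(x ^ k \<odot>\<^bsub>M\<^esub> m, n) \<in> f" by blast
  from NP.rel_dom[OF g MN.rsubD(2)[OF sf n] x] obtain l r where r: "(x ^ l \<odot>\<^bsub>N\<^esub> n, r) \<in> g" by blast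
  from MN.rsub_pow_mono[OF sf m n] r have "(x ^ (l + k) \<odot>\<^bsub>M\<^esub> m, r) \<in> f O g" by (rule relcompI)
  then show "\<exists>k. x ^ k \<odot>\<^bsub>M\<^esub> m \<in> Domain (f O g)" by (intro exI DomainI)
 qed
next
 fix r assume "(\<zero>\<^bsub>M\<^esub>, r) \<in> f O g"
 then obtain n where "(\<zero>\<^bsub>M\<^esub>, n) \<in> f" "(n, r) \<in> g" by blast
 then show "r \<in> P.tors" using NP.rel_tors[OF g] f by (auto simp: MN.rel_def)
qed

text \<open>\<open>g'\<close> need not be defined at the value \<open>n\<close> of \<open>f\<close>;
  after multiplication by a power of \<open>x\<close> it is, and its value \<open>s\<close> there
  mediates between the values \<open>r\<close> and \<open>r'\<close>.\<close>

lemma comp_eqv: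
 assumes f: "MN.rel f" "MN.rel f'" "MN.eqv f f'" and g: "NP.rel g" "NP.rel g'" "NP.eqv g g'"
 shows "MP.eqv (f O g) (f' O g')"
 unfolding MP.eqv_def
proof (intro allI impI)
 fix m r r' assume "(m, r) \<in> f O g" "(m, r') \<in> f' O g'"
 then obtain n n' where n: "(m, n) \<in> f" "(n, r) \<in> g" "(m, n') \<in> f'" "(n', r') \<in> g'" by blast
 note sg = NP.rel_rsub[OF g(1)] NP.rel_rsub[OF g(2)]
 have c: "n \<in> carrier N" "n' \<in> carrier N" "r \<in> carrier P" "r' \<in> carrier P"
  using NP.rsubD(1,2)[OF sg(1) n(2)] NP.rsubD(1,2)[OF sg(2) n(4)] by auto
 have t: "n \<ominus>\<^bsub>N\<^esub> n' \<in> N.tors" by (rule MN.eqvD[OF f(3) n(1,3)])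
 show "r \<ominus>\<^bsub>P\<^esub> r' \<in> P.tors"
 proof (rule P.tors_tors)
  show "r \<ominus>\<^bsub>P\<^esub> r' \<in> carrier P" using c by simp
  fix x :: "'k poly poly" assume "x \<in> VV"
  from NP.rel_dom[OF g(2) c(1) this] obtain k s where s: "(x ^ k \<odot>\<^bsub>N\<^esub> n, s) \<in> g'" by blast
  have 1: "x ^ k \<odot>\<^bsub>P\<^esub> r \<ominus>\<^bsub>P\<^esub> s \<in> P.tors"
   by (rule NP.eqvD[OF g(3) NP.rsubD(5)[OF sg(1) n(2)] s])
  have "(x ^ k \<odot>\<^bsub>N\<^esub> n \<ominus>\<^bsub>N\<^esub> x ^ k \<odot>\<^bsub>N\<^esub> n', s \<ominus>\<^bsub>P\<^esub> x ^ k \<odot>\<^bsub>P\<^esub> r') \<in> g'"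
   by (rule NP.rsubD(7)[OF sg(2) s NP.rsubD(5)[OF sg(2) n(4)]])
  moreover have "x ^ k \<odot>\<^bsub>N\<^esub> n \<ominus>\<^bsub>N\<^esub> x ^ k \<odot>\<^bsub>N\<^esub> n' \<in> N.tors"
   using N.torsD(4)[OF t, of "x ^ k"] c by (simp add: N.sm_rdiff)
  ultimately have 2: "s \<ominus>\<^bsub>P\<^esub> x ^ k \<odot>\<^bsub>P\<^esub> r' \<in> P.tors" by (rule NP.rel_tors[OF g(2)])
  have "x ^ k \<odot>\<^bsub>P\<^esub> r \<ominus>\<^bsub>P\<^esub> x ^ k \<odot>\<^bsub>P\<^esub> r' \<in> P.tors"
   by (rule NP.tors_triangle[OF _ _ _ 1 2]) (use c NP.rsubD(2)[OF sg(2) s] in auto)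
  then show "\<exists>k. x ^ k \<odot>\<^bsub>P\<^esub> (r \<ominus>\<^bsub>P\<^esub> r') \<in> P.tors" using c by (auto simp: P.sm_rdiff)
 qed
qed

text \<open>The union over all representatives in \<open>Cmp\<close> collapses, because by
  \<open>comp_eqv\<close> all composites of representatives lie in one class.\<close>

lemma Cmp_cls:
 assumes f: "MN.rel f" and g: "NP.rel g"
 shows "Cmp (coh p q) M N P (NP.cls g) (MN.cls f) = MP.cls (f O g)"
proof -
 have "MP.cls (f' O g') = MP.cls (f O g)" if "f' \<in> MN.cls f" "g' \<in> NP.cls g" for f' g'
 proof -
  have *: "MN.rel f'" "NP.rel g'" "MN.eqv f f'" "NP.eqv g g'"
   using that by (auto simp: MN.in_cls NP.in_cls)
  have "MP.eqv (f O g) (f' O g')" by (rule comp_eqv) (use f g * in auto)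
  then show ?thesis using MP.cls_eq_iff[OF comp_rel[OF f g] comp_rel[OF *(1,2)]] by simp
 qed
 moreover have "f \<in> MN.cls f" "g \<in> NP.cls g"
  using f g by (auto simp: MN.in_cls NP.in_cls MN.eqv_refl NP.eqv_refl)
 ultimately have "(\<Union>f'\<in>MN.cls f. \<Union>g'\<in>NP.cls g. MP.cls (f' O g')) = MP.cls (f O g)" by blast
 then show ?thesis by (simp add: coh_def MP.cls_def)
qed

end

context weight_type
begin

lemma Ob_iff: "M \<in> Ob (coh p q) \<longleftrightarrow> obj p q M"
 using weight_type_axioms
 by (auto simp: coh_def obj_def graded_mod_def graded_mod_axioms_def obj_axioms_def)

end

context obj
begin

sublocale MM: two p q M M ..

lemma Id_rel: "MM.rel (Id_on (carrier M))"
 unfolding MM.rel_def MM.rsub_def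
proof (intro conjI allI impI)
 show "carrier M \<subseteq> sat (Domain (Id_on (carrier M)))"
  using sat_incl[OF subm_carrier] by simp
qed (auto simp: torsD)

lemma Idm_eq: "Idm (coh p q) M = MM.cls (Id_on (carrier M))"
 by (simp add: coh_def MM.cls_def)

end

lemma (in weight_type) coh_category: "category (coh p q :: (('k::field poly poly, 'b) gmod, ('b \<times> 'b) set set) cat)"
proof
 fix V :: "('k poly poly, 'b) gmod"
 assume "V \<in> Ob (coh p q)"
 then interpret obj p q V by (simp add: Ob_iff)
 show "Idm (coh p q) V \<in> Mor (coh p q) V V"
  using Id_rel Idm_eq MM.Mor_iff by blast
next
 fix V Y Z :: "('k poly poly, 'b) gmod" and f g
 assume "V \<in> Ob (coh p q)" "Y \<in> Ob (coh p q)" "Z \<in> Ob (coh p q)"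
  and m: "f \<in> Mor (coh p q) V Y" "g \<in> Mor (coh p q) Y Z"
 then interpret V: obj p q V + Y: obj p q Y + Z: obj p q Z by (simp_all add: Ob_iff)
 interpret three p q V Y Z ..
 from m obtain a b where "MN.rel a" "f = MN.cls a" "NP.rel b" "g = NP.cls b"
  by (auto simp: MN.Mor_iff NP.Mor_iff)
 then show "Cmp (coh p q) V Y Z g f \<in> Mor (coh p q) V Z"
  using Cmp_cls comp_rel MP.Mor_iff by blast
next
 fix W V Y Z :: "('k poly poly, 'b) gmod" and f g h
 assume "W \<in> Ob (coh p q)" "V \<in> Ob (coh p q)" "Y \<in> Ob (coh p q)" "Z \<in> Ob (coh p q)"
  and m: "f \<in> Mor (coh p q) W V" "g \<in> Mor (coh p q) V Y" "h \<in> Mor (coh p q) Y Z"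
 then interpret W: obj p q W + V: obj p q V + Y: obj p q Y + Z: obj p q Z by (simp_all add: Ob_iff)
 interpret WXY: three p q W V Y ..
 interpret XYZ: three p q V Y Z ..
 interpret WXZ: three p q W V Z ..
 interpret WYZ: three p q W Y Z ..
 from iffD1[OF WXY.MN.Mor_iff m(1)] obtain a where a: "WXY.MN.rel a" "f = WXY.MN.cls a" by blast
 from iffD1[OF WXY.NP.Mor_iff m(2)] obtain b where b: "WXY.NP.rel b" "g = WXY.NP.cls b" by blast
 from iffD1[OF XYZ.NP.Mor_iff m(3)] obtain c where c: "XYZ.NP.rel c" "h = XYZ.NP.cls c" by blast
 note 1 = XYZ.Cmp_cls[OF b(1) c(1)] and 2 = WXY.Cmp_cls[OF a(1) b(1)]
  and 3 = WXZ.Cmp_cls[OF a(1) XYZ.comp_rel[OF b(1) c(1)]] and 4 = WYZ.Cmp_cls[OF WXY.comp_rel[OF a(1) b(1)] c(1)]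
 show "Cmp (coh p q) W V Z (Cmp (coh p q) V Y Z h g) f = Cmp (coh p q) W Y Z h (Cmp (coh p q) W V Y g f)"
  by (simp only: a(2) b(2) c(2) 1 2 3 4 O_assoc)
next
 fix V Y :: "('k poly poly, 'b) gmod" and f
 assume "V \<in> Ob (coh p q)" "Y \<in> Ob (coh p q)" and m: "f \<in> Mor (coh p q) V Y"
 then interpret V: obj p q V + Y: obj p q Y by (simp_all add: Ob_iff)
 interpret XXY: three p q V V Y ..
 interpret XYY: three p q V Y Y ..
 from m obtain a where r: "XXY.NP.rel a" and e: "f = XXY.NP.cls a"
  by (auto simp: XXY.NP.Mor_iff)
 have sub: "a \<subseteq> carrier V \<times> carrier Y" using XXY.NP.rel_rsub[OF r] by (simp add: XXY.NP.rsub_def)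
 have "a O Id_on (carrier Y) = a" "Id_on (carrier V) O a = a" using sub by auto
 then show "Cmp (coh p q) V Y Y (Idm (coh p q) Y) f = f" "Cmp (coh p q) V V Y f (Idm (coh p q) V) = f"
  unfolding e using XYY.Cmp_cls[OF r Y.Id_rel] XXY.Cmp_cls[OF V.Id_rel r] by (simp_all add: V.Idm_eq Y.Idm_eq)
qed

context two
begin

definition zr :: "('b \<times> 'b) set" where "zr = carrier M \<times> {\<zero>\<^bsub>N\<^esub>}"

lemma zr_rel: "rel zr"
 unfolding rel_def rsub_def zr_def
proof (intro conjI allI impI)
 have "Domain (carrier M \<times> {\<zero>\<^bsub>N\<^esub>}) = carrier M" by auto
 then show "carrier M \<subseteq> M.sat (Domain (carrier M \<times> {\<zero>\<^bsub>N\<^esub>}))"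
  using M.sat_incl[OF M.subm_carrier] by simp
qed (auto simp: N.torsD)

lemma eqv_zr_iff: "rel R ==> eqv R zr \<longleftrightarrow> Range R \<subseteq> N.tors"
proof
 assume R: "rel R" and e: "eqv R zr"
 show "Range R \<subseteq> N.tors"
 proof
  fix n assume "n \<in> Range R"
  then obtain m where mn: "(m, n) \<in> R" by blast
  note c = rsubD(1,2)[OF rel_rsub[OF R] mn]
  have "n \<ominus>\<^bsub>N\<^esub> \<zero>\<^bsub>N\<^esub> \<in> N.tors" by (rule eqvD[OF e mn]) (use c in \<open>simp add: zr_def\<close>)
  then show "n \<in> N.tors" using c by (simp add: N.diff_zero)
 qed
next
 assume R: "rel R" and t: "Range R \<subseteq> N.tors"
 show "eqv R zr"
  unfolding eqv_def zr_def
 proof (intro allI impI)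
  fix m n n' assume mn: "(m, n) \<in> R" "(m, n') \<in> carrier M \<times> {\<zero>\<^bsub>N\<^esub>}"
  have "n \<in> N.tors" using t mn by blast
  moreover from this have "n \<in> carrier N" by (rule N.torsD)
  ultimately show "n \<ominus>\<^bsub>N\<^esub> n' \<in> N.tors" using mn by (simp add: N.diff_zero)
 qed
qed

lemma rel_Range_tors: "rel R ==> carrier M \<subseteq> M.tors ==> Range R \<subseteq> N.tors"
 using rel_tors rsubD(1)[OF rel_rsub] by (metis RangeE subset_iff)

end

text \<open>On a zero object the identity and the zero relation represent the same morphism, which
  says that every element is torsion. Conversely, every relation into or out of a torsion module has
  torsion range.\<close>

lemma (in obj) zero_object_iff: "zero_object (coh p q) M \<longleftrightarrow> carrier M \<subseteq> tors"
proof
 assume z: "zero_object (coh p q) M"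
 have "M \<in> Ob (coh p q)" using Ob_iff obj_axioms by blast
 then have "\<exists>!f. f \<in> Mor (coh p q) M M" using z by (auto simp: zero_object_def)
 moreover have "MM.cls (Id_on (carrier M)) \<in> Mor (coh p q) M M" "MM.cls MM.zr \<in> Mor (coh p q) M M"
  using Id_rel MM.zr_rel by (auto simp: MM.Mor_iff)
 ultimately have "MM.cls (Id_on (carrier M)) = MM.cls MM.zr" by blast
 then show "carrier M \<subseteq> tors"
  using MM.cls_eq_iff[OF Id_rel MM.zr_rel] MM.eqv_zr_iff[OF Id_rel] by simp
next
 assume t: "carrier M \<subseteq> tors"
 show "zero_object (coh p q) M"
  unfolding zero_object_def
 proof (intro conjI ballI)
  show "M \<in> Ob (coh p q)" using Ob_iff obj_axioms by blast
  fix U :: "('k poly poly, 'b) gmod"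
  assume "U \<in> Ob (coh p q)"
  then interpret U: obj p q U by (simp add: Ob_iff)
  interpret UM: two p q U M ..
  interpret MU: two p q M U ..
  show "\<exists>!f. f \<in> Mor (coh p q) U M"
  proof (rule ex1I)
   show "UM.cls UM.zr \<in> Mor (coh p q) U M" using UM.zr_rel UM.Mor_iff by blast
   fix f assume "f \<in> Mor (coh p q) U M"
   then obtain R where R: "UM.rel R" "f = UM.cls R" by (auto simp: UM.Mor_iff)
   have "Range R \<subseteq> tors" using UM.rsubD(2)[OF UM.rel_rsub[OF R(1)]] t by blast
   then show "f = UM.cls UM.zr" using R UM.cls_eq_iff UM.eqv_zr_iff UM.zr_rel by simp
  qed
  show "\<exists>!f. f \<in> Mor (coh p q) M U"
  proof (rule ex1I)
   show "MU.cls MU.zr \<in> Mor (coh p q) M U" using MU.zr_rel MU.Mor_iff by blast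
   fix f assume "f \<in> Mor (coh p q) M U"
   then obtain R where R: "MU.rel R" "f = MU.cls R" by (auto simp: MU.Mor_iff)
   have "Range R \<subseteq> U.tors" by (rule MU.rel_Range_tors[OF R(1) t])
   then show "f = MU.cls MU.zr" using R MU.cls_eq_iff MU.eqv_zr_iff MU.zr_rel by simp
  qed
 qed
qed

lemma (in obj) subo_obj: "gsub N ==> obj p q (subo N)"
 using subo_graded subo_fg[OF fg] weight_type_axioms
 by (simp add: obj_def graded_mod_def graded_mod_axioms_def obj_axioms_def)

context two
begin

text \<open>A relation with torsion range is equivalent to the zero relation, which factors through
  the zero submodule of \<open>M\<close>, taken as an object of the same universe.\<close>

lemma zero_mor_iff:
 assumes R: "rel R" shows "zero_mor (coh p q) M N (cls R) \<longleftrightarrow> Range R \<subseteq> N.tors"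
proof
 assume "zero_mor (coh p q) M N (cls R)"
 then obtain Z g h where Z: "zero_object (coh p q) Z" and gh: "g \<in> Mor (coh p q) M Z" "h \<in> Mor (coh p q) Z N"
  and eq: "cls R = Cmp (coh p q) M Z N h g" unfolding zero_mor_def by blast
 have "Z \<in> Ob (coh p q)" using Z by (simp add: zero_object_def)
 then interpret Z: obj p q Z by (simp add: M.Ob_iff)
 interpret MZN: three p q M Z N ..
 have t: "carrier Z \<subseteq> Z.tors" using Z Z.zero_object_iff by simp
 from gh obtain a b where ab: "MZN.MN.rel a" "g = MZN.MN.cls a" "MZN.NP.rel b" "h = MZN.NP.cls b"
  by (auto simp: MZN.MN.Mor_iff MZN.NP.Mor_iff)
 have "cls R = cls (a O b)" unfolding eq using MZN.Cmp_cls[OF ab(1,3)] by (simp add: ab)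
 moreover have "rel (a O b)" by (rule MZN.comp_rel[OF ab(1,3)])
 moreover have "Range (a O b) \<subseteq> N.tors" using MZN.NP.rel_Range_tors[OF ab(3) t] by blast
 ultimately have "eqv R zr" using cls_eq_iff eqv_zr_iff R zr_rel by metis
 then show "Range R \<subseteq> N.tors" using eqv_zr_iff[OF R] by simp
next
 assume t: "Range R \<subseteq> N.tors"
 let ?Z = "M.subo {\<zero>\<^bsub>M\<^esub>}"
 interpret Z: obj p q ?Z by (rule M.subo_obj[OF M.gsub_zero])
 interpret MZN: three p q M ?Z N ..
 have Z0: "zero_object (coh p q) ?Z" using Z.zero_object_iff Z.torsD(2) by auto
 have "MZN.MN.zr O MZN.NP.zr = zr" by (auto simp: MZN.MN.zr_def MZN.NP.zr_def zr_def)
 then have eq: "cls R = Cmp (coh p q) M ?Z N (MZN.NP.cls MZN.NP.zr) (MZN.MN.cls MZN.MN.zr)"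
  using MZN.Cmp_cls[OF MZN.MN.zr_rel MZN.NP.zr_rel] cls_eq_iff[OF R zr_rel] eqv_zr_iff[OF R] t by simp
 have mg: "MZN.MN.cls MZN.MN.zr \<in> Mor (coh p q) M ?Z"
  unfolding MZN.MN.Mor_iff using MZN.MN.zr_rel by blast
 have mh: "MZN.NP.cls MZN.NP.zr \<in> Mor (coh p q) ?Z N"
  unfolding MZN.NP.Mor_iff using MZN.NP.zr_rel by blast
 show "zero_mor (coh p q) M N (cls R)"
  unfolding zero_mor_def
 proof (intro exI[of _ ?Z] conjI Z0)
  show "\<exists>g\<in>Mor (coh p q) M ?Z. \<exists>h\<in>Mor (coh p q) ?Z N. cls R = Cmp (coh p q) M ?Z N h g"
   by (rule bexI[where x = "MZN.MN.cls MZN.MN.zr", OF _ mg],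
     rule bexI[where x = "MZN.NP.cls MZN.NP.zr", OF _ mh], rule eq)
 qed
qed

section \<open>Isomorphisms and monomorphisms in terms of relations\<close>

lemma rsub_converse:
 assumes R: "rsub R" shows "two.rsub p q N M (R\<inverse>)"
proof -
 interpret NM: two p q N M ..
 show ?thesis unfolding NM.rsub_def
  using rsubD[OF R] by (auto simp: M.D_in_L)
qed

text \<open>Control over the elements related to 0 is enough, since a power of \<open>x\<close>
  kills the torsion value \<open>n\<close>.\<close>

lemma ker_tors:
 assumes R: "rel R" and ker: "!!m. (m, \<zero>\<^bsub>N\<^esub>) \<in> R ==> m \<in> M.tors"
  and mn: "(m, n) \<in> R" "n \<in> N.tors"
 shows "m \<in> M.tors"
proof (rule M.tors_tors)
 note s = rel_rsub[OF R]
 show "m \<in> carrier M" using rsubD(1)[OF s mn(1)] .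
 fix x :: "'k poly poly" assume "x \<in> VV"
 then obtain k where "x ^ k \<odot>\<^bsub>N\<^esub> n = \<zero>\<^bsub>N\<^esub>" using N.torsE[OF mn(2)] by blast
 then have "(x ^ k \<odot>\<^bsub>M\<^esub> m, \<zero>\<^bsub>N\<^esub>) \<in> R" using rsubD(5)[OF s mn(1), of "x ^ k"] by simp
 then show "\<exists>k. x ^ k \<odot>\<^bsub>M\<^esub> m \<in> M.tors" using ker by blast
qed

text \<open>The inverse is the class of the converse relation: the conditions on kernel and range
  say that the converse is single-valued and total up to torsion.\<close>

lemma iso_mor_cls:
 assumes R: "rel R" and ker: "!!m. (m, \<zero>\<^bsub>N\<^esub>) \<in> R ==> m \<in> M.tors" and surj: "carrier N \<subseteq> N.sat (Range R)"
 shows "iso_mor (coh p q) M N (cls R)"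
proof -
 interpret MNM: three p q M N M ..
 interpret NMN: three p q N M N ..
 note s = rel_rsub[OF R]
 have R': "MNM.NP.rel (R\<inverse>)"
  unfolding MNM.NP.rel_def using rsub_converse[OF s] surj ker by auto
 have "M.MM.eqv (R O R\<inverse>) (Id_on (carrier M))"
  unfolding M.MM.eqv_def
 proof (intro allI impI)
  fix m m' m'' assume "(m, m') \<in> R O R\<inverse>" and m: "(m, m'') \<in> Id_on (carrier M)"
  then obtain n where n: "(m, n) \<in> R" "(m', n) \<in> R" by blast
  have "(m' \<ominus>\<^bsub>M\<^esub> m, n \<ominus>\<^bsub>N\<^esub> n) \<in> R" by (rule rsubD(7)[OF s n(2,1)])
  moreover have "n \<ominus>\<^bsub>N\<^esub> n = \<zero>\<^bsub>N\<^esub>" using rsubD(2)[OF s n(1)] N.diff_zero_iff by blast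
  ultimately show "m' \<ominus>\<^bsub>M\<^esub> m'' \<in> M.tors" using ker m by auto
 qed
 moreover have "N.MM.eqv (R\<inverse> O R) (Id_on (carrier N))"
  unfolding N.MM.eqv_def
 proof (intro allI impI)
  fix n n' n'' assume "(n, n') \<in> R\<inverse> O R" and n: "(n, n'') \<in> Id_on (carrier N)"
  then obtain m where m: "(m, n) \<in> R" "(m, n') \<in> R" by blast
  have "n' \<ominus>\<^bsub>N\<^esub> n \<in> N.tors" by (rule eqvD[OF eqv_refl[OF R] m(2,1)])
  then show "n' \<ominus>\<^bsub>N\<^esub> n'' \<in> N.tors" using n by auto
 qed
 ultimately show ?thesis
  unfolding iso_mor_def M.Idm_eq N.Idm_eq
  using R R' MNM.Cmp_cls[OF R R'] NMN.Cmp_cls[OF R' R] M.MM.cls_eq_iff[OF MNM.comp_rel[OF R R'] M.Id_rel]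
   N.MM.cls_eq_iff[OF NMN.comp_rel[OF R' R] N.Id_rel]
  by (auto simp: Mor_iff MNM.NP.Mor_iff intro!: bexI[of _ "MNM.NP.cls (R\<inverse>)"])
qed

text \<open>To compare two morphisms into \<open>M\<close>, their values at \<open>w\<close> are
  multiplied by a common power that puts both into the domain of \<open>R\<close>; the difference
  then has a torsion image.\<close>

lemma mono_mor_cls:
 assumes R: "rel R" and ker: "!!m. (m, \<zero>\<^bsub>N\<^esub>) \<in> R ==> m \<in> M.tors"
 shows "mono_mor (coh p q) M N (cls R)"
 unfolding mono_mor_def
proof (intro conjI ballI impI)
 show "cls R \<in> Mor (coh p q) M N" using R Mor_iff by blast
 fix W :: "('k poly poly, 'b) gmod" and g h
 assume "W \<in> Ob (coh p q)" and gh: "g \<in> Mor (coh p q) W M" "h \<in> Mor (coh p q) W M"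
  and eq: "Cmp (coh p q) W M N (cls R) g = Cmp (coh p q) W M N (cls R) h"
 then interpret W: obj p q W by (simp add: M.Ob_iff)
 interpret WMN: three p q W M N ..
 from gh obtain a b where ab: "WMN.MN.rel a" "g = WMN.MN.cls a" "WMN.MN.rel b" "h = WMN.MN.cls b"
  by (auto simp: WMN.MN.Mor_iff)
 note s = rel_rsub[OF R] WMN.MN.rel_rsub[OF ab(1)] WMN.MN.rel_rsub[OF ab(3)]
 have e: "WMN.MP.eqv (a O R) (b O R)"
  using eq ab WMN.Cmp_cls[OF ab(1) R] WMN.Cmp_cls[OF ab(3) R]
   WMN.MP.cls_eq_iff[OF WMN.comp_rel[OF ab(1) R] WMN.comp_rel[OF ab(3) R]] by simp
 have "WMN.MN.eqv a b"
  unfolding WMN.MN.eqv_def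
 proof (intro allI impI)
  fix w m m' assume w: "(w, m) \<in> a" "(w, m') \<in> b"
  have c: "w \<in> carrier W" "m \<in> carrier M" "m' \<in> carrier M"
   using WMN.MN.rsubD(1,2)[OF s(2) w(1)] WMN.MN.rsubD(2)[OF s(3) w(2)] by auto
  show "m \<ominus>\<^bsub>M\<^esub> m' \<in> M.tors"
  proof (rule M.tors_tors)
   show "m \<ominus>\<^bsub>M\<^esub> m' \<in> carrier M" using c by simp
   fix x :: "'k poly poly" assume x: "x \<in> VV"
   from rel_dom[OF R c(2) x] rel_dom[OF R c(3) x] obtain k n l n' where
    "(x ^ k \<odot>\<^bsub>M\<^esub> m, n) \<in> R" "(x ^ l \<odot>\<^bsub>M\<^esub> m', n') \<in> R" by blast
   from rsub_pow_mono[OF s(1) c(2) this(1), of l] rsub_pow_mono[OF s(1) c(3) this(2), of k]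
   obtain j n n' where n: "(x ^ j \<odot>\<^bsub>M\<^esub> m, n) \<in> R" "(x ^ j \<odot>\<^bsub>M\<^esub> m', n') \<in> R"
    by (metis add.commute)
   have A: "n \<ominus>\<^bsub>N\<^esub> n' \<in> N.tors"
    by (rule WMN.MP.eqvD[OF e relcompI[OF WMN.MN.rsubD(5)[OF s(2) w(1)] n(1)] relcompI[OF WMN.MN.rsubD(5)[OF s(3) w(2)] n(2)]])
   have "(x ^ j \<odot>\<^bsub>M\<^esub> m \<ominus>\<^bsub>M\<^esub> x ^ j \<odot>\<^bsub>M\<^esub> m', n \<ominus>\<^bsub>N\<^esub> n') \<in> R" by (rule rsubD(7)[OF s(1) n])
   from ker_tors[OF R ker this A] have "x ^ j \<odot>\<^bsub>M\<^esub> m \<ominus>\<^bsub>M\<^esub> x ^ j \<odot>\<^bsub>M\<^esub> m' \<in> M.tors" by blast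
   then show "\<exists>k. x ^ k \<odot>\<^bsub>M\<^esub> (m \<ominus>\<^bsub>M\<^esub> m') \<in> M.tors" using c by (auto simp: M.sm_rdiff)
  qed
 qed
 then show "g = h" using ab WMN.MN.cls_eq_iff by simp
qed

end

section \<open>Graded free modules\<close>

definition ee :: "nat => nat => 'k::field poly poly" where "ee j = (\<lambda>i. if i = j then 1 else 0)"

lemma fsD: "v \<in> fs n ==> i \<ge> n ==> v i = 0"
 by (simp add: fs_def)

lemma fs_closed [simp]: "(\<lambda>_. 0) \<in> fs n" "v \<in> fs n ==> w \<in> fs n ==> (\<lambda>i. v i + w i) \<in> fs n"
 "v \<in> fs n ==> (\<lambda>i. s * v i) \<in> fs n" "v \<in> fs n ==> (\<lambda>i. - v i) \<in> fs n" "j < n ==> ee j \<in> fs n"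
 by (auto simp: fs_def ee_def)

context weight_type
begin

text \<open>The free module with basis vector \<open>ee i\<close> in degree \<open>z i\<close>, in
  terms of shifts the sum of the S(-z i). It is realised on vectors supported below
  \<open>n\<close>, hence inside the universe of \<open>sheaf\<close>.\<close>

definition FM :: "nat => (nat => int \<times> int) => ('k::field) sheaf" where
 "FM n z = \<lparr> carrier = fs n, monoid.mult = (\<lambda>_ _. undefined), monoid.one = undefined,
   ring.zero = (\<lambda>_. 0), ring.add = (\<lambda>v w i. v i + w i), module.smult = (\<lambda>s v i. s * v i),
   grade = (\<lambda>x. {v \<in> fs n. \<forall>i<n. v i \<in> S_grade p q (x \<otimes>\<^bsub>L\<^esub> D (- z i))}) \<rparr>"

lemma FM_simps [simp]: "carrier (FM n z) = fs n" "\<zero>\<^bsub>FM n z\<^esub> = (\<lambda>_. 0)"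
 "v \<oplus>\<^bsub>FM n z\<^esub> w = (\<lambda>i. v i + w i)" "s \<odot>\<^bsub>FM n z\<^esub> v = (\<lambda>i. s * v i)"
 by (simp_all add: FM_def)

lemma FM_grade: "grade (FM n z) (D u) = {v \<in> fs n. \<forall>i<n. v i \<in> Sg (u - z i)}"
 by (simp add: FM_def Sg_eq)

lemma FM_module: "module (SS :: 'k::field poly poly ring) (FM n z)"
proof (rule moduleI)
 show "abelian_group (FM n z :: 'k sheaf)"
 proof (rule abelian_groupI)
  fix x assume x: "x \<in> carrier (FM n z :: 'k sheaf)"
  then show "\<exists>y\<in>carrier (FM n z). y \<oplus>\<^bsub>FM n z\<^esub> x = \<zero>\<^bsub>FM n z\<^esub>"
   by (intro bexI[of _ "\<lambda>i. - x i"]) auto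
 qed (auto simp: algebra_simps)
qed (auto simp: SS_cring algebra_simps)

lemma FM_finsum:
 fixes f :: "'a => nat => 'k::field poly poly"
 assumes "finite A" "!!a. a \<in> A ==> f a \<in> fs n"
 shows "finsum (FM n z) f A = (\<lambda>i. \<Sum>a\<in>A. f a i)"
proof -
 interpret S: module "SS :: 'k poly poly ring" "FM n z" by (rule FM_module)
 show ?thesis
  using assms
 proof (induction A)
  case (insert a A)
  then have "f \<in> A \<rightarrow> carrier (FM n z)" "f a \<in> carrier (FM n z)" by auto
  then show ?case using insert by (simp add: S.finsum_insert)
 qed (simp add: S.finsum_empty)
qed

text \<open>The summands have different degrees, so the part of one degree isolates one of them.
  This yields the uniqueness of homogeneous decompositions in \<open>FM n z\<close>.\<close>

lemma Sg_pt_sum: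
 assumes "finite F" "F \<subseteq> carrier L" "!!u. D u \<in> F ==> f (D u) \<in> Sg (u - w)"
 shows "pt (D (u - w)) (\<Sum>x\<in>F. f x) = (if D u \<in> F then f (D u) else 0)"
proof -
 have "pt (D (u - w)) (\<Sum>x\<in>F. f x) = (\<Sum>x\<in>F. pt (D (u - w)) (f x))"
  using assms(1) by (induction F) (auto simp: pt_add)
 also have "\<dots> = (\<Sum>x\<in>F. if x = D u then f (D u) else 0)"
 proof (rule sum.cong)
  fix x assume x: "x \<in> F"
  then obtain v where v: "x = D v" using assms(2) L_cases by blast
  have fx: "f (D v) \<in> Sg (v - w)" using assms(3) x v by simp
  show "pt (D (u - w)) (f x) = (if x = D u then f (D u) else 0)"
  proof (cases "D v = D u")
   case True
   then have "D (v - w) = D (u - w)" by (simp add: D_diff_eq)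
   then show ?thesis using pt_same[OF fx] True v by simp
  next
   case False
   then have "D (u - w) \<noteq> D (v - w)" by (simp add: D_diff_eq) 
   then show ?thesis using pt_other[OF fx] False v by simp
  qed
 qed simp
 also have "\<dots> = (if D u \<in> F then f (D u) else 0)" using assms(1) by simp
 finally show ?thesis .
qed

lemma FM_graded: "graded_module p q (FM n z :: ('k::field) sheaf)"
proof -
 interpret S: module "SS :: 'k poly poly ring" "FM n z" by (rule FM_module)
 show ?thesis
  unfolding graded_module_def
 proof (intro conjI ballI)
  show "module (SS :: 'k poly poly ring) (FM n z)" by (rule FM_module)
 next
  fix x assume "x \<in> carrier L"
  then obtain u where u: "x = D u" by (rule L_cases)
  show "subgroup (grade (FM n z) x) (add_monoid (FM n z :: 'k sheaf))"
   unfolding u FM_grade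
  proof (rule S.add.subgroupI)
   show "{v \<in> fs n. \<forall>i<n. v i \<in> Sg (u - z i)} \<noteq> {}" using fs_closed(1)[of n] Sg_0 by blast
   fix a :: "nat => 'k poly poly" assume a: "a \<in> {v \<in> fs n. \<forall>i<n. v i \<in> Sg (u - z i)}"
   then have "\<ominus>\<^bsub>FM n z\<^esub> a = (\<lambda>i. - a i)"
    by (intro S.minus_equality) auto
   then show "\<ominus>\<^bsub>FM n z\<^esub> a \<in> {v \<in> fs n. \<forall>i<n. v i \<in> Sg (u - z i)}"
    using a by simp
  qed (auto intro: Sg_add)
 next
  fix x y m and s :: "'k poly poly" assume "x \<in> carrier L" "y \<in> carrier L"
   and s: "s \<in> S_grade p q x" and m: "m \<in> grade (FM n z :: 'k sheaf) y"
  then obtain u v where uv: "x = D u" "y = D v" by (metis L_cases)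
  have "s * m i \<in> Sg (u + v - z i)" if "i < n" for i
   using Sg_mult[of s u "m i" "v - z i"] s m that by (simp add: uv Sg_eq FM_grade add_diff_eq)
  then show "s \<odot>\<^bsub>FM n z\<^esub> m \<in> grade (FM n z) (x \<otimes>\<^bsub>L\<^esub> y)"
   using m by (simp add: uv FM_grade)
 next
  fix m assume m: "m \<in> carrier (FM n z :: 'k sheaf)"
  let ?P = "\<lambda>c. c \<in> (\<Pi>\<^sub>E x\<in>carrier L. grade (FM n z :: 'k sheaf) x) \<and> finite {x \<in> carrier L. c x \<noteq> \<zero>\<^bsub>FM n z\<^esub>} \<and>
     m = finsum (FM n z) c {x \<in> carrier L. c x \<noteq> \<zero>\<^bsub>FM n z\<^esub>}"
  \<comment> \<open>The component of degree \<open>x\<close>: entry \<open>i\<close> contributes its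
    part of degree \<open>x\<close> minus the degree of the basis vector
    \<open>ee i\<close>.\<close>
  define k where "k x = (\<lambda>i. if i < n then pt (x \<otimes>\<^bsub>L\<^esub> D (- z i)) (m i) else 0)" for x
  define c where "c = restrict k (carrier L)"
  have kg: "k (D u) \<in> {v \<in> fs n. \<forall>i<n. v i \<in> Sg (u - z i)}" for u
   using pt_Sg[of "u - z i" "m i" for i] by (auto simp: k_def fs_def)
  have kfs: "k x \<in> fs n" for x by (simp add: k_def fs_def)
  let ?F = "{x \<in> carrier L. c x \<noteq> \<zero>\<^bsub>FM n z\<^esub>}"
  have sub: "?F \<subseteq> (\<Union>i<n. (\<lambda>y. y \<otimes>\<^bsub>L\<^esub> D (z i)) ` dgs (m i))"
  proof
   fix x assume x: "x \<in> ?F"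
   then have xL: "x \<in> carrier L" and "k x \<noteq> (\<lambda>_. 0)" by (auto simp: c_def)
   then obtain i where i: "k x i \<noteq> 0" by blast
   then have "i < n" "x \<otimes>\<^bsub>L\<^esub> D (- z i) \<in> dgs (m i)" by (auto simp: k_def pt_nonzero split: if_splits)
   moreover obtain u where "x = D u" using xL by (rule L_cases)
   then have "x = (x \<otimes>\<^bsub>L\<^esub> D (- z i)) \<otimes>\<^bsub>L\<^esub> D (z i)" by simp
   ultimately show "x \<in> (\<Union>i<n. (\<lambda>y. y \<otimes>\<^bsub>L\<^esub> D (z i)) ` dgs (m i))" by blast
  qed
  have fin: "finite ?F" by (rule finite_subset[OF sub]) (simp add: finite_dgs)
  have "(\<Sum>x\<in>?F. c x i) = m i" for i
  proof (cases "i < n")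
   case True
   have "(\<Sum>x\<in>?F. c x i) = (\<Sum>x\<in>?F. pt (x \<otimes>\<^bsub>L\<^esub> D (- z i)) (m i))"
    by (rule sum.cong) (auto simp: c_def k_def True)
   also have "\<dots> = (\<Sum>y\<in>(\<lambda>x. x \<otimes>\<^bsub>L\<^esub> D (- z i)) ` ?F. pt y (m i))"
    by (rule sum.reindex[symmetric, unfolded o_def]) (auto simp: inj_on_def)
   also have "\<dots> = m i"
   proof (rule sum_pt)
    show "dgs (m i) \<subseteq> (\<lambda>x. x \<otimes>\<^bsub>L\<^esub> D (- z i)) ` ?F"
    proof
     fix y assume y: "y \<in> dgs (m i)"
     then obtain v where v: "y = D v" using dgs_L L_cases by blast
     have "k (D (v + z i)) i \<noteq> 0" using y True by (simp add: k_def v pt_nonzero)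
     then have "D (v + z i) \<in> ?F" by (auto simp: c_def)
     moreover have "y = D (v + z i) \<otimes>\<^bsub>L\<^esub> D (- z i)" by (simp add: v)
     ultimately show "y \<in> (\<lambda>x. x \<otimes>\<^bsub>L\<^esub> D (- z i)) ` ?F" by (rule rev_image_eqI)
    qed
   qed (use fin in simp)
   finally show ?thesis .
  next
   case False
   then have "m i = 0" using m by (simp add: fs_def)
   moreover have "(\<Sum>x\<in>?F. c x i) = 0" by (rule sum.neutral) (auto simp: c_def k_def False)
   ultimately show ?thesis by simp
  qed
  then have "finsum (FM n z) c ?F = m"
   by (subst FM_finsum[OF fin]) (auto simp: c_def kfs)
  moreover have "c \<in> (\<Pi>\<^sub>E x\<in>carrier L. grade (FM n z :: 'k sheaf) x)"
  proof (unfold c_def, rule restrict_PiE_iff[THEN iffD2], intro ballI)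
   fix x assume "x \<in> carrier L"
   then obtain u where u: "x = D u" by (rule L_cases)
   show "k x \<in> grade (FM n z) x" unfolding u FM_grade by (rule kg)
  qed
  ultimately have Pc: "?P c" using fin by simp
  show "\<exists>!c. ?P c"
  proof (rule ex1I[of _ c])
   show "?P c" by (rule Pc)
   fix c' assume c': "?P c'"
   let ?F' = "{x \<in> carrier L. c' x \<noteq> \<zero>\<^bsub>FM n z\<^esub>}"
   have g: "c' (D u) \<in> {v \<in> fs n. \<forall>i<n. v i \<in> Sg (u - z i)}" for u
    using c' PiE_mem[of c' "carrier L" _ "D u"] by (simp flip: FM_grade)
   have fin': "finite ?F'" using c' by simp
   have fs': "c' x \<in> fs n" if "x \<in> carrier L" for x using that g by (auto elim!: L_cases)
   have "finsum (FM n z) c' ?F' = (\<lambda>i. \<Sum>x\<in>?F'. c' x i)" by (rule FM_finsum[OF fin']) (use fs' in auto)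
   then have ms: "m i = (\<Sum>x\<in>?F'. c' x i)" for i using c' by metis
   have "c' x = k x" if xL: "x \<in> carrier L" for x
   proof
    fix i
    obtain u where u: "x = D u" using xL by (rule L_cases)
    show "c' x i = k x i"
    proof (cases "i < n")
     case True
     have "pt (D (u - z i)) (m i) = (if D u \<in> ?F' then c' (D u) i else 0)"
      unfolding ms using True g fin' by (intro Sg_pt_sum[of ?F' "\<lambda>x. c' x i" "z i" u]) auto
     also have "\<dots> = c' (D u) i" by auto
     finally show ?thesis using True by (simp add: k_def u)
    next
     case False
     then show ?thesis using fs'[OF xL] by (simp add: k_def fs_def)
    qed
   qed
   then show "c' = c" using c' by (intro ext) (auto simp: c_def PiE_def extensional_def)
  qed
 qed
qed

lemma FM_graded_mod: "graded_mod p q (FM n z)"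
 using FM_graded weight_type_axioms by (simp add: graded_mod_def graded_mod_axioms_def)

end

text \<open>The type argument \<open>dummy\<close> fixes the coefficient field, which does not occur
  in the types of the other parameters.\<close>

locale free_mod = weight_type p q for p q +
 fixes n :: nat and z :: "nat => int \<times> int" and dummy :: "'k::field itself"
begin

abbreviation F :: "'k sheaf" where "F \<equiv> FM n z"

sublocale F: graded_mod p q F by (rule FM_graded_mod)

lemma F_gr: "F.gr u = {v \<in> fs n. \<forall>i<n. v i \<in> Sg (u - z i)}"
 by (simp add: F.gr_def FM_grade)

lemma ee_gr: "j < n ==> ee j \<in> F.gr (z j)"
 by (auto simp: F_gr ee_def Sg_one_iff fs_def)

lemma F_lc: "F.lc g m v = (\<lambda>i. \<Sum>j<m. v j * g j i)"
 by (induction m) auto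

lemma lc_ee: "v \<in> fs n ==> F.lc ee n v = v"
proof
 fix i assume v: "v \<in> fs n"
 have "(\<Sum>j<n. v j * ee j i) = (\<Sum>j<n. if j = i then v i else 0)"
  by (rule sum.cong) (auto simp: ee_def)
 then show "F.lc ee n v i = v i" using v by (auto simp: F_lc fs_def)
qed

lemma F_fg: "finitely_generated F"
proof (rule F.lc_fg)
 show "carrier F = range (F.lc ee n)"
 proof
  show "carrier F \<subseteq> range (F.lc ee n)" using lc_ee by (metis FM_simps(1) rangeI subsetI)
  have "F.lc ee n v \<in> carrier F" for v by (rule F.lc_closed) simp
  then show "range (F.lc ee n) \<subseteq> carrier F" by blast
 qed
qed simp

sublocale F: obj p q F
 by unfold_locales (rule F_fg)

lemma F_minus: "v \<in> fs n ==> \<ominus>\<^bsub>F\<^esub> v = (\<lambda>i. - v i)"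
 by (rule F.M.minus_equality) auto

lemma F_diff: "v \<in> fs n ==> w \<in> fs n ==> v \<ominus>\<^bsub>F\<^esub> w = (\<lambda>i. v i - w i)"
 by (simp add: a_minus_def F_minus)

lemma F_tors: "F.tors = {\<lambda>_. 0}"
proof
 show "F.tors \<subseteq> {\<lambda>_. 0}"
 proof
  fix v assume "v \<in> F.tors"
  then obtain k where "X1 ^ k \<odot>\<^bsub>F\<^esub> v = \<zero>\<^bsub>F\<^esub>" using F.torsE[of v X1] by auto
  then have "X1 ^ k * v i = 0" for i by (simp add: fun_eq_iff)
  then show "v \<in> {\<lambda>_. 0}" by (auto simp: fun_eq_iff)
 qed
qed (use F.torsD(2) in simp)

lemma F_comp: "v \<in> fs n ==> F.comp (D u) v = (\<lambda>i. pt (D (u - z i)) (v i))"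
proof -
 assume v: "v \<in> fs n"
 have "F.comp (D u) (F.lc ee n v) = F.lc ee n (\<lambda>i. pt (D (u - z i)) (v i))"
  by (rule F.lc_comp) (rule ee_gr)
 also have "\<dots> = (\<lambda>i. pt (D (u - z i)) (v i))"
  by (rule lc_ee) (use v in \<open>simp add: fs_def\<close>)
 finally show ?thesis using lc_ee[OF v] by simp
qed

lemma gr_fs: "v \<in> F.gr u ==> v \<in> fs n"
 by (simp add: F_gr)

end

context two
begin

lemma rsub_lc:
 assumes R: "rsub R" and gh: "!!i. i < n ==> (g i, h i) \<in> R"
 shows "(M.lc g n v, N.lc h n v) \<in> R"
 using gh by (induction n) (auto intro: rsubD(3)[OF R] rsubD(4)[OF R] rsubD(5)[OF R])

end

lemma (in graded_mod) lc_diff_subm: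
 assumes N: "subm N" and g: "!!i. i < n ==> g i \<in> carrier M" "!!i. i < n ==> h i \<in> carrier M"
  and gh: "!!i. i < n ==> g i \<ominus> h i \<in> N"
 shows "lc g n v \<ominus> lc h n v \<in> N"
 using g gh
proof (induction n)
 case 0
 then show ?case using submD(2)[OF N] by (simp add: diff_zero)
next
 case (Suc n)
 have c: "lc g n v \<in> carrier M" "lc h n v \<in> carrier M" "g n \<in> carrier M" "h n \<in> carrier M"
  using Suc.prems by auto
 have "lc g (Suc n) v \<ominus> lc h (Suc n) v = (lc g n v \<ominus> lc h n v) \<oplus> v n \<odot> (g n \<ominus> h n)"
 proof -
  have "v n \<odot> (g n \<ominus> h n) = v n \<odot> g n \<ominus> v n \<odot> h n"
   using c by (simp add: sm_rdiff)
  then show ?thesis using c by (simp add: a_minus_def M.minus_add M.a_ac)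
 qed
 moreover have "lc g n v \<ominus> lc h n v \<in> N" using Suc by auto
 moreover have "v n \<odot> (g n \<ominus> h n) \<in> N" using Suc.prems(3)[of n] submD(4)[OF N] by auto
 ultimately show ?case using submD(3)[OF N] by simp
qed

section \<open>Morphisms out of a free module\<close>

locale free_to = FR: free_mod p q n z "TYPE('k::field)" + E: obj p q E
 for p q :: nat and n :: nat and z :: "nat => int \<times> int" and E :: "('k::field) sheaf"
begin

sublocale FE: two p q "FR.FM n z" E ..

text \<open>The graph of the everywhere defined homomorphism that sends the basis vector
  \<open>ee i\<close> to \<open>u i\<close>.\<close>

definition gph :: "(nat => nat => 'k poly poly) => ((nat => 'k poly poly) \<times> (nat => 'k poly poly)) set" where
 "gph u = {(v, E.lc u n v) | v. v \<in> fs n}"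

lemma gph_rel:
 assumes u: "!!i. i < n ==> u i \<in> E.gr (z i)"
 shows "FE.rel (gph u)"
proof -
 have uc: "u i \<in> carrier E" if "i < n" for i by (rule E.gr_closed(1)[OF u[OF that]])
 show ?thesis
  unfolding FE.rel_def FE.rsub_def
 proof (intro conjI allI impI)
  show "gph u \<subseteq> carrier (FR.FM n z) \<times> carrier E" using uc by (auto simp: gph_def)
  show "(\<zero>\<^bsub>FR.FM n z\<^esub>, \<zero>\<^bsub>E\<^esub>) \<in> gph u"
   using E.lc_zero[of n u "\<lambda>_. 0", OF uc] by (auto simp: gph_def intro!: exI[of _ "\<lambda>_. 0"])
 next
  fix v a w b assume "(v, a) \<in> gph u" "(w, b) \<in> gph u"
  then show "(v \<oplus>\<^bsub>FR.FM n z\<^esub> w, a \<oplus>\<^bsub>E\<^esub> b) \<in> gph u"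
   using E.lc_add[of n u v w, OF uc] by (auto simp: gph_def)
 next
  fix s v a assume "(v, a) \<in> gph u"
  then show "(s \<odot>\<^bsub>FR.FM n z\<^esub> v, s \<odot>\<^bsub>E\<^esub> a) \<in> gph u"
   using E.lc_smult[of n u s v, OF uc] by (auto simp: gph_def)
 next
  fix v a w assume "(v, a) \<in> gph u"
  then have v: "v \<in> fs n" "a = E.lc u n v" by (auto simp: gph_def)
  have "FR.F.comp (FR.D w) v \<in> fs n" using FR.F.comp_closed[of v "FR.D w"] v by simp
  moreover have "E.comp (FR.D w) a = E.lc u n (FR.F.comp (FR.D w) v)"
   unfolding v(2) FR.F_comp[OF v(1)] by (rule E.lc_comp) (rule u)
  ultimately show "(FR.F.comp (FR.D w) v, E.comp (FR.D w) a) \<in> gph u" by (auto simp: gph_def)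
 next
  have "Domain (gph u) = fs n" by (auto simp: gph_def)
  then show "carrier (FR.FM n z) \<subseteq> FR.F.sat (Domain (gph u))"
   using FR.F.sat_incl[OF FR.F.subm_carrier] by simp
 next
  fix a assume "(\<zero>\<^bsub>FR.FM n z\<^esub>, a) \<in> gph u"
  then have "a = \<zero>\<^bsub>E\<^esub>" using E.lc_zero[of n u "\<lambda>_. 0", OF uc] by (auto simp: gph_def)
  then show "a \<in> E.tors" using E.torsD(2) by simp
 qed
qed

lemma gph_iff: "(v, a) \<in> gph u \<longleftrightarrow> v \<in> fs n \<and> a = E.lc u n v"
 by (auto simp: gph_def)

lemma gph_ee: "(!!i. i < n ==> u i \<in> carrier E) ==> j < n ==> ((\<lambda>i. s * ee j i), s \<odot>\<^bsub>E\<^esub> u j) \<in> gph u"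
proof -
 assume u: "!!i. i < n ==> u i \<in> carrier E" and j: "j < n"
 have "(\<lambda>i. s * ee j i) = (\<lambda>i. if i = j then s else 0)" by (auto simp: ee_def)
 then show ?thesis
  unfolding gph_iff using E.lc_unit[of n u j s, OF u j] j by (auto simp: fs_def)
qed

text \<open>A relation on a free module is determined up to torsion by its values on multiples of
  basis vectors. The domains need not contain the basis vectors themselves, so one power
  \<open>x ^ K\<close> is chosen that brings all of them into both domains.\<close>

lemma eqv_free:
 assumes R: "FE.rel R" "FE.rel R'"
  and ag: "!!i s y y'. i < n ==> ((\<lambda>j. s * ee i j), y) \<in> R ==> ((\<lambda>j. s * ee i j), y') \<in> R' ==> y \<ominus>\<^bsub>E\<^esub> y' \<in> E.tors"
 shows "FE.eqv R R'"
 unfolding FE.eqv_def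
proof (intro allI impI)
 fix v y y' assume vy: "(v, y) \<in> R" "(v, y') \<in> R'"
 note s = FE.rel_rsub[OF R(1)] FE.rel_rsub[OF R(2)]
 have c: "v \<in> fs n" "y \<in> carrier E" "y' \<in> carrier E"
  using FE.rsubD(1,2)[OF s(1) vy(1)] FE.rsubD(2)[OF s(2) vy(2)] by auto
 show "y \<ominus>\<^bsub>E\<^esub> y' \<in> E.tors"
 proof (rule E.tors_tors)
  show "y \<ominus>\<^bsub>E\<^esub> y' \<in> carrier E" using c by simp
  fix x :: "'k poly poly" assume x: "x \<in> VV"
  have ex: "\<exists>k a a'. (x ^ k \<odot>\<^bsub>FR.F\<^esub> ee i, a) \<in> R \<and> (x ^ k \<odot>\<^bsub>FR.F\<^esub> ee i, a') \<in> R'" if i: "i < n" for i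
  proof -
   have ec: "ee i \<in> carrier FR.F" using i by simp
   from FE.rel_dom[OF R(1) ec x] FE.rel_dom[OF R(2) ec x] obtain k a l a' where
    ka: "(x ^ k \<odot>\<^bsub>FR.F\<^esub> ee i, a) \<in> R" "(x ^ l \<odot>\<^bsub>FR.F\<^esub> ee i, a') \<in> R'" by blast
   have "(x ^ (l + k) \<odot>\<^bsub>FR.F\<^esub> ee i, x ^ l \<odot>\<^bsub>E\<^esub> a) \<in> R" by (rule FE.rsub_pow_mono[OF s(1) ec ka(1)])
   moreover have "(x ^ (l + k) \<odot>\<^bsub>FR.F\<^esub> ee i, x ^ k \<odot>\<^bsub>E\<^esub> a') \<in> R'"
    using FE.rsub_pow_mono[OF s(2) ec ka(2), of k] by (simp only: add.commute)
   ultimately show ?thesis by blast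
  qed
  then obtain k a a' where k: "!!i. i < n ==> (x ^ k i \<odot>\<^bsub>FR.F\<^esub> ee i, a i) \<in> R"
   "!!i. i < n ==> (x ^ k i \<odot>\<^bsub>FR.F\<^esub> ee i, a' i) \<in> R'" by metis
  define K where "K = (\<Sum>i<n. k i)"
  have K: "k i \<le> K" if "i < n" for i using member_le_sum[of i "{..<n}" k] that by (simp add: K_def)
  define b where "b i = x ^ (K - k i) \<odot>\<^bsub>E\<^esub> a i" for i
  define b' where "b' i = x ^ (K - k i) \<odot>\<^bsub>E\<^esub> a' i" for i
  have bR: "((\<lambda>j. x ^ K * ee i j), b i) \<in> R" "((\<lambda>j. x ^ K * ee i j), b' i) \<in> R'" if i: "i < n" for i
  proof -
   have ec: "ee i \<in> carrier FR.F" using i by simp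
   show "((\<lambda>j. x ^ K * ee i j), b i) \<in> R" "((\<lambda>j. x ^ K * ee i j), b' i) \<in> R'"
    using FE.rsub_pow_mono[OF s(1) ec k(1)[OF i], of "K - k i"]
     FE.rsub_pow_mono[OF s(2) ec k(2)[OF i], of "K - k i"] K[OF i] by (simp_all add: b_def b'_def)
  qed
  have lcK: "FR.F.lc (\<lambda>i j. x ^ K * ee i j) n v = x ^ K \<odot>\<^bsub>FR.F\<^esub> v"
  proof -
   have "FR.F.lc (\<lambda>i j. x ^ K * ee i j) n v = (\<lambda>j. x ^ K * FR.F.lc ee n v j)"
    by (simp add: FR.F_lc sum_distrib_left mult_ac)
   then show ?thesis using FR.lc_ee[OF c(1)] by simp
  qed
  have 1: "(x ^ K \<odot>\<^bsub>FR.F\<^esub> v, E.lc b n v) \<in> R" "(x ^ K \<odot>\<^bsub>FR.F\<^esub> v, E.lc b' n v) \<in> R'"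
   using FE.rsub_lc[OF s(1), of n "\<lambda>i j. x ^ K * ee i j" b v, OF bR(1)]
    FE.rsub_lc[OF s(2), of n "\<lambda>i j. x ^ K * ee i j" b' v, OF bR(2)] by (simp_all only: lcK)
  have bc: "b i \<in> carrier E" "b' i \<in> carrier E" if "i < n" for i
   using FE.rsubD(2)[OF s(1) bR(1)[OF that]] FE.rsubD(2)[OF s(2) bR(2)[OF that]] by auto
  have 2: "E.lc b n v \<ominus>\<^bsub>E\<^esub> E.lc b' n v \<in> E.tors"
   by (rule E.lc_diff_subm[OF E.tors_subm]) (use bc ag bR in blast)+
  have 3: "x ^ K \<odot>\<^bsub>E\<^esub> y \<ominus>\<^bsub>E\<^esub> E.lc b n v \<in> E.tors"
   by (rule FE.eqvD[OF FE.eqv_refl[OF R(1)] FE.rsubD(5)[OF s(1) vy(1)] 1(1)])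
  have 4: "E.lc b' n v \<ominus>\<^bsub>E\<^esub> x ^ K \<odot>\<^bsub>E\<^esub> y' \<in> E.tors"
   by (rule FE.eqvD[OF FE.eqv_refl[OF R(2)] 1(2) FE.rsubD(5)[OF s(2) vy(2)]])
  have lcc: "E.lc b n v \<in> carrier E" "E.lc b' n v \<in> carrier E" using bc by auto
  have "x ^ K \<odot>\<^bsub>E\<^esub> y \<ominus>\<^bsub>E\<^esub> E.lc b' n v \<in> E.tors"
   by (rule FE.tors_triangle[OF _ _ _ 3 2]) (use c lcc in auto)
  then have "x ^ K \<odot>\<^bsub>E\<^esub> y \<ominus>\<^bsub>E\<^esub> x ^ K \<odot>\<^bsub>E\<^esub> y' \<in> E.tors"
   by (rule FE.tors_triangle[OF _ _ _ _ 4, rotated 3]) (use c lcc in auto)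
  then show "\<exists>k. x ^ k \<odot>\<^bsub>E\<^esub> (y \<ominus>\<^bsub>E\<^esub> y') \<in> E.tors" using c by (auto simp: E.sm_rdiff)
 qed
qed

lemma gph_eqv_iff:
 assumes u: "!!i. i < n ==> u i \<in> E.gr (z i)" and w: "!!i. i < n ==> w i \<in> E.gr (z i)"
 shows "FE.eqv (gph u) (gph w) \<longleftrightarrow> (\<forall>i<n. u i \<ominus>\<^bsub>E\<^esub> w i \<in> E.tors)"
proof
 have uc: "u i \<in> carrier E" "w i \<in> carrier E" if "i < n" for i
  using E.gr_closed(1)[OF u[OF that]] E.gr_closed(1)[OF w[OF that]] by auto
 {
  assume e: "FE.eqv (gph u) (gph w)"
  show "\<forall>i<n. u i \<ominus>\<^bsub>E\<^esub> w i \<in> E.tors"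
  proof (intro allI impI)
   fix i assume i: "i < n"
   from FE.eqvD[OF e gph_ee[OF uc(1) i, where s = 1] gph_ee[OF uc(2) i, where s = 1]]
   show "u i \<ominus>\<^bsub>E\<^esub> w i \<in> E.tors" using uc[OF i] by simp
  qed
 next
  assume t: "\<forall>i<n. u i \<ominus>\<^bsub>E\<^esub> w i \<in> E.tors"
  show "FE.eqv (gph u) (gph w)"
   unfolding FE.eqv_def gph_iff
  proof (intro allI impI, elim conjE)
   fix v y y' assume v: "v \<in> fs n" "y = E.lc u n v" "y' = E.lc w n v"
   show "y \<ominus>\<^bsub>E\<^esub> y' \<in> E.tors"
    unfolding v by (rule E.lc_diff_subm[OF E.tors_subm]) (use uc t in auto)
  qed
 }
qed

end

locale free_free = A: free_mod p q n z dummy + B: free_mod p q m w dummy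
 for p q :: nat and n :: nat and z :: "nat => int \<times> int" and m :: nat and w :: "nat => int \<times> int"
  and dummy :: "'k::field itself"
begin

sublocale AB: free_to p q n z "B.F :: 'k sheaf"
 by unfold_locales (rule B.F.gm B.F.fg)+

lemma single_valued:
 assumes R: "AB.FE.rel R" and vr: "(v, r) \<in> R" "(v, r') \<in> R" shows "r = r'"
proof -
 have c: "r \<in> fs m" "r' \<in> fs m" using AB.FE.rsubD(2)[OF AB.FE.rel_rsub[OF R]] vr by auto
 have "r \<ominus>\<^bsub>B.F\<^esub> r' \<in> B.F.tors" by (rule AB.FE.eqvD[OF AB.FE.eqv_refl[OF R] vr])
 then show ?thesis using c B.F.diff_zero_iff[of r r'] by (simp add: B.F_tors)
qed

text \<open>Morphisms between free modules are honest graded homomorphisms. At a basis vector the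
  relation gives a value \<open>a\<close> with denominator \<open>X1 ^ k\<close> and a value
  \<open>b\<close> with denominator \<open>X2 ^ l\<close>; these agree on the overlap, and
  \<open>X_regular\<close> turns the common fraction into a polynomial vector
  \<open>U\<close>.\<close>

lemma rel_to_free:
 assumes R: "AB.FE.rel R"
 shows "\<exists>u. (\<forall>i<n. u i \<in> B.F.gr (z i)) \<and> AB.FE.eqv R (AB.gph u)"
proof -
 note s = AB.FE.rel_rsub[OF R]
 have "\<exists>U k. U \<in> B.F.gr (z i) \<and> ((\<lambda>j. X1 ^ k * ee i j), (\<lambda>j. X1 ^ k * U j)) \<in> R" if i: "i < n" for i
 proof -
  have ec: "ee i \<in> carrier A.F" using i by simp
  from AB.FE.rel_dom[OF R ec, of X1] AB.FE.rel_dom[OF R ec, of X2] obtain k a l b where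
   a: "((\<lambda>j. X1 ^ k * ee i j), a) \<in> R" and b: "((\<lambda>j. X2 ^ l * ee i j), b) \<in> R" by auto
  have c: "a \<in> fs m" "b \<in> fs m" using AB.FE.rsubD(2)[OF s] a b by auto
  have eq: "(\<lambda>j. X2 ^ l * (X1 ^ k * ee i j)) = (\<lambda>j. X1 ^ k * (X2 ^ l * ee i j))"
   by (simp add: mult_ac)
  have f1: "((\<lambda>j. X2 ^ l * (X1 ^ k * ee i j)), (\<lambda>j. X2 ^ l * a j)) \<in> R"
   using AB.FE.rsubD(5)[OF s a, of "X2 ^ l"] by simp
  have f2: "((\<lambda>j. X1 ^ k * (X2 ^ l * ee i j)), (\<lambda>j. X1 ^ k * b j)) \<in> R"
   using AB.FE.rsubD(5)[OF s b, of "X1 ^ k"] by simp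
  have "(\<lambda>j. X2 ^ l * a j) = (\<lambda>j. X1 ^ k * b j)"
   by (rule single_valued[OF R f1[unfolded eq] f2])
  then have "X2 ^ l * a j = X1 ^ k * b j" for j by (rule fun_cong)
  then have "\<exists>U. a j = X1 ^ k * U" for j using X_regular by metis
  then obtain U where U: "!!j. a j = X1 ^ k * U j" by metis
  have kd: "X1 ^ k \<in> A.Sg (int k, 0)" by simp
  have eg: "(\<lambda>j. X1 ^ k * ee i j) \<in> A.F.gr ((int k, 0) + z i)"
   using A.F.gr_smult[OF kd A.ee_gr[OF i]] by simp
  let ?d = "A.D ((int k, 0) + z i)"
  \<comment> \<open>At a homogeneous argument the component of the value \<open>a\<close> is again a
    value, so single-valuedness forces \<open>a\<close> itself to be homogeneous.\<close>
  have "A.F.comp ?d (\<lambda>j. X1 ^ k * ee i j) = (\<lambda>j. X1 ^ k * ee i j)"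
   using A.F.comp_hom[OF eg, of ?d] by simp
  then have "((\<lambda>j. X1 ^ k * ee i j), B.F.comp ?d a) \<in> R"
   using AB.FE.rsubD(6)[OF s a, of ?d] by simp
  then have "B.F.comp ?d a = a" by (rule single_valued[OF R _ a])
  then have ag: "a \<in> B.F.gr ((int k, 0) + z i)" using B.F.comp_gr[of a "(int k, 0) + z i"] c by simp
  have "U j \<in> A.Sg (z i - w j)" if "j < m" for j
  proof -
   have "X1 ^ k * U j \<in> A.Sg ((int k, 0) + z i - w j)" using ag that by (simp add: B.F_gr U)
   then have "U j \<in> A.Sg ((int k, 0) + z i - w j - (int k, 0))" by (simp only: A.Sg_X1_mult)
   moreover have "(int k, 0) + z i - w j - (int k, 0) = z i - w j" by simp
   ultimately show ?thesis by simp
  qed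
  moreover have "U j = 0" if "j \<ge> m" for j using U[of j] fsD[OF c(1) that] by simp
  ultimately have "U \<in> B.F.gr (z i)" by (simp add: B.F_gr fs_def)
  moreover have "a = (\<lambda>j. X1 ^ k * U j)" using U by (rule ext)
  ultimately show ?thesis using a by blast
 qed
 then obtain u k where u: "!!i. i < n ==> u i \<in> B.F.gr (z i)"
  and k: "!!i. i < n ==> ((\<lambda>j. X1 ^ k i * ee i j), (\<lambda>j. X1 ^ k i * u i j)) \<in> R" by metis
 have uc: "u i \<in> carrier B.F" if "i < n" for i by (rule B.F.gr_closed(1)[OF u[OF that]])
 have "AB.FE.eqv R (AB.gph u)"
 proof (rule AB.eqv_free[OF R AB.gph_rel[OF u]])
  fix i s' y y' assume i: "i < n" and y: "((\<lambda>j. s' * ee i j), y) \<in> R" and y': "((\<lambda>j. s' * ee i j), y') \<in> AB.gph u"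
  have y'eq: "y' = (\<lambda>j. s' * u i j)"
   using y' AB.gph_ee[of u i s', OF uc i] by (simp add: AB.gph_iff)
  have eq: "(\<lambda>j. s' * (X1 ^ k i * ee i j)) = (\<lambda>j. X1 ^ k i * (s' * ee i j))" by (simp add: mult_ac)
  have f1: "((\<lambda>j. s' * (X1 ^ k i * ee i j)), (\<lambda>j. s' * (X1 ^ k i * u i j))) \<in> R"
   using AB.FE.rsubD(5)[OF s k[OF i], of s'] by simp
  have f2: "((\<lambda>j. X1 ^ k i * (s' * ee i j)), (\<lambda>j. X1 ^ k i * y j)) \<in> R"
   using AB.FE.rsubD(5)[OF s y, of "X1 ^ k i"] by simp
  have "(\<lambda>j. s' * (X1 ^ k i * u i j)) = (\<lambda>j. X1 ^ k i * y j)"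
   by (rule single_valued[OF R f1[unfolded eq] f2])
  then have "s' * (X1 ^ k i * u i j) = X1 ^ k i * y j" for j by (rule fun_cong)
  then have "X1 ^ k i * (s' * u i j) = X1 ^ k i * y j" for j by (simp add: mult_ac)
  then have "y = y'" by (auto simp: y'eq fun_eq_iff)
  moreover have "y \<in> carrier B.F" using AB.FE.rsubD(2)[OF s y] .
  ultimately show "y \<ominus>\<^bsub>B.F\<^esub> y' \<in> B.F.tors" using B.F.diff_zero_iff[of y y'] B.F.torsD(2) by simp
 qed auto
 then show ?thesis using u by blast
qed

end

context weight_type
begin

end

section \<open>Coproducts and short exact sequences in categories\<close>

context category
begin

lemma isoE:
 assumes "isomorphic C A B"
 obtains f g where "f \<in> Mor C A B" "g \<in> Mor C B A" "Cmp C A B A g f = Idm C A" "Cmp C B A B f g = Idm C B"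
 using assms unfolding isomorphic_def iso_mor_def by blast

lemma isoI:
 assumes "f \<in> Mor C A B" "g \<in> Mor C B A" "Cmp C A B A g f = Idm C A" "Cmp C B A B f g = Idm C B"
 shows "isomorphic C A B"
 using assms unfolding isomorphic_def iso_mor_def by blast

lemma iso_refl: "A \<in> Ob C ==> isomorphic C A A"
 by (rule isoI[of "Idm C A" _ _ "Idm C A"]) (simp_all add: Idm_Mor Idm_left)

lemma iso_sym: "isomorphic C A B ==> isomorphic C B A"
 by (erule isoE) (rule isoI)

lemma cancel_inv:
 assumes "W \<in> Ob C" "A \<in> Ob C" "B \<in> Ob C" "f \<in> Mor C A B" "g \<in> Mor C B A" "Cmp C A B A g f = Idm C A" "h \<in> Mor C W A"
 shows "Cmp C W B A g (Cmp C W A B f h) = h"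
 using Cmp_assoc[OF assms(1,2,3,2,7,4,5)] assms by (simp add: Idm_left)

lemma cancel_inv':
 assumes "W \<in> Ob C" "A \<in> Ob C" "B \<in> Ob C" "f \<in> Mor C A B" "g \<in> Mor C B A" "Cmp C A B A g f = Idm C A" "h \<in> Mor C A W"
 shows "Cmp C A B W (Cmp C B A W h g) f = h"
 using Cmp_assoc[OF assms(2,3,2,1,4,5,7)] assms by (simp add: Idm_right)

lemma iso_trans:
 assumes O: "A \<in> Ob C" "B \<in> Ob C" "E \<in> Ob C" and "isomorphic C A B" "isomorphic C B E"
 shows "isomorphic C A E"
proof -
 from assms(4) obtain f g where f: "f \<in> Mor C A B" "g \<in> Mor C B A" "Cmp C A B A g f = Idm C A" "Cmp C B A B f g = Idm C B"
  by (rule isoE)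
 from assms(5) obtain h k where h: "h \<in> Mor C B E" "k \<in> Mor C E B" "Cmp C B E B k h = Idm C B" "Cmp C E B E h k = Idm C E"
  by (rule isoE)
 have m: "Cmp C A B E h f \<in> Mor C A E" "Cmp C E B A g k \<in> Mor C E A" using O f h Cmp_Mor by auto
 show ?thesis
 proof (rule isoI[OF m])
  have "Cmp C A E A (Cmp C E B A g k) (Cmp C A B E h f) = Cmp C A B A g (Cmp C A E B k (Cmp C A B E h f))"
   by (rule Cmp_assoc) (use O f h m in auto)
  then show "Cmp C A E A (Cmp C E B A g k) (Cmp C A B E h f) = Idm C A"
   using cancel_inv[OF O(1) O(2) O(3) h(1) h(2) h(3) f(1)] f by simp
  have "Cmp C E A E (Cmp C A B E h f) (Cmp C E B A g k) = Cmp C E B E h (Cmp C E A B f (Cmp C E B A g k))"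
   by (rule Cmp_assoc) (use O f h m in auto)
  then show "Cmp C E A E (Cmp C A B E h f) (Cmp C E B A g k) = Idm C E"
   using cancel_inv[OF O(3) O(2) O(1) f(2) f(1) f(4) h(2)] h by simp
 qed
qed

definition cocone :: "'i set => ('i => 'o) => 'o => ('i => 'm) => bool" where
 "cocone I U T \<iota> \<longleftrightarrow> (\<forall>i\<in>I. U i \<in> Ob C) \<and> T \<in> Ob C \<and> (\<forall>i\<in>I. \<iota> i \<in> Mor C (U i) T)"

text \<open>The universal property of \<open>direct_sum\<close> with explicit injections, where
  existence and uniqueness of the mediating morphism are separated.\<close>

definition coprod :: "'i set => ('i => 'o) => 'o => ('i => 'm) => bool" where
 "coprod I U T \<iota> \<longleftrightarrow> cocone I U T \<iota> \<and>
   (\<forall>Y \<phi>. cocone I U Y \<phi> --> (\<exists>h\<in>Mor C T Y. \<forall>i\<in>I. Cmp C (U i) T Y h (\<iota> i) = \<phi> i)) \<and>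
   (\<forall>Y\<in>Ob C. \<forall>h\<in>Mor C T Y. \<forall>k\<in>Mor C T Y. (\<forall>i\<in>I. Cmp C (U i) T Y h (\<iota> i) = Cmp C (U i) T Y k (\<iota> i)) --> h = k)"

lemma direct_sum_iff: "direct_sum C I U T \<longleftrightarrow> (\<exists>\<iota>. coprod I U T \<iota>)"
proof
 assume "direct_sum C I U T"
 then obtain \<iota> where T: "\<forall>i\<in>I. U i \<in> Ob C" "T \<in> Ob C" and \<iota>: "\<forall>i\<in>I. \<iota> i \<in> Mor C (U i) T"
  and u: "!!Y \<phi>. Y \<in> Ob C ==> (\<forall>i\<in>I. \<phi> i \<in> Mor C (U i) Y) ==>
   \<exists>!h. h \<in> Mor C T Y \<and> (\<forall>i\<in>I. Cmp C (U i) T Y h (\<iota> i) = \<phi> i)"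
  unfolding direct_sum_def by metis
 have "coprod I U T \<iota>"
  unfolding coprod_def
 proof (intro conjI allI impI ballI)
  show "cocone I U T \<iota>" using T \<iota> by (simp add: cocone_def)
  fix Y \<phi> assume "cocone I U Y \<phi>"
  then have "\<exists>!h. h \<in> Mor C T Y \<and> (\<forall>i\<in>I. Cmp C (U i) T Y h (\<iota> i) = \<phi> i)"
   by (intro u) (auto simp: cocone_def)
  then show "\<exists>h\<in>Mor C T Y. \<forall>i\<in>I. Cmp C (U i) T Y h (\<iota> i) = \<phi> i" by blast
 next
  fix Y h k assume Y: "Y \<in> Ob C" and hk: "h \<in> Mor C T Y" "k \<in> Mor C T Y"
   and eq: "\<forall>i\<in>I. Cmp C (U i) T Y h (\<iota> i) = Cmp C (U i) T Y k (\<iota> i)"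
  have "\<exists>!g. g \<in> Mor C T Y \<and> (\<forall>i\<in>I. Cmp C (U i) T Y g (\<iota> i) = Cmp C (U i) T Y k (\<iota> i))"
   by (rule u[OF Y]) (use T \<iota> hk Y Cmp_Mor in blast)
  then show "h = k" using hk eq by blast
 qed
 then show "\<exists>\<iota>. coprod I U T \<iota>" by blast
next
 assume "\<exists>\<iota>. coprod I U T \<iota>"
 then obtain \<iota> where co: "cocone I U T \<iota>"
  and ex: "!!Y \<phi>. cocone I U Y \<phi> ==> \<exists>h\<in>Mor C T Y. \<forall>i\<in>I. Cmp C (U i) T Y h (\<iota> i) = \<phi> i"
  and un: "!!Y h k. Y\<in>Ob C ==> h\<in>Mor C T Y ==> k\<in>Mor C T Y ==> (\<forall>i\<in>I. Cmp C (U i) T Y h (\<iota> i) = Cmp C (U i) T Y k (\<iota> i)) ==> h = k"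
  unfolding coprod_def by metis
 show "direct_sum C I U T"
  unfolding direct_sum_def
 proof (intro conjI exI[of _ \<iota>] ballI allI impI)
  fix Y \<phi> assume Y: "Y \<in> Ob C" "\<forall>i\<in>I. \<phi> i \<in> Mor C (U i) Y"
  then have "cocone I U Y \<phi>" using co by (auto simp: cocone_def)
  from ex[OF this] obtain h where h: "h \<in> Mor C T Y" "\<forall>i\<in>I. Cmp C (U i) T Y h (\<iota> i) = \<phi> i" by blast
  show "\<exists>!h. h \<in> Mor C T Y \<and> (\<forall>i\<in>I. Cmp C (U i) T Y h (\<iota> i) = \<phi> i)"
  proof (rule ex1I[of _ h])
   fix k assume "k \<in> Mor C T Y \<and> (\<forall>i\<in>I. Cmp C (U i) T Y k (\<iota> i) = \<phi> i)"
   then show "k = h" using un[OF Y(1), of k h] h by simp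
  qed (use h in simp)
 qed (use co in \<open>auto simp: cocone_def\<close>)
qed

lemma coprodD:
 assumes "coprod I U T \<iota>"
 shows "i \<in> I ==> U i \<in> Ob C" "T \<in> Ob C" "i \<in> I ==> \<iota> i \<in> Mor C (U i) T"
  "cocone I U Y \<phi> ==> \<exists>h\<in>Mor C T Y. \<forall>i\<in>I. Cmp C (U i) T Y h (\<iota> i) = \<phi> i"
  "Y \<in> Ob C ==> h \<in> Mor C T Y ==> k \<in> Mor C T Y ==>
   (!!i. i \<in> I ==> Cmp C (U i) T Y h (\<iota> i) = Cmp C (U i) T Y k (\<iota> i)) ==> h = k"
 using assms unfolding coprod_def cocone_def by blast+

lemma coprod_unique:
 assumes "direct_sum C I U T" "direct_sum C I U T'"
 shows "isomorphic C T T'"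
proof -
 from assms obtain \<iota> \<iota>' where c: "coprod I U T \<iota>" "coprod I U T' \<iota>'" by (auto simp: direct_sum_iff)
 note d = coprodD[OF c(1)] and d' = coprodD[OF c(2)]
 have co: "cocone I U T \<iota>" "cocone I U T' \<iota>'" using c by (auto simp: coprod_def)
 from d(4)[OF co(2)] obtain h where h: "h \<in> Mor C T T'" "!!i. i \<in> I ==> Cmp C (U i) T T' h (\<iota> i) = \<iota>' i" by blast
 from d'(4)[OF co(1)] obtain k where k: "k \<in> Mor C T' T" "!!i. i \<in> I ==> Cmp C (U i) T' T k (\<iota>' i) = \<iota> i" by blast
 show ?thesis
 proof (rule isoI[OF h(1) k(1)])
  show "Cmp C T T' T k h = Idm C T"
  proof (rule d(5)[OF d(2)])
   fix i assume i: "i \<in> I"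
   have "Cmp C (U i) T T (Cmp C T T' T k h) (\<iota> i) = Cmp C (U i) T' T k (Cmp C (U i) T T' h (\<iota> i))"
    by (rule Cmp_assoc) (use d d' i h k in auto)
   then show "Cmp C (U i) T T (Cmp C T T' T k h) (\<iota> i) = Cmp C (U i) T T (Idm C T) (\<iota> i)"
    using h(2)[OF i] k(2)[OF i] Idm_left[OF d(1)[OF i] d(2) d(3)[OF i]] by simp
  qed (use Cmp_Mor[OF d(2) d'(2) d(2) h(1) k(1)] Idm_Mor[OF d(2)] in auto)
  show "Cmp C T' T T' h k = Idm C T'"
  proof (rule d'(5)[OF d'(2)])
   fix i assume i: "i \<in> I"
   have "Cmp C (U i) T' T' (Cmp C T' T T' h k) (\<iota>' i) = Cmp C (U i) T T' h (Cmp C (U i) T' T k (\<iota>' i))"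
    by (rule Cmp_assoc) (use d d' i h k in auto)
   then show "Cmp C (U i) T' T' (Cmp C T' T T' h k) (\<iota>' i) = Cmp C (U i) T' T' (Idm C T') (\<iota>' i)"
    using h(2)[OF i] k(2)[OF i] Idm_left[OF d'(1)[OF i] d'(2) d'(3)[OF i]] by simp
  qed (use Cmp_Mor[OF d'(2) d(2) d'(2) k(1) h(1)] Idm_Mor[OF d'(2)] in auto)
 qed
qed

lemma coprod_iso_summands:
 assumes ds: "direct_sum C I U T" and U': "!!i. i \<in> I ==> U' i \<in> Ob C" "!!i. i \<in> I ==> isomorphic C (U' i) (U i)"
 shows "direct_sum C I U' T"
proof -
 from ds obtain \<iota> where c: "coprod I U T \<iota>" by (auto simp: direct_sum_iff)
 note d = coprodD[OF c]
 have "\<forall>i\<in>I. \<exists>f g. f \<in> Mor C (U' i) (U i) \<and> g \<in> Mor C (U i) (U' i) \<and>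
   Cmp C (U' i) (U i) (U' i) g f = Idm C (U' i) \<and> Cmp C (U i) (U' i) (U i) f g = Idm C (U i)"
  using U'(2) isoE by metis
 then obtain f g where f: "!!i. i \<in> I ==> f i \<in> Mor C (U' i) (U i)" "!!i. i \<in> I ==> g i \<in> Mor C (U i) (U' i)"
  "!!i. i \<in> I ==> Cmp C (U' i) (U i) (U' i) (g i) (f i) = Idm C (U' i)"
  "!!i. i \<in> I ==> Cmp C (U i) (U' i) (U i) (f i) (g i) = Idm C (U i)" by metis
 define \<kappa> where "\<kappa> i = Cmp C (U' i) (U i) T (\<iota> i) (f i)" for i
 have \<kappa>: "\<kappa> i \<in> Mor C (U' i) T" if "i \<in> I" for i
  unfolding \<kappa>_def by (rule Cmp_Mor) (use that U' d f in auto)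
 have bk: "Cmp C (U i) (U' i) T (\<kappa> i) (g i) = \<iota> i" if i: "i \<in> I" for i
  unfolding \<kappa>_def by (rule cancel_inv'[of T "U i" "U' i" "g i" "f i"]) (use i U' d f in auto)
 have "coprod I U' T \<kappa>"
  unfolding coprod_def
 proof (intro conjI allI impI ballI)
  show "cocone I U' T \<kappa>" using U' d(2) \<kappa> by (simp add: cocone_def)
  fix Y \<phi> assume \<phi>: "cocone I U' Y \<phi>"
  then have Y: "Y \<in> Ob C" "!!i. i \<in> I ==> \<phi> i \<in> Mor C (U' i) Y" by (auto simp: cocone_def)
  have "cocone I U Y (\<lambda>i. Cmp C (U i) (U' i) Y (\<phi> i) (g i))"
   using Y U' d f Cmp_Mor by (auto simp: cocone_def)
  from d(4)[OF this] obtain h where h: "h \<in> Mor C T Y" "!!i. i \<in> I ==> Cmp C (U i) T Y h (\<iota> i) = Cmp C (U i) (U' i) Y (\<phi> i) (g i)"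
   by blast
  have "Cmp C (U' i) T Y h (\<kappa> i) = \<phi> i" if i: "i \<in> I" for i
  proof -
   have "Cmp C (U' i) T Y h (\<kappa> i) = Cmp C (U' i) (U i) Y (Cmp C (U i) T Y h (\<iota> i)) (f i)"
    unfolding \<kappa>_def by (rule Cmp_assoc[symmetric]) (use i U' d f h Y in auto)
   also have "\<dots> = \<phi> i" unfolding h(2)[OF i]
    by (rule cancel_inv'[of Y "U' i" "U i" "f i" "g i"]) (use i U' d f h Y in auto)
   finally show ?thesis .
  qed
  then show "\<exists>h\<in>Mor C T Y. \<forall>i\<in>I. Cmp C (U' i) T Y h (\<kappa> i) = \<phi> i" using h(1) by blast
 next
  fix Y h k assume Y: "Y \<in> Ob C" and hk: "h \<in> Mor C T Y" "k \<in> Mor C T Y"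
   and eq: "\<forall>i\<in>I. Cmp C (U' i) T Y h (\<kappa> i) = Cmp C (U' i) T Y k (\<kappa> i)"
  have "Cmp C (U i) T Y l (\<iota> i) = Cmp C (U i) (U' i) Y (Cmp C (U' i) T Y l (\<kappa> i)) (g i)"
   if i: "i \<in> I" and l: "l \<in> Mor C T Y" for i l
  proof -
   have "Cmp C (U i) (U' i) Y (Cmp C (U' i) T Y l (\<kappa> i)) (g i) = Cmp C (U i) T Y l (Cmp C (U i) (U' i) T (\<kappa> i) (g i))"
    by (rule Cmp_assoc) (use i U' d f \<kappa> l Y in auto)
   then show ?thesis using bk[OF i] by simp
  qed
  then show "h = k" using eq hk by (intro d(5)[OF Y hk]) auto
 qed
 then show ?thesis by (auto simp: direct_sum_iff)
qed

text \<open>Associativity of coproducts: the injections of the first \<open>n\<close> summands are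
  composed with the injection of \<open>T\<close>.\<close>

lemma coprod_Suc:
 assumes T: "direct_sum C {..<n} U T" and T': "direct_sum C {..<2::nat} (\<lambda>i. if i = 0 then T else U n) T'"
 shows "direct_sum C {..<Suc n} U T'"
proof -
 from T obtain \<iota> where c: "coprod {..<n} U T \<iota>" by (auto simp: direct_sum_iff)
 from T' obtain \<kappa> where c': "coprod {..<2::nat} (\<lambda>i. if i = 0 then T else U n) T' \<kappa>" by (auto simp: direct_sum_iff)
 note d = coprodD[OF c] and d' = coprodD[OF c']
 have two: "{..<2::nat} = {0, 1}" by auto
 have j: "\<kappa> 0 \<in> Mor C T T'" "\<kappa> 1 \<in> Mor C (U n) T'" using d'(3)[of 0] d'(3)[of 1] by auto
 have Un: "U i \<in> Ob C" if "i < Suc n" for i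
  using d(1)[of i] d'(1)[of 1] that by (cases "i = n") auto
 define l where "l i = (if i = n then \<kappa> 1 else Cmp C (U i) T T' (\<kappa> 0) (\<iota> i))" for i
 have l: "l i \<in> Mor C (U i) T'" if "i < Suc n" for i
  unfolding l_def using that j Un d(2,3) d'(2) by (auto intro!: Cmp_Mor)
 have comp: "Cmp C (U i) T' Y h (l i) = Cmp C (U i) T Y (Cmp C T T' Y h (\<kappa> 0)) (\<iota> i)"
  if "i < n" "Y \<in> Ob C" "h \<in> Mor C T' Y" for i Y h
  using that Cmp_assoc[of "U i" T T' Y "\<iota> i" "\<kappa> 0" h] d(1)[of i] d(2) d(3)[of i] d'(2) j by (simp add: l_def)
 have "coprod {..<Suc n} U T' l"
  unfolding coprod_def
 proof (intro conjI allI impI ballI)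
  show "cocone {..<Suc n} U T' l" using Un l d'(2) by (simp add: cocone_def)
  fix Y \<phi> assume "cocone {..<Suc n} U Y \<phi>"
  then have Y: "Y \<in> Ob C" "!!i. i < Suc n ==> \<phi> i \<in> Mor C (U i) Y" by (auto simp: cocone_def)
  have "cocone {..<n} U Y \<phi>" using Y Un by (auto simp: cocone_def)
  from d(4)[OF this] obtain h where h: "h \<in> Mor C T Y" "!!i. i < n ==> Cmp C (U i) T Y h (\<iota> i) = \<phi> i" by auto
  have "cocone {..<2::nat} (\<lambda>i. if i = 0 then T else U n) Y (\<lambda>i. if i = 0 then h else \<phi> n)"
   using Y Un d(2) h(1) by (auto simp: cocone_def)
  from d'(4)[OF this] obtain k where k: "k \<in> Mor C T' Y" "Cmp C T T' Y k (\<kappa> 0) = h" "Cmp C (U n) T' Y k (\<kappa> 1) = \<phi> n"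
   by (auto simp: two)
  have "Cmp C (U i) T' Y k (l i) = \<phi> i" if "i < Suc n" for i
  proof (cases "i = n")
   case True then show ?thesis using k by (simp add: l_def)
  next
   case False then show ?thesis using comp[of i Y k] that Y k h by simp
  qed
  then show "\<exists>h\<in>Mor C T' Y. \<forall>i\<in>{..<Suc n}. Cmp C (U i) T' Y h (l i) = \<phi> i" using k(1) by blast
 next
  fix Y h k assume Y: "Y \<in> Ob C" and hk: "h \<in> Mor C T' Y" "k \<in> Mor C T' Y"
   and eq: "\<forall>i\<in>{..<Suc n}. Cmp C (U i) T' Y h (l i) = Cmp C (U i) T' Y k (l i)"
  have m: "Cmp C T T' Y h (\<kappa> 0) \<in> Mor C T Y" "Cmp C T T' Y k (\<kappa> 0) \<in> Mor C T Y"
   using Cmp_Mor[OF d(2) d'(2) Y j(1)] hk by auto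
  have "Cmp C T T' Y h (\<kappa> 0) = Cmp C T T' Y k (\<kappa> 0)"
  proof (rule d(5)[OF Y m])
   fix i assume i: "i \<in> {..<n}"
   then show "Cmp C (U i) T Y (Cmp C T T' Y h (\<kappa> 0)) (\<iota> i) = Cmp C (U i) T Y (Cmp C T T' Y k (\<kappa> 0)) (\<iota> i)"
    using comp[of i Y h] comp[of i Y k] Y hk bspec[OF eq, of i] by simp
  qed
  moreover have "Cmp C (U n) T' Y h (\<kappa> 1) = Cmp C (U n) T' Y k (\<kappa> 1)" using bspec[OF eq, of n] by (simp add: l_def)
  ultimately show "h = k" by (intro d'(5)[OF Y hk]) (auto simp: two)
 qed
 then show ?thesis by (auto simp: direct_sum_iff)
qed

lemma coprod_reindex:
 assumes ds: "direct_sum C I (\<lambda>i. U (\<sigma> i)) T" and \<sigma>: "bij_betw \<sigma> I J"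
 shows "direct_sum C J U T"
proof -
 from ds obtain \<iota> where c: "coprod I (\<lambda>i. U (\<sigma> i)) T \<iota>" by (auto simp: direct_sum_iff)
 note d = coprodD[OF c]
 define \<rho> where "\<rho> = inv_into I \<sigma>"
 have \<rho>: "\<rho> j \<in> I" "\<sigma> (\<rho> j) = j" if "j \<in> J" for j
  using that \<sigma> bij_betw_inv_into_right[OF \<sigma> that] bij_betwE[OF bij_betw_inv_into[OF \<sigma>]] by (auto simp: \<rho>_def)
 have \<sigma>': "\<sigma> i \<in> J" "\<rho> (\<sigma> i) = i" if "i \<in> I" for i
  using that \<sigma> bij_betw_inv_into_left[OF \<sigma> that] bij_betwE[OF \<sigma>] by (auto simp: \<rho>_def)
 have "coprod J U T (\<lambda>j. \<iota> (\<rho> j))"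
  unfolding coprod_def
 proof (intro conjI allI impI ballI)
  show "cocone J U T (\<lambda>j. \<iota> (\<rho> j))"
   unfolding cocone_def using d(1)[OF \<rho>(1)] d(2) d(3)[OF \<rho>(1)] \<rho>(2) by auto
  fix Y \<phi> assume \<phi>: "cocone J U Y \<phi>"
  then have "cocone I (\<lambda>i. U (\<sigma> i)) Y (\<lambda>i. \<phi> (\<sigma> i))" using \<sigma>'(1) by (auto simp: cocone_def)
  from d(4)[OF this] obtain h where "h \<in> Mor C T Y" "!!i. i \<in> I ==> Cmp C (U (\<sigma> i)) T Y h (\<iota> i) = \<phi> (\<sigma> i)" by blast
  then show "\<exists>h\<in>Mor C T Y. \<forall>j\<in>J. Cmp C (U j) T Y h (\<iota> (\<rho> j)) = \<phi> j" using \<rho> by (metis (full_types))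
 next
  fix Y h k assume Y: "Y \<in> Ob C" and hk: "h \<in> Mor C T Y" "k \<in> Mor C T Y"
   and eq: "\<forall>j\<in>J. Cmp C (U j) T Y h (\<iota> (\<rho> j)) = Cmp C (U j) T Y k (\<iota> (\<rho> j))"
  show "h = k"
  proof (rule d(5)[OF Y hk])
   fix i assume "i \<in> I"
   then show "Cmp C (U (\<sigma> i)) T Y h (\<iota> i) = Cmp C (U (\<sigma> i)) T Y k (\<iota> i)"
    using bspec[OF eq \<sigma>'(1)] \<sigma>'(2) by simp
  qed
 qed
 then show ?thesis by (auto simp: direct_sum_iff)
qed

lemma coprod_iso_sum:
 assumes ds: "direct_sum C I U T" and T': "T' \<in> Ob C" "isomorphic C T T'"
 shows "direct_sum C I U T'"
proof -
 from ds obtain \<iota> where c: "coprod I U T \<iota>" by (auto simp: direct_sum_iff)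
 note d = coprodD[OF c]
 from T'(2) obtain f g where f: "f \<in> Mor C T T'" "g \<in> Mor C T' T" "Cmp C T T' T g f = Idm C T" "Cmp C T' T T' f g = Idm C T'"
  by (rule isoE)
 define \<kappa> where "\<kappa> i = Cmp C (U i) T T' f (\<iota> i)" for i
 have \<kappa>: "\<kappa> i \<in> Mor C (U i) T'" if "i \<in> I" for i
  unfolding \<kappa>_def by (rule Cmp_Mor) (use that T' d f in auto)
 have comp: "Cmp C (U i) T' Y h (\<kappa> i) = Cmp C (U i) T Y (Cmp C T T' Y h f) (\<iota> i)" if "i \<in> I" "Y \<in> Ob C" "h \<in> Mor C T' Y" for i Y h
  unfolding \<kappa>_def by (rule Cmp_assoc[symmetric]) (use that T' d f in auto)
 have "coprod I U T' \<kappa>"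
  unfolding coprod_def
 proof (intro conjI allI impI ballI)
  show "cocone I U T' \<kappa>" using T' d(1) \<kappa> by (simp add: cocone_def)
  fix Y \<phi> assume \<phi>: "cocone I U Y \<phi>"
  then have Y: "Y \<in> Ob C" by (simp add: cocone_def)
  from d(4)[OF \<phi>] obtain h where h: "h \<in> Mor C T Y" "!!i. i \<in> I ==> Cmp C (U i) T Y h (\<iota> i) = \<phi> i" by blast
  have hg: "Cmp C T' T Y h g \<in> Mor C T' Y" using Cmp_Mor[OF T'(1) d(2) Y f(2) h(1)] .
  have "Cmp C T T' Y (Cmp C T' T Y h g) f = h"
   by (rule cancel_inv') (use T' d f h Y in auto)
  then have "\<forall>i\<in>I. Cmp C (U i) T' Y (Cmp C T' T Y h g) (\<kappa> i) = \<phi> i" using comp[OF _ Y hg] h(2) by simp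
  then show "\<exists>h\<in>Mor C T' Y. \<forall>i\<in>I. Cmp C (U i) T' Y h (\<kappa> i) = \<phi> i" using hg by blast
 next
  fix Y h k assume Y: "Y \<in> Ob C" and hk: "h \<in> Mor C T' Y" "k \<in> Mor C T' Y"
   and eq: "\<forall>i\<in>I. Cmp C (U i) T' Y h (\<kappa> i) = Cmp C (U i) T' Y k (\<kappa> i)"
  have m: "Cmp C T T' Y h f \<in> Mor C T Y" "Cmp C T T' Y k f \<in> Mor C T Y"
   using Cmp_Mor[OF d(2) T'(1) Y f(1)] hk by auto
  have "Cmp C T T' Y h f = Cmp C T T' Y k f"
   by (rule d(5)[OF Y m]) (use eq comp Y hk in auto)
  then have "Cmp C T' T Y (Cmp C T T' Y h f) g = Cmp C T' T Y (Cmp C T T' Y k f) g" by simp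
  then show "h = k"
   using cancel_inv'[OF Y T'(1) d(2) f(2,1,4) hk(1)] cancel_inv'[OF Y T'(1) d(2) f(2,1,4) hk(2)] by simp
 qed
 then show ?thesis by (auto simp: direct_sum_iff)
qed

lemma iso_zero:
 assumes "zero_object C A" "isomorphic C A B" "B \<in> Ob C" shows "zero_object C B"
proof -
 have A: "A \<in> Ob C" using assms(1) by (simp add: zero_object_def)
 from assms(2) obtain f g where f: "f \<in> Mor C A B" "g \<in> Mor C B A" "Cmp C A B A g f = Idm C A" "Cmp C B A B f g = Idm C B"
  by (rule isoE)
 show ?thesis
  unfolding zero_object_def
 proof (intro conjI ballI)
  fix W assume W: "W \<in> Ob C"
  from assms(1) W obtain a where a: "a \<in> Mor C W A" "!!a'. a' \<in> Mor C W A ==> a' = a" unfolding zero_object_def by metis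
  from assms(1) W obtain b where b: "b \<in> Mor C A W" "!!b'. b' \<in> Mor C A W ==> b' = b" unfolding zero_object_def by metis
  show "\<exists>!f. f \<in> Mor C W B"
  proof (rule ex1I)
   show "Cmp C W A B f a \<in> Mor C W B" by (rule Cmp_Mor[OF W A assms(3) a(1) f(1)])
   fix k assume k: "k \<in> Mor C W B"
   have "Cmp C W A B f (Cmp C W B A g k) = k" by (rule cancel_inv) (use W A assms f k in auto)
   then show "k = Cmp C W A B f a" using a(2)[OF Cmp_Mor[OF W assms(3) A k f(2)]] by simp
  qed
  show "\<exists>!f. f \<in> Mor C B W"
  proof (rule ex1I)
   show "Cmp C B A W b g \<in> Mor C B W" by (rule Cmp_Mor[OF assms(3) A W f(2) b(1)])
   fix k assume k: "k \<in> Mor C B W"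
   have "Cmp C B A W (Cmp C A B W k f) g = k" by (rule cancel_inv') (use W A assms f k in auto)
   then show "k = Cmp C B A W b g" using b(2)[OF Cmp_Mor[OF A assms(3) W f(1) k]] by simp
  qed
 qed (rule assms(3))
qed

lemma iso_indecomposable:
 assumes ind: "indecomposable C A" and AB: "isomorphic C A B" "B \<in> Ob C"
 shows "indecomposable C B"
proof -
 have A: "A \<in> Ob C" using ind by (simp add: indecomposable_def)
 have "\<not> zero_object C B" using ind iso_zero[OF _ iso_sym[OF AB(1)] A] by (auto simp: indecomposable_def)
 moreover have "zero_object C (Y 0) \<or> zero_object C (Y 1)" if "direct_sum C {..<2::nat} Y B" for Y
  using coprod_iso_sum[OF that A iso_sym[OF AB(1)]] ind by (simp add: indecomposable_def)
 ultimately show ?thesis using AB(2) by (simp add: indecomposable_def)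
qed

end

section \<open>Zero morphisms, idempotents, and transport of exact sequences along
  isomorphisms\<close>

locale category_zero = category C for C :: "('o, 'm) cat" +
 fixes Z0 assumes Z0: "zero_object C Z0"
begin

lemma zero_obj_Ob: "zero_object C Z ==> Z \<in> Ob C"
 by (simp add: zero_object_def)

lemma zero_to: "zero_object C Z ==> A \<in> Ob C ==> \<exists>f. f \<in> Mor C A Z"
 by (auto simp: zero_object_def)

lemma zero_from: "zero_object C Z ==> A \<in> Ob C ==> \<exists>f. f \<in> Mor C Z A"
 by (auto simp: zero_object_def)

lemma zero_to_unique: "zero_object C Z ==> A \<in> Ob C ==> f \<in> Mor C A Z ==> g \<in> Mor C A Z ==> f = g"
 unfolding zero_object_def by blast

lemma zero_mor_ex: "A \<in> Ob C ==> B \<in> Ob C ==> \<exists>f\<in>Mor C A B. zero_mor C A B f"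
proof -
 assume O: "A \<in> Ob C" "B \<in> Ob C"
 obtain g h where gh: "g \<in> Mor C A Z0" "h \<in> Mor C Z0 B" using zero_to[OF Z0 O(1)] zero_from[OF Z0 O(2)] by blast
 have "zero_mor C A B (Cmp C A Z0 B h g)" unfolding zero_mor_def using Z0 gh by blast
 then show ?thesis using Cmp_Mor[OF O(1) zero_obj_Ob[OF Z0] O(2) gh] by blast
qed

lemma zero_mor_left:
 assumes O: "A \<in> Ob C" "B \<in> Ob C" "E \<in> Ob C" and f: "zero_mor C A B f" and g: "g \<in> Mor C B E"
 shows "zero_mor C A E (Cmp C A B E g f)"
proof -
 from f obtain Z a b where Z: "zero_object C Z" "a \<in> Mor C A Z" "b \<in> Mor C Z B" "f = Cmp C A Z B b a"
  unfolding zero_mor_def by blast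
 note ZO = zero_obj_Ob[OF Z(1)]
 have "Cmp C A B E g f = Cmp C A Z E (Cmp C Z B E g b) a"
  unfolding Z(4) using Cmp_assoc[OF O(1) ZO O(2,3) Z(2,3) g] by simp
 then show ?thesis unfolding zero_mor_def using Z Cmp_Mor[OF ZO O(2,3) Z(3) g] by blast
qed

lemma zero_mor_right:
 assumes O: "A \<in> Ob C" "B \<in> Ob C" "E \<in> Ob C" and f: "f \<in> Mor C A B" and g: "zero_mor C B E g"
 shows "zero_mor C A E (Cmp C A B E g f)"
proof -
 from g obtain Z a b where Z: "zero_object C Z" "a \<in> Mor C B Z" "b \<in> Mor C Z E" "g = Cmp C B Z E b a"
  unfolding zero_mor_def by blast
 note ZO = zero_obj_Ob[OF Z(1)]
 have "Cmp C A B E g f = Cmp C A Z E b (Cmp C A B Z a f)"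
  unfolding Z(4) by (rule Cmp_assoc[OF O(1,2) ZO O(3) f Z(2,3)])
 then show ?thesis unfolding zero_mor_def using Z Cmp_Mor[OF O(1,2) ZO f Z(2)] by blast
qed

text \<open>If the identity of \<open>A\<close> factors through a zero object \<open>Z\<close>, the
  two factors are mutually inverse, since \<open>Z\<close> has a single endomorphism.\<close>

lemma zero_id:
 assumes A: "A \<in> Ob C" and z: "zero_mor C A A (Idm C A)" shows "zero_object C A"
proof -
 from z obtain Z g h where Z: "zero_object C Z" "g \<in> Mor C A Z" "h \<in> Mor C Z A" "Idm C A = Cmp C A Z A h g"
  unfolding zero_mor_def by blast
 note ZO = zero_obj_Ob[OF Z(1)]
 have "Cmp C Z A Z g h = Idm C Z" by (rule zero_to_unique[OF Z(1) ZO Cmp_Mor[OF ZO A ZO Z(3,2)] Idm_Mor[OF ZO]])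
 then have "isomorphic C Z A" by (intro isoI[OF Z(3,2)]) (simp_all add: Z(4))
 then show ?thesis using iso_zero[OF Z(1) _ A] by blast
qed

text \<open>The mediating morphism of the cocone with the identity at \<open>i\<close> and zero
  morphisms elsewhere.\<close>

lemma coprod_projection:
 assumes c: "coprod I U T \<iota>" and i: "i \<in> I"
 shows "\<exists>\<pi>\<in>Mor C T (U i). Cmp C (U i) T (U i) \<pi> (\<iota> i) = Idm C (U i) \<and>
  (\<forall>j\<in>I. j \<noteq> i --> zero_mor C (U j) (U i) (Cmp C (U j) T (U i) \<pi> (\<iota> j)))"
proof -
 note d = coprodD[OF c]
 have "\<forall>j\<in>I. \<exists>f\<in>Mor C (U j) (U i). zero_mor C (U j) (U i) f"
  using zero_mor_ex[OF d(1) d(1)[OF i]] by blast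
 then obtain f where f: "!!j. j \<in> I ==> f j \<in> Mor C (U j) (U i)" "!!j. j \<in> I ==> zero_mor C (U j) (U i) (f j)" by metis
 have "cocone I U (U i) (f(i := Idm C (U i)))"
  unfolding cocone_def using d(1) i f(1) Idm_Mor by auto
 from d(4)[OF this] obtain \<pi> where "\<pi> \<in> Mor C T (U i)"
  "!!j. j \<in> I ==> Cmp C (U j) T (U i) \<pi> (\<iota> j) = (f(i := Idm C (U i))) j" by blast
 then show ?thesis using f i by (intro bexI[of _ \<pi>]) auto
qed

text \<open>A decomposition into two summands yields the idempotent projecting onto summand 0. If it
  is the identity, summand 1 vanishes; if it is zero, summand 0 vanishes.\<close>

lemma indecomposableI:
 assumes A: "A \<in> Ob C" "\<not> zero_object C A"
  and e: "!!e. e \<in> Mor C A A ==> Cmp C A A A e e = e ==> e = Idm C A \<or> zero_mor C A A e"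
 shows "indecomposable C A"
 unfolding indecomposable_def
proof (intro conjI A allI impI)
 fix Y assume "direct_sum C {..<2::nat} Y A"
 then obtain \<iota> where c: "coprod {..<2} Y A \<iota>" by (auto simp: direct_sum_iff)
 note d = coprodD[OF c]
 have O: "Y 0 \<in> Ob C" "Y 1 \<in> Ob C" using d(1) by auto
 have \<iota>: "\<iota> 0 \<in> Mor C (Y 0) A" "\<iota> 1 \<in> Mor C (Y 1) A" using d(3) by auto
 from coprod_projection[OF c, of 0] obtain a where a: "a \<in> Mor C A (Y 0)"
  "Cmp C (Y 0) A (Y 0) a (\<iota> 0) = Idm C (Y 0)" "zero_mor C (Y 1) (Y 0) (Cmp C (Y 1) A (Y 0) a (\<iota> 1))" by auto
 from coprod_projection[OF c, of 1] obtain b where b: "b \<in> Mor C A (Y 1)"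
  "Cmp C (Y 1) A (Y 1) b (\<iota> 1) = Idm C (Y 1)" by auto
 define f where "f = Cmp C A (Y 0) A (\<iota> 0) a"
 have f: "f \<in> Mor C A A" unfolding f_def by (rule Cmp_Mor[OF A(1) O(1) A(1) a(1) \<iota>(1)])
 have f\<iota>: "Cmp C W A A f h = Cmp C W (Y 0) A (\<iota> 0) (Cmp C W A (Y 0) a h)" if "W \<in> Ob C" "h \<in> Mor C W A" for W h
  unfolding f_def by (rule Cmp_assoc[OF that(1) A(1) O(1) A(1) that(2) a(1) \<iota>(1)])
 have f0: "Cmp C (Y 0) A A f (\<iota> 0) = \<iota> 0"
  using f\<iota>[OF O(1) \<iota>(1)] a(2) Idm_right[OF O(1) A(1) \<iota>(1)] by simp
 have "Cmp C A A A f f = Cmp C A (Y 0) A (Cmp C (Y 0) A A f (\<iota> 0)) a"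
  using Cmp_assoc[OF A(1) O(1) A(1) A(1) a(1) \<iota>(1) f] by (simp add: f_def)
 also have "\<dots> = f" by (simp only: f0) (simp only: f_def)
 finally have "Cmp C A A A f f = f" .
 from e[OF f this] show "zero_object C (Y 0) \<or> zero_object C (Y 1)"
 proof
  assume "f = Idm C A"
  then have "\<iota> 1 = Cmp C (Y 1) (Y 0) A (\<iota> 0) (Cmp C (Y 1) A (Y 0) a (\<iota> 1))"
   using f\<iota>[OF O(2) \<iota>(2)] Idm_left[OF O(2) A(1) \<iota>(2)] by simp
  then have "zero_mor C (Y 1) A (\<iota> 1)" using zero_mor_left[OF O(2,1) A(1) a(3) \<iota>(1)] by simp
  then have "zero_mor C (Y 1) (Y 1) (Idm C (Y 1))"
   using zero_mor_left[OF O(2) A(1) O(2) _ b(1)] b(2) by metis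
  then show ?thesis using zero_id[OF O(2)] by blast
 next
  assume "zero_mor C A A f"
  then have "zero_mor C (Y 0) A (\<iota> 0)" using zero_mor_right[OF O(1) A(1) A(1) \<iota>(1)] f0 by metis
  then have "zero_mor C (Y 0) (Y 0) (Idm C (Y 0))"
   using zero_mor_left[OF O(1) A(1) O(1) _ a(1)] a(2) by metis
  then show ?thesis using zero_id[OF O(1)] by blast
 qed
qed

lemma mono_comp:
 assumes O: "A \<in> Ob C" "B \<in> Ob C" "E \<in> Ob C" and f: "mono_mor C A B f" and g: "mono_mor C B E g"
 shows "mono_mor C A E (Cmp C A B E g f)"
 unfolding mono_mor_def
proof (intro conjI ballI impI)
 have m: "f \<in> Mor C A B" "g \<in> Mor C B E" using f g by (auto simp: mono_mor_def)
 show "Cmp C A B E g f \<in> Mor C A E" by (rule Cmp_Mor[OF O m])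
 fix W a b assume W: "W \<in> Ob C" "a \<in> Mor C W A" "b \<in> Mor C W A"
  and eq: "Cmp C W A E (Cmp C A B E g f) a = Cmp C W A E (Cmp C A B E g f) b"
 have "Cmp C W B E g (Cmp C W A B f a) = Cmp C W B E g (Cmp C W A B f b)"
  using eq Cmp_assoc[OF W(1) O W(2) m] Cmp_assoc[OF W(1) O W(3) m] by simp
 then have "Cmp C W A B f a = Cmp C W A B f b"
  using g W Cmp_Mor[OF W(1) O(1,2) W(2) m(1)] Cmp_Mor[OF W(1) O(1,2) W(3) m(1)] unfolding mono_mor_def by blast
 then show "a = b" using f W unfolding mono_mor_def by blast
qed

lemma split_mono:
 assumes O: "A \<in> Ob C" "B \<in> Ob C" and f: "f \<in> Mor C A B" "g \<in> Mor C B A" "Cmp C A B A g f = Idm C A"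
 shows "mono_mor C A B f"
 unfolding mono_mor_def
proof (intro conjI ballI impI)
 show "f \<in> Mor C A B" by (rule f)
 fix W a b assume W: "W \<in> Ob C" "a \<in> Mor C W A" "b \<in> Mor C W A" and eq: "Cmp C W A B f a = Cmp C W A B f b"
 show "a = b" using cancel_inv[OF W(1) O f W(2)] cancel_inv[OF W(1) O f W(3)] eq by metis
qed

text \<open>All three objects are replaced by isomorphic ones. This prepares the invariance of
  \<open>Ext1_zero\<close>, which speaks of sequences with prescribed end terms, while bundles are
  only known up to isomorphism.\<close>

lemma kernel_iso:
 assumes k: "is_kernel C A E B f g" and O: "A \<in> Ob C" "E \<in> Ob C" "B \<in> Ob C" "A' \<in> Ob C" "E' \<in> Ob C" "B' \<in> Ob C"
  and a: "a \<in> Mor C A A'" "a' \<in> Mor C A' A" "Cmp C A A' A a' a = Idm C A" "Cmp C A' A A' a a' = Idm C A'"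
  and e: "e \<in> Mor C E E'" "e' \<in> Mor C E' E" "Cmp C E E' E e' e = Idm C E" "Cmp C E' E E' e e' = Idm C E'"
  and b: "b \<in> Mor C B B'" "b' \<in> Mor C B' B" "Cmp C B B' B b' b = Idm C B" "Cmp C B' B B' b b' = Idm C B'"
 shows "is_kernel C A' E' B' (Cmp C A' E E' e (Cmp C A' A E f a')) (Cmp C E' B B' b (Cmp C E' E B g e'))"
  (is "is_kernel C A' E' B' ?f ?g")
proof -
 have fg: "f \<in> Mor C A E" "g \<in> Mor C E B" "zero_mor C A B (Cmp C A E B g f)" using k by (auto simp: is_kernel_def)
 have m: "Cmp C A' A E f a' \<in> Mor C A' E" "Cmp C E' E B g e' \<in> Mor C E' B" "?f \<in> Mor C A' E'" "?g \<in> Mor C E' B'"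
  using O fg a e b Cmp_Mor by auto
 have gW: "Cmp C W E' B' ?g h = Cmp C W B B' b (Cmp C W E B g (Cmp C W E' E e' h))" if "W \<in> Ob C" "h \<in> Mor C W E'" for W h
  using that O fg a e b m Cmp_Mor Cmp_assoc[of W E' B B' h "Cmp C E' E B g e'" b] Cmp_assoc[of W E' E B h e' g] by simp
 have fW: "Cmp C W E' E e' (Cmp C W A' E' ?f h) = Cmp C W A E f (Cmp C W A' A a' h)" if "W \<in> Ob C" "h \<in> Mor C W A'" for W h
 proof -
  have 1: "Cmp C W A' E' ?f h = Cmp C W E E' e (Cmp C W A E f (Cmp C W A' A a' h))"
   using that O fg a e m Cmp_assoc[of W A' E E' h "Cmp C A' A E f a'" e] Cmp_assoc[of W A' A E h a' f] by simp
  have 2: "Cmp C W A E f (Cmp C W A' A a' h) \<in> Mor C W E" using that O fg a Cmp_Mor by auto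
  show ?thesis unfolding 1 by (rule cancel_inv[OF that(1) O(2,5) e(1,2,3) 2])
 qed
 show ?thesis
  unfolding is_kernel_def
 proof (intro conjI m ballI impI)
  have "Cmp C A' E' E e' ?f = Cmp C A' A E f a'" by (rule cancel_inv[OF O(4,2,5) e(1,2,3) m(1)])
  then have "Cmp C A' E' B' ?g ?f = Cmp C A' B B' b (Cmp C A' E B g (Cmp C A' A E f a'))" using gW[OF O(4) m(3)] by simp
  also have "Cmp C A' E B g (Cmp C A' A E f a') = Cmp C A' A B (Cmp C A E B g f) a'"
   using Cmp_assoc[OF O(4,1,2,3) a(2) fg(1,2)] by simp
  finally show "zero_mor C A' B' (Cmp C A' E' B' ?g ?f)"
   using zero_mor_left[OF O(4,3,6) zero_mor_right[OF O(4,1,3) a(2) fg(3)] b(1)] by simp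
 next
  fix W h assume W: "W \<in> Ob C" and h: "h \<in> Mor C W E'" and z: "zero_mor C W B' (Cmp C W E' B' ?g h)"
  let ?h = "Cmp C W E' E e' h"
  have hm: "?h \<in> Mor C W E" using Cmp_Mor[OF W O(5,2) h e(2)] .
  have gm: "Cmp C W E B g ?h \<in> Mor C W B" using Cmp_Mor[OF W O(2,3) hm fg(2)] .
  have "Cmp C W B' B b' (Cmp C W E' B' ?g h) = Cmp C W E B g ?h"
   unfolding gW[OF W h] by (rule cancel_inv[OF W O(3,6) b(1,2,3) gm])
  then have "zero_mor C W B (Cmp C W E B g ?h)" using zero_mor_left[OF W O(6,3) z b(2)] by simp
  then have "\<exists>!l. l \<in> Mor C W A \<and> Cmp C W A E f l = ?h" using k W hm unfolding is_kernel_def by blast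
  then obtain l where l: "l \<in> Mor C W A" "Cmp C W A E f l = ?h" and lu: "!!l'. l' \<in> Mor C W A ==> Cmp C W A E f l' = ?h ==> l' = l" by blast
  have al: "Cmp C W A A' a l \<in> Mor C W A'" using Cmp_Mor[OF W O(1,4) l(1) a(1)] .
  have inj: "x = y" if "x \<in> Mor C W E'" "y \<in> Mor C W E'" "Cmp C W E' E e' x = Cmp C W E' E e' y" for x y
   using cancel_inv[OF W O(5,2) e(2,1,4) that(1)] cancel_inv[OF W O(5,2) e(2,1,4) that(2)] that(3) by metis
  show "\<exists>!l. l \<in> Mor C W A' \<and> Cmp C W A' E' ?f l = h"
  proof (rule ex1I[of _ "Cmp C W A A' a l"])
   have "Cmp C W E' E e' (Cmp C W A' E' ?f (Cmp C W A A' a l)) = ?h"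
    unfolding fW[OF W al] using cancel_inv[OF W O(1,4) a(1,2,3) l(1)] l(2) by simp
   from inj[OF Cmp_Mor[OF W O(4,5) al m(3)] h this]
   show "Cmp C W A A' a l \<in> Mor C W A' \<and> Cmp C W A' E' ?f (Cmp C W A A' a l) = h" using al by simp
  next
   fix l' assume l': "l' \<in> Mor C W A' \<and> Cmp C W A' E' ?f l' = h"
   then have "Cmp C W A E f (Cmp C W A' A a' l') = ?h" using fW[OF W, of l'] by simp
   then have "Cmp C W A' A a' l' = l" using lu Cmp_Mor[OF W O(4,1) _ a(2)] l' by blast
   then show "l' = Cmp C W A A' a l" using cancel_inv[OF W O(4,1) a(2,1,4), of l'] l' by simp
  qed
 qed
qed

lemma cokernel_iso:
 assumes k: "is_cokernel C A E B f g" and O: "A \<in> Ob C" "E \<in> Ob C" "B \<in> Ob C" "A' \<in> Ob C" "E' \<in> Ob C" "B' \<in> Ob C"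
  and a: "a \<in> Mor C A A'" "a' \<in> Mor C A' A" "Cmp C A A' A a' a = Idm C A" "Cmp C A' A A' a a' = Idm C A'"
  and e: "e \<in> Mor C E E'" "e' \<in> Mor C E' E" "Cmp C E E' E e' e = Idm C E" "Cmp C E' E E' e e' = Idm C E'"
  and b: "b \<in> Mor C B B'" "b' \<in> Mor C B' B" "Cmp C B B' B b' b = Idm C B" "Cmp C B' B B' b b' = Idm C B'"
 shows "is_cokernel C A' E' B' (Cmp C A' E E' e (Cmp C A' A E f a')) (Cmp C E' B B' b (Cmp C E' E B g e'))"
  (is "is_cokernel C A' E' B' ?f ?g")
proof -
 have fg: "f \<in> Mor C A E" "g \<in> Mor C E B" "zero_mor C A B (Cmp C A E B g f)" using k by (auto simp: is_cokernel_def)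
 have m: "Cmp C A' A E f a' \<in> Mor C A' E" "Cmp C E' E B g e' \<in> Mor C E' B" "?f \<in> Mor C A' E'" "?g \<in> Mor C E' B'"
  using O fg a e b Cmp_Mor by auto
 have fW: "Cmp C A' E' W h ?f = Cmp C A' A W (Cmp C A E W (Cmp C E E' W h e) f) a'" if "W \<in> Ob C" "h \<in> Mor C E' W" for W h
  using that O fg a e b m Cmp_Mor[OF O(2,5) that(1) e(1) that(2)] Cmp_assoc[of A' E E' W "Cmp C A' A E f a'" e h]
   Cmp_assoc[of A' A E W a' f "Cmp C E E' W h e"] by simp
 have gW: "Cmp C E E' W (Cmp C E' B' W h ?g) e = Cmp C E B W (Cmp C B B' W h b) g" if "W \<in> Ob C" "h \<in> Mor C B' W" for W h
 proof -
  have hb: "Cmp C B B' W h b \<in> Mor C B W" using Cmp_Mor[OF O(3,6) that(1) b(1) that(2)] .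
  have 1: "Cmp C E' B' W h ?g = Cmp C E' E W (Cmp C E B W (Cmp C B B' W h b) g) e'"
   using that O fg b e m hb Cmp_assoc[of E' B B' W "Cmp C E' E B g e'" b h] Cmp_assoc[of E' E B W e' g "Cmp C B B' W h b"] by simp
  have 2: "Cmp C E B W (Cmp C B B' W h b) g \<in> Mor C E W" using Cmp_Mor[OF O(2,3) that(1) fg(2) hb] .
  show ?thesis unfolding 1 by (rule cancel_inv'[OF that(1) O(2,5) e(1,2,3) 2])
 qed
 show ?thesis
  unfolding is_cokernel_def
 proof (intro conjI m ballI impI)
  have "Cmp C A' E' E e' ?f = Cmp C A' A E f a'" by (rule cancel_inv[OF O(4,2,5) e(1,2,3) m(1)])
  moreover have "Cmp C A' E' B' ?g ?f = Cmp C A' B B' b (Cmp C A' E' B (Cmp C E' E B g e') ?f)"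
   by (rule Cmp_assoc[OF O(4,5,3,6) m(3,2) b(1)])
  moreover have "Cmp C A' E' B (Cmp C E' E B g e') ?f = Cmp C A' E B g (Cmp C A' E' E e' ?f)"
   by (rule Cmp_assoc[OF O(4,5,2,3) m(3) e(2) fg(2)])
  ultimately have "Cmp C A' E' B' ?g ?f = Cmp C A' B B' b (Cmp C A' E B g (Cmp C A' A E f a'))" by simp
  also have "Cmp C A' E B g (Cmp C A' A E f a') = Cmp C A' A B (Cmp C A E B g f) a'"
   using Cmp_assoc[OF O(4,1,2,3) a(2) fg(1,2)] by simp
  finally show "zero_mor C A' B' (Cmp C A' E' B' ?g ?f)"
   using zero_mor_left[OF O(4,3,6) zero_mor_right[OF O(4,1,3) a(2) fg(3)] b(1)] by simp
 next
  fix W h assume W: "W \<in> Ob C" and h: "h \<in> Mor C E' W" and z: "zero_mor C A' W (Cmp C A' E' W h ?f)"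
  let ?h = "Cmp C E E' W h e"
  have hm: "?h \<in> Mor C E W" using Cmp_Mor[OF O(2,5) W e(1) h] .
  have fm: "Cmp C A E W ?h f \<in> Mor C A W" using Cmp_Mor[OF O(1,2) W fg(1) hm] .
  have "Cmp C A A' W (Cmp C A' E' W h ?f) a = Cmp C A E W ?h f"
   unfolding fW[OF W h] by (rule cancel_inv'[OF W O(1,4) a(1,2,3) fm])
  then have "zero_mor C A W (Cmp C A E W ?h f)" using zero_mor_right[OF O(1,4) W a(1) z] by simp
  then have "\<exists>!l. l \<in> Mor C B W \<and> Cmp C E B W l g = ?h" using k W hm unfolding is_cokernel_def by blast
  then obtain l where l: "l \<in> Mor C B W" "Cmp C E B W l g = ?h" and lu: "!!l'. l' \<in> Mor C B W ==> Cmp C E B W l' g = ?h ==> l' = l" by blast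
  have bl: "Cmp C B' B W l b' \<in> Mor C B' W" using Cmp_Mor[OF O(6,3) W b(2) l(1)] .
  have inj: "x = y" if "x \<in> Mor C E' W" "y \<in> Mor C E' W" "Cmp C E E' W x e = Cmp C E E' W y e" for x y
   using cancel_inv'[OF W O(5,2) e(2,1,4) that(1)] cancel_inv'[OF W O(5,2) e(2,1,4) that(2)] that(3) by metis
  show "\<exists>!l. l \<in> Mor C B' W \<and> Cmp C E' B' W l ?g = h"
  proof (rule ex1I[of _ "Cmp C B' B W l b'"])
   have "Cmp C E E' W (Cmp C E' B' W (Cmp C B' B W l b') ?g) e = ?h"
    unfolding gW[OF W bl] using cancel_inv'[OF W O(3,6) b(1,2,3) l(1)] l(2) by simp
   from inj[OF Cmp_Mor[OF O(5,6) W m(4) bl] h this]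
   show "Cmp C B' B W l b' \<in> Mor C B' W \<and> Cmp C E' B' W (Cmp C B' B W l b') ?g = h" using bl by simp
  next
   fix l' assume l': "l' \<in> Mor C B' W \<and> Cmp C E' B' W l' ?g = h"
   then have "Cmp C E B W (Cmp C B B' W l' b) g = ?h" using gW[OF W, of l'] by simp
   then have "Cmp C B B' W l' b = l" using lu Cmp_Mor[OF O(3,6) W b(1)] l' by blast
   then show "l' = Cmp C B' B W l b'" using cancel_inv'[OF W O(6,3) b(2,1,4), of l'] l' by simp
  qed
 qed
qed

lemma short_exact_iso:
 assumes s: "short_exact C A E B f g" and O: "A' \<in> Ob C" "E' \<in> Ob C" "B' \<in> Ob C"
  and a: "a \<in> Mor C A A'" "a' \<in> Mor C A' A" "Cmp C A A' A a' a = Idm C A" "Cmp C A' A A' a a' = Idm C A'"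
  and e: "e \<in> Mor C E E'" "e' \<in> Mor C E' E" "Cmp C E E' E e' e = Idm C E" "Cmp C E' E E' e e' = Idm C E'"
  and b: "b \<in> Mor C B B'" "b' \<in> Mor C B' B" "Cmp C B B' B b' b = Idm C B" "Cmp C B' B B' b b' = Idm C B'"
 shows "short_exact C A' E' B' (Cmp C A' E E' e (Cmp C A' A E f a')) (Cmp C E' B B' b (Cmp C E' E B g e'))"
 using kernel_iso[OF _ _ _ _ O a e b] cokernel_iso[OF _ _ _ _ O a e b] s O unfolding short_exact_def by blast

text \<open>Both end terms are moved along the isomorphism while the middle term stays; the
  splitting \<open>t\<close> of the resulting sequence, composed with \<open>a\<close>, splits the
  given one.\<close>

lemma Ext1_zero_iso:
 assumes E: "Ext1_zero C T T" and iso: "isomorphic C T F" and O: "T \<in> Ob C" "F \<in> Ob C"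
 shows "Ext1_zero C F F"
 unfolding Ext1_zero_def
proof (intro allI impI)
 fix A f g assume s: "short_exact C F A F f g"
 then have A: "A \<in> Ob C" and g: "g \<in> Mor C A F" by (auto simp: short_exact_def is_cokernel_def)
 from iso obtain a' a where a: "a' \<in> Mor C T F" "a \<in> Mor C F T" "Cmp C T F T a a' = Idm C T" "Cmp C F T F a' a = Idm C F" by (rule isoE)
 note idA = Idm_Mor[OF A] Idm_Mor[OF A] Idm_left[OF A A Idm_Mor[OF A]] Idm_left[OF A A Idm_Mor[OF A]]
 have "short_exact C T A T (Cmp C T A A (Idm C A) (Cmp C T F A f a')) (Cmp C A F T a (Cmp C A A F g (Idm C A)))"
  by (rule short_exact_iso[OF s O(1) A O(1) a(2,1,4,3) idA a(2,1,4,3)])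
 then obtain t where t: "t \<in> Mor C T A" "Cmp C T A T (Cmp C A F T a (Cmp C A A F g (Idm C A))) t = Idm C T"
  using E unfolding Ext1_zero_def by blast
 have t2: "Cmp C T A T (Cmp C A F T a g) t = Idm C T" using t(2) Idm_right[OF A O(2) g] by simp
 then have "Cmp C T F T a (Cmp C T A F g t) = Idm C T" using Cmp_assoc[OF O(1) A O(2,1) t(1) g a(2)] by simp
 then have gt: "Cmp C T A F g t = a'"
  using cancel_inv[OF O(1) O(2,1) a(2,1,4) Cmp_Mor[OF O(1) A O(2) t(1) g]] Idm_right[OF O a(1)] by simp
 have "Cmp C F A F g (Cmp C F T A t a) = Cmp C F T F (Cmp C T A F g t) a"
  using Cmp_assoc[OF O(2,1) A O(2) a(2) t(1) g] by simp
 then have "Cmp C F A F g (Cmp C F T A t a) = Idm C F" using gt a by simp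
 then show "\<exists>s\<in>Mor C F A. Cmp C F A F g s = Idm C F" using Cmp_Mor[OF O(2,1) A a(2) t(1)] by blast
qed

end

section \<open>Line bundles and their sums\<close>

context weight_type
begin

lemma FM_obj: "obj p q (FM n z :: ('k::field) sheaf)"
proof -
 interpret free_mod p q n z "TYPE('k)" by unfold_locales
 show ?thesis by (rule F.obj_axioms)
qed

lemma FM_Ob: "FM n z \<in> Ob (coh p q)"
 using FM_obj Ob_iff by blast

lemma FM_zero_iff: "zero_object (coh p q) (FM n z :: ('k::field) sheaf) \<longleftrightarrow> n = 0"
proof -
 interpret free_mod p q n z "TYPE('k)" by unfold_locales
 have "carrier F \<subseteq> F.tors \<longleftrightarrow> n = 0"
 proof
  assume "carrier F \<subseteq> F.tors"
  then have s: "fs n \<subseteq> {\<lambda>_. 0 :: 'k poly poly}" by (simp add: F_tors)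
  show "n = 0"
  proof (rule ccontr)
   assume "n \<noteq> 0"
   then have "(ee 0 :: nat => 'k poly poly) \<in> fs n" by simp
   then have "(ee 0 :: nat => 'k poly poly) = (\<lambda>_. 0)" using s by blast
   from fun_cong[OF this, of 0] show False by (simp add: ee_def)
  qed
 next
  assume "n = 0"
  then have "v = (\<lambda>_. 0)" if "v \<in> fs n" for v :: "nat => 'k poly poly" using that by (auto simp: fs_def)
  then show "carrier F \<subseteq> F.tors" unfolding F_tors by auto
 qed
 then show ?thesis using F.zero_object_iff by simp
qed

lemma cohX_category_zero: "category_zero (cohX p q :: (('k::field) sheaf, _) cat) (FM 0 z)"
 by (intro category_zero.intro coh_category category_zero_axioms.intro) (simp add: FM_zero_iff)

lemma FM_cong: "(!!i. i < n ==> D (z i) = D (w i)) ==> FM n z = FM n w"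
proof -
 assume e: "!!i. i < n ==> D (z i) = D (w i)"
 have "D (- z i) = D (- w i)" if "i < n" for i
  using e[OF that] L_inv by metis
 then show ?thesis by (auto simp: FM_def)
qed

end

locale free_free_to = AB: free_free p q n z m w "TYPE('k::field)" + E: obj p q E
 for p q :: nat and n :: nat and z :: "nat => int \<times> int" and m :: nat and w :: "nat => int \<times> int"
  and E :: "('k::field) sheaf"
begin

sublocale BE: free_to p q m w E ..
sublocale AE: free_to p q n z E ..
sublocale ABE: three p q "AB.A.F :: 'k sheaf" "AB.B.F :: 'k sheaf" E
 by unfold_locales

text \<open>Composition of graphs is multiplication of matrices.\<close>

lemma gph_O:
 assumes u: "!!i. i < n ==> u i \<in> AB.B.F.gr (z i)" and t: "!!i. i < m ==> t i \<in> E.gr (w i)"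
 shows "AB.AB.gph u O BE.gph t = AE.gph (\<lambda>i. E.lc t m (u i))"
proof -
 have tc: "t i \<in> carrier E" if "i < m" for i by (rule E.gr_closed(1)[OF t[OF that]])
 have uf: "u i \<in> fs m" if "i < n" for i by (rule AB.B.gr_fs[OF u[OF that]])
 have lin: "E.lc t m (AB.B.F.lc u k v) = E.lc (\<lambda>i. E.lc t m (u i)) k v" if "k \<le> n" for k v
  using that
 proof (induction k)
  case 0
  show ?case using E.lc_zero[of m t "\<lambda>_. 0", OF tc] by simp
 next
  case (Suc k)
  have "E.lc t m (AB.B.F.lc u (Suc k) v) = E.lc t m (\<lambda>j. AB.B.F.lc u k v j + v k * u k j)" by simp
  also have "\<dots> = E.lc t m (AB.B.F.lc u k v) \<oplus>\<^bsub>E\<^esub> v k \<odot>\<^bsub>E\<^esub> E.lc t m (u k)"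
   using E.lc_add[of m t "AB.B.F.lc u k v" "\<lambda>j. v k * u k j", OF tc] E.lc_smult[of m t "v k" "u k", OF tc] by simp
  finally show ?case using Suc by simp
 qed
 have lf: "AB.B.F.lc u n v \<in> fs m" for v
  using AB.B.F.lc_closed[of n u v] uf by simp
 show ?thesis
 proof (intro equalityI subsetI)
  fix r assume "r \<in> AB.AB.gph u O BE.gph t"
  then obtain v a b where r: "r = (v, b)" "(v, a) \<in> AB.AB.gph u" "(a, b) \<in> BE.gph t" by blast
  then show "r \<in> AE.gph (\<lambda>i. E.lc t m (u i))" using lin[of n v] by (simp add: AB.AB.gph_iff BE.gph_iff AE.gph_iff)
 next
  fix r assume "r \<in> AE.gph (\<lambda>i. E.lc t m (u i))"
  then obtain v where v: "v \<in> fs n" "r = (v, E.lc (\<lambda>i. E.lc t m (u i)) n v)" by (auto simp: AE.gph_def)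
  have "(v, AB.B.F.lc u n v) \<in> AB.AB.gph u" using v by (simp add: AB.AB.gph_iff)
  moreover have "(AB.B.F.lc u n v, E.lc t m (AB.B.F.lc u n v)) \<in> BE.gph t" using lf by (simp add: BE.gph_iff)
  ultimately show "r \<in> AB.AB.gph u O BE.gph t" unfolding v(2) using lin[of n v] by auto
 qed
qed

lemma Cmp_gph:
 assumes u: "!!i. i < n ==> u i \<in> AB.B.F.gr (z i)" and t: "!!i. i < m ==> t i \<in> E.gr (w i)"
 shows "Cmp (coh p q) AB.A.F AB.B.F E (BE.FE.cls (BE.gph t)) (AB.AB.FE.cls (AB.AB.gph u)) = AE.FE.cls (AE.gph (\<lambda>i. E.lc t m (u i)))"
 using ABE.Cmp_cls[OF AB.AB.gph_rel[OF u] BE.gph_rel[OF t]] gph_O[OF u t] by simp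

lemma lc_gr: 
 assumes u: "!!i. i < n ==> u i \<in> AB.B.F.gr (z i)" and t: "!!i. i < m ==> t i \<in> E.gr (w i)" and i: "i < n"
 shows "E.lc t m (u i) \<in> E.gr (z i)"
 by (rule E.lc_gr[OF t]) (use u[OF i] in \<open>auto simp: AB.B.F_gr\<close>)

end

context free_free
begin

lemma Mor_gph: "f \<in> Mor (coh p q) A.F B.F ==> \<exists>u. (\<forall>i<n. u i \<in> B.F.gr (z i)) \<and> f = AB.FE.cls (AB.gph u)"
proof -
 assume "f \<in> Mor (coh p q) A.F B.F"
 then obtain R where R: "AB.FE.rel R" "f = AB.FE.cls R" by (auto simp: AB.FE.Mor_iff)
 from rel_to_free[OF R(1)] obtain u where u: "!!i. i < n ==> u i \<in> B.F.gr (z i)" "AB.FE.eqv R (AB.gph u)" by blast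
 then show ?thesis using R AB.FE.cls_eq_iff[OF R(1) AB.gph_rel[OF u(1)]] by blast
qed

lemma cls_gph_eq_iff:
 assumes u: "!!i. i < n ==> u i \<in> B.F.gr (z i)" and t: "!!i. i < n ==> t i \<in> B.F.gr (z i)"
 shows "AB.FE.cls (AB.gph u) = AB.FE.cls (AB.gph t) \<longleftrightarrow> (\<forall>i<n. u i = t i)"
proof -
 have "u i \<ominus>\<^bsub>B.F\<^esub> t i \<in> B.F.tors \<longleftrightarrow> u i = t i" if "i < n" for i
  using B.F.diff_zero_iff[of "u i" "t i"] B.gr_fs[OF u[OF that]] B.gr_fs[OF t[OF that]] by (simp add: B.F_tors)
 then show ?thesis
  using AB.FE.cls_eq_iff[OF AB.gph_rel[OF u] AB.gph_rel[OF t]] AB.gph_eqv_iff[OF u t] by simp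
qed

lemma zero_gph_iff:
 assumes u: "!!i. i < n ==> u i \<in> B.F.gr (z i)"
 shows "zero_mor (coh p q) A.F B.F (AB.FE.cls (AB.gph u)) \<longleftrightarrow> (\<forall>i<n. u i = (\<lambda>_. 0))"
proof
 have uc: "u i \<in> carrier B.F" if "i < n" for i using B.F.gr_closed(1)[OF u[OF that]] .
 assume "zero_mor (coh p q) A.F B.F (AB.FE.cls (AB.gph u))"
 then have r: "Range (AB.gph u) \<subseteq> {\<lambda>_. 0}" using AB.FE.zero_mor_iff[OF AB.gph_rel[OF u]] by (simp add: B.F_tors)
 show "\<forall>i<n. u i = (\<lambda>_. 0)"
 proof (intro allI impI)
  fix i assume "i < n"
  from AB.gph_ee[of u i 1, OF uc this] r show "u i = (\<lambda>_. 0)" by (simp add: Range_iff subset_iff) blast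
 qed
next
 assume z: "\<forall>i<n. u i = (\<lambda>_. 0)"
 have "B.F.lc u n v = (\<lambda>_. 0)" for v using z by (simp add: B.F_lc)
 then have "Range (AB.gph u) \<subseteq> B.F.tors" by (auto simp: AB.gph_def B.F_tors)
 then show "zero_mor (coh p q) A.F B.F (AB.FE.cls (AB.gph u))" using AB.FE.zero_mor_iff[OF AB.gph_rel[OF u]] by simp
qed

end

context free_mod
begin

sublocale FF: free_free p q n z n z dummy ..

lemma gph_ee_Id: "FF.AB.gph ee = Id_on (carrier F)"
 using lc_ee by (auto simp: FF.AB.gph_def Id_on_def)

lemma Idm_gph: "Idm (coh p q) F = F.MM.cls (FF.AB.gph ee)"
 unfolding gph_ee_Id by (rule F.Idm_eq)

end

context weight_type
begin

text \<open>A diagonal entry of the product of two inverse matrices is 1, so some entry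
  \<open>u i j\<close> has a non-zero constant term. A homogeneous polynomial with a constant term
  has degree 0, which is the equality of degrees.\<close>

lemma iso_free_degrees:
 assumes iso: "isomorphic (coh p q) (FM n z :: ('k::field) sheaf) (FM m w)" and i: "i < n"
 shows "\<exists>j<m. D (z i) = D (w j)"
proof -
 interpret A: free_mod p q n z "TYPE('k)" by unfold_locales
 interpret B: free_mod p q m w "TYPE('k)" by unfold_locales
 interpret free_free_to p q n z m w A.F by unfold_locales (rule A.F.gm A.F.fg)+
 interpret BA: free_free p q m w n z "TYPE('k)" by unfold_locales
 interpret C: category "cohX p q :: ('k sheaf, _) cat" by (rule coh_category)
 from iso obtain f g where fg: "f \<in> Mor (coh p q) A.F B.F" "g \<in> Mor (coh p q) B.F A.F"
  "Cmp (coh p q) A.F B.F A.F g f = Idm (coh p q) A.F" by (rule C.isoE)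
 from AB.Mor_gph[OF fg(1)] obtain u where u: "!!i. i < n ==> u i \<in> B.F.gr (z i)" "f = AB.AB.FE.cls (AB.AB.gph u)" by blast
 from BA.Mor_gph[OF fg(2)] obtain t where t: "!!i. i < m ==> t i \<in> A.F.gr (w i)" "g = BE.FE.cls (BE.gph t)" by blast
 have e: "A.F.MM.cls (A.FF.AB.gph (\<lambda>i. A.F.lc t m (u i))) = A.F.MM.cls (A.FF.AB.gph ee)"
  using fg(3) Cmp_gph[OF u(1) t(1)] A.Idm_gph by (simp add: u(2) t(2))
 have "A.F.lc t m (u i) = ee i"
  using iffD1[OF A.FF.cls_gph_eq_iff[OF lc_gr[OF u(1) t(1)] A.ee_gr] e] i by simp
 then have "A.F.lc t m (u i) i = 1" by (simp add: ee_def)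
 then have "(\<Sum>j<m. u i j * t j i) = 1" by (simp add: A.F_lc)
 then have "cf (\<Sum>j<m. u i j * t j i) 0 0 = 1" by (simp add: cf_one)
 then have "(\<Sum>j<m. cf (u i j) 0 0 * cf (t j i) 0 0) = 1" by (simp add: cf_mult)
 then obtain j where j: "j < m" "cf (u i j) 0 0 \<noteq> 0"
  by (metis (no_types, lifting) lessThan_iff mult_zero_left sum.neutral zero_neq_one)
 have "u i j \<in> Sg (z i - w j)" using u(1)[OF i] j by (simp add: B.F_gr)
 from SgD[OF this j(2)] have "D (z i - w j) = D 0" by (simp add: zero_prod_def)
 then have "D (z i) = D (w j)" by (simp add: D_diff_eq)
 then show ?thesis using j by blast
qed

text \<open>An endomorphism is multiplication by a polynomial, and the idempotents of a domain are 0
  and 1.\<close>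

lemma line_indecomposable: "indecomposable (coh p q) (FM 1 z :: ('k::field) sheaf)"
proof -
 interpret A: free_mod p q 1 z "TYPE('k)" by unfold_locales
 interpret free_free_to p q 1 z 1 z A.F by unfold_locales
 interpret C: category_zero "cohX p q :: ('k sheaf, _) cat" "FM 0 z" by (rule cohX_category_zero)
 show ?thesis
 proof (rule C.indecomposableI)
  show "A.F \<in> Ob (coh p q)" by (rule FM_Ob)
  show "\<not> zero_object (coh p q) A.F" by (simp add: FM_zero_iff)
  fix e assume e: "e \<in> Mor (coh p q) A.F A.F" "Cmp (coh p q) A.F A.F A.F e e = e"
  from A.FF.Mor_gph[OF e(1)] obtain u where u0: "\<forall>i<1. u i \<in> A.F.gr (z i)" and eu: "e = A.F.MM.cls (A.FF.AB.gph u)" by blast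
  have u: "!!i. i < 1 ==> u i \<in> A.F.gr (z i)" using u0 by blast
  have "A.F.MM.cls (A.FF.AB.gph (\<lambda>i. A.F.lc u 1 (u i))) = A.F.MM.cls (A.FF.AB.gph u)"
   using e(2) Cmp_gph[OF u u] by (simp add: eu)
  from iffD1[OF A.FF.cls_gph_eq_iff[OF lc_gr[OF u u] u] this]
  have "A.F.lc u 1 (u 0) = u 0" by simp
  moreover have "A.F.lc u 1 (u 0) 0 = u 0 0 * u 0 0" unfolding A.F_lc by simp
  ultimately have sq: "u 0 0 * u 0 0 = u 0 0" by simp
  then have "u 0 0 = 0 \<or> u 0 0 = 1" by (metis mult_cancel_left2)
  moreover have uf: "u 0 i = 0" if "i \<ge> 1" for i using A.gr_fs[OF u[of 0]] that by (simp add: fs_def)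
  ultimately have "u 0 = (\<lambda>_. 0) \<or> u 0 = ee 0"
   by (auto simp: ee_def fun_eq_iff) (metis One_nat_def Suc_leI neq0_conv)+
  then show "e = Idm (coh p q) A.F \<or> zero_mor (coh p q) A.F A.F e"
  proof
   assume "u 0 = ee 0"
   then have "e = A.F.MM.cls (A.FF.AB.gph ee)"
    unfolding eu using A.FF.cls_gph_eq_iff[OF u A.ee_gr] by simp
   then show ?thesis unfolding A.Idm_gph by blast
  next
   assume "u 0 = (\<lambda>_. 0)"
   then have "\<forall>i<1. u i = (\<lambda>_. 0)" by simp
   then have "zero_mor (coh p q) A.F A.F e" unfolding eu using A.FF.zero_gph_iff[OF u] by blast
   then show ?thesis by blast
  qed
 qed
qed

end

declare One_nat_def [simp del]

lemma sum_lessThan_one: "(\<Sum>j<1::nat. f j) = f 0"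
 by (simp add: One_nat_def)

text \<open>The universal property of \<open>FM (Suc n) z\<close>: a pair of relations out of \<open>FM n z\<close> and \<open>FM 1 (z n)\<close>
 is added along the splitting of a vector into its first \<open>n\<close> entries and its last one.\<close>

definition hd_part :: "nat => (nat => 'k::field poly poly) => nat => 'k poly poly" where
 "hd_part n v = (\<lambda>i. if i < n then v i else 0)"

definition tl_part :: "nat => (nat => 'k::field poly poly) => nat => 'k poly poly" where
 "tl_part n v = (\<lambda>i. if i = 0 then v n else 0)"

lemma part_simps [simp]:
 "hd_part n (\<lambda>_. 0) = (\<lambda>_. 0)" "tl_part n (\<lambda>_. 0) = (\<lambda>_. 0)"
 "hd_part n (\<lambda>i. v i + w i) = (\<lambda>i. hd_part n v i + hd_part n w i)"
 "tl_part n (\<lambda>i. v i + w i) = (\<lambda>i. tl_part n v i + tl_part n w i)"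
 "hd_part n (\<lambda>i. s * v i) = (\<lambda>i. s * hd_part n v i)"
 "tl_part n (\<lambda>i. s * v i) = (\<lambda>i. s * tl_part n v i)"
 "hd_part n v \<in> fs n" "tl_part n v \<in> fs 1"
 by (auto simp: hd_part_def tl_part_def fs_def)

locale split_free = Y: obj p q Y for p q and Y :: "('k::field) sheaf" +
 fixes n :: nat and z :: "nat => int \<times> int"
begin

sublocale H: free_to p q n z Y by unfold_locales
sublocale T: free_to p q 1 "\<lambda>_. z n" Y by unfold_locales
sublocale S: free_to p q "Suc n" z Y by unfold_locales

definition join :: "((nat => 'k poly poly) \<times> (nat => 'k poly poly)) set =>
  ((nat => 'k poly poly) \<times> (nat => 'k poly poly)) set => ((nat => 'k poly poly) \<times> (nat => 'k poly poly)) set" where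
 "join R R' = {(v, y \<oplus>\<^bsub>Y\<^esub> y') | v y y'. v \<in> fs (Suc n) \<and> (hd_part n v, y) \<in> R \<and> (tl_part n v, y') \<in> R'}"

lemma join_rel:
 assumes R: "H.FE.rel R" and R': "T.FE.rel R'" shows "S.FE.rel (join R R')"
 unfolding S.FE.rel_def S.FE.rsub_def
proof (intro conjI allI impI subsetI)
 note s = H.FE.rel_rsub[OF R] T.FE.rel_rsub[OF R']
 have c: "(a, y) \<in> R ==> y \<in> carrier Y" "(a, y) \<in> R' ==> y \<in> carrier Y" for a y
  using H.FE.rsubD(2)[OF s(1)] T.FE.rsubD(2)[OF s(2)] by auto
 {
  fix r assume "r \<in> join R R'"
  then show "r \<in> carrier (Y.FM (Suc n) z) \<times> carrier Y" using c by (auto simp: join_def)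
 }
 show "(\<zero>\<^bsub>Y.FM (Suc n) z\<^esub>, \<zero>\<^bsub>Y\<^esub>) \<in> join R R'"
  using H.FE.rsubD(3)[OF s(1)] T.FE.rsubD(3)[OF s(2)]
  by (auto simp: join_def intro!: exI[of _ "\<zero>\<^bsub>Y\<^esub>"])
 {
  fix v a w b assume "(v, a) \<in> join R R'" "(w, b) \<in> join R R'"
  then obtain y y' t t' where
   v: "v \<in> fs (Suc n)" "(hd_part n v, y) \<in> R" "(tl_part n v, y') \<in> R'" "a = y \<oplus>\<^bsub>Y\<^esub> y'" and
   w: "w \<in> fs (Suc n)" "(hd_part n w, t) \<in> R" "(tl_part n w, t') \<in> R'" "b = t \<oplus>\<^bsub>Y\<^esub> t'"
   by (auto simp: join_def)
  have "(hd_part n (\<lambda>i. v i + w i), y \<oplus>\<^bsub>Y\<^esub> t) \<in> R" "(tl_part n (\<lambda>i. v i + w i), y' \<oplus>\<^bsub>Y\<^esub> t') \<in> R'"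
   using H.FE.rsubD(4)[OF s(1) v(2) w(2)] T.FE.rsubD(4)[OF s(2) v(3) w(3)] by simp_all
  moreover have "a \<oplus>\<^bsub>Y\<^esub> b = (y \<oplus>\<^bsub>Y\<^esub> t) \<oplus>\<^bsub>Y\<^esub> (y' \<oplus>\<^bsub>Y\<^esub> t')"
   using c(1)[OF v(2)] c(2)[OF v(3)] c(1)[OF w(2)] c(2)[OF w(3)] by (simp add: v(4) w(4) Y.M.a_ac)
  ultimately show "(v \<oplus>\<^bsub>Y.FM (Suc n) z\<^esub> w, a \<oplus>\<^bsub>Y\<^esub> b) \<in> join R R'"
   using v(1) w(1) unfolding join_def by (auto intro!: exI)
 }
 {
  fix x v a assume "(v, a) \<in> join R R'"
  then obtain y y' where
   v: "v \<in> fs (Suc n)" "(hd_part n v, y) \<in> R" "(tl_part n v, y') \<in> R'" "a = y \<oplus>\<^bsub>Y\<^esub> y'" by (auto simp: join_def)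
  have "(hd_part n (\<lambda>i. x * v i), x \<odot>\<^bsub>Y\<^esub> y) \<in> R" "(tl_part n (\<lambda>i. x * v i), x \<odot>\<^bsub>Y\<^esub> y') \<in> R'"
   using H.FE.rsubD(5)[OF s(1) v(2), of x] T.FE.rsubD(5)[OF s(2) v(3), of x] by simp_all
  moreover have "x \<odot>\<^bsub>Y\<^esub> a = x \<odot>\<^bsub>Y\<^esub> y \<oplus>\<^bsub>Y\<^esub> x \<odot>\<^bsub>Y\<^esub> y'"
   using c(1)[OF v(2)] c(2)[OF v(3)] by (simp add: v(4) Y.sm_radd)
  ultimately show "(x \<odot>\<^bsub>Y.FM (Suc n) z\<^esub> v, x \<odot>\<^bsub>Y\<^esub> a) \<in> join R R'"
   using v(1) unfolding join_def by (auto intro!: exI)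
 }
 {
  fix v a u assume "(v, a) \<in> join R R'"
  then obtain y y' where
   v: "v \<in> fs (Suc n)" "(hd_part n v, y) \<in> R" "(tl_part n v, y') \<in> R'" "a = y \<oplus>\<^bsub>Y\<^esub> y'" by (auto simp: join_def)
  let ?v = "S.FR.F.comp (Y.D u) v"
  have e: "?v = (\<lambda>i. Y.pt (Y.D (u - z i)) (v i))" by (rule S.FR.F_comp[OF v(1)])
  have "hd_part n ?v = H.FR.F.comp (Y.D u) (hd_part n v)" "tl_part n ?v = T.FR.F.comp (Y.D u) (tl_part n v)"
   unfolding e H.FR.F_comp[OF part_simps(7)] T.FR.F_comp[OF part_simps(8)]
   by (auto simp: hd_part_def tl_part_def Y.pt_0)
  then have "(hd_part n ?v, Y.comp (Y.D u) y) \<in> R" "(tl_part n ?v, Y.comp (Y.D u) y') \<in> R'"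
   using H.FE.rsubD(6)[OF s(1) v(2), of "Y.D u"] T.FE.rsubD(6)[OF s(2) v(3), of "Y.D u"] by simp_all
  moreover have "Y.comp (Y.D u) a = Y.comp (Y.D u) y \<oplus>\<^bsub>Y\<^esub> Y.comp (Y.D u) y'"
   using c(1)[OF v(2)] c(2)[OF v(3)] by (simp add: v(4) Y.comp_add)
  moreover have "?v \<in> fs (Suc n)" using S.FR.F.comp_closed[of v "Y.D u"] v(1) by simp
  ultimately show "(?v, Y.comp (Y.D u) a) \<in> join R R'"
   unfolding join_def by blast
 }
 {
  fix v assume "v \<in> carrier (Y.FM (Suc n) z :: 'k sheaf)"
  then have v: "v \<in> fs (Suc n)" by simp
  show "v \<in> S.FR.F.sat (Domain (join R R'))"
  proof (rule S.FR.F.satI)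
   show "v \<in> carrier S.FR.F" using v by simp
   fix x :: "'k poly poly" assume x: "x \<in> VV"
   have hc: "hd_part n v \<in> carrier H.FR.F" "tl_part n v \<in> carrier T.FR.F" by simp_all
   from H.FE.rel_dom[OF R hc(1) x] T.FE.rel_dom[OF R' hc(2) x] obtain k y l y' where
    "(x ^ k \<odot>\<^bsub>H.FR.F\<^esub> hd_part n v, y) \<in> R" "(x ^ l \<odot>\<^bsub>T.FR.F\<^esub> tl_part n v, y') \<in> R'" by blast
   from H.FE.rsub_pow_mono[OF s(1) hc(1) this(1), of l] T.FE.rsub_pow_mono[OF s(2) hc(2) this(2), of k]
   have "(hd_part n (\<lambda>i. x ^ (l + k) * v i), x ^ l \<odot>\<^bsub>Y\<^esub> y) \<in> R" "(tl_part n (\<lambda>i. x ^ (l + k) * v i), x ^ k \<odot>\<^bsub>Y\<^esub> y') \<in> R'"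
    by (simp_all add: add.commute)
   then have "(\<lambda>i. x ^ (l + k) * v i) \<in> Domain (join R R')"
    using fs_closed(3)[OF v, of "x ^ (l + k)"] unfolding join_def by blast
   then show "\<exists>k. x ^ k \<odot>\<^bsub>S.FR.F\<^esub> v \<in> Domain (join R R')" by auto
  qed
 }
 {
  fix a assume "(\<zero>\<^bsub>Y.FM (Suc n) z\<^esub>, a) \<in> join R R'"
  then obtain y y' where v: "((\<lambda>_. 0), y) \<in> R" "((\<lambda>_. 0), y') \<in> R'" "a = y \<oplus>\<^bsub>Y\<^esub> y'" by (auto simp: join_def)
  have "y \<in> Y.tors" "y' \<in> Y.tors" using v R R' by (auto simp: H.FE.rel_def T.FE.rel_def)
  then show "a \<in> Y.tors" unfolding v(3) by (rule Y.torsD(3))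
 }
qed

end

context weight_type
begin

text \<open>The injections are the inclusion of the first \<open>n\<close> coordinates and the map
  to coordinate \<open>n\<close>. \<open>join\<close> supplies the mediating morphism and
  \<open>eqv_free\<close> its uniqueness.\<close>

lemma coprod_FM_Suc:
 "direct_sum (cohX p q) {..<2::nat} (\<lambda>i. if i = 0 then FM n z else FM 1 (\<lambda>_. z n)) (FM (Suc n) z :: ('k::field) sheaf)"
proof -
 interpret C: category "cohX p q :: ('k sheaf, _) cat" by (rule coh_category)
 interpret HS: free_free p q n z "Suc n" z "TYPE('k)" by unfold_locales
 interpret TS: free_free p q 1 "\<lambda>_. z n" "Suc n" z "TYPE('k)" by unfold_locales
 let ?U = "\<lambda>i::nat. if i = 0 then FM n z else FM 1 (\<lambda>_. z n) :: 'k sheaf"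
 let ?a = "HS.AB.FE.cls (HS.AB.gph ee)" and ?b = "TS.AB.FE.cls (TS.AB.gph (\<lambda>_. ee n))"
 have two: "{..<2::nat} = {0, 1}" by auto
 have u: "ee i \<in> HS.B.F.gr (z i)" if "i < n" for i using HS.B.ee_gr[of i] that by simp
 have t: "ee n \<in> HS.B.F.gr (z n)" using HS.B.ee_gr[of n] by simp
 have hd: "(v, w) \<in> HS.AB.gph ee \<longleftrightarrow> v \<in> fs n \<and> w = v" for v w :: "nat => 'k poly poly"
  using HS.A.lc_ee[of v] by (auto simp: HS.AB.gph_iff HS.A.F_lc HS.B.F_lc)
 have tl: "(v, w) \<in> TS.AB.gph (\<lambda>_. ee n) \<longleftrightarrow> v \<in> fs 1 \<and> w = (\<lambda>i. v 0 * ee n i)" for v w :: "nat => 'k poly poly"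
  by (auto simp: TS.AB.gph_iff HS.B.F_lc sum_lessThan_one)
 have rel: "HS.AB.FE.rel (HS.AB.gph ee)" "TS.AB.FE.rel (TS.AB.gph (\<lambda>_. ee n))"
  using HS.AB.gph_rel[OF u] TS.AB.gph_rel[of "\<lambda>_. ee n"] t by auto
 have m: "?a \<in> Mor (coh p q) HS.A.F HS.B.F" "?b \<in> Mor (coh p q) TS.A.F HS.B.F"
  using rel HS.AB.FE.Mor_iff TS.AB.FE.Mor_iff by blast+
 have "C.coprod {..<2::nat} ?U HS.B.F (\<lambda>i. if i = 0 then ?a else ?b)"
  unfolding C.coprod_def
 proof (intro conjI allI impI ballI)
  show "C.cocone {..<2::nat} ?U HS.B.F (\<lambda>i. if i = 0 then ?a else ?b)"
   using m FM_Ob by (auto simp: C.cocone_def two)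
  fix Y :: "'k sheaf" and \<phi>
  assume co: "C.cocone {..<2::nat} ?U Y \<phi>"
  then have "Y \<in> Ob (coh p q)" by (simp add: C.cocone_def)
  then interpret Y: obj p q Y by (simp add: Ob_iff)
  interpret sp: split_free p q Y n z by unfold_locales
  interpret HY: three p q HS.A.F HS.B.F Y by unfold_locales
  interpret TY: three p q TS.A.F HS.B.F Y by unfold_locales
  have "\<phi> 0 \<in> Mor (coh p q) HS.A.F Y" "\<phi> 1 \<in> Mor (coh p q) TS.A.F Y" using co by (auto simp: C.cocone_def two)
  then obtain R R' where R: "sp.H.FE.rel R" "\<phi> 0 = sp.H.FE.cls R" and R': "sp.T.FE.rel R'" "\<phi> 1 = sp.T.FE.cls R'"
   unfolding sp.H.FE.Mor_iff sp.T.FE.Mor_iff by blast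
  note s = sp.H.FE.rel_rsub[OF R(1)] sp.T.FE.rel_rsub[OF R'(1)]
  note J = sp.join_rel[OF R(1) R'(1)]
  have zR: "y \<in> Y.tors" if "((\<lambda>_. 0), y) \<in> R" for y using that R(1) by (simp add: sp.H.FE.rel_def)
  have zR': "y \<in> Y.tors" if "((\<lambda>_. 0), y) \<in> R'" for y using that R'(1) by (simp add: sp.T.FE.rel_def)
  have "sp.H.FE.eqv (HS.AB.gph ee O sp.join R R') R"
   unfolding sp.H.FE.eqv_def
  proof (intro allI impI)
   fix v y y2 assume "(v, y) \<in> HS.AB.gph ee O sp.join R R'" and y2: "(v, y2) \<in> R"
   then obtain a b where v: "v \<in> fs n" and ab: "(hd_part n v, a) \<in> R" "(tl_part n v, b) \<in> R'" "y = a \<oplus>\<^bsub>Y\<^esub> b"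
    by (auto simp: hd sp.join_def)
   have "hd_part n v = v" "tl_part n v = (\<lambda>_. 0)" using v by (auto simp: hd_part_def tl_part_def fs_def)
   then have ab': "(v, a) \<in> R" "b \<in> Y.tors" using ab zR' by auto
   have c: "a \<in> carrier Y" "b \<in> carrier Y" "y2 \<in> carrier Y"
    using sp.H.FE.rsubD(2)[OF s(1)] ab'(1) y2 Y.torsD(1)[OF ab'(2)] by auto
   have "a \<ominus>\<^bsub>Y\<^esub> y2 \<in> Y.tors" by (rule sp.H.FE.eqvD[OF sp.H.FE.eqv_refl[OF R(1)] ab'(1) y2])
   then have "(a \<ominus>\<^bsub>Y\<^esub> y2) \<oplus>\<^bsub>Y\<^esub> b \<in> Y.tors" using ab'(2) by (rule Y.torsD(3))
   also have "(a \<ominus>\<^bsub>Y\<^esub> y2) \<oplus>\<^bsub>Y\<^esub> b = y \<ominus>\<^bsub>Y\<^esub> y2" using c by (simp add: ab(3) a_minus_def Y.M.a_ac)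
   finally show "y \<ominus>\<^bsub>Y\<^esub> y2 \<in> Y.tors" .
  qed
  then have eH: "Cmp (coh p q) HS.A.F HS.B.F Y (sp.S.FE.cls (sp.join R R')) ?a = \<phi> 0"
   using HY.Cmp_cls[OF rel(1) J] sp.H.FE.cls_eq_iff[OF HY.comp_rel[OF rel(1) J] R(1)] R(2) by simp
  have "sp.T.FE.eqv (TS.AB.gph (\<lambda>_. ee n) O sp.join R R') R'"
   unfolding sp.T.FE.eqv_def
  proof (intro allI impI)
   fix v y y2 assume "(v, y) \<in> TS.AB.gph (\<lambda>_. ee n) O sp.join R R'" and y2: "(v, y2) \<in> R'"
   then obtain a b where v: "v \<in> fs 1" and ab: "(hd_part n (\<lambda>i. v 0 * ee n i), a) \<in> R" "(tl_part n (\<lambda>i. v 0 * ee n i), b) \<in> R'" "y = a \<oplus>\<^bsub>Y\<^esub> b"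
    unfolding relcomp_unfold mem_Collect_eq case_prod_conv tl sp.join_def by blast
   have "hd_part n (\<lambda>i. v 0 * ee n i) = (\<lambda>_. 0)" "tl_part n (\<lambda>i. v 0 * ee n i) = v"
    using v by (auto simp: hd_part_def tl_part_def fs_def ee_def)
   then have ab': "a \<in> Y.tors" "(v, b) \<in> R'" using ab zR by auto
   have c: "a \<in> carrier Y" "b \<in> carrier Y" "y2 \<in> carrier Y"
    using sp.T.FE.rsubD(2)[OF s(2)] ab'(2) y2 Y.torsD(1)[OF ab'(1)] by auto
   have "b \<ominus>\<^bsub>Y\<^esub> y2 \<in> Y.tors" by (rule sp.T.FE.eqvD[OF sp.T.FE.eqv_refl[OF R'(1)] ab'(2) y2])
   then have "a \<oplus>\<^bsub>Y\<^esub> (b \<ominus>\<^bsub>Y\<^esub> y2) \<in> Y.tors" by (rule Y.torsD(3)[OF ab'(1)])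
   also have "a \<oplus>\<^bsub>Y\<^esub> (b \<ominus>\<^bsub>Y\<^esub> y2) = y \<ominus>\<^bsub>Y\<^esub> y2" using c by (simp add: ab(3) a_minus_def Y.M.a_ac)
   finally show "y \<ominus>\<^bsub>Y\<^esub> y2 \<in> Y.tors" .
  qed
  then have eT: "Cmp (coh p q) TS.A.F HS.B.F Y (sp.S.FE.cls (sp.join R R')) ?b = \<phi> 1"
   using TY.Cmp_cls[OF rel(2) J] sp.T.FE.cls_eq_iff[OF TY.comp_rel[OF rel(2) J] R'(1)] R'(2) by simp
  have "sp.S.FE.cls (sp.join R R') \<in> Mor (coh p q) HS.B.F Y" using J sp.S.FE.Mor_iff by blast
  then show "\<exists>h\<in>Mor (coh p q) HS.B.F Y. \<forall>i\<in>{..<2::nat}. Cmp (coh p q) (?U i) HS.B.F Y h (if i = 0 then ?a else ?b) = \<phi> i"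
   using eH eT by (intro bexI[of _ "sp.S.FE.cls (sp.join R R')"]) (auto simp: two)
 next
  fix Y :: "'k sheaf" and h k
  assume "Y \<in> Ob (coh p q)" and hk: "h \<in> Mor (coh p q) HS.B.F Y" "k \<in> Mor (coh p q) HS.B.F Y"
   and eq: "\<forall>i\<in>{..<2::nat}. Cmp (coh p q) (?U i) HS.B.F Y h (if i = 0 then ?a else ?b) =
    Cmp (coh p q) (?U i) HS.B.F Y k (if i = 0 then ?a else ?b)"
  then interpret Y: obj p q Y by (simp add: Ob_iff)
  interpret sp: split_free p q Y n z by unfold_locales
  interpret HY: three p q HS.A.F HS.B.F Y by unfold_locales
  interpret TY: three p q TS.A.F HS.B.F Y by unfold_locales
  from hk obtain R R' where R: "sp.S.FE.rel R" "h = sp.S.FE.cls R" and R': "sp.S.FE.rel R'" "k = sp.S.FE.cls R'"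
   unfolding sp.S.FE.Mor_iff by blast
  have e0: "sp.H.FE.eqv (HS.AB.gph ee O R) (HS.AB.gph ee O R')"
   using bspec[OF eq, of 0] HY.Cmp_cls[OF rel(1) R(1)] HY.Cmp_cls[OF rel(1) R'(1)]
    sp.H.FE.cls_eq_iff[OF HY.comp_rel[OF rel(1) R(1)] HY.comp_rel[OF rel(1) R'(1)]] R(2) R'(2) by simp
  have e1: "sp.T.FE.eqv (TS.AB.gph (\<lambda>_. ee n) O R) (TS.AB.gph (\<lambda>_. ee n) O R')"
   using bspec[OF eq, of 1] TY.Cmp_cls[OF rel(2) R(1)] TY.Cmp_cls[OF rel(2) R'(1)]
    sp.T.FE.cls_eq_iff[OF TY.comp_rel[OF rel(2) R(1)] TY.comp_rel[OF rel(2) R'(1)]] R(2) R'(2) by simp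
  have "sp.S.FE.eqv R R'"
  proof (rule sp.S.eqv_free[OF R(1) R'(1)])
   fix i x y y' assume i: "i < Suc n" and y: "((\<lambda>j. x * ee i j), y) \<in> R" "((\<lambda>j. x * ee i j), y') \<in> R'"
   show "y \<ominus>\<^bsub>Y\<^esub> y' \<in> Y.tors"
   proof (cases "i < n")
    case True
    then have "((\<lambda>j. x * ee i j), (\<lambda>j. x * ee i j)) \<in> HS.AB.gph ee" unfolding hd by simp
    from sp.H.FE.eqvD[OF e0 relcompI[OF this y(1)] relcompI[OF this y(2)]] show ?thesis .
   next
    case False
    then have "i = n" using i by simp
    then have "((\<lambda>j. x * ee 0 j), (\<lambda>j. x * ee i j)) \<in> TS.AB.gph (\<lambda>_. ee n)"
     unfolding tl by (auto simp: ee_def fs_def)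
    from sp.T.FE.eqvD[OF e1 relcompI[OF this y(1)] relcompI[OF this y(2)]] show ?thesis .
   qed
  qed
  then show "h = k" using R R' sp.S.FE.cls_eq_iff by simp
 qed
 then show ?thesis unfolding C.direct_sum_iff by blast
qed

lemma direct_sum_FM:
 "direct_sum (cohX p q) {..<n} (\<lambda>i. FM 1 (\<lambda>_. z i)) (FM n z :: ('k::field) sheaf)"
proof (induction n)
 case 0
 interpret C: category "cohX p q :: ('k sheaf, _) cat" by (rule coh_category)
 have "zero_object (cohX p q) (FM 0 z :: 'k sheaf)" by (simp add: FM_zero_iff)
 then show ?case unfolding direct_sum_def zero_object_def by auto
next
 case (Suc n)
 interpret C: category "cohX p q :: ('k sheaf, _) cat" by (rule coh_category)
 show ?case by (rule C.coprod_Suc[OF Suc coprod_FM_Suc])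
qed

text \<open>Splitting off the last coordinate forces one of the two parts to vanish.\<close>

lemma FM_indecomposable:
 assumes "indecomposable (cohX p q) (FM n z :: ('k::field) sheaf)" shows "n = 1"
proof (cases n)
 case 0
 then show ?thesis using assms by (simp add: indecomposable_def FM_zero_iff)
next
 case (Suc m)
 have "zero_object (cohX p q) (FM m z :: 'k sheaf) \<or> zero_object (cohX p q) (FM 1 (\<lambda>_. z m) :: 'k sheaf)"
  using assms coprod_FM_Suc[of m z] unfolding Suc indecomposable_def by fastforce
 then show ?thesis unfolding FM_zero_iff Suc by simp
qed

end

section \<open>Vector bundles are sums of line bundles\<close>

lemma const_zero_split: "cf P 0 0 = 0 ==> \<exists>A B. P = X1 * A + X2 * (B :: 'k::field poly poly)"
proof -
 assume z: "cf P 0 0 = 0"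
 obtain P1 where P1: "!!a b. cf P1 a b = (if a \<ge> 1 then cf P a b else 0)"
  using cf_restrict[of "\<lambda>a b. a \<ge> 1" P] by auto
 obtain P2 where P2: "!!a b. cf P2 a b = (if \<not> a \<ge> 1 then cf P a b else 0)"
  using cf_restrict[of "\<lambda>a b. \<not> a \<ge> 1" P] by metis
 obtain A where A: "P1 = X1 ^ 1 * A" using X1_pow_dvd[of 1 P1] P1 by auto
 have "cf P2 a b = 0" if "b < 1" for a b using z that by (cases "a = 0") (auto simp: P2)
 then obtain B where B: "P2 = X2 ^ 1 * B" using X2_pow_dvd[of 1 P2] by blast
 have "P = P1 + P2" by (rule cf_eqI) (simp add: P1 P2)
 then show ?thesis using A B by auto
qed

lemma (in obj) subo_lc: "graded_mod.lc (subo N) g k v = lc g k v" if "gsub N"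
proof -
 interpret S: graded_mod p q "subo N" using subo_graded[OF that] by unfold_locales
 show ?thesis by (induction k) simp_all
qed

context free_mod
begin

text \<open>Coefficients are indexed by the generators themselves, so that the cardinality of
  \<open>B\<close> can be minimised and a redundant generator can simply be removed.\<close>

definition spans :: "(nat => 'k poly poly) set => (nat => 'k poly poly) set => bool" where
 "spans B G \<longleftrightarrow> finite B \<and> B \<subseteq> G \<and> (\<forall>b\<in>B. \<exists>d. b \<in> F.gr d) \<and>
   (\<forall>v\<in>G. \<exists>c. v = (\<lambda>k. \<Sum>b\<in>B. c b * b k))"

lemma ex_spans:
 assumes G: "F.gsub G" shows "\<exists>B. spans B G"
proof -
 interpret S: obj p q "F.subo G" by (rule F.subo_obj[OF G])
 from S.fg_lc[OF S.fg] obtain m g d where g: "!!i. i < m ==> g i \<in> S.gr (d i)" and G2: "G = range (S.lc g m)" by auto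
 have gG: "g i \<in> G \<and> g i \<in> F.gr (d i)" if "i < m" for i
  using g[OF that] by (simp add: S.gr_def F.gr_def)
 have "\<exists>c. v = (\<lambda>k. \<Sum>b\<in>g ` {..<m}. c b * b k)" if "v \<in> G" for v
 proof -
  from that G2 obtain w where "v = S.lc g m w" by blast
  then have v: "v = (\<lambda>k. \<Sum>j<m. w j * g j k)" using F.subo_lc[OF G, of g m w] by (simp add: F_lc)
  have "(\<Sum>j<m. w j * g j k) = (\<Sum>b\<in>g ` {..<m}. (\<Sum>j\<in>{j\<in>{..<m}. g j = b}. w j) * b k)" for k
  proof -
   have "(\<Sum>j<m. w j * g j k) = (\<Sum>b\<in>g ` {..<m}. \<Sum>j\<in>{j\<in>{..<m}. g j = b}. w j * g j k)"
    by (rule sum.image_gen) simp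
   also have "\<dots> = (\<Sum>b\<in>g ` {..<m}. (\<Sum>j\<in>{j\<in>{..<m}. g j = b}. w j) * b k)"
    by (rule sum.cong) (auto simp: sum_distrib_right intro!: sum.cong)
   finally show ?thesis .
  qed
  then show ?thesis unfolding v by (intro exI[of _ "\<lambda>b. \<Sum>j\<in>{j\<in>{..<m}. g j = b}. w j"]) auto
 qed
 moreover have "\<forall>b\<in>g ` {..<m}. \<exists>d. b \<in> F.gr d" using gG by blast
 moreover have "g ` {..<m} \<subseteq> G" using gG by blast
 ultimately have "spans (g ` {..<m}) G" unfolding spans_def by blast
 then show ?thesis ..
qed

lemma comp_sum:
 assumes "finite B" "!!b. b \<in> B ==> b \<in> F.gr (d b)"
 shows "F.comp (D u) (\<lambda>k. \<Sum>b\<in>B. c b * b k) = (\<lambda>k. \<Sum>b\<in>B. pt (D (u - d b)) (c b) * b k)"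
 using assms
proof (induction B)
 case empty
 show ?case using F.comp_zero[of "D u"] by simp
next
 case (insert b B)
 have bfs: "b' \<in> fs n" if "b' \<in> insert b B" for b' using gr_fs[OF insert.prems[OF that]] .
 have s: "(\<lambda>k. \<Sum>b\<in>B. c b * b k) \<in> fs n" using bfs by (auto simp: fs_def intro!: sum.neutral)
 have "(\<lambda>k. \<Sum>b\<in>insert b B. c b * b k) = c b \<odot>\<^bsub>F\<^esub> b \<oplus>\<^bsub>F\<^esub> (\<lambda>k. \<Sum>b\<in>B. c b * b k)"
  using insert.hyps by simp
 then have "F.comp (D u) (\<lambda>k. \<Sum>b\<in>insert b B. c b * b k) =
   F.comp (D u) (c b \<odot>\<^bsub>F\<^esub> b) \<oplus>\<^bsub>F\<^esub> F.comp (D u) (\<lambda>k. \<Sum>b\<in>B. c b * b k)"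
  using F.comp_add[of "c b \<odot>\<^bsub>F\<^esub> b" "\<lambda>k. \<Sum>b\<in>B. c b * b k" "D u"] s bfs[of b] by (simp del: FM_simps(3))
 also have "F.comp (D u) (c b \<odot>\<^bsub>F\<^esub> b) = pt (D (u - d b)) (c b) \<odot>\<^bsub>F\<^esub> b"
  by (rule F.comp_smult_hom) (rule insert.prems, simp)
 also have "F.comp (D u) (\<lambda>k. \<Sum>b\<in>B. c b * b k) = (\<lambda>k. \<Sum>b\<in>B. pt (D (u - d b)) (c b) * b k)"
  using insert.IH insert.prems by simp
 finally show ?case using insert.hyps by simp
qed

text \<open>The graded Nakayama argument: a coefficient with a non-zero constant term would make the
  generator \<open>b0\<close> redundant.\<close>

lemma minimal_relation:
 assumes sp: "spans B G" and min: "!!B'. spans B' G ==> card B \<le> card B'"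
  and rel: "(\<lambda>k. \<Sum>b\<in>B. c b * b k) = (\<lambda>_. 0)" and b0: "b0 \<in> B"
 shows "cf (c b0) 0 0 = 0"
proof (rule ccontr)
 assume nz: "cf (c b0) 0 0 \<noteq> 0"
 have fin: "finite B" using sp by (simp add: spans_def)
 from sp have "\<forall>b\<in>B. \<exists>d. b \<in> F.gr d" by (simp add: spans_def)
 from bchoice[OF this] obtain d where d: "!!b. b \<in> B ==> b \<in> F.gr (d b)" by blast
 \<comment> \<open>The component of the relation in the degree of \<open>b0\<close>. There the
   coefficient of \<open>b0\<close> has degree 0, so it is a scalar, and it is non-zero by
   assumption.\<close>
 define c' where "c' b = pt (D (d b0 - d b)) (c b)" for b
 have "F.comp (D (d b0)) (\<lambda>_. 0) = (\<lambda>k. \<Sum>b\<in>B. c' b * b k)"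
  using comp_sum[OF fin d, of "d b0" c] rel by (simp add: c'_def)
 then have z: "(\<Sum>b\<in>B. c' b * b k) = 0" for k using F.comp_zero[of "D (d b0)"] by (simp add: fun_eq_iff)
 have c0: "c' b0 \<in> Sg 0" "cf (c' b0) 0 0 \<noteq> 0"
  using pt_Sg[of "d b0 - d b0" "c b0"] nz by (auto simp: c'_def zero_prod_def)
 define a where "a = cf (c' b0) 0 0"
 have a: "c' b0 = cst a" "a \<noteq> 0" using Sg_const[OF c0(1)] c0(2) by (auto simp: a_def)
 define e where "e b = - cst (1 / a) * c' b" for b
 have b0e: "b0 k = (\<Sum>b\<in>B - {b0}. e b * b k)" for k
 proof -
  have "0 = cst a * b0 k + (\<Sum>b\<in>B - {b0}. c' b * b k)"
   using z[of k] sum.remove[OF fin b0, of "\<lambda>b. c' b * b k"] a by simp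
  then have "cst a * b0 k = - (\<Sum>b\<in>B - {b0}. c' b * b k)" by (simp add: eq_neg_iff_add_eq_0)
  then have "cst (1 / a) * (cst a * b0 k) = - cst (1 / a) * (\<Sum>b\<in>B - {b0}. c' b * b k)" by simp
  moreover have "cst (1 / a) * (cst a * b0 k) = b0 k"
   using a(2) by (simp add: mult.assoc[symmetric] cst_simps(3)[symmetric] cst_simps(2))
  ultimately show ?thesis by (simp add: e_def sum_distrib_left mult.assoc sum_negf)
 qed
 have "spans (B - {b0}) G"
  unfolding spans_def
 proof (intro conjI ballI)
  fix v assume "v \<in> G"
  then obtain c where c: "v = (\<lambda>k. \<Sum>b\<in>B. c b * b k)" using sp unfolding spans_def by blast
  have "v k = (\<Sum>b\<in>B - {b0}. (c b0 * e b + c b) * b k)" for k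
  proof -
   have "v k = c b0 * b0 k + (\<Sum>b\<in>B - {b0}. c b * b k)"
    unfolding c using sum.remove[OF fin b0, of "\<lambda>b. c b * b k"] by simp
   also have "c b0 * b0 k = (\<Sum>b\<in>B - {b0}. c b0 * e b * b k)"
    by (subst b0e) (simp only: sum_distrib_left mult.assoc)
   finally show ?thesis by (simp only: sum.distrib[symmetric] distrib_right)
  qed
  then show "\<exists>c. v = (\<lambda>k. \<Sum>b\<in>B - {b0}. c b * b k)" by (intro exI[of _ "\<lambda>b. c b0 * e b + c b"]) auto
 qed (use sp in \<open>auto simp: spans_def\<close>)
 from min[OF this] show False using card_Diff1_less[OF fin b0] by simp
qed

text \<open>A relation between minimal generators has no constant terms, so it is \<open>X1 c1 + X2 c2\<close>; since
 \<open>X1\<close>, \<open>X2\<close> is a regular sequence on \<open>G\<close>, the coefficients \<open>c1\<close> and \<open>c2\<close> can be chosen to be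
 relations as well. Hence all coefficients of a relation vanish, by induction on their degree.\<close>

lemma minimal_relation_trivial:
 assumes sp: "spans B G" and min: "!!B'. spans B' G ==> card B \<le> card B'" and G: "F.subm G"
  and sat: "!!u. u \<in> fs n ==> (\<lambda>i. X1 * u i) \<in> G ==> (\<lambda>i. X2 * u i) \<in> G ==> u \<in> G"
  and rel: "(\<lambda>k. \<Sum>b\<in>B. c b * b k) = (\<lambda>_. 0)" and b: "b \<in> B"
 shows "c b = 0"
proof -
 have fin: "finite B" and BG: "B \<subseteq> G" using sp by (auto simp: spans_def)
 have inG: "(\<lambda>k. \<Sum>b\<in>B'. e b * b k) \<in> G" if "B' \<subseteq> B" for B' e
  using finite_subset[OF that fin] that
 proof (induction B')
  case empty show ?case using F.submD(2)[OF G] by simp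
 next
  case (insert b B')
  have "(\<lambda>k. \<Sum>b\<in>insert b B'. e b * b k) = (\<lambda>k. e b * b k + (\<Sum>b\<in>B'. e b * b k))"
   using insert.hyps by simp
  moreover have "(\<lambda>k. e b * b k) \<in> G" using F.submD(4)[OF G, of b "e b"] insert.prems BG by auto
  ultimately show ?case using F.submD(3)[OF G, of "\<lambda>k. e b * b k"] insert by simp
 qed
 \<comment> \<open>All relations are treated at once, because the induction replaces a relation by
   two others; \<open>m\<close> bounds the total degree of the coefficient under inspection.\<close>
 have vanish: "(\<lambda>k. \<Sum>b\<in>B. c b * b k) = (\<lambda>_. 0) ==> b \<in> B ==> i + j < m ==> cf (c b) i j = 0" for m c b i j
 proof (induction m arbitrary: c b i j)
  case (Suc m)
  note rel = Suc.prems(1)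
  have "\<forall>b\<in>B. \<exists>e. c b = X1 * fst e + X2 * snd e"
   using const_zero_split[OF minimal_relation[OF sp min rel]] by (metis fst_conv snd_conv)
  from bchoice[OF this] obtain e where e: "!!b. b \<in> B ==> c b = X1 * fst (e b) + X2 * snd (e b)" by blast
  define v where "v k = (\<Sum>b\<in>B. fst (e b) * b k)" for k
  define w where "w k = (\<Sum>b\<in>B. snd (e b) * b k)" for k
  have vG: "v \<in> G" and wG: "w \<in> G" using inG[of B] by (auto simp: v_def[abs_def] w_def[abs_def])
  have "X2 * (- w k) = X1 * v k" for k
  proof -
   have "(\<Sum>b\<in>B. c b * b k) = X1 * v k + X2 * w k"
    unfolding v_def w_def sum_distrib_left sum.distrib[symmetric]
    by (rule sum.cong) (auto simp: e algebra_simps)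
   then show ?thesis using fun_cong[OF rel, of k] by (simp add: add_eq_0_iff)
  qed
  then have "\<exists>U. - w k = X1 * U \<and> v k = X2 * U" for k using X_regular[of 1 "- w k" 1 "v k"] by simp
  then obtain u where u: "!!k. - w k = X1 * u k" "!!k. v k = X2 * u k" by metis
  have "v \<in> fs n" using F.submD(1)[OF G vG] by simp
  then have ufs: "u \<in> fs n" using u(2) by (auto simp: fs_def)
  have "(\<lambda>i. X1 * u i) = (-1) \<odot>\<^bsub>F\<^esub> w" by (simp add: u(1)[symmetric])
  then have "(\<lambda>i. X1 * u i) \<in> G" using F.submD(4)[OF G wG, of "-1"] by simp
  moreover have "(\<lambda>i. X2 * u i) = v" using u(2) by auto
  ultimately have "u \<in> G" using sat[OF ufs] vG by simp
  then obtain h where h: "u = (\<lambda>k. \<Sum>b\<in>B. h b * b k)" using sp unfolding spans_def by blast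
  \<comment> \<open>Correcting by the Koszul syzygy, with \<open>X2 * h b\<close> subtracted from
    the first part and \<open>X1 * h b\<close> added to the second, leaves \<open>c b\<close>
    unchanged and turns both parts into relations.\<close>
  have r1: "(\<lambda>k. \<Sum>b\<in>B. (fst (e b) - X2 * h b) * b k) = (\<lambda>_. 0)"
  proof
   fix k
   have "(\<Sum>b\<in>B. (fst (e b) - X2 * h b) * b k) = v k - X2 * u k"
    unfolding v_def h sum_distrib_left sum_subtractf[symmetric] by (rule sum.cong) (auto simp: algebra_simps)
   then show "(\<Sum>b\<in>B. (fst (e b) - X2 * h b) * b k) = 0" using u(2) by simp
  qed
  have r2: "(\<lambda>k. \<Sum>b\<in>B. (snd (e b) + X1 * h b) * b k) = (\<lambda>_. 0)"
  proof
   fix k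
   have "(\<Sum>b\<in>B. (snd (e b) + X1 * h b) * b k) = w k + X1 * u k"
    unfolding w_def h sum_distrib_left sum.distrib[symmetric] by (rule sum.cong) (auto simp: algebra_simps)
   then show "(\<Sum>b\<in>B. (snd (e b) + X1 * h b) * b k) = 0" using u(1)[of k] by (metis add.right_inverse)
  qed
  have "c b = X1 * (fst (e b) - X2 * h b) + X2 * (snd (e b) + X1 * h b)"
   using e[OF Suc.prems(2)] by (simp add: algebra_simps)
  then show ?case
   using Suc.IH[OF r1 Suc.prems(2), of "i - 1" j] Suc.IH[OF r2 Suc.prems(2), of i "j - 1"] Suc.prems(3)
   by (simp only: cf_simps(2) cf_X) auto
 qed simp
 show ?thesis by (rule cf_eqI) (use vanish[OF rel b, of _ _ "Suc (_ + _)"] in auto)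
qed

text \<open>A homogeneous generating set of least cardinality is a basis by
  \<open>minimal_relation_trivial\<close>. The condition \<open>sat\<close> says that the quotient
  of the free module by \<open>G\<close> has no non-zero element killed by both variables.\<close>

lemma saturated_free:
 assumes G: "F.gsub G"
  and sat: "!!u. u \<in> fs n ==> (\<lambda>i. X1 * u i) \<in> G ==> (\<lambda>i. X2 * u i) \<in> G ==> u \<in> G"
 shows "\<exists>N g d. (\<forall>i<N. g i \<in> G \<and> g i \<in> F.gr (d i)) \<and> (\<forall>v\<in>G. \<exists>c\<in>fs N. v = F.lc g N c) \<and>
  (\<forall>c\<in>fs N. F.lc g N c = (\<lambda>_. 0) --> c = (\<lambda>_. 0))"
proof -
 have sG: "F.subm G" using G by (simp add: F.gsub_def)
 obtain B0 where "spans B0 G" using ex_spans[OF G] ..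
 define B where "B = arg_min card (\<lambda>B. spans B G)"
 have B: "spans B G" "!!B'. spans B' G ==> card B \<le> card B'"
  using arg_min_nat_lemma[of "\<lambda>B. spans B G" B0 card] \<open>spans B0 G\<close> by (auto simp: B_def)
 have fin: "finite B" using B(1) by (simp add: spans_def)
 obtain g where g: "bij_betw g {0..<card B} B" using ex_bij_betw_nat_finite[OF fin] ..
 let ?N = "card B"
 have gB: "bij_betw g {..<?N} B" using g by (simp add: lessThan_atLeast0)
 have gm: "g i \<in> B" if "i < ?N" for i using bij_betwE[OF gB] that by simp
 have "\<forall>i. \<exists>d. i < ?N --> g i \<in> F.gr d" using gm B(1) unfolding spans_def by blast
 then obtain d where d: "!!i. i < ?N ==> g i \<in> F.gr (d i)" by metis
 have lc: "F.lc g ?N (\<lambda>i. if i < ?N then c (g i) else 0) = (\<lambda>k. \<Sum>b\<in>B. c b * b k)" for c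
 proof
  fix k
  have "(\<Sum>j<?N. (if j < ?N then c (g j) else 0) * g j k) = (\<Sum>j<?N. c (g j) * g j k)" by (rule sum.cong) auto
  also have "\<dots> = (\<Sum>b\<in>B. c b * b k)" by (rule sum.reindex_bij_betw[OF gB])
  finally show "F.lc g ?N (\<lambda>i. if i < ?N then c (g i) else 0) k = (\<Sum>b\<in>B. c b * b k)" by (simp add: F_lc)
 qed
 show ?thesis
 proof (intro exI[of _ ?N] exI[of _ g] exI[of _ d] conjI allI impI ballI)
  fix i assume "i < ?N"
  then show "g i \<in> G" "g i \<in> F.gr (d i)" using gm B(1) d by (auto simp: spans_def)
 next
  fix v assume "v \<in> G"
  then obtain c where "v = (\<lambda>k. \<Sum>b\<in>B. c b * b k)" using B(1) unfolding spans_def by blast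
  then show "\<exists>c\<in>fs ?N. v = F.lc g ?N c"
   using lc[of c] by (intro bexI[of _ "\<lambda>i. if i < ?N then c (g i) else 0"]) (auto simp: fs_def)
 next
  fix c assume c: "c \<in> fs ?N" "F.lc g ?N c = (\<lambda>_. 0)"
  define e where "e b = c (inv_into {..<?N} g b)" for b
  have eg: "e (g i) = c i" if "i < ?N" for i
   using bij_betw_inv_into_left[OF gB, of i] that by (simp add: e_def)
  have "(\<lambda>i. if i < ?N then e (g i) else 0) = c" using eg c(1) by (auto simp: fs_def)
  then have "(\<lambda>k. \<Sum>b\<in>B. e b * b k) = (\<lambda>_. 0)" using lc[of e] c(2) by simp
  from minimal_relation_trivial[OF B sG sat this] have "e b = 0" if "b \<in> B" for b using that by blast
  then have "c i = 0" if "i < ?N" for i using eg[OF that] gm[OF that] by metis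
  then show "c = (\<lambda>_. 0)" using c(1) by (auto simp: fs_def fun_eq_iff) (metis not_le)
 qed
qed

end

section \<open>Torsion-free objects and their embedding into free modules\<close>

context obj
begin

text \<open>Torsion-freeness as seen by the quotient category: elements of \<open>tors\<close> may
  have annihilators, other homogeneous elements have no homogeneous ones.\<close>

definition torsion_only :: bool where
 "torsion_only \<longleftrightarrow> (\<forall>d u s m. s \<in> Sg d --> s \<noteq> 0 --> m \<in> gr u --> s \<odot> m = \<zero> --> m \<in> tors)"

definition indep :: "nat => (nat => 'b) => bool" where
 "indep n g \<longleftrightarrow> (\<forall>v\<in>fs n. lc g n v = \<zero> --> v = (\<lambda>_. 0))"

lemma lc_restrict: "\<exists>w\<in>fs n. lc g n w = lc g n v"
 by (rule bexI[of _ "\<lambda>i. if i < n then v i else 0"]) (auto simp: fs_def intro: lc_cong)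

text \<open>The family \<open>e\<close> plays the role of a basis over fractions, with common
  denominator \<open>a\<close>. Each new generator either has a non-zero homogeneous multiple in the
  span, which enlarges the denominator, or it is adjoined to the family.\<close>

lemma ex_indep:
 fixes r :: nat
 assumes g: "!!j. j < r ==> g j \<in> gr (d j)"
 shows "\<exists>n e \<epsilon> a c. (\<forall>i<n. e i \<in> gr (\<epsilon> i)) \<and> indep n e \<and> a \<in> Sg c \<and> a \<noteq> 0 \<and>
  (\<forall>j<r. \<exists>v\<in>fs n. a \<odot> g j = lc e n v)"
 using g
proof (induction r)
 case 0
 have "indep 0 e" for e by (auto simp: indep_def fs_def)
 then show ?case using Sg_one by (intro exI[of _ 0] exI[of _ "undefined"] exI[of _ 1]) auto
next
 case (Suc r)
 then obtain n e \<epsilon> a c where e: "!!i. i < n ==> e i \<in> gr (\<epsilon> i)" "indep n e" and a: "a \<in> Sg c" "a \<noteq> 0"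
  and ag: "!!j. j < r ==> \<exists>v\<in>fs n. a \<odot> g j = lc e n v"
  using Suc.IH Suc.prems less_SucI by blast
 have ec: "e i \<in> carrier M" if "i < n" for i by (rule gr_closed(1)[OF e(1)[OF that]])
 have gc: "g j \<in> carrier M" if "j < Suc r" for j by (rule gr_closed(1)[OF Suc.prems[OF that]])
 have xg: "g r \<in> gr (d r)" and xc: "g r \<in> carrier M" using Suc.prems[of r] gc[of r] by auto
 show ?case
 proof (cases "\<exists>s b v. s \<in> Sg b \<and> s \<noteq> 0 \<and> v \<in> fs n \<and> s \<odot> g r = lc e n v")
  case True
  then obtain s b v where s: "s \<in> Sg b" "s \<noteq> 0" "v \<in> fs n" "s \<odot> g r = lc e n v" by blast
  have mult: "(t * t') \<odot> m = lc e n (\<lambda>i. t * w i)" if "m \<in> carrier M" "t' \<odot> m = lc e n w" for t t' m w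
   using that lc_smult[of n e t w, OF ec] by (simp add: sm_assoc)
  have "\<exists>w\<in>fs n. (s * a) \<odot> g j = lc e n w" if j: "j < Suc r" for j
  proof (cases "j < r")
   case True
   then obtain w where "w \<in> fs n" "a \<odot> g j = lc e n w" using ag by blast
   then show ?thesis using mult[OF gc[OF j], of a w s] by (intro bexI[of _ "\<lambda>i. s * w i"]) simp_all
  next
   case False
   then have "j = r" using j by simp
   then show ?thesis using mult[OF xc s(4), of a] s(3) by (intro bexI[of _ "\<lambda>i. a * v i"]) (simp_all add: mult.commute)
  qed
  moreover have "s * a \<in> Sg (b + c)" "s * a \<noteq> 0" using Sg_mult[OF s(1) a(1)] s(2) a(2) by auto
  ultimately show ?thesis using e by (intro exI[of _ n] exI[of _ e] exI[of _ \<epsilon>] exI[of _ "s * a"] exI[of _ "b + c"]) blast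
 next
  case False
  let ?e = "e(n := g r)"
  have e': "?e i \<in> gr ((\<epsilon>(n := d r)) i)" if "i < Suc n" for i using that e(1) xg by auto
  have same: "lc ?e n v = lc e n v" for v by (rule lc_cong) auto
  have "indep (Suc n) ?e"
   unfolding indep_def
  proof (intro ballI impI)
   fix v assume v: "v \<in> fs (Suc n)" and z: "lc ?e (Suc n) v = \<zero>"
   then have z': "lc e n v \<oplus> v n \<odot> g r = \<zero>" by (simp add: same)
   \<comment> \<open>A non-zero last coefficient has a non-zero homogeneous part, and the component
     of the relation in the matching degree would put a homogeneous multiple of \<open>g r\<close>
     into the span of \<open>e\<close>.\<close>
   have "v n = 0"
   proof (rule ccontr)
    assume "v n \<noteq> 0"
    then have "dgs (v n) \<noteq> {}" using sum_pt[of "{}" "v n"] by auto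
    then obtain y where y: "y \<in> dgs (v n)" by blast
    then obtain w where w: "y = D w" using dgs_L L_cases by blast
    define s where "s = pt (D w) (v n)"
    have s: "s \<noteq> 0" "s \<in> Sg w" using y pt_nonzero[of "D w" "v n"] pt_Sg[of w "v n"] by (simp_all add: s_def w)
    have lcc: "lc e n v \<in> carrier M" using ec by simp
    have "comp (D (w + d r)) (lc e n v) \<oplus> comp (D (w + d r)) (v n \<odot> g r) = \<zero>"
     using comp_add[OF lcc, of "v n \<odot> g r" "D (w + d r)"] xc z' by simp
    moreover have "comp (D (w + d r)) (v n \<odot> g r) = s \<odot> g r"
     using comp_smult_hom[OF xg, of "w + d r" "v n"] by (simp add: s_def)
    moreover have "comp (D (w + d r)) (lc e n v) = lc e n (\<lambda>i. pt (D (w + d r - \<epsilon> i)) (v i))"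
     by (rule lc_comp) (rule e(1))
    ultimately have "lc e n (\<lambda>i. pt (D (w + d r - \<epsilon> i)) (v i)) \<oplus> s \<odot> g r = \<zero>" by simp
    then have "s \<odot> g r = \<ominus> lc e n (\<lambda>i. pt (D (w + d r - \<epsilon> i)) (v i))"
     using ec xc M.minus_equality[of "s \<odot> g r" "lc e n (\<lambda>i. pt (D (w + d r - \<epsilon> i)) (v i))"]
      M.a_comm[of "s \<odot> g r" "lc e n (\<lambda>i. pt (D (w + d r - \<epsilon> i)) (v i))"] by simp
    also have "\<dots> = lc e n (\<lambda>i. - pt (D (w + d r - \<epsilon> i)) (v i))"
     using lc_minus[of n e, OF ec] by simp
    finally have "s \<odot> g r = lc e n (\<lambda>i. - pt (D (w + d r - \<epsilon> i)) (v i))" .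
    moreover obtain v' where "v' \<in> fs n" "lc e n v' = lc e n (\<lambda>i. - pt (D (w + d r - \<epsilon> i)) (v i))"
     using lc_restrict[of n e "\<lambda>i. - pt (D (w + d r - \<epsilon> i)) (v i)"] by blast
    ultimately have "s \<odot> g r = lc e n v'" by simp
    then show False using False s \<open>v' \<in> fs n\<close> by blast
   qed
   have "v i = 0" if "n \<le> i" for i using v \<open>v n = 0\<close> that by (cases "i = n") (auto simp: fs_def)
   then have "v \<in> fs n" by (simp add: fs_def)
   moreover have "lc e n v = \<zero>" using z' \<open>v n = 0\<close> xc ec by simp
   ultimately show "v = (\<lambda>_. 0)" using e(2) by (auto simp: indep_def)
  qed
  moreover have "\<exists>v\<in>fs (Suc n). a \<odot> g j = lc ?e (Suc n) v" if j: "j < Suc r" for j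
  proof (cases "j < r")
   case True
   then obtain v where v: "v \<in> fs n" "a \<odot> g j = lc e n v" using ag by blast
   then have "v n = 0" "v \<in> fs (Suc n)" by (auto simp: fs_def)
   moreover have "lc ?e (Suc n) v = lc e n v" using \<open>v n = 0\<close> xc ec by (simp add: same)
   ultimately show ?thesis using v by metis
  next
   case False
   then have "j = r" using j by simp
   moreover have "lc ?e (Suc n) (\<lambda>i. if i = n then a else 0) = a \<odot> ?e n"
    by (rule lc_unit) (use e' gr_closed(1) in blast, simp)
   ultimately show ?thesis by (intro bexI[of _ "\<lambda>i. if i = n then a else 0"]) (auto simp: fs_def)
  qed
  ultimately show ?thesis using e' a by blast
 qed
qed

end

lemma (in obj) torsion_only_all:
 assumes t: "torsion_only" and s: "s \<in> Sg d" "s \<noteq> 0" and m: "m \<in> carrier M" "s \<odot> m = \<zero>"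
 shows "m \<in> tors"
 using m(1)
proof (rule comp_induct)
 fix x assume "x \<in> carrier L"
 then obtain u where u: "x = D u" by (rule L_cases)
 have "s \<odot> comp (D u) m = \<zero>" using comp_smult[OF s(1) m(1), of u] m(2) by simp
 then show "comp x m \<in> tors" unfolding u using t[unfolded torsion_only_def, rule_format, OF s comp_gr[OF m(1)]] by simp
qed (use torsD in auto)

text \<open>Multiplication by the common denominator \<open>a\<close> maps \<open>M\<close> into the
  span of the independent family \<open>e\<close>, which is free, and the kernel is torsion. The
  saturation of the image, pulled back to coordinates, satisfies the hypothesis of
  \<open>saturated_free\<close>.\<close>

lemma (in weight_type) torsion_only_free:
 fixes M :: "('k::field) sheaf"
 assumes M: "obj p q M" and t: "obj.torsion_only p q M"
 shows "\<exists>n z. isomorphic (cohX p q) M (FM n z)"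
proof -
 interpret M: obj p q M by (rule M)
 from M.fg_lc[OF M.fg] obtain r g \<delta> where g: "!!j. j < r ==> g j \<in> M.gr (\<delta> j)" "carrier M = range (M.lc g r)" by blast
 obtain n e \<epsilon> a c where e: "!!i. i < n ==> e i \<in> M.gr (\<epsilon> i)" "M.indep n e"
  and a: "a \<in> Sg c" "a \<noteq> 0" and ag: "!!j. j < r ==> \<exists>v\<in>fs n. a \<odot>\<^bsub>M\<^esub> g j = M.lc e n v"
  using M.ex_indep[of r g \<delta>] g(1) by blast
 interpret F: free_mod p q n \<epsilon> "TYPE('k)" by unfold_locales
 have ec: "e i \<in> carrier M" if "i < n" for i by (rule M.gr_closed(1)[OF e(1)[OF that]])
 have gc: "g j \<in> carrier M" if "j < r" for j by (rule M.gr_closed(1)[OF g(1)[OF that]])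
 note lc_add = M.lc_add[of n e, OF ec] and lc_smult = M.lc_smult[of n e, OF ec]
 have inj: "v = (\<lambda>_. 0)" if "v \<in> fs n" "M.lc e n v = \<zero>\<^bsub>M\<^esub>" for v using e(2) that by (auto simp: M.indep_def)
 have aM: "\<exists>v\<in>fs n. a \<odot>\<^bsub>M\<^esub> m = M.lc e n v" if m: "m \<in> carrier M" for m
 proof -
  let ?S = "{m \<in> carrier M. \<exists>v\<in>fs n. a \<odot>\<^bsub>M\<^esub> m = M.lc e n v}"
  have "M.subm ?S"
   unfolding M.subm_def
  proof (intro conjI ballI allI)
   show "\<zero>\<^bsub>M\<^esub> \<in> ?S" using M.lc_zero[of n e "\<lambda>_. 0", OF ec] by (auto intro!: bexI[of _ "\<lambda>_. 0"])
  next
   fix m m' assume "m \<in> ?S" "m' \<in> ?S"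
   then obtain v w where "m \<in> carrier M" "m' \<in> carrier M" "v \<in> fs n" "w \<in> fs n" "a \<odot>\<^bsub>M\<^esub> m = M.lc e n v" "a \<odot>\<^bsub>M\<^esub> m' = M.lc e n w" by blast
   then show "m \<oplus>\<^bsub>M\<^esub> m' \<in> ?S" using lc_add[of v w] by (auto simp: M.sm_radd intro!: bexI[of _ "\<lambda>i. v i + w i"])
  next
   fix s m assume "m \<in> ?S"
   then obtain v where "m \<in> carrier M" "v \<in> fs n" "a \<odot>\<^bsub>M\<^esub> m = M.lc e n v" by blast
   then show "s \<odot>\<^bsub>M\<^esub> m \<in> ?S" using lc_smult[of s v] by (auto simp: M.sm_commute[of m a s] intro!: bexI[of _ "\<lambda>i. s * v i"])
  qed auto
  moreover have "g j \<in> ?S" if "j < r" for j using ag[OF that] gc[OF that] by blast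
  ultimately have S: "M.lc g r v \<in> ?S" for v by (rule M.lc_subm)
  obtain v where "m = M.lc g r v" using m g(2) by auto
  then show ?thesis using S[of v] by simp
 qed
 let ?aM = "(\<lambda>m. a \<odot>\<^bsub>M\<^esub> m) ` carrier M"
 have aM_gsub: "M.gsub ?aM"
  unfolding M.gsub_def M.subm_def
 proof (intro conjI ballI allI)
  show "\<zero>\<^bsub>M\<^esub> \<in> ?aM" by (rule image_eqI[of _ _ "\<zero>\<^bsub>M\<^esub>"]) auto
 next
  fix m m' assume "m \<in> ?aM" "m' \<in> ?aM"
  then obtain b b' where "b \<in> carrier M" "b' \<in> carrier M" "m = a \<odot>\<^bsub>M\<^esub> b" "m' = a \<odot>\<^bsub>M\<^esub> b'" by blast
  then show "m \<oplus>\<^bsub>M\<^esub> m' \<in> ?aM" by (intro image_eqI[of _ _ "b \<oplus>\<^bsub>M\<^esub> b'"]) (auto simp: M.sm_radd)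
 next
  fix s m assume "m \<in> ?aM"
  then obtain b where "b \<in> carrier M" "m = a \<odot>\<^bsub>M\<^esub> b" by blast
  then show "s \<odot>\<^bsub>M\<^esub> m \<in> ?aM" by (intro image_eqI[of _ _ "s \<odot>\<^bsub>M\<^esub> b"]) (auto simp: M.sm_commute[of b s a])
 next
  fix m x assume "m \<in> ?aM" and x: "x \<in> carrier L"
  then obtain b where b: "b \<in> carrier M" "m = a \<odot>\<^bsub>M\<^esub> b" by blast
  obtain u where u: "x = D u" using x by (rule L_cases)
  have "M.comp x m = a \<odot>\<^bsub>M\<^esub> M.comp (D (u - c)) b"
   using M.comp_smult[OF a(1) b(1), of "u - c"] by (simp add: u b(2))
  then show "M.comp x m \<in> ?aM" using b(1) by (intro image_eqI[of _ _ "M.comp (D (u - c)) b"]) auto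
 qed auto
 let ?sat = "M.sat ?aM"
 have sat_gsub: "M.gsub ?sat" by (rule M.gsub_sat[OF aM_gsub])
 then have sat_subm: "M.subm ?sat" by (simp add: M.gsub_def)
 \<comment> \<open>The coordinate vectors of those elements in the span of \<open>e\<close> that lie
   in the saturation of the image of \<open>a\<close>.\<close>
 define G where "G = {v \<in> fs n. M.lc e n v \<in> ?sat}"
 have lc_comp: "M.lc e n (F.F.comp (D u) v) = M.comp (D u) (M.lc e n v)" if "v \<in> fs n" for u v
  unfolding F.F_comp[OF that] by (rule M.lc_comp[symmetric]) (rule e(1))
 have G: "F.F.gsub G"
  unfolding F.F.gsub_def F.F.subm_def
 proof (intro conjI ballI allI)
  show "G \<subseteq> carrier F.F" by (auto simp: G_def)
  show "\<zero>\<^bsub>F.F\<^esub> \<in> G" using M.lc_zero[of n e "\<lambda>_. 0", OF ec] M.submD(2)[OF sat_subm] by (simp add: G_def)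
 next
  fix v w assume "v \<in> G" "w \<in> G"
  then show "v \<oplus>\<^bsub>F.F\<^esub> w \<in> G" using lc_add[of v w] M.submD(3)[OF sat_subm] by (simp add: G_def)
 next
  fix s v assume "v \<in> G"
  then show "s \<odot>\<^bsub>F.F\<^esub> v \<in> G" using lc_smult[of s v] M.submD(4)[OF sat_subm] by (simp add: G_def)
 next
  fix v x assume v: "v \<in> G" and x: "x \<in> carrier L"
  obtain u where u: "x = D u" using x by (rule L_cases)
  have "v \<in> fs n" using v by (simp add: G_def)
  moreover have "M.comp x (M.lc e n v) \<in> ?sat" using sat_gsub v x by (auto simp: M.gsub_def G_def)
  ultimately show "F.F.comp x v \<in> G" using lc_comp[of v u] F.F.comp_closed[of v x] x by (simp add: G_def u)
 qed
 have satG: "u \<in> G" if u: "u \<in> fs n" and 1: "(\<lambda>i. X1 * u i) \<in> G" and 2: "(\<lambda>i. X2 * u i) \<in> G" for u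
 proof -
  have "M.lc e n u \<in> ?sat"
  proof (rule M.sat_sat)
   show "M.lc e n u \<in> carrier M" using ec by simp
   fix x :: "'k poly poly" assume "x \<in> VV"
   then have "(\<lambda>i. x * u i) \<in> G" using 1 2 by auto
   then have "x ^ 1 \<odot>\<^bsub>M\<^esub> M.lc e n u \<in> ?sat" using lc_smult[of x u] by (simp add: G_def)
   then show "\<exists>k. x ^ k \<odot>\<^bsub>M\<^esub> M.lc e n u \<in> ?sat" ..
  qed
  then show ?thesis using u by (simp add: G_def)
 qed
 have "\<exists>N f d. (\<forall>i<N. f i \<in> G \<and> f i \<in> F.F.gr (d i)) \<and> (\<forall>v\<in>G. \<exists>b\<in>fs N. v = F.F.lc f N b) \<and>
   (\<forall>b\<in>fs N. F.F.lc f N b = (\<lambda>_. 0) --> b = (\<lambda>_. 0))"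
  by (rule F.saturated_free[OF G]) (rule satG)
 then obtain N f d where f: "!!i. i < N ==> f i \<in> G \<and> f i \<in> F.F.gr (d i)"
  and fG: "!!v. v \<in> G ==> \<exists>b\<in>fs N. v = F.F.lc f N b"
  and f0: "!!b. b \<in> fs N ==> F.F.lc f N b = (\<lambda>_. 0) ==> b = (\<lambda>_. 0)"
  by (elim exE conjE) (rule that; blast)
 \<comment> \<open>Multiplication by \<open>a\<close> raises degrees by \<open>c\<close>, so the
   degrees of the basis of \<open>G\<close> are shifted back.\<close>
 let ?z = "\<lambda>i. d i - c"
 interpret N: free_mod p q N ?z "TYPE('k)" by unfold_locales
 interpret MN: two p q M N.F by unfold_locales
 define ph where "ph b = M.lc e n (F.F.lc f N b)" for b
 have fs: "f i \<in> carrier F.F" if "i < N" for i using f[OF that] by (simp add: G_def)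
 have lcG: "F.F.lc f N b \<in> G" for b
  using F.F.lc_subm[of G N f b] f G by (simp add: F.F.gsub_def)
 have lcfs: "F.F.lc f N b \<in> fs n" for b using lcG[of b] by (simp add: G_def)
 have ph_add: "ph (\<lambda>i. b i + b' i) = ph b \<oplus>\<^bsub>M\<^esub> ph b'" for b b'
  using F.F.lc_add[of N f b b', OF fs] lc_add by (simp add: ph_def)
 have ph_smult: "ph (\<lambda>i. s * b i) = s \<odot>\<^bsub>M\<^esub> ph b" for s b
  using F.F.lc_smult[of N f s b, OF fs] lc_smult by (simp add: ph_def)
 have ph_0: "ph (\<lambda>_. 0) = \<zero>\<^bsub>M\<^esub>"
  using F.F.lc_zero[of N f "\<lambda>_. 0", OF fs] M.lc_zero[of n e "\<lambda>_. 0", OF ec] by (simp add: ph_def)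
 have ph_inj: "b = (\<lambda>_. 0)" if "b \<in> fs N" "ph b = \<zero>\<^bsub>M\<^esub>" for b
  by (rule f0[OF that(1) inj[OF lcfs]]) (use that(2) in \<open>simp add: ph_def\<close>)
 have ph_c: "ph b \<in> carrier M" for b using ec by (simp add: ph_def)
 \<comment> \<open>The graph of multiplication by \<open>a\<close>, with the target expressed in the
   basis of \<open>G\<close>.\<close>
 define R where "R = {(m, b). m \<in> carrier M \<and> b \<in> fs N \<and> a \<odot>\<^bsub>M\<^esub> m = ph b}"
 have dom: "Domain R = carrier M"
 proof (intro equalityI subsetI)
  fix m assume m: "m \<in> carrier M"
  then obtain v where v: "v \<in> fs n" "a \<odot>\<^bsub>M\<^esub> m = M.lc e n v" using aM by blast
  have "a \<odot>\<^bsub>M\<^esub> m \<in> ?sat" using M.sat_incl[of ?aM] aM_gsub m by (auto simp: M.gsub_def)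
  then have "v \<in> G" using v by (simp add: G_def)
  then obtain b where "b \<in> fs N" "v = F.F.lc f N b" using fG by blast
  then have "(m, b) \<in> R" using m v by (simp add: R_def ph_def)
  then show "m \<in> Domain R" by blast
 qed (auto simp: R_def)
 have rel: "MN.rel R"
  unfolding MN.rel_def MN.rsub_def
 proof (intro conjI allI impI)
  show "R \<subseteq> carrier M \<times> carrier N.F" by (auto simp: R_def)
  show "(\<zero>\<^bsub>M\<^esub>, \<zero>\<^bsub>N.F\<^esub>) \<in> R" by (simp add: R_def ph_0)
  show "carrier M \<subseteq> M.sat (Domain R)" unfolding dom by (rule M.sat_incl[OF M.subm_carrier])
 next
  fix m b m' b' assume "(m, b) \<in> R" "(m', b') \<in> R"
  then show "(m \<oplus>\<^bsub>M\<^esub> m', b \<oplus>\<^bsub>N.F\<^esub> b') \<in> R" by (auto simp: R_def M.sm_radd ph_add)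
 next
  fix s m b assume "(m, b) \<in> R"
  then show "(s \<odot>\<^bsub>M\<^esub> m, s \<odot>\<^bsub>N.F\<^esub> b) \<in> R" by (auto simp: R_def M.sm_commute[of m a s] ph_smult)
 next
  fix m b u assume "(m, b) \<in> R"
  then have mb: "m \<in> carrier M" "b \<in> fs N" "a \<odot>\<^bsub>M\<^esub> m = ph b" by (auto simp: R_def)
  have "a \<odot>\<^bsub>M\<^esub> M.comp (D u) m = M.comp (D (c + u)) (ph b)" using M.comp_smult[OF a(1) mb(1), of u] mb(3) by simp
  also have "\<dots> = M.lc e n (F.F.comp (D (c + u)) (F.F.lc f N b))" unfolding ph_def by (rule lc_comp[OF lcfs, symmetric])
  also have "F.F.comp (D (c + u)) (F.F.lc f N b) = F.F.lc f N (\<lambda>i. pt (D (c + u - d i)) (b i))"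
   by (rule F.F.lc_comp) (use f in blast)
  also have "(\<lambda>i. pt (D (c + u - d i)) (b i)) = N.F.comp (D u) b"
   unfolding N.F_comp[OF mb(2)] by (simp add: algebra_simps)
  finally have "a \<odot>\<^bsub>M\<^esub> M.comp (D u) m = ph (N.F.comp (D u) b)" by (simp add: ph_def)
  then show "(M.comp (D u) m, N.F.comp (D u) b) \<in> R"
   using mb N.F.comp_closed[of b "D u"] by (simp add: R_def)
 next
  fix b assume "(\<zero>\<^bsub>M\<^esub>, b) \<in> R"
  then have "b = (\<lambda>_. 0)" using ph_inj by (auto simp: R_def)
  then show "b \<in> N.F.tors" by (simp add: N.F_tors)
 qed
 have "iso_mor (coh p q) M N.F (MN.cls R)"
 proof (rule MN.iso_mor_cls[OF rel])
  fix m assume "(m, \<zero>\<^bsub>N.F\<^esub>) \<in> R"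
  then have "m \<in> carrier M" "a \<odot>\<^bsub>M\<^esub> m = \<zero>\<^bsub>M\<^esub>" by (auto simp: R_def ph_0)
  then show "m \<in> M.tors" by (rule M.torsion_only_all[OF t a])
 next
  show "carrier N.F \<subseteq> N.F.sat (Range R)"
  proof
   fix b assume "b \<in> carrier N.F"
   then have b: "b \<in> fs N" by simp
   show "b \<in> N.F.sat (Range R)"
   proof (rule N.F.satI)
    fix x :: "'k poly poly" assume "x \<in> VV"
    have "ph b \<in> ?sat" using lcG[of b] by (simp add: G_def ph_def)
    then obtain k m where "m \<in> carrier M" "x ^ k \<odot>\<^bsub>M\<^esub> ph b = a \<odot>\<^bsub>M\<^esub> m" using M.satE \<open>x \<in> VV\<close> by blast
    then have "(m, (\<lambda>i. x ^ k * b i)) \<in> R" using b by (simp add: R_def ph_smult)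
    then show "\<exists>k. x ^ k \<odot>\<^bsub>N.F\<^esub> b \<in> Range R" by auto
   qed (use b in simp)
  qed
 qed
 then show ?thesis unfolding isomorphic_def by blast
qed

section \<open>Subobjects of torsion-free objects\<close>

lemma (in graded_mod) lc_one: "g 0 \<in> carrier M ==> lc g 1 v = v 0 \<odot> g 0"
 by (simp add: One_nat_def)

lemma (in graded_mod) hom_not_tors:
 assumes "m \<in> carrier M" "m \<notin> tors" shows "\<exists>u. comp (D u) m \<notin> tors"
proof (rule ccontr)
 assume "\<not> ?thesis"
 then have *: "comp (D u) m \<in> tors" for u by blast
 have "m \<in> tors"
 proof (rule comp_induct[OF assms(1)])
  fix x assume "x \<in> carrier L"
  then obtain v where "x = D v" by (rule L_cases)
  then show "comp x m \<in> tors" using *[of v] by simp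
 qed (rule torsD; assumption)+
 then show False using assms(2) by simp
qed

lemma (in graded_mod) subo_comp:
 assumes N: "gsub N" and n: "n \<in> N" and x: "x \<in> carrier L"
 shows "graded_mod.comp p q (subo N) x n = comp x n"
proof -
 interpret S: graded_mod p q "subo N" by unfold_locales (rule subo_graded[OF N])
 have sN: "subm N" and cl: "!!y. y \<in> carrier L ==> comp y n \<in> N" using N n by (auto simp: gsub_def)
 have nc: "n \<in> carrier M" by (rule submD(1)[OF sN n])
 show ?thesis
 proof (rule S.comp_unique[where F = "supp n"])
  show "comp (D u) n \<in> S.gr u" for u using cl[of "D u"] comp_gr[OF nc, of u] by (simp add: S.gr_def gr_def)
  show "n = finsum (subo N) (\<lambda>x. comp x n) (supp n)"
   using subo_finsum[OF sN finite_supp[OF nc], of "\<lambda>x. comp x n"] finsum_comp[OF nc finite_supp[OF nc]] cl by auto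
 qed (use x finite_supp[OF nc] in auto)
qed

lemma (in obj) subo_incl:
 assumes N: "gsub N" shows "two.rel p q (subo N) M (Id_on N)"
proof -
 interpret S: obj p q "subo N" by (rule subo_obj[OF N])
 interpret two p q "subo N" M by unfold_locales
 show ?thesis
  unfolding rel_def rsub_def
 proof (intro conjI allI impI)
  show "carrier (subo N) \<subseteq> S.sat (Domain (Id_on N))" using S.sat_incl[OF S.subm_carrier] by simp
  fix n n' v assume "(n, n') \<in> Id_on N"
  then have n: "n' = n" "n \<in> N" by auto
  then show "(S.comp (D v) n, comp (D v) n') \<in> Id_on N"
   using subo_comp[OF N n(2), of "D v"] N by (auto simp: gsub_def)
 qed (use N torsD(2) in \<open>auto simp: gsub_def subm_def\<close>)
qed

locale sheaves = two p q M N for p q :: nat and M N :: "('k::field) sheaf"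
begin

text \<open>The converse of \<open>mono_mor_cls\<close>. A non-torsion homogeneous element
  \<open>h\<close> of the kernel gives two different morphisms from a free module of rank one, with
  \<open>h\<close> and 0 as images of the generator, that agree after composition with the
  monomorphism.\<close>

lemma mono_ker:
 assumes R: "rel R" and mono: "mono_mor (coh p q) M N (cls R)" and mn: "(m, \<zero>\<^bsub>N\<^esub>) \<in> R"
 shows "m \<in> M.tors"
proof (rule ccontr)
 note s = rel_rsub[OF R]
 assume "m \<notin> M.tors"
 then obtain u where u: "M.comp (M.D u) m \<notin> M.tors" using M.hom_not_tors rsubD(1)[OF s mn] by blast
 define h where "h = M.comp (M.D u) m"
 have h: "h \<in> M.gr u" unfolding h_def by (rule M.comp_gr[OF rsubD(1)[OF s mn]])
 have hR: "(h, \<zero>\<^bsub>N\<^esub>) \<in> R" using rsubD(6)[OF s mn, of "M.D u"] by (simp add: h_def)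
 have hc: "h \<in> carrier M" by (rule M.gr_closed(1)[OF h])
 interpret F: free_to p q 1 "\<lambda>_. u" M by unfold_locales
 interpret T: three p q F.FR.F M N by unfold_locales
 have a: "F.FE.rel (F.gph (\<lambda>_. h))" "F.FE.rel (F.gph (\<lambda>_. \<zero>\<^bsub>M\<^esub>))" by (rule F.gph_rel; simp add: h)+
 have e: "T.MP.eqv (F.gph (\<lambda>_. h) O R) (F.gph (\<lambda>_. \<zero>\<^bsub>M\<^esub>) O R)"
  unfolding T.MP.eqv_def
 proof (intro allI impI)
  fix v y y' assume "(v, y) \<in> F.gph (\<lambda>_. h) O R" "(v, y') \<in> F.gph (\<lambda>_. \<zero>\<^bsub>M\<^esub>) O R"
  then have "(v 0 \<odot>\<^bsub>M\<^esub> h, y) \<in> R" "(\<zero>\<^bsub>M\<^esub>, y') \<in> R"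
   using hc by (auto simp: F.gph_iff M.lc_one)
  moreover have "(v 0 \<odot>\<^bsub>M\<^esub> h, \<zero>\<^bsub>N\<^esub>) \<in> R" "(\<zero>\<^bsub>M\<^esub>, \<zero>\<^bsub>N\<^esub>) \<in> R" using rsubD(5)[OF s hR, of "v 0"] rsubD(3)[OF s] by simp_all
  ultimately have "y \<ominus>\<^bsub>N\<^esub> \<zero>\<^bsub>N\<^esub> \<in> N.tors" "y' \<ominus>\<^bsub>N\<^esub> \<zero>\<^bsub>N\<^esub> \<in> N.tors" "y \<in> carrier N" "y' \<in> carrier N"
   using eqvD[OF eqv_refl[OF R]] rsubD(2)[OF s] by blast+
  then show "y \<ominus>\<^bsub>N\<^esub> y' \<in> N.tors" using N.torsD(6)[of y y'] by (simp add: N.diff_zero)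
 qed
 have "T.MP.cls (F.gph (\<lambda>_. h) O R) = T.MP.cls (F.gph (\<lambda>_. \<zero>\<^bsub>M\<^esub>) O R)"
  using T.MP.cls_eq_iff[OF T.comp_rel[OF a(1) R] T.comp_rel[OF a(2) R]] e by blast
 then have c: "Cmp (coh p q) F.FR.F M N (cls R) (F.FE.cls (F.gph (\<lambda>_. h))) =
   Cmp (coh p q) F.FR.F M N (cls R) (F.FE.cls (F.gph (\<lambda>_. \<zero>\<^bsub>M\<^esub>)))"
  by (simp only: T.Cmp_cls[OF a(1) R] T.Cmp_cls[OF a(2) R])
 have o: "F.FR.F \<in> Ob (coh p q)" by (rule M.FM_Ob)
 have k: "F.FE.cls (F.gph (\<lambda>_. h)) \<in> Mor (coh p q) F.FR.F M" "F.FE.cls (F.gph (\<lambda>_. \<zero>\<^bsub>M\<^esub>)) \<in> Mor (coh p q) F.FR.F M"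
  unfolding F.FE.Mor_iff using a by blast+
 have "F.FE.cls (F.gph (\<lambda>_. h)) = F.FE.cls (F.gph (\<lambda>_. \<zero>\<^bsub>M\<^esub>))"
  by (rule mono[unfolded mono_mor_def, THEN conjunct2, rule_format, OF o k c])
 then have "F.FE.eqv (F.gph (\<lambda>_. h)) (F.gph (\<lambda>_. \<zero>\<^bsub>M\<^esub>))" using F.FE.cls_eq_iff[OF a] by blast
 then have "h \<ominus>\<^bsub>M\<^esub> \<zero>\<^bsub>M\<^esub> \<in> M.tors"
  using F.gph_eqv_iff[of "\<lambda>_. h" "\<lambda>_. \<zero>\<^bsub>M\<^esub>"] h by auto
 then show False using u hc by (simp add: h_def M.diff_zero)
qed

text \<open>After a power of \<open>x\<close> the annihilated element has a value \<open>n\<close>,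
  and \<open>s\<close> sends \<open>n\<close> to torsion. Hence some \<open>X1 ^ l * s\<close>
  annihilates \<open>n\<close>, so \<open>n\<close> is torsion, and the trivial kernel reflects this
  back to \<open>m\<close>.\<close>

lemma torsion_only_mono:
 assumes R: "rel R" and mono: "mono_mor (coh p q) M N (cls R)" and N: "N.torsion_only"
 shows "M.torsion_only"
 unfolding M.torsion_only_def
proof (intro allI impI)
 note r = rel_rsub[OF R]
 fix d u :: "int \<times> int" and s m assume s: "s \<in> M.Sg d" "s \<noteq> 0" and m: "m \<in> M.gr u" and sm: "s \<odot>\<^bsub>M\<^esub> m = \<zero>\<^bsub>M\<^esub>"
 have mc: "m \<in> carrier M" by (rule M.gr_closed(1)[OF m])
 show "m \<in> M.tors"
 proof (rule M.tors_tors[OF mc])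
  fix x :: "'k poly poly" assume "x \<in> VV"
  then obtain k n where kn: "(x ^ k \<odot>\<^bsub>M\<^esub> m, n) \<in> R" using rel_dom[OF R mc] by blast
  then have "(\<zero>\<^bsub>M\<^esub>, s \<odot>\<^bsub>N\<^esub> n) \<in> R" using rsubD(5)[OF r kn, of s] mc sm M.sm_commute[of m s "x ^ k"] by simp
  then have "s \<odot>\<^bsub>N\<^esub> n \<in> N.tors" using R by (simp add: rel_def)
  then obtain l where l: "X1 ^ l \<odot>\<^bsub>N\<^esub> (s \<odot>\<^bsub>N\<^esub> n) = \<zero>\<^bsub>N\<^esub>" using N.torsE by blast
  have nc: "n \<in> carrier N" by (rule rsubD(2)[OF r kn])
  have "n \<in> N.tors"
  proof (rule N.torsion_only_all[OF N _ _ nc])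
   show "X1 ^ l * s \<in> M.Sg ((int l, 0) + d)" by (rule M.Sg_mult[OF M.Sg_X(1) s(1)])
  qed (use l nc s(2) in \<open>simp_all add: N.sm_assoc\<close>)
  then have "x ^ k \<odot>\<^bsub>M\<^esub> m \<in> M.tors" using ker_tors[OF R mono_ker[OF R mono] kn] by blast
  then show "\<exists>k. x ^ k \<odot>\<^bsub>M\<^esub> m \<in> M.tors" ..
 qed
qed

end

lemma (in free_mod) torsion_only: "F.torsion_only"
 by (auto simp: F.torsion_only_def F_tors fun_eq_iff)

context weight_type
begin

text \<open>Multiplication by \<open>X1\<close> from a module of rank one into summand 0 is a
  monomorphism, and an inverse would make \<open>X1\<close> a unit.\<close>

lemma FM_not_simple: "\<not> simple_object (cohX p q) (FM n z :: ('k::field) sheaf)"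
proof
 assume s: "simple_object (cohX p q) (FM n z :: 'k sheaf)"
 then have n: "n \<noteq> 0" using FM_zero_iff[of n z] by (auto simp: simple_object_def)
 interpret B: free_mod p q n z "TYPE('k)" by unfold_locales
 let ?w = "\<lambda>_. z 0 + (1, 0)" and ?u = "\<lambda>_ i. X1 ^ 1 * ee 0 i"
 interpret A: free_mod p q 1 ?w "TYPE('k)" by unfold_locales
 interpret AB: free_free_to p q n z 1 ?w B.F by unfold_locales
 interpret BA: free_free p q 1 ?w n z "TYPE('k)" by unfold_locales
 have u: "?u i \<in> B.F.gr (?w i)" for i
  using n Sg_X(1)[of 1, where ?'a = 'k] by (auto simp: B.F_gr ee_def fs_def)
 have "mono_mor (coh p q) A.F B.F (AB.BE.FE.cls (AB.BE.gph ?u))"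
 proof (rule AB.BE.FE.mono_mor_cls)
  show "AB.BE.FE.rel (AB.BE.gph ?u)" by (rule AB.BE.gph_rel) (rule u)
  fix v assume "(v, \<zero>\<^bsub>B.F\<^esub>) \<in> AB.BE.gph ?u"
  then have v: "v \<in> fs 1" "(\<lambda>i. v 0 * (X1 ^ 1 * ee 0 i)) = (\<lambda>_. 0)"
   using n by (auto simp: AB.BE.gph_iff B.F.lc_one fs_def ee_def)
  from fun_cong[OF v(2), of 0] have "v 0 = 0" by (simp add: ee_def)
  moreover have "v i = 0" if "i \<noteq> 0" for i using fsD[OF v(1)] that by simp
  ultimately have "v = (\<lambda>_. 0)" by (metis ext)
  then show "v \<in> A.F.tors" by (simp add: A.F_tors)
 qed
 moreover have "\<not> zero_object (cohX p q) A.F" using FM_zero_iff[of 1 ?w] by simp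
 ultimately have "iso_mor (coh p q) A.F B.F (AB.BE.FE.cls (AB.BE.gph ?u))"
  using s FM_Ob[of 1 ?w] unfolding simple_object_def by blast
 then obtain g where g: "g \<in> Mor (coh p q) B.F A.F"
  "Cmp (coh p q) B.F A.F B.F (AB.BE.FE.cls (AB.BE.gph ?u)) g = Idm (coh p q) B.F" unfolding iso_mor_def by blast
 from AB.AB.Mor_gph[OF g(1)] obtain t where t: "!!i. i < n ==> t i \<in> A.F.gr (z i)" "g = AB.AB.AB.FE.cls (AB.AB.AB.gph t)" by blast
 have lu: "B.F.lc ?u 1 (t i) \<in> B.F.gr (z i)" if "i < n" for i
  by (rule AB.lc_gr[OF t(1) u that])
 have e: "B.F.MM.cls (B.FF.AB.gph (\<lambda>i. B.F.lc ?u 1 (t i))) = B.F.MM.cls (B.FF.AB.gph ee)"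
  using g(2) AB.Cmp_gph[of t ?u, OF t(1) u] B.Idm_gph by (simp add: t(2))
 have "B.F.lc ?u 1 (t 0) = ee 0"
  using B.FF.cls_gph_eq_iff[of "\<lambda>i. B.F.lc ?u 1 (t i)" ee, OF lu B.ee_gr] e n by simp
 then have "t 0 0 * (X1 ^ 1 * ee 0 0) = (1 :: 'k poly poly)"
  using n by (subst (asm) B.F.lc_one) (auto simp: fs_def ee_def fun_eq_iff split: if_splits)
 then have "X1 * t 0 0 = (1 :: 'k poly poly)" by (simp add: ee_def mult.commute)
 then have "cf (X1 * t 0 0) 0 0 = (1 :: 'k)" by (simp add: cf_one)
 then show False by simp
qed

lemma iso_simple:
 assumes s: "simple_object (cohX p q) (Y :: ('k::field) sheaf)" and i: "isomorphic (cohX p q) Y E" and E: "E \<in> Ob (cohX p q)"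
 shows "simple_object (cohX p q) E"
 unfolding simple_object_def
proof (intro conjI ballI allI impI)
 interpret C: category_zero "cohX p q :: ('k sheaf, _) cat" "FM 0 undefined" by (rule cohX_category_zero)
 have Y: "Y \<in> Ob (coh p q)" using s by (simp add: simple_object_def)
 show "E \<in> Ob (coh p q)" by (rule E)
 show "\<not> zero_object (cohX p q) E" using s C.iso_zero[OF _ C.iso_sym[OF i] Y] by (auto simp: simple_object_def)
 from i obtain f g where fg: "f \<in> Mor (coh p q) Y E" "g \<in> Mor (coh p q) E Y"
  "Cmp (coh p q) Y E Y g f = Idm (coh p q) Y" "Cmp (coh p q) E Y E f g = Idm (coh p q) E" by (rule C.isoE)
 fix W h assume W: "W \<in> Ob (cohX p q)" and h: "mono_mor (cohX p q) W E h"
 have hm: "h \<in> Mor (coh p q) W E" using h by (simp add: mono_mor_def)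
 let ?k = "Cmp (coh p q) W E Y g h"
 have "mono_mor (cohX p q) W Y ?k"
  by (rule C.mono_comp[OF W E Y h C.split_mono[OF E Y fg(2,1,4)]])
 then have "zero_object (cohX p q) W \<or> iso_mor (cohX p q) W Y ?k" using s W by (simp add: simple_object_def)
 then show "zero_object (cohX p q) W \<or> iso_mor (cohX p q) W E h"
 proof
  assume "iso_mor (cohX p q) W Y ?k"
  then obtain l where l: "l \<in> Mor (coh p q) Y W" "Cmp (coh p q) W Y W l ?k = Idm (coh p q) W" "Cmp (coh p q) Y W Y ?k l = Idm (coh p q) Y"
   by (auto simp: iso_mor_def)
  have lg: "Cmp (coh p q) E Y W l g \<in> Mor (coh p q) E W" by (rule C.Cmp_Mor[OF E Y W fg(2) l(1)])
  have "Cmp (coh p q) W E W (Cmp (coh p q) E Y W l g) h = Idm (coh p q) W"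
   using l(2) C.Cmp_assoc[OF W E Y W hm fg(2) l(1)] by simp
  moreover have "Cmp (coh p q) E W E h (Cmp (coh p q) E Y W l g) = Idm (coh p q) E"
  proof -
   have hl: "Cmp (coh p q) Y W E h l \<in> Mor (coh p q) Y E" by (rule C.Cmp_Mor[OF Y W E l(1) hm])
   have "Cmp (coh p q) Y E Y g (Cmp (coh p q) Y W E h l) = Idm (coh p q) Y"
    using l(3) C.Cmp_assoc[OF Y W E Y l(1) hm fg(2)] by simp
   then have "Cmp (coh p q) Y Y E f (Idm (coh p q) Y) = Cmp (coh p q) Y W E h l"
    using C.cancel_inv[OF Y E Y fg(2,1,4) hl] by simp
   then have "f = Cmp (coh p q) Y W E h l" using C.Idm_right[OF Y E fg(1)] by simp
   then show ?thesis using fg(4) C.Cmp_assoc[OF E Y W E fg(2) l(1) hm] by simp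
  qed
  ultimately show ?thesis using lg hm by (auto simp: iso_mor_def)
 qed simp
qed

text \<open>A simple subobject would be torsion-free itself, hence isomorphic to a free module, and
  free modules are not simple.\<close>

lemma torsion_only_vector_bundle:
 assumes M: "obj p q (M :: ('k::field) sheaf)" and t: "obj.torsion_only p q M"
 shows "vector_bundle p q M"
 unfolding vector_bundle_def
proof (intro conjI notI)
 show "M \<in> Ob (cohX p q)" using M by (simp add: Ob_iff)
 assume "\<exists>Y f. simple_object (cohX p q) Y \<and> mono_mor (cohX p q) Y M f"
 then obtain Y f where Y: "simple_object (cohX p q) Y" and f: "mono_mor (cohX p q) Y M f" by blast
 then have oY: "obj p q Y" by (simp add: Ob_iff simple_object_def)
 interpret M: obj p q M by (rule M)
 interpret Y: obj p q Y by (rule oY)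
 interpret YM: sheaves p q Y M by unfold_locales
 obtain R where R: "YM.rel R" "f = YM.cls R" using f YM.Mor_iff by (auto simp: mono_mor_def)
 have "Y.torsion_only" using YM.torsion_only_mono[OF R(1)] f t by (simp add: R(2))
 then obtain n z where "isomorphic (cohX p q) Y (FM n z)" using torsion_only_free[OF oY] by blast
 then show False using FM_not_simple iso_simple[OF Y _ FM_Ob] by blast
qed

end

section \<open>Homogeneous primes and the simple subobjects they produce\<close>

context weight_type
begin

text \<open>Homogeneous elements generating a prime ideal: modulo them, every other homogeneous element
 divides a power of each variable.\<close>

definition gprime :: "'k::field poly poly => bool" where
 "gprime f \<longleftrightarrow> (\<forall>e. \<forall>t\<in>Sg e. f dvd t \<or> (\<forall>x\<in>VV. \<exists>k r. f dvd x ^ k - r * t))"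

lemma X1_dvd: "X1 dvd P" if "!!b. cf P 0 b = 0"
 using X1_pow_dvd[of 1 P] that by (auto simp: dvd_def)

lemma X2_dvd: "X2 dvd P" if "!!a. cf P a 0 = 0"
 using X2_pow_dvd[of 1 P] that by (auto simp: dvd_def)

lemma cst_inverse: "c \<noteq> 0 ==> cst (inverse c) * cst c = 1"
 by (simp flip: cst_simps)

lemma cst_diff: "cst (c - d) = cst c - cst d"
 by (rule cf_eqI) (simp add: cf_cst)

text \<open>Distinct powers of \<open>X2\<close> have distinct degrees, so modulo \<open>X1\<close>
  a homogeneous polynomial is a scalar times a single power of \<open>X2\<close>. If it is non-zero
  there, it divides that power, while \<open>X1\<close> becomes 0.\<close>

lemma gprime_X1: "gprime X1"
 unfolding gprime_def disj_imp
proof (intro allI ballI impI)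
 fix e :: "int \<times> int" and t x :: "'a poly poly" assume t: "t \<in> Sg e" "x \<in> VV" and "\<not> X1 dvd t"
 then obtain b where b: "cf t 0 b \<noteq> 0" using X1_dvd by blast
 have u: "b' = b" if "cf t 0 b' \<noteq> 0" for b'
  using trans[OF SgD[OF t(1) that] SgD[OF t(1) b, symmetric]] by (simp only: D_axis2 of_nat_eq_iff)
 have "X1 dvd X2 ^ b - cst (inverse (cf t 0 b)) * t"
 proof (rule X1_dvd)
  fix b'
  have "cf t 0 b' = 0" if "b' \<noteq> b" using u[of b'] that by blast
  then show "cf (X2 ^ b - cst (inverse (cf t 0 b)) * t) 0 b' = 0"
   using b cf_X2_pow[of b 1 0 b'] by (cases "b' = b") (auto simp: cf_one)
 qed
 moreover have "X1 dvd X1 ^ 1 - 0 * t" by simp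
 ultimately show "\<exists>k r. X1 dvd x ^ k - r * t" using t(2) by blast
qed

lemma gprime_X2: "gprime X2"
 unfolding gprime_def disj_imp
proof (intro allI ballI impI)
 fix e :: "int \<times> int" and t x :: "'a poly poly" assume t: "t \<in> Sg e" "x \<in> VV" and "\<not> X2 dvd t"
 then obtain a where a: "cf t a 0 \<noteq> 0" using X2_dvd by blast
 have u: "a' = a" if "cf t a' 0 \<noteq> 0" for a'
  using trans[OF SgD[OF t(1) that] SgD[OF t(1) a, symmetric]] by (simp only: D_axis1 of_nat_eq_iff)
 have "X2 dvd X1 ^ a - cst (inverse (cf t a 0)) * t"
 proof (rule X2_dvd)
  fix a'
  have "cf t a' 0 = 0" if "a' \<noteq> a" using u[of a'] that by blast
  then show "cf (X1 ^ a - cst (inverse (cf t a 0)) * t) a' 0 = 0"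
   using a cf_X1_pow[of a 1 a' 0] by (cases "a' = a") (auto simp: cf_one)
 qed
 moreover have "X2 dvd X2 ^ 1 - 0 * t" by simp
 ultimately show "\<exists>k r. X2 dvd x ^ k - r * t" using t(2) by blast
qed

text \<open>For \<open>c \<noteq> 0\<close> the equation of an ordinary point of the weighted
  projective line; the two remaining points are given by \<open>X1\<close> and
  \<open>X2\<close>.\<close>

definition pencil :: "'k::field => 'k poly poly" where
 "pencil c = X1 ^ p - cst c * X2 ^ q"

lemma cst_pow: "cst (c ^ n) = cst c ^ n"
 by (induction n) (simp_all add: cst_simps)

text \<open>Modulo the pencil \<open>X1 ^ p\<close> is congruent to \<open>cst c * X2 ^ q\<close>,
  and a difference of k-th powers is divisible by the difference of the bases.\<close>

lemma pencil_shift: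
 "pencil c dvd X1 ^ (a + k * p) * X2 ^ b - cst (c ^ k) * (X1 ^ a * X2 ^ (b + k * q))"
proof -
 have "pencil c dvd (X1 ^ p) ^ k - (cst c * X2 ^ q) ^ k"
  by (subst power_diff_sumr2) (simp add: pencil_def)
 then have *: "pencil c dvd X1 ^ a * X2 ^ b * ((X1 ^ p) ^ k - (cst c * X2 ^ q) ^ k)" by (rule dvd_mult)
 have e: "(X1 ^ p) ^ k = (X1 :: 'a poly poly) ^ (k * p)" "(cst c * X2 ^ q) ^ k = cst (c ^ k) * X2 ^ (k * q)"
  by (simp_all add: power_mult_distrib cst_pow power_mult[symmetric] mult.commute)
 show ?thesis using * unfolding e by (simp add: power_add algebra_simps)
qed

lemma solve_coefficient:
 fixes i :: "'a::comm_ring_1"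
 assumes "i * d = 1" shows "- i * (v - d * w) = w - i * v"
 using assms by (simp add: right_diff_distrib mult.assoc[symmetric])

lemma solve_remainder:
 fixes i :: "'a::comm_ring_1"
 assumes "i * d = 1" shows "(x - e * (y * m)) - (e * y * i) * (t - d * m) = x - (e * y * i) * t"
proof -
 have "(e * y * i) * (t - d * m) = (e * y * i) * t - (i * d) * (e * (y * m))" by (simp add: algebra_simps)
 then show ?thesis using assms by simp
qed

text \<open>Monomials of equal degree differ by exchanging powers of \<open>X1 ^ p\<close> for
  powers of \<open>X2 ^ q\<close>. One direction of the exchange costs a power of \<open>c\<close>,
  the other its inverse.\<close>

lemma pencil_mon:
 assumes c: "c \<noteq> 0" and D: "D (int a, int b) = D (int a', int b')"
 shows "\<exists>d. pencil c dvd X1 ^ a * X2 ^ b - cst d * (X1 ^ a' * X2 ^ b')"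
proof -
 obtain k where k: "int a = int a' + k * int p" "int b = int b' - k * int q" using D by (auto simp: D_eq_iff)
 show ?thesis
 proof (cases "k \<ge> 0")
  case True
  then have "a = a' + nat k * p" "b' = b + nat k * q" using k by (simp_all flip: of_nat_eq_iff[where 'a = int])
  then show ?thesis using pencil_shift[of c a' "nat k" b] by auto
 next
  case False
  define l where "l = nat (- k)"
  have "a' = a + l * p" "b = b' + l * q" using k False by (simp_all add: l_def flip: of_nat_eq_iff[where 'a = int])
  then have "pencil c dvd X1 ^ a' * X2 ^ b' - cst (c ^ l) * (X1 ^ a * X2 ^ b)" using pencil_shift[of c a l b'] by simp
  then have "pencil c dvd - cst (inverse (c ^ l)) * (X1 ^ a' * X2 ^ b' - cst (c ^ l) * (X1 ^ a * X2 ^ b))" by (rule dvd_mult)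
  also have "\<dots> = X1 ^ a * X2 ^ b - cst (inverse (c ^ l)) * (X1 ^ a' * X2 ^ b')"
   by (rule solve_coefficient) (use c cst_inverse[of "c ^ l"] in simp)
  finally show ?thesis by blast
 qed
qed

text \<open>Modulo the pencil a homogeneous \<open>t\<close> is a scalar multiple of any one of its
  monomials, and that monomial divides a power of each variable up to a scalar.\<close>

lemma gprime_pencil:
 assumes c: "c \<noteq> 0" shows "gprime (pencil c)"
 unfolding gprime_def disj_imp
proof (intro allI ballI impI)
 fix e :: "int \<times> int" and t x :: "'a poly poly" assume t: "t \<in> Sg e" "x \<in> VV" and nd: "\<not> pencil c dvd t"
 have "t \<noteq> 0" using nd by auto
 then obtain a b where ab: "cf t a b \<noteq> 0" using cf_eqI[of t 0] by auto
 let ?m = "X1 ^ a * X2 ^ b :: 'a poly poly"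
 have "\<exists>d. pencil c dvd (\<Sum>(i, j)\<in>A. mnm (cf t i j) i j) - cst d * ?m"
  if "finite A" "A \<subseteq> {(i, j). cf t i j \<noteq> 0}" for A
  using that
 proof (induction A)
  case empty
  show ?case by (auto intro: exI[of _ 0] simp: cst_simps)
 next
  case (insert y A)
  obtain i j where y: "y = (i, j)" "cf t i j \<noteq> 0" using insert.prems by auto
  obtain d where "pencil c dvd (\<Sum>(i, j)\<in>A. mnm (cf t i j) i j) - cst d * ?m" using insert.IH insert.prems by blast
  moreover obtain d' where "pencil c dvd X1 ^ i * X2 ^ j - cst d' * ?m"
   using pencil_mon[OF c] SgD[OF t(1) y(2)] SgD[OF t(1) ab] by metis
  ultimately have "pencil c dvd (\<Sum>(i, j)\<in>A. mnm (cf t i j) i j) - cst d * ?m + cst (cf t i j) * (X1 ^ i * X2 ^ j - cst d' * ?m)"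
   by (intro dvd_add dvd_mult)
  also have "\<dots> = (\<Sum>(i, j)\<in>insert y A. mnm (cf t i j) i j) - cst (d + cf t i j * d') * ?m"
   using insert by (simp add: y(1) mnm_def cst_simps algebra_simps)
  finally show ?case by blast
 qed
 from this[OF finite_cf order_refl] obtain d where d: "pencil c dvd t - cst d * ?m"
  by (simp only: sum_mon[symmetric]) blast
 have d0: "d \<noteq> 0" using d nd by (auto simp: cst_simps)
 have *: "\<exists>k r. pencil c dvd x ^ k - r * t" if "pencil c dvd x ^ k - cst d' * (y * ?m)" for k d' y
 proof -
  have "pencil c dvd (x ^ k - cst d' * (y * ?m)) - (cst d' * y * cst (inverse d)) * (t - cst d * ?m)"
   by (rule dvd_diff[OF that dvd_mult[OF d]])
  also have "\<dots> = x ^ k - (cst d' * y * cst (inverse d)) * t"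
   by (rule solve_remainder[OF cst_inverse[OF d0]])
  finally show ?thesis by blast
 qed
 \<comment> \<open>The point on the right is \<open>(a, q * b)\<close>. Its second coordinate is
   written as \<open>b + (q - 1) * b\<close> to exhibit the factor \<open>X2 ^ b\<close> of the
   monomial.\<close>
 have e1: "D (int (a + p * b), int 0) = D (int a, int (b + (q - 1) * b))"
  unfolding D_eq_iff using q_pos by (intro exI[of _ "int b"]) (simp add: algebra_simps of_nat_diff)
 have e2: "D (int 0, int (b + q * a)) = D (int (a + (p - 1) * a), int b)"
  unfolding D_eq_iff using p_pos by (intro exI[of _ "- int a"]) (simp add: algebra_simps of_nat_diff)
 show "\<exists>k r. pencil c dvd x ^ k - r * t"
 proof (cases "x = X1")
  case True
  obtain d' where "pencil c dvd X1 ^ (a + p * b) * X2 ^ 0 - cst d' * (X1 ^ a * X2 ^ (b + (q - 1) * b))" using pencil_mon[OF c e1] by blast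
  then show ?thesis using True by (intro *[of "a + p * b" d' "X2 ^ ((q - 1) * b)"]) (simp add: power_add mult_ac)
 next
  case False
  then have "x = X2" using t(2) by simp
  moreover obtain d' where "pencil c dvd X1 ^ 0 * X2 ^ (b + q * a) - cst d' * (X1 ^ (a + (p - 1) * a) * X2 ^ b)" using pencil_mon[OF c e2] by blast
  ultimately show ?thesis by (intro *[of "b + q * a" d' "X1 ^ ((p - 1) * a)"]) (simp add: power_add mult_ac)
 qed
qed

text \<open>For \<open>f\<close> of degree at most \<open>n\<close>, the binary form of degree
  \<open>n\<close> in \<open>X1 ^ p\<close> and \<open>X2 ^ q\<close> whose dehomogenisation is
  \<open>f\<close>.\<close>

definition homogenize :: "nat => 'k::field poly => 'k poly poly" where
 "homogenize n f = (\<Sum>j\<le>n. cst (coeff f j) * (X1 ^ (j * p) * X2 ^ ((n - j) * q)))"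

lemma homogenize_Sg: "homogenize n f \<in> Sg (0, int (n * q))"
 unfolding homogenize_def
proof (rule Sg_sum)
 fix j assume "j \<in> {..n}"
 then have "D (int (j * p), int ((n - j) * q)) = D (0, int (n * q))"
  unfolding D_eq_iff by (intro exI[of _ "int j"]) (simp add: algebra_simps of_nat_diff)
 then show "cst (coeff f j) * (X1 ^ (j * p) * X2 ^ ((n - j) * q)) \<in> Sg (0, int (n * q))"
  using Sg_mon[of "coeff f j" "j * p" "(n - j) * q"] Sg_cong by (metis mnm_def)
qed

text \<open>A linear factor of the dehomogenisation corresponds to a pencil dividing the
  form.\<close>

lemma homogenize_root:
 assumes "degree g \<le> n"
 shows "homogenize (Suc n) ([:- c, 1:] * g) = pencil c * homogenize n g"
proof -
 let ?m = "\<lambda>n j. X1 ^ (j * p) * X2 ^ ((n - j) * q) :: 'a poly poly"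
 have "[:- c, 1:] * g = pCons 0 g - smult c g" by simp
 then have "homogenize (Suc n) ([:- c, 1:] * g) =
   (\<Sum>j\<le>Suc n. cst (coeff (pCons 0 g) j) * ?m (Suc n) j) - (\<Sum>j\<le>Suc n. cst c * (cst (coeff g j) * ?m (Suc n) j))"
  unfolding homogenize_def by (simp only: sum_subtractf[symmetric]) (rule sum.cong; simp add: cst_simps cst_diff left_diff_distrib mult.assoc)
 also have "(\<Sum>j\<le>Suc n. cst (coeff (pCons 0 g) j) * ?m (Suc n) j) = (\<Sum>j\<le>n. cst (coeff g j) * ?m (Suc n) (Suc j))"
  by (subst sum.atMost_Suc_shift) (simp add: cst_simps)
 also have "\<dots> = X1 ^ p * homogenize n g"
  unfolding homogenize_def sum_distrib_left by (rule sum.cong) (simp_all add: power_add mult_ac)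
 also have "(\<Sum>j\<le>Suc n. cst c * (cst (coeff g j) * ?m (Suc n) j)) = (\<Sum>j\<le>n. cst c * (cst (coeff g j) * ?m (Suc n) j))"
  using assms by (simp add: coeff_eq_0 cst_simps)
 also have "\<dots> = cst c * X2 ^ q * homogenize n g"
  unfolding homogenize_def sum_distrib_left by (rule sum.cong) (simp_all add: Suc_diff_le power_add mult_ac)
 finally show ?thesis by (simp add: pencil_def algebra_simps)
qed

text \<open>If neither variable divides \<open>s\<close>, a pure power of each occurs, and
  homogeneity makes \<open>s\<close> a binary form in \<open>X1 ^ p\<close> and
  \<open>X2 ^ q\<close>; a root of its dehomogenisation splits off a pencil. The weight
  \<open>q * a + p * b\<close> depends only on the degree and drops with every factor, which makes
  the factorisation terminate.\<close>

lemma homogeneous_factor: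
 fixes s :: "'k::alg_closed_field poly poly"
 assumes s: "s \<in> Sg e" "s \<noteq> 0" and w: "!!a b. cf s a b \<noteq> 0 ==> q * a + p * b = n"
 shows "(n = 0 \<and> s = cst (cf s 0 0)) \<or> (\<exists>f t e' n'. gprime f \<and> s = f * t \<and> t \<in> Sg e' \<and> n' < n \<and> (\<forall>a b. cf t a b \<noteq> 0 --> q * a + p * b = n'))"
proof -
 consider "!!b. cf s 0 b = 0" | "!!a. cf s a 0 = 0" | a b where "cf s 0 b \<noteq> 0" "cf s a 0 \<noteq> 0" by blast
 then show ?thesis
 proof cases
  case 1
  then obtain t where t: "s = X1 * t" using X1_dvd[of s] by (auto simp: dvd_def)
  have "q * a + p * b = n - q \<and> q \<le> n" if "cf t a b \<noteq> 0" for a b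
   using w[of "Suc a" b] that by (simp add: t)
  moreover obtain a b where "cf t a b \<noteq> 0" using s(2) cf_eqI[of t 0] by (auto simp: t)
  moreover have "t \<in> Sg (e - (int 1, 0))" using s(1) Sg_X1_mult[of 1 t e] by (simp add: t)
  ultimately show ?thesis using gprime_X1 t q_pos by (intro disjI2 exI[of _ X1] exI[of _ t] exI[of _ "e - (int 1, 0)"] exI[of _ "n - q"]) force
 next
  case 2
  then obtain t where t: "s = X2 * t" using X2_dvd[of s] by (auto simp: dvd_def)
  have "q * a + p * b = n - p \<and> p \<le> n" if "cf t a b \<noteq> 0" for a b
   using w[of a "Suc b"] that by (simp add: t)
  moreover obtain a b where "cf t a b \<noteq> 0" using s(2) cf_eqI[of t 0] by (auto simp: t)
  moreover have "t \<in> Sg (e - (0, int 1))" using s(1) Sg_X2_mult[of 1 t e] by (simp add: t)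
  ultimately show ?thesis using gprime_X2 t p_pos by (intro disjI2 exI[of _ X2] exI[of _ t] exI[of _ "e - (0, int 1)"] exI[of _ "n - p"]) force
 next
  case (3 a b)
  have De: "D e = D (int a, 0)" "D (0, int b) = D (int a, 0)" using SgD[OF s(1) 3(1)] SgD[OF s(1) 3(2)] by simp_all
  \<comment> \<open>The two pure powers have equal degree, so their exponents are the same multiple
    \<open>l\<close> of \<open>p\<close> and of \<open>q\<close>.\<close>
  obtain k0 where "0 = int a + k0 * int p" "int b = - (k0 * int q)" using De(2) by (auto simp: D_eq_iff)
  then obtain k where k: "int a = k * int p" "int b = k * int q" using that[of "- k0"] by auto
  then have "0 \<le> k" using p_pos by (metis of_nat_0_le_iff of_nat_0_less_iff zero_le_mult_iff linorder_not_le mult_less_0_iff)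
  then obtain l where l: "k = int l" using zero_le_imp_eq_int by blast
  have ab: "a = l * p" "b = l * q" using k unfolding l by (metis of_nat_eq_iff of_nat_mult)+
  have supp: "\<exists>j\<le>l. i = j * p \<and> i' = (l - j) * q" if ii: "cf s i i' \<noteq> 0" for i i'
  proof -
   have "D (int i, int i') = D (0, int b)" using SgD[OF s(1) ii] De by simp
   then obtain j where j: "int i = j * int p" "int i' = (int l - j) * int q" by (auto simp: D_eq_iff ab algebra_simps)
   have "0 \<le> j" "j \<le> int l"
    using j p_pos q_pos zero_le_mult_iff[of j "int p"] zero_le_mult_iff[of "int l - j" "int q"] by auto
   then obtain j' where j': "j = int j'" "j' \<le> l" using zero_le_imp_eq_int by fastforce
   have "int i = int (j' * p)" "int i' = int ((l - j') * q)" using j j' by (simp_all add: of_nat_diff)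
   then show ?thesis using j'(2) by (metis of_nat_eq_iff)
  qed
  define f where "f = (\<Sum>j\<le>l. monom (cf s (j * p) ((l - j) * q)) j)"
  have cff: "coeff f j = (if j \<le> l then cf s (j * p) ((l - j) * q) else 0)" for j
   by (simp add: f_def coeff_sum)
  have sf: "s = homogenize l f"
  proof (rule cf_eqI)
   fix i i'
   have "cf (homogenize l f) i i' = (\<Sum>j\<le>l. if i = j * p \<and> i' = (l - j) * q then cf s i i' else 0)"
    unfolding homogenize_def cf_sum by (rule sum.cong) (use cff in \<open>auto simp: mnm_def[symmetric] cf_mon\<close>)
   also have "\<dots> = cf s i i'"
   proof (cases "cf s i i' = 0")
    case False
    then obtain j where j: "j \<le> l" "i = j * p" "i' = (l - j) * q" using supp by blast
    have "(\<Sum>j'\<le>l. if i = j' * p \<and> i' = (l - j') * q then cf s i i' else 0) = (\<Sum>j'\<le>l. if j' = j then cf s i i' else 0)"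
     by (rule sum.cong) (use j p_pos in auto)
    then show ?thesis using j(1) by simp
   next
    case True
    show ?thesis by (simp only: True if_cancel sum.neutral_const)
   qed
   finally show "cf s i i' = cf (homogenize l f) i i'" by simp
  qed
  show ?thesis
  proof (cases l)
   case 0
   then have "s = cst (cf s 0 0)" using sf cff[of 0] by (simp add: homogenize_def)
   then show ?thesis using w[OF 3(1)] 0 ab by simp
  next
   case (Suc l')
   have f0: "coeff f l \<noteq> 0" "coeff f 0 \<noteq> 0" using 3 cff[of l] cff[of 0] ab by simp_all
   then have "degree f > 0" using le_degree[of f l] Suc by simp
   then obtain c where c: "poly f c = 0" using alg_closed_imp_poly_has_root by blast
   \<comment> \<open>The constant coefficient of \<open>f\<close> belongs to the pure power of
     \<open>X2\<close> in \<open>s\<close> and does not vanish.\<close>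
   have "c \<noteq> 0" using c f0(2) by (auto simp: poly_0_coeff_0)
   obtain g where g: "f = [:- c, 1:] * g" using c by (auto simp: poly_eq_0_iff_dvd dvd_def)
   have "degree f \<le> l" by (rule degree_le) (simp add: cff)
   moreover have "f \<noteq> 0" using f0 by auto
   then have "g \<noteq> 0" using g by auto
   then have "degree f = 1 + degree g" unfolding g by (subst degree_mult_eq) simp_all
   ultimately have dg: "degree g \<le> l'" using Suc by simp
   have sg: "s = pencil c * homogenize l' g" using sf homogenize_root[OF dg, of c] Suc g by simp
   have wg: "q * i + p * i' = l' * q * p" if "cf (homogenize l' g) i i' \<noteq> 0" for i i'
   proof -
    have "D (int i, int i') = D (0, int (l' * q))" by (rule SgD[OF homogenize_Sg that])
    then obtain j where j: "int i = j * int p" "int i' = int (l' * q) - j * int q" by (auto simp: D_eq_iff)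
    have "int (q * i + p * i') = int (l' * q * p)"
     by (simp only: of_nat_add[of "q * i"] of_nat_mult[of _ i] of_nat_mult[of _ i'] j) (simp add: algebra_simps)
    then show ?thesis by (metis of_nat_eq_iff)
   qed
   have "n = l * q * p" using w[OF 3(1)] ab by (simp add: mult_ac)
   then have "l' * q * p < n" using Suc p_pos q_pos by simp
   then show ?thesis using gprime_pencil[OF \<open>c \<noteq> 0\<close>] sg homogenize_Sg wg by blast
  qed
 qed
qed

text \<open>Factors of \<open>s\<close> are split off one at a time. If the cofactor
  \<open>t\<close> still sends \<open>m\<close> to torsion, the weight has dropped; otherwise
  \<open>t \<odot> m\<close> is a non-torsion element that the prime factor sends to
  torsion.\<close>

lemma torsion_prime:
 fixes M :: "('k::alg_closed_field poly poly, 'b) gmod"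
 assumes M: "obj p q M" and m: "m \<in> graded_mod.gr p q M u" "m \<notin> graded_mod.tors M"
  and s: "s \<in> Sg e" "s \<noteq> 0" "s \<odot>\<^bsub>M\<^esub> m \<in> graded_mod.tors M"
  and w: "!!a b. cf s a b \<noteq> 0 ==> q * a + p * b = n"
 shows "\<exists>f m' u'. gprime f \<and> m' \<in> graded_mod.gr p q M u' \<and> m' \<notin> graded_mod.tors M \<and> f \<odot>\<^bsub>M\<^esub> m' \<in> graded_mod.tors M"
proof -
 interpret M: obj p q M by (rule M)
 have mc: "m \<in> carrier M" by (rule M.gr_closed(1)[OF m(1)])
 show ?thesis
  using s w
 proof (induction n arbitrary: s e rule: less_induct)
  case (less n)
  from homogeneous_factor[OF less.prems(1,2), of n] less.prems(4)
  consider "s = cst (cf s 0 0)" | f t e' n' where "gprime f" "s = f * t" "t \<in> Sg e'" "n' < n" "!!a b. cf t a b \<noteq> 0 ==> q * a + p * b = n'"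
   by blast
  then show ?case
  proof cases
   case 1
   then have c: "cf s 0 0 \<noteq> 0" using less.prems(2) cst_simps(1) by metis
   have "cst (inverse (cf s 0 0)) * s = 1" using c by (subst 1) (simp flip: cst_simps)
   then have "m = cst (inverse (cf s 0 0)) \<odot>\<^bsub>M\<^esub> (s \<odot>\<^bsub>M\<^esub> m)" using mc by (simp flip: M.sm_assoc)
   then show ?thesis using m(2) M.torsD(4)[OF less.prems(3)] by metis
  next
   case (2 f t e' n')
   show ?thesis
   proof (cases "t \<odot>\<^bsub>M\<^esub> m \<in> M.tors")
    case True
    have "t \<noteq> 0" using less.prems(2) 2(2) by auto
    then show ?thesis using less.IH[OF 2(4,3) _ True 2(5)] by blast
   next
    case False
    have "f \<odot>\<^bsub>M\<^esub> (t \<odot>\<^bsub>M\<^esub> m) \<in> M.tors" using less.prems(3) mc 2(2) by (simp add: M.sm_assoc)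
    then show ?thesis using 2(1) M.gr_smult[OF 2(3) m(1)] False by blast
   qed
  qed
 qed
qed

text \<open>The submodule generated by \<open>m\<close> is a simple object. A non-zero subobject
  reaches \<open>t \<odot> m\<close> for a homogeneous \<open>t\<close> not divisible by
  \<open>f\<close>; then a power of each variable lies in the ideal of \<open>f\<close> and
  \<open>t\<close>, so the subobject is everything up to torsion.\<close>

lemma cyclic_simple:
 fixes M :: "('k::field) sheaf"
 assumes M: "obj p q M" and f: "gprime f" and m: "m \<in> graded_mod.gr p q M u" "m \<notin> graded_mod.tors M"
  and fm: "f \<odot>\<^bsub>M\<^esub> m \<in> graded_mod.tors M"
 shows "\<not> vector_bundle p q M"
proof -
 interpret M: obj p q M by (rule M)
 have mc: "m \<in> carrier M" by (rule M.gr_closed(1)[OF m(1)])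
 define N where "N = range (\<lambda>r. r \<odot>\<^bsub>M\<^esub> m)"
 have N: "M.gsub N"
  unfolding M.gsub_def M.subm_def
 proof (intro conjI ballI allI)
  show "N \<subseteq> carrier M" using mc by (auto simp: N_def)
  show "\<zero>\<^bsub>M\<^esub> \<in> N" unfolding N_def by (rule range_eqI[of _ _ 0]) (simp add: mc)
 next
  fix a b assume "a \<in> N" "b \<in> N"
  then obtain r r' where "a = r \<odot>\<^bsub>M\<^esub> m" "b = r' \<odot>\<^bsub>M\<^esub> m" by (auto simp: N_def)
  then show "a \<oplus>\<^bsub>M\<^esub> b \<in> N" unfolding N_def by (intro range_eqI[of _ _ "r + r'"]) (simp add: M.sm_ladd mc)
 next
  fix s a assume "a \<in> N"
  then obtain r where "a = r \<odot>\<^bsub>M\<^esub> m" by (auto simp: N_def)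
  then show "s \<odot>\<^bsub>M\<^esub> a \<in> N" unfolding N_def by (intro range_eqI[of _ _ "s * r"]) (simp add: M.sm_assoc mc)
 next
  fix a x assume "a \<in> N" and x: "x \<in> carrier L"
  then obtain r where "a = r \<odot>\<^bsub>M\<^esub> m" by (auto simp: N_def)
  then show "M.comp x a \<in> N" using M.comp_smult_hom[OF m(1)] L_cases[OF x] by (metis N_def rangeI)
 qed
 interpret W: obj p q "M.subo N" by (rule M.subo_obj[OF N])
 interpret WM: two p q "M.subo N" M by unfold_locales
 have Nc: "N \<subseteq> carrier M" "m \<in> N" using N M.sm_one[OF mc] by (auto simp: M.gsub_def M.subm_def N_def intro: range_eqI[of _ _ 1])
 have Wt: "a \<in> W.tors \<longleftrightarrow> a \<in> M.tors" if "a \<in> N" for a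
  using that Nc by (auto simp: W.tors_def M.tors_def W.sat_def M.sat_def)
 have "simple_object (cohX p q) (M.subo N)"
  unfolding simple_object_def
 proof (intro conjI ballI allI impI)
  show "M.subo N \<in> Ob (cohX p q)" using W.obj_axioms by (simp add: Ob_iff)
  show "\<not> zero_object (cohX p q) (M.subo N)" using Wt m(2) Nc(2) by (auto simp: W.zero_object_iff)
 next
  fix Y h assume "Y \<in> Ob (cohX p q)" and h: "mono_mor (cohX p q) Y (M.subo N) h"
  then interpret Y: obj p q Y by (simp add: Ob_iff)
  interpret YW: sheaves p q Y "M.subo N" by unfold_locales
  obtain R where R: "YW.rel R" "h = YW.cls R" using h YW.Mor_iff by (auto simp: mono_mor_def)
  note r = YW.rel_rsub[OF R(1)]
  have ker: "a \<in> Y.tors" if "(a, b) \<in> R" "b \<in> W.tors" for a b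
   using YW.ker_tors[OF R(1) YW.mono_ker[OF R(1)] that] h by (simp add: R(2))
  show "zero_object (cohX p q) Y \<or> iso_mor (cohX p q) Y (M.subo N) h"
  proof (rule disjCI)
   assume "\<not> iso_mor (cohX p q) Y (M.subo N) h"
   show "zero_object (cohX p q) Y"
    unfolding Y.zero_object_iff
   proof (rule ccontr)
    assume "\<not> carrier Y \<subseteq> Y.tors"
    then obtain y v where y: "y \<in> carrier Y" "Y.comp (D v) y \<notin> Y.tors" using Y.hom_not_tors by blast
    let ?y = "Y.comp (D v) y"
    have yc: "?y \<in> carrier Y" "?y \<in> Y.gr v" using y(1) Y.comp_gr by simp_all
    \<comment> \<open>By the contrapositive of \<open>tors_tors\<close> some variable has no power
      that makes the element torsion. Using this variable to enter the domain of \<open>R\<close>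
      keeps the element non-torsion.\<close>
    then obtain x where x: "x \<in> VV" "!!k. x ^ k \<odot>\<^bsub>Y\<^esub> ?y \<notin> Y.tors" using Y.tors_tors y(2) by blast
    obtain k n where kn: "(x ^ k \<odot>\<^bsub>Y\<^esub> ?y, n) \<in> R" using YW.rel_dom[OF R(1) yc(1) x(1)] by blast
    obtain d where d: "x ^ k \<in> Sg d" using M.X_hom[OF x(1)] by blast
    \<comment> \<open>Since the argument is homogeneous, the value may be replaced by its component,
      which makes the multiplier \<open>t\<close> of \<open>m\<close> homogeneous.\<close>
    have "Y.comp (D (d + v)) (x ^ k \<odot>\<^bsub>Y\<^esub> ?y) = x ^ k \<odot>\<^bsub>Y\<^esub> ?y"
     by (subst Y.comp_hom[OF Y.gr_smult[OF d yc(2)]]) simp_all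
    then have kn': "(x ^ k \<odot>\<^bsub>Y\<^esub> ?y, W.comp (D (d + v)) n) \<in> R" using YW.rsubD(6)[OF r kn, of "D (d + v)"] by simp
    have nW: "n \<in> N" using YW.rsubD(2)[OF r kn] by simp
    then obtain r0 where r0: "n = r0 \<odot>\<^bsub>M\<^esub> m" by (auto simp: N_def)
    have mW: "m \<in> W.gr u" using m(1) Nc(2) by (simp add: W.gr_def M.gr_def)
    define t where "t = pt (D (d + v - u)) r0"
    have t: "t \<in> Sg (d + v - u)" unfolding t_def by (rule pt_Sg)
    have nt: "W.comp (D (d + v)) n = t \<odot>\<^bsub>M\<^esub> m" using W.comp_smult_hom[OF mW, of "d + v" r0] by (simp add: r0 t_def)
    have tN: "t \<odot>\<^bsub>M\<^esub> m \<in> N" by (simp add: N_def)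
    have tm: "t \<odot>\<^bsub>M\<^esub> m \<notin> M.tors" using ker[OF kn'] x(2) Wt[OF tN] by (auto simp: nt)
    have "\<not> f dvd t"
    proof
     assume "f dvd t"
     then obtain s where "t = s * f" by (auto simp: dvd_def mult.commute)
     then show False using tm M.torsD(4)[OF fm, of s] by (simp add: M.sm_assoc mc)
    qed
    then have ex: "\<exists>k r. f dvd x ^ k - r * t" if "x \<in> VV" for x using f t that \<open>\<not> f dvd t\<close> unfolding gprime_def by blast
    have "iso_mor (coh p q) Y (M.subo N) (YW.cls R)"
    proof (rule YW.iso_mor_cls[OF R(1)])
     fix a assume "(a, \<zero>\<^bsub>M.subo N\<^esub>) \<in> R"
     then show "a \<in> Y.tors" using ker W.torsD(2) by blast
    next
     show "carrier (M.subo N) \<subseteq> W.sat (Range R)"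
     proof (rule subsetI, rule W.satI)
      fix n :: "nat => 'k poly poly" and x' :: "'k poly poly" assume n: "n \<in> carrier (M.subo N)" and "x' \<in> VV"
      then obtain r' where r': "n = r' \<odot>\<^bsub>M\<^esub> m" by (auto simp: N_def)
      obtain j c g where g: "x' ^ j - c * t = f * g" using ex[OF \<open>x' \<in> VV\<close>] by (auto simp: dvd_def)
      have "r' \<odot>\<^bsub>M\<^esub> (g \<odot>\<^bsub>M\<^esub> (f \<odot>\<^bsub>M\<^esub> m)) \<in> M.tors" using fm M.torsD(4) by blast
      then obtain l where l: "x' ^ l \<odot>\<^bsub>M\<^esub> (r' \<odot>\<^bsub>M\<^esub> (g \<odot>\<^bsub>M\<^esub> (f \<odot>\<^bsub>M\<^esub> m))) = \<zero>\<^bsub>M\<^esub>" using M.torsE \<open>x' \<in> VV\<close> by blast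
      \<comment> \<open>The part divisible by \<open>f\<close> acts on \<open>m\<close> as zero by
        the choice of \<open>l\<close>; the rest is a multiple of \<open>t\<close>.\<close>
      have "x' ^ (l + j) * r' = x' ^ l * (r' * (g * f)) + x' ^ l * r' * c * t"
      proof -
       have "x' ^ j = f * g + c * t" using g by (simp add: algebra_simps)
       then show ?thesis by (simp add: power_add algebra_simps)
      qed
      then have "x' ^ (l + j) \<odot>\<^bsub>M\<^esub> n = (x' ^ l * r' * c) \<odot>\<^bsub>M\<^esub> (t \<odot>\<^bsub>M\<^esub> m)"
       using l mc by (simp add: r' M.sm_ladd flip: M.sm_assoc)
      also have "\<dots> \<in> Range R" using YW.rsubD(5)[OF r kn', of "x' ^ l * r' * c"] by (auto simp: nt)
      finally show "\<exists>k. x' ^ k \<odot>\<^bsub>M.subo N\<^esub> n \<in> Range R" by auto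
     qed
    qed
    then show False using \<open>\<not> iso_mor (cohX p q) Y (M.subo N) h\<close> by (simp add: R(2))
   qed
  qed
 qed
 moreover have "WM.rel (Id_on N)" by (rule M.subo_incl[OF N])
 then have "mono_mor (cohX p q) (M.subo N) M (WM.cls (Id_on N))"
  by (rule WM.mono_mor_cls) (use W.torsD(2) in auto)
 ultimately show ?thesis unfolding vector_bundle_def by blast
qed

text \<open>All monomials of a homogeneous polynomial have the same weight, so a homogeneous
  annihilator of a non-torsion element leads through \<open>torsion_prime\<close> and
  \<open>cyclic_simple\<close> to a simple subobject.\<close>

lemma vector_bundle_iff:
 "vector_bundle p q (M :: ('k::alg_closed_field) sheaf) \<longleftrightarrow> (\<exists>n z. M \<in> Ob (cohX p q) \<and> isomorphic (cohX p q) M (FM n z))"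
proof
 assume v: "vector_bundle p q M"
 then have M: "obj p q M" by (simp add: vector_bundle_def Ob_iff)
 interpret M: obj p q M by (rule M)
 have "M.torsion_only"
  unfolding M.torsion_only_def
 proof (intro allI impI, rule ccontr)
  fix e u s m assume s: "s \<in> Sg e" "s \<noteq> 0" and m: "m \<in> M.gr u" "m \<notin> M.tors" and sm: "s \<odot>\<^bsub>M\<^esub> m = \<zero>\<^bsub>M\<^esub>"
  obtain a b where ab: "cf s a b \<noteq> 0" using s(2) cf_eqI[of s 0] by auto
  have w: "q * a' + p * b' = q * a + p * b" if a': "cf s a' b' \<noteq> 0" for a' b'
  proof -
   have "D (int a', int b') = D (int a, int b)" using SgD[OF s(1) a'] SgD[OF s(1) ab] by simp
   then obtain k where k: "int a' = int a + k * int p" "int b' = int b - k * int q" by (auto simp: D_eq_iff)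
   have "int (q * a' + p * b') = int (q * a + p * b)"
    by (simp only: of_nat_add of_nat_mult k) (simp add: algebra_simps)
   then show ?thesis by (metis of_nat_eq_iff)
  qed
  have "s \<odot>\<^bsub>M\<^esub> m \<in> M.tors" using sm M.torsD(2) by simp
  from torsion_prime[OF M m s this w] obtain f m' u' where
   "gprime f" "m' \<in> M.gr u'" "m' \<notin> M.tors" "f \<odot>\<^bsub>M\<^esub> m' \<in> M.tors" by blast
  then show False using cyclic_simple[OF M] v by blast
 qed
 then show "\<exists>n z. M \<in> Ob (cohX p q) \<and> isomorphic (cohX p q) M (FM n z)" using torsion_only_free[OF M] M by (simp add: Ob_iff)
next
 assume "\<exists>n z. M \<in> Ob (cohX p q) \<and> isomorphic (cohX p q) M (FM n z)"
 then obtain n z where M: "M \<in> Ob (cohX p q)" and i: "isomorphic (cohX p q) M (FM n z)" by blast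
 interpret F: free_mod p q n z "TYPE('k)" by unfold_locales
 interpret C: category "cohX p q :: ('k sheaf, _) cat" by (rule coh_category)
 have vF: "vector_bundle p q F.F" by (rule torsion_only_vector_bundle[OF F.F.obj_axioms F.torsion_only])
 show "vector_bundle p q M"
  unfolding vector_bundle_def
 proof (intro conjI notI)
  assume "\<exists>Y f. simple_object (cohX p q) Y \<and> mono_mor (cohX p q) Y M f"
  then obtain Y f where Y: "simple_object (cohX p q) Y" "mono_mor (cohX p q) Y M f" by blast
  then have Yo: "Y \<in> Ob (cohX p q)" by (simp add: simple_object_def)
  from i obtain h g where hg: "h \<in> Mor (coh p q) M F.F" "g \<in> Mor (coh p q) F.F M" "Cmp (coh p q) M F.F M g h = Idm (coh p q) M" by (rule C.isoE)
  have "mono_mor (cohX p q) M F.F h"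
   using category_zero.split_mono[OF cohX_category_zero M FM_Ob hg] .
  then have "mono_mor (cohX p q) Y F.F (Cmp (coh p q) Y M F.F h f)"
   using category_zero.mono_comp[OF cohX_category_zero Yo M FM_Ob Y(2)] by blast
  then show False using vF Y(1) by (auto simp: vector_bundle_def)
 qed (rule M)
qed

end

section \<open>Extensions of vector bundles\<close>

text \<open>Concatenation of two families, used for the modules of rank \<open>N + N\<close> in both
  extension arguments.\<close>

definition app :: "nat => (nat => 'c) => (nat => 'c) => nat => 'c" where
 "app N f g = (\<lambda>k. if k < N then f k else g (k - N))"

context graded_mod
begin

lemma pow_pow: "m \<in> carrier M ==> x ^ a \<odot> (x ^ b \<odot> m) = x ^ (a + b) \<odot> m"
 by (simp add: power_add sm_assoc)

lemma lc_app:
 assumes "!!i. i < N ==> f i \<in> carrier M" "!!i. i < n ==> g i \<in> carrier M"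
 shows "lc (app N f g) (N + n) c = lc f N c \<oplus> lc g n (\<lambda>i. c (N + i))"
 using assms(2)
proof (induction n)
 case 0
 have "lc (app N f g) N c = lc f N c" by (rule lc_cong) (auto simp: app_def)
 then show ?case using assms(1) by simp
next
 case (Suc n)
 have "app N f g (N + n) = g n" by (simp add: app_def)
 then show ?case using Suc assms(1) by (simp add: M.a_assoc)
qed

lemma lc_add_pointwise:
 assumes "!!i. i < n ==> f i \<in> carrier M" "!!i. i < n ==> g i \<in> carrier M"
 shows "lc f n v \<oplus> lc g n w = lc (\<lambda>i. v i \<odot> f i \<oplus> w i \<odot> g i) n (\<lambda>_. 1)"
 using assms
proof (induction n)
 case (Suc n)
 then show ?case by (simp add: M.a_ac flip: Suc.IH)
qed simp

end

section \<open>Saturated representatives and exact sequences\<close>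

context two
begin

text \<open>Saturating inside the direct sum changes a relation only up to equivalence. Afterwards
  membership of a pair can be tested after multiplication by powers of the variables.\<close>

lemma rel_saturate:
 assumes R: "rel R"
 obtains R' where "rel R'" "cls R' = cls R"
  "!!m n. m \<in> carrier M ==> n \<in> carrier N ==> (!!x. x \<in> VV ==> \<exists>k. (x ^ k \<odot>\<^bsub>M\<^esub> m, x ^ k \<odot>\<^bsub>N\<^esub> n) \<in> R') ==> (m, n) \<in> R'"
proof -
 interpret S: graded_mod p q "gsum M N" by unfold_locales (rule gsum_graded)
 have g: "S.gsub R" using rel_rsub[OF R] rsub_iff S.graded_submodule_iff by blast
 define R' where "R' = S.sat R"
 have g': "rsub R'" using S.gsub_sat[OF g] rsub_iff S.graded_submodule_iff unfolding R'_def by blast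
 have sub: "R \<subseteq> R'" unfolding R'_def by (rule S.sat_incl) (use g in \<open>simp add: S.gsub_def\<close>)
 have R'E: "\<exists>k. (x ^ k \<odot>\<^bsub>M\<^esub> m, x ^ k \<odot>\<^bsub>N\<^esub> n) \<in> R" if mn: "(m, n) \<in> R'" and x: "x \<in> VV" for m n x
  using S.satE[OF mn[unfolded R'_def] x] by simp
 have r: "rel R'"
  unfolding rel_def
 proof (intro conjI allI impI)
  show "rsub R'" by (rule g')
  have "carrier M \<subseteq> M.sat (Domain R)" using R by (simp add: rel_def)
  also have "\<dots> \<subseteq> M.sat (Domain R')" by (rule M.sat_mono[OF Domain_mono[OF sub]])
  finally show "carrier M \<subseteq> M.sat (Domain R')" .
  fix n assume n: "(\<zero>\<^bsub>M\<^esub>, n) \<in> R'"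
  show "n \<in> N.tors"
  proof (rule N.tors_tors)
   show "n \<in> carrier N" by (rule rsubD(2)[OF g' n])
   fix x :: "'k poly poly" assume "x \<in> VV"
   then obtain k where "(x ^ k \<odot>\<^bsub>M\<^esub> \<zero>\<^bsub>M\<^esub>, x ^ k \<odot>\<^bsub>N\<^esub> n) \<in> R" using R'E[OF n] by blast
   then show "\<exists>k. x ^ k \<odot>\<^bsub>N\<^esub> n \<in> N.tors" using R unfolding rel_def by (auto simp: M.sm_0)
  qed
 qed
 have "cls R' = cls R" using cls_eq_iff[OF r R] eqv_sym[OF R r eqv_subset[OF r sub]] by blast
 moreover have "(m, n) \<in> R'" if mn: "m \<in> carrier M" "n \<in> carrier N" "!!x. x \<in> VV ==> \<exists>k. (x ^ k \<odot>\<^bsub>M\<^esub> m, x ^ k \<odot>\<^bsub>N\<^esub> n) \<in> R'" for m n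
  unfolding R'_def
 proof (rule S.sat_sat)
  show "(m, n) \<in> carrier (gsum M N)" using mn(1,2) by simp
  fix x :: "'k poly poly" assume "x \<in> VV"
  then obtain k where "(x ^ k \<odot>\<^bsub>M\<^esub> m, x ^ k \<odot>\<^bsub>N\<^esub> n) \<in> R'" using mn(3) by blast
  then have "x ^ k \<odot>\<^bsub>gsum M N\<^esub> (m, n) \<in> S.sat R" by (simp add: R'_def)
  then show "\<exists>k. x ^ k \<odot>\<^bsub>gsum M N\<^esub> (m, n) \<in> S.sat R" ..
 qed
 ultimately show ?thesis using that[OF r] by blast
qed

lemma hom_pair: "rsub R ==> (m, n) \<in> R ==> m \<in> M.gr u ==> (m, N.comp (M.D u) n) \<in> R"
 using rsubD(6)[of R m n "M.D u"] M.comp_hom[of m u "M.D u"] by simp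

lemma hom_pair': "rsub R ==> (m, n) \<in> R ==> n \<in> N.gr u ==> (M.comp (M.D u) m, n) \<in> R"
 using rsubD(6)[of R m n "M.D u"] N.comp_hom[of n u "M.D u"] by simp

lemma rel_single: "rel R ==> (m, n) \<in> R ==> (m, n') \<in> R ==> n \<ominus>\<^bsub>N\<^esub> n' \<in> N.tors"
 using eqvD[OF eqv_refl] by blast

lemma tors_diffD:
 assumes "x \<in> VV" "a \<in> carrier N" "b \<in> carrier N" "a \<ominus>\<^bsub>N\<^esub> b \<in> N.tors"
 shows "\<exists>k. x ^ k \<odot>\<^bsub>N\<^esub> a = x ^ k \<odot>\<^bsub>N\<^esub> b"
 using N.torsE[OF assms(4,1)] assms(2,3) by (auto simp: N.sm_rdiff N.diff_zero_iff)

end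

context three
begin

text \<open>Exactness in the quotient category from conditions on elements up to torsion. The
  mediating morphisms are given by the relations \<open>T O A\<inverse>\<close> for the kernel and
  \<open>B\<inverse> O T\<close> for the cokernel.\<close>

lemma short_exactI:
 assumes A: "MN.rel A" and B: "NP.rel B" and ker: "!!m. (m, \<zero>\<^bsub>N\<^esub>) \<in> A ==> m \<in> M.tors"
  and z: "Range (A O B) \<subseteq> P.tors" and ex: "!!n. (n, \<zero>\<^bsub>P\<^esub>) \<in> B ==> n \<in> N.sat (Range A)"
  and surj: "carrier P \<subseteq> P.sat (Range B)"
 shows "short_exact (coh p q) M N P (MN.cls A) (NP.cls B)"
proof -
 note rA = MN.rel_rsub[OF A] and rB = NP.rel_rsub[OF B]
 have mor: "MN.cls A \<in> Mor (coh p q) M N" "NP.cls B \<in> Mor (coh p q) N P"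
  using A B MN.Mor_iff NP.Mor_iff by blast+
 have zm: "zero_mor (coh p q) M P (Cmp (coh p q) M N P (NP.cls B) (MN.cls A))"
  unfolding Cmp_cls[OF A B] using MP.zero_mor_iff[OF comp_rel[OF A B]] z by blast
 have K: "\<exists>!h. h \<in> Mor (coh p q) W M \<and> Cmp (coh p q) W M N (MN.cls A) h = g"
  if W: "W \<in> Ob (coh p q)" and g: "g \<in> Mor (coh p q) W N" "zero_mor (coh p q) W P (Cmp (coh p q) W N P (NP.cls B) g)" for W g
 proof -
  interpret W: obj p q W using W by (simp add: M.Ob_iff)
  interpret WN: two p q W N by unfold_locales
  interpret WNP: three p q W N P by unfold_locales
  interpret WMN: three p q W M N by unfold_locales
  interpret WNM: three p q W N M by unfold_locales
  obtain T where T: "WN.rel T" "g = WN.cls T" using g WN.Mor_iff by blast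
  note rT = WN.rel_rsub[OF T(1)]
  have TB: "Range (T O B) \<subseteq> P.tors"
   using g(2) WNP.MP.zero_mor_iff[OF WNP.comp_rel[OF T(1) B]] by (simp add: T(2) WNP.Cmp_cls[OF T(1) B])
  define H where "H = T O A\<inverse>"
  have rH: "WMN.MN.rsub H" unfolding H_def by (rule WNM.comp_rsub[OF rT MN.rsub_converse[OF rA]])
  have H: "WMN.MN.rel H"
   unfolding WMN.MN.rel_def
  proof (intro conjI allI impI subsetI)
   show "WMN.MN.rsub H" by (rule rH)
   fix w assume w: "w \<in> carrier W"
   \<comment> \<open>Four successive powers of \<open>x\<close> are used: into the domain of
     \<open>T\<close>, into the domain of \<open>B\<close>, to kill the torsion value in
     \<open>P\<close>, and to reach the range of \<open>A\<close>.\<close>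
   show "w \<in> W.sat (Domain H)"
   proof (rule W.satI[OF w])
    fix x :: "'k poly poly" assume x: "x \<in> VV"
    obtain k e where e: "(x ^ k \<odot>\<^bsub>W\<^esub> w, e) \<in> T" using WN.rel_dom[OF T(1) w x] by blast
    have ec: "e \<in> carrier N" by (rule WN.rsubD(2)[OF rT e])
    obtain l y where y: "(x ^ l \<odot>\<^bsub>N\<^esub> e, y) \<in> B" using NP.rel_dom[OF B ec x] by blast
    have le: "(x ^ (l + k) \<odot>\<^bsub>W\<^esub> w, x ^ l \<odot>\<^bsub>N\<^esub> e) \<in> T" by (rule WN.rsub_pow_mono[OF rT w e])
    have "y \<in> P.tors" using TB relcompI[OF le y] by blast
    then obtain i where "x ^ i \<odot>\<^bsub>P\<^esub> y = \<zero>\<^bsub>P\<^esub>" using P.torsE x by blast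
    then have "(x ^ i \<odot>\<^bsub>N\<^esub> (x ^ l \<odot>\<^bsub>N\<^esub> e), \<zero>\<^bsub>P\<^esub>) \<in> B" using NP.rsubD(5)[OF rB y, of "x ^ i"] by simp
    then obtain j m where j: "(m, x ^ j \<odot>\<^bsub>N\<^esub> (x ^ i \<odot>\<^bsub>N\<^esub> (x ^ l \<odot>\<^bsub>N\<^esub> e))) \<in> A" using N.satE[OF ex x] by blast
    have "(x ^ j \<odot>\<^bsub>W\<^esub> (x ^ i \<odot>\<^bsub>W\<^esub> (x ^ (l + k) \<odot>\<^bsub>W\<^esub> w)), x ^ j \<odot>\<^bsub>N\<^esub> (x ^ i \<odot>\<^bsub>N\<^esub> (x ^ l \<odot>\<^bsub>N\<^esub> e))) \<in> T"
     by (intro WN.rsubD(5)[OF rT] le)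
    then have "x ^ (j + (i + (l + k))) \<odot>\<^bsub>W\<^esub> w \<in> Domain H" using j w by (auto simp: H_def W.pow_pow)
    then show "\<exists>k. x ^ k \<odot>\<^bsub>W\<^esub> w \<in> Domain H" ..
   qed
  next
   fix m assume "(\<zero>\<^bsub>W\<^esub>, m) \<in> H"
   then obtain e where e: "(\<zero>\<^bsub>W\<^esub>, e) \<in> T" "(m, e) \<in> A" by (auto simp: H_def)
   have "e \<in> N.tors" using T(1) e(1) by (simp add: WN.rel_def)
   then show "m \<in> M.tors" using MN.ker_tors[OF A ker e(2)] by blast
  qed
  have "WN.eqv (H O A) T"
   unfolding WN.eqv_def
  proof (intro allI impI)
   fix w e' e1 assume "(w, e') \<in> H O A" and e1: "(w, e1) \<in> T"
   then obtain m e where e: "(w, e) \<in> T" "(m, e) \<in> A" "(m, e') \<in> A" by (auto simp: H_def)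
   show "e' \<ominus>\<^bsub>N\<^esub> e1 \<in> N.tors"
    by (rule MN.tors_triangle[OF _ _ _ MN.rel_single[OF A e(3,2)] WN.rel_single[OF T(1) e(1) e1]])
     (rule MN.rsubD(2)[OF rA e(3)] MN.rsubD(2)[OF rA e(2)] WN.rsubD(2)[OF rT e1])+
  qed
  then have "Cmp (coh p q) W M N (MN.cls A) (WMN.MN.cls H) = g"
   unfolding WMN.Cmp_cls[OF H A] T(2) using WN.cls_eq_iff[OF WMN.comp_rel[OF H A] T(1)] by blast
  moreover have "WMN.MN.cls H \<in> Mor (coh p q) W M" using H WMN.MN.Mor_iff by blast
  moreover have "mono_mor (coh p q) M N (MN.cls A)" by (rule MN.mono_mor_cls[OF A ker])
  ultimately show ?thesis using W unfolding mono_mor_def by blast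
 qed
 have C: "\<exists>!h. h \<in> Mor (coh p q) P W \<and> Cmp (coh p q) N P W h (NP.cls B) = g"
  if W: "W \<in> Ob (coh p q)" and g: "g \<in> Mor (coh p q) N W" "zero_mor (coh p q) M W (Cmp (coh p q) M N W g (MN.cls A))" for W g
 proof -
  interpret W: obj p q W using W by (simp add: M.Ob_iff)
  interpret NW: two p q N W by unfold_locales
  interpret MNW: three p q M N W by unfold_locales
  interpret NPW: three p q N P W by unfold_locales
  interpret PNW: three p q P N W by unfold_locales
  obtain T where T: "NW.rel T" "g = NW.cls T" using g NW.Mor_iff by blast
  note rT = NW.rel_rsub[OF T(1)]
  have AT: "Range (A O T) \<subseteq> W.tors"
   using g(2) MNW.MP.zero_mor_iff[OF MNW.comp_rel[OF A T(1)]] by (simp add: T(2) MNW.Cmp_cls[OF A T(1)])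
  define H where "H = B\<inverse> O T"
  have rH: "NPW.NP.rsub H" unfolding H_def by (rule PNW.comp_rsub[OF NP.rsub_converse[OF rB] rT])
  have kt: "w \<in> W.tors" if e: "(e, \<zero>\<^bsub>P\<^esub>) \<in> B" "(e, w) \<in> T" for e w
  proof (rule W.tors_tors)
   show "w \<in> carrier W" by (rule NW.rsubD(2)[OF rT e(2)])
   fix x :: "'k poly poly" assume x: "x \<in> VV"
   obtain k m where "(m, x ^ k \<odot>\<^bsub>N\<^esub> e) \<in> A" using N.satE[OF ex[OF e(1)] x] by blast
   then have "x ^ k \<odot>\<^bsub>W\<^esub> w \<in> W.tors" using AT NW.rsubD(5)[OF rT e(2), of "x ^ k"] by blast
   then show "\<exists>k. x ^ k \<odot>\<^bsub>W\<^esub> w \<in> W.tors" ..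
  qed
  have H: "NPW.NP.rel H"
   unfolding NPW.NP.rel_def
  proof (intro conjI allI impI subsetI)
   show "NPW.NP.rsub H" by (rule rH)
   fix y assume y: "y \<in> carrier P"
   show "y \<in> P.sat (Domain H)"
   proof (rule P.satI[OF y])
    fix x :: "'k poly poly" assume x: "x \<in> VV"
    obtain k e where e: "(e, x ^ k \<odot>\<^bsub>P\<^esub> y) \<in> B" using P.satE[OF subsetD[OF surj y] x] by blast
    obtain l w where "(x ^ l \<odot>\<^bsub>N\<^esub> e, w) \<in> T" using NW.rel_dom[OF T(1) NP.rsubD(1)[OF rB e] x] by blast
    then have "x ^ (l + k) \<odot>\<^bsub>P\<^esub> y \<in> Domain H"
     using NP.rsubD(5)[OF rB e, of "x ^ l"] y by (auto simp: H_def P.pow_pow)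
    then show "\<exists>k. x ^ k \<odot>\<^bsub>P\<^esub> y \<in> Domain H" ..
   qed
  next
   fix w assume "(\<zero>\<^bsub>P\<^esub>, w) \<in> H"
   then show "w \<in> W.tors" using kt by (auto simp: H_def)
  qed
  have "NW.eqv (B O H) T"
   unfolding NW.eqv_def
  proof (intro allI impI)
   fix e w' w1 assume "(e, w') \<in> B O H" and w1: "(e, w1) \<in> T"
   then obtain y e' where e: "(e, y) \<in> B" "(e', y) \<in> B" "(e', w') \<in> T" by (auto simp: H_def)
   have "y \<in> carrier P" by (rule NP.rsubD(2)[OF rB e(1)])
   then have "(e' \<ominus>\<^bsub>N\<^esub> e, \<zero>\<^bsub>P\<^esub>) \<in> B" using NP.rsubD(7)[OF rB e(2,1)] P.diff_zero_iff[of y y] by simp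
   then show "w' \<ominus>\<^bsub>W\<^esub> w1 \<in> W.tors" using kt NW.rsubD(7)[OF rT e(3) w1] by blast
  qed
  then have hg: "Cmp (coh p q) N P W (NPW.NP.cls H) (NP.cls B) = g"
   unfolding NPW.Cmp_cls[OF B H] T(2) using NW.cls_eq_iff[OF NPW.comp_rel[OF B H] T(1)] by blast
  have hm: "NPW.NP.cls H \<in> Mor (coh p q) P W" using H NPW.NP.Mor_iff by blast
  have epi: "h' = NPW.NP.cls H" if h': "h' \<in> Mor (coh p q) P W" "Cmp (coh p q) N P W h' (NP.cls B) = g" for h'
  proof -
   obtain H' where H': "NPW.NP.rel H'" "h' = NPW.NP.cls H'" using h' NPW.NP.Mor_iff by blast
   note rH' = NPW.NP.rel_rsub[OF H'(1)]
   have "NW.cls (B O H') = NW.cls (B O H)" using h'(2) hg unfolding H'(2) NPW.Cmp_cls[OF B H] NPW.Cmp_cls[OF B H'(1)] by simp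
   then have eq: "NW.eqv (B O H') (B O H)" using NW.cls_eq_iff[OF NPW.comp_rel[OF B H'(1)] NPW.comp_rel[OF B H]] by blast
   have "NPW.NP.eqv H' H"
    unfolding NPW.NP.eqv_def
   proof (intro allI impI)
    fix y w' w assume w: "(y, w') \<in> H'" "(y, w) \<in> H"
    have yc: "y \<in> carrier P" by (rule NPW.NP.rsubD(1)[OF rH w(2)])
    have wc: "w \<in> carrier W" "w' \<in> carrier W" by (rule NPW.NP.rsubD(2)[OF rH w(2)] NPW.NP.rsubD(2)[OF rH' w(1)])+
    show "w' \<ominus>\<^bsub>W\<^esub> w \<in> W.tors"
    proof (rule W.tors_tors)
     fix x :: "'k poly poly" assume x: "x \<in> VV"
     obtain k e where e: "(e, x ^ k \<odot>\<^bsub>P\<^esub> y) \<in> B" using P.satE[OF subsetD[OF surj yc] x] by blast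
     have "x ^ k \<odot>\<^bsub>W\<^esub> w' \<ominus>\<^bsub>W\<^esub> x ^ k \<odot>\<^bsub>W\<^esub> w \<in> W.tors"
      by (rule NW.eqvD[OF eq relcompI[OF e NPW.NP.rsubD(5)[OF rH' w(1)]] relcompI[OF e NPW.NP.rsubD(5)[OF rH w(2)]]])
     then have "x ^ k \<odot>\<^bsub>W\<^esub> (w' \<ominus>\<^bsub>W\<^esub> w) \<in> W.tors" using wc by (simp add: W.sm_rdiff)
     then show "\<exists>k. x ^ k \<odot>\<^bsub>W\<^esub> (w' \<ominus>\<^bsub>W\<^esub> w) \<in> W.tors" ..
    qed (use wc in \<open>simp add: a_minus_def\<close>)
   qed
   then show ?thesis unfolding H'(2) using NPW.NP.cls_eq_iff[OF H'(1) H] by blast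
  qed
  show ?thesis by (rule ex1I[of _ "NPW.NP.cls H"]) (use hg hm epi in blast)+
 qed
 show ?thesis
  unfolding short_exact_def is_kernel_def is_cokernel_def
  by (intro conjI ballI allI impI mor zm K C)
   (assumption | (rule M.Ob_iff[THEN iffD2], (rule M.obj_axioms | rule N.obj_axioms | rule P.obj_axioms)))+
qed

end

context sheaves
begin

text \<open>The relation factors through the object on its own range. The universal property of the
  cokernel gives a morphism from \<open>N\<close> to that object, and uniqueness makes its composite
  with the inclusion the identity of \<open>N\<close>; hence the range is everything up to
  torsion.\<close>

lemma cokernel_surj:
 assumes R: "rel R" and c: "is_cokernel (coh p q) A M N f (cls R)" and A: "A \<in> Ob (cohX p q)"
 shows "carrier N \<subseteq> N.sat (Range R)"
proof
 interpret A: obj p q A using A by (simp add: M.Ob_iff)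
 interpret NM: two p q N M by unfold_locales
 note r = rel_rsub[OF R]
 have I: "N.gsub (Range R)" using NM.rsub_Domain[OF rsub_converse[OF r]] by simp
 then have Ic: "Range R \<subseteq> carrier N" by (auto simp: N.gsub_def N.subm_def)
 interpret I: obj p q "N.subo (Range R)" by (rule N.subo_obj[OF I])
 interpret AM: two p q A M by unfold_locales
 interpret AMN: three p q A M N by unfold_locales
 interpret MI: two p q M "N.subo (Range R)" by unfold_locales
 interpret AMI: three p q A M "N.subo (Range R)" by unfold_locales
 interpret MNI: three p q M N "N.subo (Range R)" by unfold_locales
 interpret NIN: three p q N "N.subo (Range R)" N by unfold_locales
 interpret MIN: three p q M "N.subo (Range R)" N by unfold_locales
 interpret C: category "cohX p q :: ('k sheaf, _) cat" by (rule M.coh_category)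
 have It: "y \<in> I.tors \<longleftrightarrow> y \<in> N.tors" if "y \<in> Range R" for y
  using that Ic by (auto simp: I.tors_def N.tors_def I.sat_def N.sat_def)
 have f: "f \<in> Mor (coh p q) A M" and z: "zero_mor (coh p q) A N (Cmp (coh p q) A M N (cls R) f)"
  and u: "!!W g. W \<in> Ob (coh p q) ==> g \<in> Mor (coh p q) M W ==> zero_mor (coh p q) A W (Cmp (coh p q) A M W g f) ==>
   \<exists>!h. h \<in> Mor (coh p q) N W \<and> Cmp (coh p q) M N W h (cls R) = g"
  using c unfolding is_cokernel_def by blast+
 obtain P where P: "AM.rel P" "f = AM.cls P" using f AM.Mor_iff by blast
 have PR: "Range (P O R) \<subseteq> N.tors"
  using z AMN.MP.zero_mor_iff[OF AMN.comp_rel[OF P(1) R]] by (simp add: P(2) AMN.Cmp_cls[OF P(1) R])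
 have RI: "MI.rel R"
  unfolding MI.rel_def MI.rsub_def
 proof (intro conjI allI impI)
  show "R \<subseteq> carrier M \<times> carrier (N.subo (Range R))" using rsubD(1)[OF r] by auto
  show "carrier M \<subseteq> M.sat (Domain R)" using R by (simp add: rel_def)
  fix n assume "(\<zero>\<^bsub>M\<^esub>, n) \<in> R"
  then show "n \<in> I.tors" using R It by (auto simp: rel_def)
 next
  fix m n v assume mn: "(m, n) \<in> R"
  then show "(M.comp (M.D v) m, I.comp (M.D v) n) \<in> R"
   using rsubD(6)[OF r mn, of "M.D v"] N.subo_comp[OF I RangeI[OF mn], of "M.D v"] by simp
 qed (use rsubD[OF r] in auto)
 have iN: "NIN.NP.rel (Id_on (Range R))"
  by (rule N.subo_incl[OF I])
 have "Range (P O R) \<subseteq> I.tors" using PR It by blast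
 then have "zero_mor (coh p q) A (N.subo (Range R)) (Cmp (coh p q) A M (N.subo (Range R)) (MI.cls R) f)"
  unfolding P(2) AMI.Cmp_cls[OF P(1) RI] using AMI.MP.zero_mor_iff[OF AMI.comp_rel[OF P(1) RI]] by blast
 moreover have "MI.cls R \<in> Mor (coh p q) M (N.subo (Range R))" using MI.Mor_iff RI by blast
 moreover have oI: "N.subo (Range R) \<in> Ob (coh p q)" using M.Ob_iff I.obj_axioms by blast
 ultimately obtain k where k: "k \<in> Mor (coh p q) N (N.subo (Range R))" "Cmp (coh p q) M N (N.subo (Range R)) k (cls R) = MI.cls R"
  using u by blast
 then obtain K where K: "MNI.NP.rel K" "k = MNI.NP.cls K" using MNI.NP.Mor_iff by blast
 have ob: "M \<in> Ob (coh p q)" "N \<in> Ob (coh p q)" using M.Ob_iff M.obj_axioms N.obj_axioms by blast+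
 have im: "NIN.NP.cls (Id_on (Range R)) \<in> Mor (coh p q) (N.subo (Range R)) N" using NIN.NP.Mor_iff iN by blast
 have Rm: "cls R \<in> Mor (coh p q) M N" using Mor_iff R by blast
 let ?e = "Cmp (coh p q) N (N.subo (Range R)) N (NIN.NP.cls (Id_on (Range R))) k"
 have "R O Id_on (Range R) = R" by auto
 then have "Cmp (coh p q) M (N.subo (Range R)) N (NIN.NP.cls (Id_on (Range R))) (MI.cls R) = cls R"
  using MIN.Cmp_cls[OF RI iN] by simp
 then have "Cmp (coh p q) M N N ?e (cls R) = cls R"
  using C.Cmp_assoc[OF ob oI ob(2) Rm k(1) im] k(2) by simp
 moreover have "?e \<in> Mor (coh p q) N N" by (rule C.Cmp_Mor[OF ob(2) oI ob(2) k(1) im])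
 moreover have "Cmp (coh p q) M N N (Idm (coh p q) N) (cls R) = cls R" "Idm (coh p q) N \<in> Mor (coh p q) N N"
  by (rule C.Idm_left[OF ob Rm] C.Idm_Mor[OF ob(2)])+
 ultimately have "?e = Idm (coh p q) N" using u[OF ob(2) Rm z] by blast
 then have "N.MM.cls (K O Id_on (Range R)) = N.MM.cls (Id_on (carrier N))"
  unfolding K(2) NIN.Cmp_cls[OF K(1) iN] N.Idm_eq .
 then have eq: "N.MM.eqv (K O Id_on (Range R)) (Id_on (carrier N))"
  using N.MM.cls_eq_iff[OF NIN.comp_rel[OF K(1) iN] N.Id_rel] by blast
 fix n assume n: "n \<in> carrier N"
 show "n \<in> N.sat (Range R)"
 proof (rule N.satI[OF n])
  fix x :: "'k poly poly" assume x: "x \<in> VV"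
  obtain j y where y: "(x ^ j \<odot>\<^bsub>N\<^esub> n, y) \<in> K" using MNI.NP.rel_dom[OF K(1) n x] by blast
  have yI: "y \<in> Range R" using MNI.NP.rsubD(2)[OF MNI.NP.rel_rsub[OF K(1)] y] by simp
  have "y \<ominus>\<^bsub>N\<^esub> x ^ j \<odot>\<^bsub>N\<^esub> n \<in> N.tors"
   by (rule N.MM.eqvD[OF eq, of "x ^ j \<odot>\<^bsub>N\<^esub> n"]) (use y yI n in auto)
  then obtain l where "x ^ l \<odot>\<^bsub>N\<^esub> y = x ^ l \<odot>\<^bsub>N\<^esub> (x ^ j \<odot>\<^bsub>N\<^esub> n)"
   using tors_diffD[OF x, of y "x ^ j \<odot>\<^bsub>N\<^esub> n"] yI Ic n by auto
  then have "x ^ (l + j) \<odot>\<^bsub>N\<^esub> n = x ^ l \<odot>\<^bsub>N\<^esub> y" using n by (simp add: N.pow_pow)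
  also have "\<dots> \<in> Range R" using I yI by (simp add: N.gsub_def N.subm_def)
  finally show "\<exists>k. x ^ k \<odot>\<^bsub>N\<^esub> n \<in> Range R" ..
 qed
qed

end

context graded_mod
begin

lemma sat_uniform:
 fixes N :: nat
 assumes S: "subm S" and g: "!!j. j < N ==> g j \<in> sat S"
 shows "\<exists>n. \<forall>j<N. \<forall>x\<in>VV. x ^ n \<odot> g j \<in> S"
 using g
proof (induction N)
 case (Suc N)
 then obtain n where n: "\<forall>j<N. \<forall>x\<in>VV. x ^ n \<odot> g j \<in> S" using less_SucI by blast
 have gN: "g N \<in> sat S" using Suc.prems by simp
 obtain k l where kl: "X1 ^ k \<odot> g N \<in> S" "X2 ^ l \<odot> g N \<in> S" using satE[OF gN] by blast
 have c: "g j \<in> carrier M" if "j < Suc N" for j using Suc.prems[OF that] sat_carrier by blast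
 have "x ^ (n + k + l) \<odot> g j \<in> S" if j: "j < Suc N" and x: "x \<in> VV" for j x
 proof (cases "j < N")
  case True
  then have "x ^ n \<odot> g j \<in> S" using n x by blast
  then show ?thesis by (rule pow_mono[OF S c[OF j]]) simp
 next
  case False
  then have "j = N" using j by simp
  then show ?thesis using x kl pow_mono[OF S c[OF j], of X1 k "n + k + l"] pow_mono[OF S c[OF j], of X2 l "n + k + l"] by auto
 qed
 then show ?case by blast
qed simp

lemma diff_diff_swap:
 assumes "a \<in> carrier M" "b \<in> carrier M" "c \<in> carrier M" "d \<in> carrier M"
 shows "(a \<ominus> b) \<ominus> (c \<ominus> d) = (a \<ominus> c) \<ominus> (b \<ominus> d)"
 using assms by (simp add: a_minus_def M.minus_add M.a_ac)

end

context free_mod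
begin

lemma lc_ee_upd:
 assumes "j < m"
 shows "F.lc (ee(j := h)) m v = (\<lambda>l. v j * h l + (if l < m \<and> l \<noteq> j then v l else 0))"
proof
 fix l
 have "(\<Sum>k\<in>{..<m} - {j}. v k * (ee(j := h)) k l) = (\<Sum>k\<in>{..<m} - {j}. if l = k then v k else 0)"
  by (rule sum.cong) (auto simp: ee_def)
 also have "\<dots> = (if l < m \<and> l \<noteq> j then v l else 0)" by (simp add: sum.delta')
 finally show "F.lc (ee(j := h)) m v l = v j * h l + (if l < m \<and> l \<noteq> j then v l else 0)"
  using assms sum.remove[of "{..<m}" j "\<lambda>k. v k * (ee(j := h)) k l"] by (simp add: F_lc)
qed

lemma lc_zero_upd:
 assumes "j < m"
 shows "F.lc ((\<lambda>_ _. 0)(j := h)) m v = (\<lambda>l. v j * h l)"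
proof
 fix l
 have "(\<Sum>k\<in>{..<m} - {j}. v k * ((\<lambda>_ _. 0)(j := h)) k l) = 0" by (rule sum.neutral) auto
 then show "F.lc ((\<lambda>_ _. 0)(j := h)) m v l = v j * h l"
  using assms sum.remove[of "{..<m}" j "\<lambda>k. v k * ((\<lambda>_ _. 0)(j := h)) k l"] by (simp add: F_lc)
qed

lemma lc_ee_scaled: "F.lc (\<lambda>i k. s * ee i k) n v = (\<lambda>l. if l < n then s * v l else 0)"
proof
 fix l
 have "(\<Sum>k<n. v k * (s * ee k l)) = (\<Sum>k<n. if l = k then s * v k else 0)"
  by (rule sum.cong) (auto simp: ee_def)
 also have "\<dots> = (if l < n then s * v l else 0)" by (simp add: sum.delta')
 finally show "F.lc (\<lambda>i k. s * ee i k) n v l = (if l < n then s * v l else 0)" by (simp add: F_lc)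
qed

end

section \<open>Self-extensions of free modules and the condition on their degrees\<close>

context weight_type
begin

text \<open>The first cohomology of the structure sheaf lives in the degrees of Laurent monomials
  with two negative exponents, and the condition excludes these as differences of degrees. Both
  signs are covered because \<open>i\<close> and \<open>j\<close> run independently.\<close>

definition compat :: "nat => (nat => int \<times> int) => bool" where
 "compat N z \<longleftrightarrow> (\<forall>i<N. \<forall>j<N. \<forall>a>0. \<forall>b>0. D (z i) \<noteq> D (z j + (a, b)))"

text \<open>Lift \<open>x1^n e_j\<close> and \<open>x2^n e_j\<close> along the epimorphism. By compatibility, their discrepancy
 \<open>x2^n w1 - x1^n w2\<close> comes from an element of the ideal \<open>(x1^n, x2^n)\<close> and can be removed; the lifts
 then agree on overlaps and define a section.\<close>

lemma compat_Ext1_zero: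
 assumes c: "compat N z"
 shows "Ext1_zero (cohX p q) (FM N z :: ('k::field) sheaf) (FM N z)"
 unfolding Ext1_zero_def
proof (intro allI impI)
 interpret F: free_mod p q N z "TYPE('k)" by unfold_locales
 fix E f g assume se: "short_exact (cohX p q) F.F E F.F f g"
 then have "E \<in> Ob (cohX p q)" by (simp add: short_exact_def)
 then interpret E: obj p q E by (simp add: Ob_iff)
 interpret FE: sheaves p q F.F E by unfold_locales
 interpret EF: sheaves p q E F.F by unfold_locales
 interpret FEF: three p q F.F E F.F by unfold_locales
 have ker: "is_kernel (coh p q) F.F E F.F f g" and co: "is_cokernel (coh p q) F.F E F.F f g"
  using se by (auto simp: short_exact_def)
 have fm: "f \<in> Mor (coh p q) F.F E" and gm: "g \<in> Mor (coh p q) E F.F" using ker by (simp_all add: is_kernel_def)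
 obtain R0 where R0: "FE.rel R0" "f = FE.cls R0" using fm[unfolded FE.Mor_iff] by blast
 obtain G0 where G0: "EF.rel G0" "g = EF.cls G0" using gm[unfolded EF.Mor_iff] by blast
 \<comment> \<open>Both morphisms get saturated representatives, so that pairs can be recognised
   after multiplication by powers of the variables.\<close>
 obtain R where R: "FE.rel R" "FE.cls R = f"
  and Rsat: "!!m n. m \<in> carrier F.F ==> n \<in> carrier E ==> (!!x. x \<in> VV ==> \<exists>k. (x ^ k \<odot>\<^bsub>F.F\<^esub> m, x ^ k \<odot>\<^bsub>E\<^esub> n) \<in> R) ==> (m, n) \<in> R"
  using FE.rel_saturate[OF R0(1)] unfolding R0(2) by blast
 obtain G where G: "EF.rel G" "EF.cls G = g"
  and Gsat: "!!m n. m \<in> carrier E ==> n \<in> carrier F.F ==> (!!x. x \<in> VV ==> \<exists>k. (x ^ k \<odot>\<^bsub>E\<^esub> m, x ^ k \<odot>\<^bsub>F.F\<^esub> n) \<in> G) ==> (m, n) \<in> G"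
  using EF.rel_saturate[OF G0(1)] unfolding G0(2) by blast
 note rR = FE.rel_rsub[OF R(1)] and rG = EF.rel_rsub[OF G(1)]
 have RG: "y = (\<lambda>_. 0)" if "(a, e) \<in> R" "(e, y) \<in> G" for a e y
 proof -
  have "zero_mor (coh p q) F.F F.F (Cmp (coh p q) F.F E F.F g f)" using ker by (simp add: is_kernel_def)
  then have "zero_mor (coh p q) F.F F.F (F.F.MM.cls (R O G))"
   using FEF.Cmp_cls[OF R(1) G(1)] by (simp add: R(2) G(2))
  then show ?thesis using F.F.MM.zero_mor_iff[OF FEF.comp_rel[OF R(1) G(1)]] that by (auto simp: F.F_tors)
 qed
 have Gu: "y = y'" if "(e, y) \<in> G" "(e, y') \<in> G" for e y y'
  using EF.rel_single[OF G(1) that] EF.rsubD(2)[OF rG that(1)] EF.rsubD(2)[OF rG that(2)] F.F.diff_zero_iff[of y y']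
  by (simp add: F.F_tors)
 \<comment> \<open>The kernel property on homogeneous elements: \<open>e\<close> defines a morphism
   from a free module of rank one that vanishes after \<open>g\<close>, so it factors through
   \<open>f\<close>, and by \<open>Mor_gph\<close> the factorisation is given by a vector.\<close>
 have KER: "\<exists>r\<in>F.F.gr v. (r, e) \<in> R" if e: "e \<in> E.gr v" "(e, \<lambda>_. 0) \<in> G" for e v
 proof -
  interpret W: free_to p q 1 "\<lambda>_. v" E by unfold_locales
  interpret WF: free_free p q 1 "\<lambda>_. v" N z "TYPE('k)" by unfold_locales
  interpret T: three p q W.FR.F E F.F by unfold_locales
  interpret S: three p q W.FR.F F.F E by unfold_locales
  have ec: "e \<in> carrier E" by (rule E.gr_closed(1)[OF e(1)])
  have a: "W.FE.rel (W.gph (\<lambda>_. e))" by (rule W.gph_rel) (rule e(1))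
  have "Range (W.gph (\<lambda>_. e) O G) \<subseteq> F.F.tors"
  proof
   fix y assume "y \<in> Range (W.gph (\<lambda>_. e) O G)"
   then obtain c where "(c 0 \<odot>\<^bsub>E\<^esub> e, y) \<in> G" using ec by (auto simp: W.gph_iff E.lc_one)
   moreover have "(c 0 \<odot>\<^bsub>E\<^esub> e, \<lambda>_. 0) \<in> G" using EF.rsubD(5)[OF rG e(2), of "c 0"] by simp
   ultimately show "y \<in> F.F.tors" using Gu by (auto simp: F.F_tors)
  qed
  then have "zero_mor (coh p q) W.FR.F F.F (Cmp (coh p q) W.FR.F E F.F g (W.FE.cls (W.gph (\<lambda>_. e))))"
   using T.Cmp_cls[OF a G(1)] WF.AB.FE.zero_mor_iff[OF T.comp_rel[OF a G(1)]] by (simp add: G(2))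
  moreover have "W.FE.cls (W.gph (\<lambda>_. e)) \<in> Mor (coh p q) W.FR.F E" using a W.FE.Mor_iff by blast
  ultimately obtain h where h: "h \<in> Mor (coh p q) W.FR.F F.F" "Cmp (coh p q) W.FR.F F.F E f h = W.FE.cls (W.gph (\<lambda>_. e))"
   using ker FM_Ob[of 1 "\<lambda>_. v"] unfolding is_kernel_def by metis
  obtain r where r: "r 0 \<in> F.F.gr v" "h = WF.AB.FE.cls (WF.AB.gph r)" using WF.Mor_gph[OF h(1)] by auto
  have b: "WF.AB.FE.rel (WF.AB.gph r)" by (rule WF.AB.gph_rel) (use r(1) in simp)
  have eq: "W.FE.eqv (WF.AB.gph r O R) (W.gph (\<lambda>_. e))"
   using h(2) S.Cmp_cls[OF b R(1)] W.FE.cls_eq_iff[OF S.comp_rel[OF b R(1)] a] by (simp add: R(2) r(2))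
  have rc: "r 0 \<in> carrier F.F" by (rule F.F.gr_closed(1)[OF r(1)])
  have "(r 0, e) \<in> R"
  proof (rule Rsat[OF rc ec])
   fix x :: "'k poly poly" assume x: "x \<in> VV"
   obtain k y where y: "(x ^ k \<odot>\<^bsub>F.F\<^esub> r 0, y) \<in> R" using FE.rel_dom[OF R(1) rc x] by blast
   have "((\<lambda>i. x ^ k * ee 0 i), x ^ k \<odot>\<^bsub>F.F\<^esub> r 0) \<in> WF.AB.gph r"
    by (rule WF.AB.gph_ee) (use rc in simp_all)
   moreover have "((\<lambda>i. x ^ k * ee 0 i), x ^ k \<odot>\<^bsub>E\<^esub> e) \<in> W.gph (\<lambda>_. e)" by (rule W.gph_ee) (use ec in simp_all)
   ultimately have "y \<ominus>\<^bsub>E\<^esub> x ^ k \<odot>\<^bsub>E\<^esub> e \<in> E.tors" using W.FE.eqvD[OF eq] y by blast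
   then obtain l where "x ^ l \<odot>\<^bsub>E\<^esub> y = x ^ l \<odot>\<^bsub>E\<^esub> (x ^ k \<odot>\<^bsub>E\<^esub> e)"
    using FE.tors_diffD[OF x FE.rsubD(2)[OF rR y]] ec by fastforce
   then have "(x ^ (l + k) \<odot>\<^bsub>F.F\<^esub> r 0, x ^ (l + k) \<odot>\<^bsub>E\<^esub> e) \<in> R"
    using FE.rsub_pow_mono[OF rR rc y, of l] ec by (simp add: E.pow_pow)
   then show "\<exists>k. (x ^ k \<odot>\<^bsub>F.F\<^esub> r 0, x ^ k \<odot>\<^bsub>E\<^esub> e) \<in> R" ..
  qed
  then show ?thesis using r(1) by blast
 qed
 have RanG: "F.F.gsub (Range G)" using FE.rsub_Domain[OF EF.rsub_converse[OF rG]] by simp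
 have DomR: "F.F.gsub (Domain R)" by (rule FE.rsub_Domain[OF rR])
 have epi: "carrier F.F \<subseteq> F.F.sat (Range G)"
  by (rule EF.cokernel_surj[OF G(1) _ FM_Ob]) (use co in \<open>simp add: G(2)\<close>)
 \<comment> \<open>Two uniform exponents are extracted: multiples by n-th powers lift basis vectors
   along \<open>G\<close>, and multiples by m-th powers lie in the domain of \<open>R\<close>. The
   corrected lifts therefore live at exponent \<open>m + n\<close>.\<close>
 have "ee j \<in> F.F.sat (Range G)" "ee j \<in> F.F.sat (Domain R)" if "j < N" for j
  using epi R(1) that by (auto simp: FE.rel_def)
 then obtain n m where n: "!!j x. j < N ==> x \<in> VV ==> x ^ n \<odot>\<^bsub>F.F\<^esub> ee j \<in> Range G"
  and m: "!!j x. j < N ==> x \<in> VV ==> x ^ m \<odot>\<^bsub>F.F\<^esub> ee j \<in> Domain R"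
  using F.F.sat_uniform[of "Range G" N ee] F.F.sat_uniform[of "Domain R" N ee] RanG DomR unfolding F.F.gsub_def by metis
 have Dm: "x ^ m \<odot>\<^bsub>F.F\<^esub> v \<in> Domain R" if x: "x \<in> VV" and v: "v \<in> fs N" for x v
 proof -
  have "F.F.lc ee N (\<lambda>i. x ^ m * v i) \<in> Domain R"
  proof (rule F.F.lc_subm')
   show "F.F.subm (Domain R)" using DomR by (simp add: F.F.gsub_def)
   fix i assume i: "i < N"
   have "v i \<odot>\<^bsub>F.F\<^esub> (x ^ m \<odot>\<^bsub>F.F\<^esub> ee i) \<in> Domain R" using m[OF i x] FE.rsubD(5)[OF rR] by blast
   then show "(x ^ m * v i) \<odot>\<^bsub>F.F\<^esub> ee i \<in> Domain R" by (simp add: mult_ac)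
  qed
  then show ?thesis using v by (simp add: F.lc_ee)
 qed
 have aG: "(\<alpha>, \<lambda>_. 0) \<in> G" if a: "(a, \<alpha>) \<in> R" for a \<alpha>
 proof (rule Gsat)
  show ac: "\<alpha> \<in> carrier E" by (rule FE.rsubD(2)[OF rR a])
  fix x :: "'k poly poly" assume "x \<in> VV"
  then obtain k y where y: "(x ^ k \<odot>\<^bsub>E\<^esub> \<alpha>, y) \<in> G" using EF.rel_dom[OF G(1) ac] by blast
  then have "y = (\<lambda>_. 0)" using RG[OF FE.rsubD(5)[OF rR a]] by blast
  then show "\<exists>k. (x ^ k \<odot>\<^bsub>E\<^esub> \<alpha>, x ^ k \<odot>\<^bsub>F.F\<^esub> (\<lambda>_. 0)) \<in> G" using y by auto
 qed simp
 let ?n = "m + n"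
 have lift: "\<exists>w1 w2. w1 \<in> E.gr ((int ?n, 0) + z j) \<and> w2 \<in> E.gr ((0, int ?n) + z j) \<and>
   (w1, X1 ^ ?n \<odot>\<^bsub>F.F\<^esub> ee j) \<in> G \<and> (w2, X2 ^ ?n \<odot>\<^bsub>F.F\<^esub> ee j) \<in> G \<and>
   X2 ^ ?n \<odot>\<^bsub>E\<^esub> w1 \<ominus>\<^bsub>E\<^esub> X1 ^ ?n \<odot>\<^bsub>E\<^esub> w2 \<in> E.tors" if j: "j < N" for j
 proof -
  have eg: "X1 ^ n \<odot>\<^bsub>F.F\<^esub> ee j \<in> F.F.gr ((int n, 0) + z j)" "X2 ^ n \<odot>\<^bsub>F.F\<^esub> ee j \<in> F.F.gr ((0, int n) + z j)"
   by (rule F.F.gr_smult[OF Sg_X(1) F.ee_gr[OF j]] F.F.gr_smult[OF Sg_X(2) F.ee_gr[OF j]])+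
  obtain a1 a2 where a: "(a1, X1 ^ n \<odot>\<^bsub>F.F\<^esub> ee j) \<in> G" "(a2, X2 ^ n \<odot>\<^bsub>F.F\<^esub> ee j) \<in> G"
   using n[OF j, of X1] n[OF j, of X2] by blast
  define u1 where "u1 = E.comp (D ((int n, 0) + z j)) a1"
  define u2 where "u2 = E.comp (D ((0, int n) + z j)) a2"
  have u: "(u1, X1 ^ n \<odot>\<^bsub>F.F\<^esub> ee j) \<in> G" "(u2, X2 ^ n \<odot>\<^bsub>F.F\<^esub> ee j) \<in> G"
   unfolding u1_def u2_def by (rule EF.hom_pair'[OF rG a(1) eg(1)] EF.hom_pair'[OF rG a(2) eg(2)])+
  have ug: "u1 \<in> E.gr ((int n, 0) + z j)" "u2 \<in> E.gr ((0, int n) + z j)"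
   unfolding u1_def u2_def by (rule E.comp_gr[OF EF.rsubD(1)[OF rG a(1)]] E.comp_gr[OF EF.rsubD(1)[OF rG a(2)]])+
  have uc: "u1 \<in> carrier E" "u2 \<in> carrier E" by (rule E.gr_closed(1)[OF ug(1)] E.gr_closed(1)[OF ug(2)])+
  let ?d = "X2 ^ n \<odot>\<^bsub>E\<^esub> u1 \<ominus>\<^bsub>E\<^esub> X1 ^ n \<odot>\<^bsub>E\<^esub> u2"
  have e: "(0, int n) + ((int n, 0) + z j) = (int n, int n) + z j" "(int n, 0) + ((0, int n) + z j) = (int n, int n) + z j"
   by (simp_all add: prod_eq_iff)
  have dg: "?d \<in> E.gr ((int n, int n) + z j)"
   using E.gr_smult[OF Sg_X(2)[of n] ug(1)] E.gr_smult[OF Sg_X(1)[of n] ug(2)] unfolding e by (rule E.gr_minus(2))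
  have "(?d, X2 ^ n \<odot>\<^bsub>F.F\<^esub> (X1 ^ n \<odot>\<^bsub>F.F\<^esub> ee j) \<ominus>\<^bsub>F.F\<^esub> X1 ^ n \<odot>\<^bsub>F.F\<^esub> (X2 ^ n \<odot>\<^bsub>F.F\<^esub> ee j)) \<in> G"
   by (intro EF.rsubD(7)[OF rG] EF.rsubD(5)[OF rG] u)
  moreover have "X2 ^ n \<odot>\<^bsub>F.F\<^esub> (X1 ^ n \<odot>\<^bsub>F.F\<^esub> ee j) \<ominus>\<^bsub>F.F\<^esub> X1 ^ n \<odot>\<^bsub>F.F\<^esub> (X2 ^ n \<odot>\<^bsub>F.F\<^esub> ee j) = (\<lambda>_. 0)"
   using j by (subst F.F_diff) (auto simp: mult.left_commute)
  ultimately have dG: "(?d, \<lambda>_. 0) \<in> G" by simp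
  obtain r where r: "r \<in> F.F.gr ((int n, int n) + z j)" "(r, ?d) \<in> R" using KER[OF dg dG] by blast
  have "\<exists>A B. (i < N --> A \<in> Sg ((int n, 0) + z j - z i) \<and> B \<in> Sg ((0, int n) + z j - z i) \<and> r i = X2 ^ n * A - X1 ^ n * B) \<and>
    (\<not> i < N --> A = 0 \<and> B = 0)" for i
  proof (cases "i < N")
   case True
   then have ri: "r i \<in> Sg ((int n, int n) + z j - z i)" using r(1) by (simp add: F.F_gr)
   \<comment> \<open>A monomial with both exponents below \<open>n\<close> would realise a
     difference of degrees that \<open>compat\<close> forbids.\<close>
   have "a \<ge> n \<or> b \<ge> n" if ab: "cf (r i) a b \<noteq> 0" for a b
   proof (rule ccontr)
    assume "\<not> (a \<ge> n \<or> b \<ge> n)"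
    then have lt: "int n - int a > 0" "int n - int b > 0" by auto
    have "D ((int n, int n) + z j - z i) = D (int a, int b)" using SgD[OF ri ab] by simp
    then have "D ((int n, int n) + z j) = D ((int a, int b) + z i)" by (simp add: D_diff_eq)
    then have "D ((z j + (int n - int a, int n - int b)) + (int a, int b)) = D (z i + (int a, int b))"
     by (simp add: prod_eq_iff add.commute[of _ "z j"] add.assoc add.commute[of _ "z i"])
    then show False using c True j lt unfolding D_add_cancel compat_def by metis
   qed
   from Sg_split[OF ri this] obtain A B where "A \<in> Sg ((int n, int n) + z j - z i - (0, int n))"
    "B \<in> Sg ((int n, int n) + z j - z i - (int n, 0))" "r i = X2 ^ n * A - X1 ^ n * B" by blast
   moreover have "(int n, int n) + z j - z i - (0, int n) = (int n, 0) + z j - z i"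
    "(int n, int n) + z j - z i - (int n, 0) = (0, int n) + z j - z i" by (simp_all add: prod_eq_iff)
   ultimately show ?thesis using True by auto
  qed simp
  then obtain A B where AB: "!!i. i < N ==> A i \<in> Sg ((int n, 0) + z j - z i) \<and> B i \<in> Sg ((0, int n) + z j - z i) \<and> r i = X2 ^ n * A i - X1 ^ n * B i"
   "!!i. \<not> i < N ==> A i = 0 \<and> B i = 0" by metis
  have Afs: "A \<in> fs N" "B \<in> fs N" using AB(2) by (auto simp: fs_def)
  have rc: "r \<in> fs N" by (rule F.gr_fs[OF r(1)])
  have AG: "A \<in> F.F.gr ((int n, 0) + z j)" "B \<in> F.F.gr ((0, int n) + z j)" using AB(1) Afs by (auto simp: F.F_gr)
  have rAB: "r i = X2 ^ n * A i - X1 ^ n * B i" for i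
   using AB[of i] fsD[OF rc, of i] by (cases "i < N") auto
  \<comment> \<open>\<open>A\<close> and \<open>B\<close> need not lie in the domain of
    \<open>R\<close>, but their multiples by \<open>X1 ^ m\<close> and \<open>X2 ^ m\<close> do; the
    values there are the corrections to the two lifts.\<close>
  obtain \<alpha>0 \<beta>0 where ab0: "(X1 ^ m \<odot>\<^bsub>F.F\<^esub> A, \<alpha>0) \<in> R" "(X2 ^ m \<odot>\<^bsub>F.F\<^esub> B, \<beta>0) \<in> R"
   using Dm[OF _ Afs(1), of X1] Dm[OF _ Afs(2), of X2] by blast
  have e': "(int m, 0) + ((int n, 0) + z j) = (int ?n, 0) + z j" "(0, int m) + ((0, int n) + z j) = (0, int ?n) + z j"
   by (simp_all add: prod_eq_iff)
  note mA = F.F.gr_smult[OF Sg_X(1)[of m] AG(1), unfolded e'] and mB = F.F.gr_smult[OF Sg_X(2)[of m] AG(2), unfolded e']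
  define \<alpha> where "\<alpha> = E.comp (D ((int ?n, 0) + z j)) \<alpha>0"
  define \<beta> where "\<beta> = E.comp (D ((0, int ?n) + z j)) \<beta>0"
  have ab: "(X1 ^ m \<odot>\<^bsub>F.F\<^esub> A, \<alpha>) \<in> R" "(X2 ^ m \<odot>\<^bsub>F.F\<^esub> B, \<beta>) \<in> R"
   unfolding \<alpha>_def \<beta>_def by (rule FE.hom_pair[OF rR ab0(1) mA] FE.hom_pair[OF rR ab0(2) mB])+
  have abg: "\<alpha> \<in> E.gr ((int ?n, 0) + z j)" "\<beta> \<in> E.gr ((0, int ?n) + z j)"
   unfolding \<alpha>_def \<beta>_def by (rule E.comp_gr[OF FE.rsubD(2)[OF rR ab0(1)]] E.comp_gr[OF FE.rsubD(2)[OF rR ab0(2)]])+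
  have abc: "\<alpha> \<in> carrier E" "\<beta> \<in> carrier E" by (rule E.gr_closed(1)[OF abg(1)] E.gr_closed(1)[OF abg(2)])+
  define w1 where "w1 = X1 ^ m \<odot>\<^bsub>E\<^esub> u1 \<ominus>\<^bsub>E\<^esub> \<alpha>"
  define w2 where "w2 = X2 ^ m \<odot>\<^bsub>E\<^esub> u2 \<ominus>\<^bsub>E\<^esub> \<beta>"
  have "w1 \<in> E.gr ((int ?n, 0) + z j)" "w2 \<in> E.gr ((0, int ?n) + z j)"
   unfolding w1_def w2_def
   by (rule E.gr_minus(2)[OF E.gr_smult[OF Sg_X(1)[of m] ug(1), unfolded e'] abg(1)]
    E.gr_minus(2)[OF E.gr_smult[OF Sg_X(2)[of m] ug(2), unfolded e'] abg(2)])+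
  moreover have z0: "x ^ m \<odot>\<^bsub>F.F\<^esub> (x ^ n \<odot>\<^bsub>F.F\<^esub> ee j) \<ominus>\<^bsub>F.F\<^esub> (\<lambda>_. 0) = x ^ ?n \<odot>\<^bsub>F.F\<^esub> ee j" for x :: "'k poly poly"
  proof -
   have e: "x ^ m \<odot>\<^bsub>F.F\<^esub> (x ^ n \<odot>\<^bsub>F.F\<^esub> ee j) = x ^ ?n \<odot>\<^bsub>F.F\<^esub> ee j" by (simp add: power_add mult.assoc)
   show ?thesis using F.F.diff_zero[of "x ^ ?n \<odot>\<^bsub>F.F\<^esub> ee j"] j unfolding e by simp
  qed
  moreover have "(w1, X1 ^ ?n \<odot>\<^bsub>F.F\<^esub> ee j) \<in> G"
   using EF.rsubD(7)[OF rG EF.rsubD(5)[OF rG u(1), of "X1 ^ m"] aG[OF ab(1)]] unfolding z0 w1_def .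
  moreover have "(w2, X2 ^ ?n \<odot>\<^bsub>F.F\<^esub> ee j) \<in> G"
   using EF.rsubD(7)[OF rG EF.rsubD(5)[OF rG u(2), of "X2 ^ m"] aG[OF ab(2)]] unfolding z0 w2_def .
  moreover have "X2 ^ ?n \<odot>\<^bsub>E\<^esub> w1 \<ominus>\<^bsub>E\<^esub> X1 ^ ?n \<odot>\<^bsub>E\<^esub> w2 \<in> E.tors"
  proof -
   let ?P = "X1 ^ m * X2 ^ m :: 'k poly poly"
   have "(?P \<odot>\<^bsub>F.F\<^esub> r, ?P \<odot>\<^bsub>E\<^esub> ?d) \<in> R" by (rule FE.rsubD(5)[OF rR r(2)])
   moreover have "(X2 ^ ?n \<odot>\<^bsub>F.F\<^esub> (X1 ^ m \<odot>\<^bsub>F.F\<^esub> A) \<ominus>\<^bsub>F.F\<^esub> X1 ^ ?n \<odot>\<^bsub>F.F\<^esub> (X2 ^ m \<odot>\<^bsub>F.F\<^esub> B),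
     X2 ^ ?n \<odot>\<^bsub>E\<^esub> \<alpha> \<ominus>\<^bsub>E\<^esub> X1 ^ ?n \<odot>\<^bsub>E\<^esub> \<beta>) \<in> R" (is "(?r, ?ab) \<in> R")
    by (intro FE.rsubD(7)[OF rR] FE.rsubD(5)[OF rR] ab)
   moreover have "?r = ?P \<odot>\<^bsub>F.F\<^esub> r"
   proof -
    have "?r = (\<lambda>i. X2 ^ ?n * (X1 ^ m * A i) - X1 ^ ?n * (X2 ^ m * B i))"
     using Afs F.F_diff[of "X2 ^ ?n \<odot>\<^bsub>F.F\<^esub> (X1 ^ m \<odot>\<^bsub>F.F\<^esub> A)" "X1 ^ ?n \<odot>\<^bsub>F.F\<^esub> (X2 ^ m \<odot>\<^bsub>F.F\<^esub> B)"] by simp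
    also have "\<dots> = ?P \<odot>\<^bsub>F.F\<^esub> r" by (simp add: rAB power_add algebra_simps)
    finally show ?thesis .
   qed
   ultimately have "?P \<odot>\<^bsub>E\<^esub> ?d \<ominus>\<^bsub>E\<^esub> ?ab \<in> E.tors" using FE.rel_single[OF R(1)] by metis
   then show ?thesis
    unfolding w1_def w2_def using uc abc
    by (simp add: E.sm_rdiff E.diff_diff_swap power_add mult_ac flip: E.sm_assoc)
  qed
  ultimately show ?thesis by blast
 qed
 have "\<forall>j. \<exists>w1 w2. j < N --> w1 \<in> E.gr ((int ?n, 0) + z j) \<and> w2 \<in> E.gr ((0, int ?n) + z j) \<and>
   (w1, X1 ^ ?n \<odot>\<^bsub>F.F\<^esub> ee j) \<in> G \<and> (w2, X2 ^ ?n \<odot>\<^bsub>F.F\<^esub> ee j) \<in> G \<and>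
   X2 ^ ?n \<odot>\<^bsub>E\<^esub> w1 \<ominus>\<^bsub>E\<^esub> X1 ^ ?n \<odot>\<^bsub>E\<^esub> w2 \<in> E.tors" using lift by blast
 from choice[OF this] obtain w1 where "\<forall>j. \<exists>w2. j < N --> w1 j \<in> E.gr ((int ?n, 0) + z j) \<and> w2 \<in> E.gr ((0, int ?n) + z j) \<and>
   (w1 j, X1 ^ ?n \<odot>\<^bsub>F.F\<^esub> ee j) \<in> G \<and> (w2, X2 ^ ?n \<odot>\<^bsub>F.F\<^esub> ee j) \<in> G \<and>
   X2 ^ ?n \<odot>\<^bsub>E\<^esub> w1 j \<ominus>\<^bsub>E\<^esub> X1 ^ ?n \<odot>\<^bsub>E\<^esub> w2 \<in> E.tors" by blast
 from choice[OF this] obtain w2 where w: "!!j. j < N ==> w1 j \<in> E.gr ((int ?n, 0) + z j)" "!!j. j < N ==> w2 j \<in> E.gr ((0, int ?n) + z j)"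
  and wG: "!!j. j < N ==> (w1 j, X1 ^ ?n \<odot>\<^bsub>F.F\<^esub> ee j) \<in> G" "!!j. j < N ==> (w2 j, X2 ^ ?n \<odot>\<^bsub>F.F\<^esub> ee j) \<in> G"
  and wt: "!!j. j < N ==> X2 ^ ?n \<odot>\<^bsub>E\<^esub> w1 j \<ominus>\<^bsub>E\<^esub> X1 ^ ?n \<odot>\<^bsub>E\<^esub> w2 j \<in> E.tors" by blast
 have wc: "w1 j \<in> carrier E" "w2 j \<in> carrier E" if "j < N" for j
  by (rule E.gr_closed(1)[OF w(1)[OF that]] E.gr_closed(1)[OF w(2)[OF that]])+
 \<comment> \<open>The section is assembled from a free module of rank \<open>N + N\<close>, with
   one generator for each of the two lifts of a basis vector: \<open>a\<close> maps the generators
   to multiples of basis vectors and \<open>b\<close> maps them to the lifts.\<close>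
 define zz where "zz = app N (\<lambda>j. (int ?n, 0) + z j) (\<lambda>j. (0, int ?n) + z j)"
 define a :: "nat => nat => 'k poly poly" where "a = app N (\<lambda>i k. X1 ^ ?n * ee i k) (\<lambda>i k. X2 ^ ?n * ee i k)"
 define b where "b = app N w1 w2"
 interpret QE: free_to p q "N + N" zz E by unfold_locales
 interpret QF: free_free p q "N + N" zz N z "TYPE('k)" by unfold_locales
 interpret Y: three p q F.F QE.FR.F E by unfold_locales
 have lt: "i - N < N" if "i < N + N" "\<not> i < N" for i using that by simp
 have ra: "QF.AB.FE.rel (QF.AB.gph a)"
 proof (rule QF.AB.gph_rel)
  fix i assume "i < N + N"
  then show "a i \<in> F.F.gr (zz i)"
   using F.F.gr_smult[OF Sg_X(1)[of ?n] F.ee_gr[of i]] F.F.gr_smult[OF Sg_X(2)[of ?n] F.ee_gr[of "i - N"]] lt[of i]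
   by (auto simp: a_def zz_def app_def)
 qed
 have rb: "QE.FE.rel (QE.gph b)"
 proof (rule QE.gph_rel)
  fix i assume "i < N + N"
  then show "b i \<in> E.gr (zz i)" using w[of i] w(2)[of "i - N"] lt[of i] by (auto simp: b_def zz_def app_def)
 qed
 have lca: "F.F.lc a (N + N) c = (\<lambda>i. if i < N then X1 ^ ?n * c i + X2 ^ ?n * c (N + i) else 0)" for c
  unfolding a_def by (subst F.F.lc_app) (auto simp: F.lc_ee_scaled)
 have lcb: "E.lc b (N + N) c = E.lc (\<lambda>i. c i \<odot>\<^bsub>E\<^esub> w1 i \<oplus>\<^bsub>E\<^esub> c (N + i) \<odot>\<^bsub>E\<^esub> w2 i) N (\<lambda>_. 1)" for c
  unfolding b_def using wc E.lc_app[of N w1 N w2 c] E.lc_add_pointwise[of N w1 w2 c "\<lambda>i. c (N + i)"] by simp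
 define S where "S = (QF.AB.gph a)\<inverse> O QE.gph b"
 have SI: "(F.F.lc a (N + N) c, E.lc b (N + N) c) \<in> S" if "c \<in> fs (N + N)" for c
  using that unfolding S_def by (auto simp: QF.AB.gph_iff QE.gph_iff)
 have SE: "\<exists>c\<in>fs (N + N). v = F.F.lc a (N + N) c \<and> e = E.lc b (N + N) c" if "(v, e) \<in> S" for v e
  using that unfolding S_def by (auto simp: QF.AB.gph_iff QE.gph_iff)
 have rS: "FE.rsub S" unfolding S_def
  by (rule Y.comp_rsub[OF QF.AB.FE.rsub_converse[OF QF.AB.FE.rel_rsub[OF ra]] QE.FE.rel_rsub[OF rb]])
 have S: "FE.rel S"
  unfolding FE.rel_def
 proof (intro conjI allI impI subsetI)
  show "FE.rsub S" by (rule rS)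
  fix v assume "v \<in> carrier F.F"
  then have v: "v \<in> fs N" by simp
  show "v \<in> F.F.sat (Domain S)"
  proof (rule F.F.satI)
   fix x :: "'k poly poly" assume x: "x \<in> VV"
   let ?c = "\<lambda>k. if x = X1 then if k < N then v k else 0 else if N \<le> k then v (k - N) else 0"
   have "?c \<in> fs (N + N)" using v by (auto simp: fs_def)
   moreover have "F.F.lc a (N + N) ?c = x ^ ?n \<odot>\<^bsub>F.F\<^esub> v"
    using x fsD[OF v] by (auto simp: lca fun_eq_iff)
   ultimately have "x ^ ?n \<odot>\<^bsub>F.F\<^esub> v \<in> Domain S" using SI[of ?c] by auto
   then show "\<exists>k. x ^ k \<odot>\<^bsub>F.F\<^esub> v \<in> Domain S" ..
  qed (use v in simp)
 next
  fix e assume "(\<zero>\<^bsub>F.F\<^esub>, e) \<in> S"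
  then obtain c where c: "F.F.lc a (N + N) c = (\<lambda>_. 0)" "e = E.lc b (N + N) c" using SE[of "\<zero>\<^bsub>F.F\<^esub>" e] by auto
  \<comment> \<open>By \<open>X_regular\<close> a relation between the two powers is a multiple of
    the Koszul relation, on which the lifts \<open>w1 i\<close> and \<open>w2 i\<close> differ by
    torsion.\<close>
  have "c i \<odot>\<^bsub>E\<^esub> w1 i \<oplus>\<^bsub>E\<^esub> c (N + i) \<odot>\<^bsub>E\<^esub> w2 i \<in> E.tors" if i: "i < N" for i
  proof -
   have "X1 ^ ?n * c i + X2 ^ ?n * c (N + i) = 0" using fun_cong[OF c(1)[unfolded lca], of i] i by simp
   then have "X2 ^ ?n * c (N + i) = X1 ^ ?n * (- c i)" by (simp add: add_eq_0_iff add.commute)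
   then obtain U where U: "c (N + i) = X1 ^ ?n * U" "- c i = X2 ^ ?n * U" using X_regular by blast
   have "c i = - (X2 ^ ?n * U)" using U(2) by (metis minus_minus)
   then have "c i \<odot>\<^bsub>E\<^esub> w1 i \<oplus>\<^bsub>E\<^esub> c (N + i) \<odot>\<^bsub>E\<^esub> w2 i = (- U) \<odot>\<^bsub>E\<^esub> (X2 ^ ?n \<odot>\<^bsub>E\<^esub> w1 i \<ominus>\<^bsub>E\<^esub> X1 ^ ?n \<odot>\<^bsub>E\<^esub> w2 i)"
    using wc[OF i] U(1) by (simp add: a_minus_def E.sm_radd E.sm_minus E.M.minus_add E.sm_assoc E.sm_commute[of _ U])
   then show ?thesis using wt[OF i] E.torsD(4) by simp
  qed
  then show "e \<in> E.tors" unfolding c(2) lcb by (rule E.lc_subm[OF E.tors_subm])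
 qed
 have "F.F.MM.eqv (S O G) (Id_on (carrier F.F))"
  unfolding F.F.MM.eqv_def
 proof (intro allI impI)
  fix v y v' assume "(v, y) \<in> S O G" and v': "(v, v') \<in> Id_on (carrier F.F)"
  then obtain e where e: "(v, e) \<in> S" "(e, y) \<in> G" by blast
  then obtain c where c: "v = F.F.lc a (N + N) c" "e = E.lc b (N + N) c" using SE by blast
  have "(E.lc b (N + N) c, F.F.lc a (N + N) c) \<in> G"
  proof (rule EF.rsub_lc[OF rG])
   fix i assume "i < N + N"
   then show "(b i, a i) \<in> G" using wG(1)[of i] wG(2)[of "i - N"] lt[of i] by (auto simp: a_def b_def app_def)
  qed
  then have "y = v" using Gu e(2) c by blast
  then show "y \<ominus>\<^bsub>F.F\<^esub> v' \<in> F.F.tors" using v' F.F.diff_zero_iff[of v v] F.F.torsD(2) by auto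
 qed
 then have "Cmp (coh p q) F.F E F.F g (FE.cls S) = Idm (coh p q) F.F"
  using FEF.Cmp_cls[OF S G(1)] F.F.MM.cls_eq_iff[OF FEF.comp_rel[OF S G(1)] F.F.Id_rel] by (simp add: G(2) F.F.Idm_eq)
 moreover have "FE.cls S \<in> Mor (coh p q) F.F E" using S FE.Mor_iff by blast
 ultimately show "\<exists>s\<in>Mor (cohX p q) F.F E. Cmp (cohX p q) F.F E F.F g s = Idm (cohX p q) F.F" by blast
qed

end

section \<open>Tilting bundles and their degrees\<close>

context weight_type
begin

text \<open>The Koszul complex of \<open>x1^a\<close> and \<open>x2^b\<close> gives a non-split extension of \<open>O(z)\<close> by
 \<open>O(z + a x1 + b x2)\<close>; the other summands of the two ends are added with a split sequence.\<close>

lemma Ext1_zero_compat: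
 assumes e: "Ext1_zero (cohX p q) (FM N z :: ('k::field) sheaf) (FM N z)"
 shows "compat N z"
proof (rule ccontr)
 assume "\<not> compat N z"
 then obtain i j a' b' where ij: "i < N" "j < N" "a' > 0" "b' > 0" "D (z i) = D (z j + (a', b'))"
  unfolding compat_def by blast
 obtain a b where ab: "a' = int a" "b' = int b" "a > 0" "b > 0" using zero_less_imp_eq_int ij(3,4) by metis
 \<comment> \<open>The degrees of the middle term: two copies of \<open>z\<close>, in which entry
   \<open>i\<close> of the first and entry \<open>j\<close> of the second are replaced by the two
   middle degrees of the Koszul complex.\<close>
 define w where "w = app N (z(i := z j + (int a, 0))) (z(j := z j + (0, int b)))"
 interpret F: free_mod p q N z "TYPE('k)" by unfold_locales
 interpret K: free_mod p q "N + N" w "TYPE('k)" by unfold_locales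
 interpret FF: free_free_to p q N z "N + N" w F.F by unfold_locales (rule F.F.gm F.F.fg)+
 \<comment> \<open>The Koszul column. The left map sends \<open>ee i\<close> to \<open>h\<close> and
   any other basis vector to itself in the first block; the right map uses the Koszul entries for
   coordinate \<open>j\<close> and the second block for all other coordinates.\<close>
 define h :: "nat => 'k poly poly" where "h = (\<lambda>l. X2 ^ b * ee i l - X1 ^ a * ee (N + j) l)"
 define fu where "fu = (ee(i := h) :: nat => nat => 'k poly poly)"
 define gu :: "nat => nat => 'k poly poly" where
  "gu = app N ((\<lambda>_ _. 0)(i := \<lambda>l. X1 ^ a * ee j l)) (ee(j := \<lambda>l. X2 ^ b * ee j l))"
 have hh: "h i = X2 ^ b" "h (N + j) = - (X1 ^ a)" "!!l. l \<noteq> i ==> l \<noteq> N + j ==> h l = 0"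
  using ij(1) by (auto simp: h_def ee_def)
 have d1: "Sg (z i - (z j + (int a, 0))) = Sg (0, int b)"
  by (rule Sg_cong) (use ij(5) in \<open>simp add: D_diff_eq ab add_ac\<close>)
 have d2: "Sg (z i - (z j + (0, int b))) = Sg (int a, 0)"
  by (rule Sg_cong) (use ij(5) in \<open>simp add: D_diff_eq ab add_ac\<close>)
 have fg: "fu k \<in> K.F.gr (z k)" if k: "k < N" for k
 proof -
  have "fu k l \<in> Sg (z k - w l)" if l: "l < N + N" for l
  proof (cases "k = i")
   case True
   have "w i = z j + (int a, 0)" "w (N + j) = z j + (0, int b)" using ij by (simp_all add: w_def app_def)
   then show ?thesis using hh True d1 d2 ij(1) by (cases "l = i"; cases "l = N + j") (auto simp: fu_def)
  next
   case False
   then have "w k = z k" using k by (simp add: w_def app_def)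
   then show ?thesis using False Sg_one by (cases "l = k") (auto simp: fu_def ee_def)
  qed
  moreover have "fu k \<in> fs (N + N)" using k ij(1,2) by (auto simp: fu_def fs_def h_def ee_def)
  ultimately show ?thesis by (simp add: K.F_gr)
 qed
 have gg: "gu k \<in> F.F.gr (w k)" if k: "k < N + N" for k
 proof -
  have "gu k l \<in> Sg (w k - z l)" if l: "l < N" for l
  proof (cases "k < N")
   case True
   then show ?thesis by (cases "k = i"; cases "l = j") (auto simp: gu_def w_def app_def ee_def)
  next
   case False
   then show ?thesis using Sg_one
    by (cases "k - N = j"; cases "l = j"; cases "l = k - N") (auto simp: gu_def w_def app_def ee_def)
  qed
  moreover have "gu k \<in> fs N" using k ij(1,2) by (auto simp: gu_def app_def fs_def ee_def)
  ultimately show ?thesis by (simp add: F.F_gr)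
 qed
 have lcf: "K.F.lc fu N v = (\<lambda>l. v i * h l + (if l < N \<and> l \<noteq> i then v l else 0))" for v
  unfolding fu_def by (rule K.lc_ee_upd[OF ij(1)])
 have lcg: "F.F.lc gu (N + N) c = (\<lambda>l. c i * (X1 ^ a * ee j l) + (c (N + j) * (X2 ^ b * ee j l) + (if l < N \<and> l \<noteq> j then c (N + l) else 0)))" for c
 proof -
  have "((\<lambda>_ _. 0)(i := \<lambda>l. X1 ^ a * ee j l)) k \<in> carrier F.F" "(ee(j := \<lambda>l. X2 ^ b * ee j l)) k \<in> carrier F.F" if "k < N" for k
   using that ij(2) by (auto simp: fs_def ee_def)
  then show ?thesis
   unfolding gu_def using F.F.lc_app[of N "(\<lambda>_ _. 0)(i := \<lambda>l. X1 ^ a * ee j l)" N "ee(j := \<lambda>l. X2 ^ b * ee j l)" c]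
   by (simp add: F.lc_zero_upd[OF ij(1)] F.lc_ee_upd[OF ij(2)])
 qed
 have lcgj: "F.F.lc gu (N + N) c j = X1 ^ a * c i + X2 ^ b * c (N + j)" for c
  unfolding lcg by (simp add: ee_def mult.commute)
 have lcgl: "F.F.lc gu (N + N) c l = c (N + l)" if "l < N" "l \<noteq> j" for c l
  unfolding lcg using that by (simp add: ee_def)
 have zero_out: "v \<in> fs n ==> w \<in> fs n ==> (!!l. l < n ==> v l = w l) ==> v = w" for v w :: "nat => 'k poly poly" and n
  by (rule ext, rename_tac l, case_tac "l < n") (auto simp: fs_def)
 have gufs: "F.F.lc gu (N + N) c \<in> fs N" for c
  using F.F.lc_closed[of "N + N" gu c] F.gr_fs[OF gg] by simp
 have fufs: "K.F.lc fu N v \<in> fs (N + N)" for v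
  using K.F.lc_closed[of N fu v] K.gr_fs[OF fg] by simp
 have se: "short_exact (coh p q) F.F K.F F.F (FF.AB.AB.FE.cls (FF.AB.AB.gph fu)) (FF.BE.FE.cls (FF.BE.gph gu))"
 proof (rule FF.ABE.short_exactI)
  show "FF.AB.AB.FE.rel (FF.AB.AB.gph fu)" by (rule FF.AB.AB.gph_rel) (rule fg)
  show "FF.BE.FE.rel (FF.BE.gph gu)" by (rule FF.BE.gph_rel) (rule gg)
  fix v assume "(v, \<zero>\<^bsub>K.F\<^esub>) \<in> FF.AB.AB.gph fu"
  then have v: "v \<in> fs N" "K.F.lc fu N v = (\<lambda>_. 0)" by (auto simp: FF.AB.AB.gph_iff)
  have "v l = 0" if l: "l < N" for l
   using fun_cong[OF v(2)[unfolded lcf], of l] hh l by (cases "l = i") auto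
  then have "v = (\<lambda>_. 0)" using zero_out[OF v(1), of "\<lambda>_. 0"] by simp
  then show "v \<in> F.F.tors" by (simp add: F.F_tors)
 next
  show "Range (FF.AB.AB.gph fu O FF.BE.gph gu) \<subseteq> F.F.tors"
  proof
   fix y assume "y \<in> Range (FF.AB.AB.gph fu O FF.BE.gph gu)"
   then obtain v where y: "y = F.F.lc gu (N + N) (K.F.lc fu N v)" by (auto simp: FF.AB.AB.gph_iff FF.BE.gph_iff)
   have "F.F.lc gu (N + N) (K.F.lc fu N v) l = 0" if l: "l < N" for l
   proof (cases "l = j")
    case True
    show ?thesis unfolding True lcgj lcf using hh ij(1) by (simp add: algebra_simps)
   next
    case False
    then have "N + l \<noteq> i" "N + l \<noteq> N + j" using ij(1) by auto
    then show ?thesis unfolding lcgl[OF l False] lcf using hh(3) by simp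
   qed
   then have "y = (\<lambda>_. 0)" unfolding y by (intro zero_out[OF gufs]) simp_all
   then show "y \<in> F.F.tors" by (simp add: F.F_tors)
  qed
 next
  fix c assume "(c, \<zero>\<^bsub>F.F\<^esub>) \<in> FF.BE.gph gu"
  then have c: "c \<in> fs (N + N)" "F.F.lc gu (N + N) c = (\<lambda>_. 0)" by (auto simp: FF.BE.gph_iff)
  have "X1 ^ a * c i + X2 ^ b * c (N + j) = 0" using fun_cong[OF c(2), of j] by (simp add: lcgj)
  then have "X2 ^ b * c (N + j) = X1 ^ a * (- c i)" by (simp add: add_eq_0_iff)
  then obtain U where U: "c (N + j) = X1 ^ a * U" "- c i = X2 ^ b * U" using X_regular by blast
  have U2: "c i = - (X2 ^ b * U)" using U(2) by (metis minus_minus)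
  have c0: "c (N + l) = 0" if "l < N" "l \<noteq> j" for l
   using fun_cong[OF c(2), of l] lcgl[OF that, of c] by simp
  define v where "v = (\<lambda>l. if l = i then - U else if l < N then c l else 0)"
  have v: "v \<in> fs N" using ij(1) by (auto simp: v_def fs_def)
  have "K.F.lc fu N v = c"
  proof (rule zero_out[OF fufs c(1)])
   fix l assume l: "l < N + N"
   consider "l = i" | "l = N + j" | "l < N" "l \<noteq> i" | l' where "l = N + l'" "l' < N" "l' \<noteq> j"
    using l by (metis add_diff_inverse_nat add_less_cancel_left)
   then show "K.F.lc fu N v l = c l"
    using hh ij(1) U(1) U2 c0 by cases (auto simp: lcf v_def mult.commute)
  qed
  then have "(v, c) \<in> FF.AB.AB.gph fu" using v by (auto simp: FF.AB.AB.gph_iff)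
  moreover have "K.F.subm (Range (FF.AB.AB.gph fu))"
   using FF.AB.AB.FE.rsub_image fg
    K.F.subm_range_lc[of N fu] K.gr_fs[OF fg]
  proof -
   have "Range (FF.AB.AB.gph fu) = range (K.F.lc fu N)"
   proof (intro equalityI subsetI)
    fix y assume "y \<in> range (K.F.lc fu N)"
    then obtain v where "y = K.F.lc fu N v" by blast
    then have "y = K.F.lc fu N (\<lambda>l. if l < N then v l else 0)" by (simp add: K.F_lc)
    then show "y \<in> Range (FF.AB.AB.gph fu)"
     by (intro RangeI[of "\<lambda>l. if l < N then v l else 0"]) (simp add: FF.AB.AB.gph_iff fs_def)
   qed (auto simp: FF.AB.AB.gph_iff)
   then show ?thesis using K.F.subm_range_lc[of N fu] K.gr_fs[OF fg] by simp
  qed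
  ultimately show "c \<in> K.F.sat (Range (FF.AB.AB.gph fu))" using K.F.sat_incl by blast
 next
  show "carrier F.F \<subseteq> F.F.sat (Range (FF.BE.gph gu))"
  proof (rule subsetI, rule F.F.satI)
   fix y and x :: "'k poly poly" assume "y \<in> carrier F.F" and x: "x \<in> VV"
   then have y: "y \<in> fs N" by simp
   \<comment> \<open>Preimages of \<open>y\<close> multiplied by \<open>X1 ^ a\<close> and by
     \<open>X2 ^ b\<close>: coordinate \<open>j\<close> is reached through one Koszul entry, every
     other coordinate through the second block.\<close>
   let ?c1 = "\<lambda>k. if k = i then y j else if N \<le> k \<and> k \<noteq> N + j then X1 ^ a * y (k - N) else 0"
   let ?c2 = "\<lambda>k. if k = N + j then y j else if N \<le> k then X2 ^ b * y (k - N) else 0"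
   have fs: "?c1 \<in> fs (N + N)" "?c2 \<in> fs (N + N)" using y ij(1,2) by (auto simp: fs_def)
   have "F.F.lc gu (N + N) ?c1 = (\<lambda>l. X1 ^ a * y l)"
   proof (rule zero_out[OF gufs])
    fix l assume "l < N"
    then show "F.F.lc gu (N + N) ?c1 l = X1 ^ a * y l" using ij(1,2) lcgj[of ?c1] lcgl[of l ?c1] by (cases "l = j") auto
   qed (use y in simp)
   then have "(?c1, \<lambda>l. X1 ^ a * y l) \<in> FF.BE.gph gu" using fs by (simp add: FF.BE.gph_iff)
   moreover have "F.F.lc gu (N + N) ?c2 = (\<lambda>l. X2 ^ b * y l)"
   proof (rule zero_out[OF gufs])
    fix l assume "l < N"
    then show "F.F.lc gu (N + N) ?c2 l = X2 ^ b * y l" using ij(1,2) lcgj[of ?c2] lcgl[of l ?c2] by (cases "l = j") auto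
   qed (use y in simp)
   then have "(?c2, \<lambda>l. X2 ^ b * y l) \<in> FF.BE.gph gu" using fs by (simp add: FF.BE.gph_iff)
   ultimately show "\<exists>k. x ^ k \<odot>\<^bsub>F.F\<^esub> y \<in> Range (FF.BE.gph gu)" using x by (auto intro: RangeI)
  qed
 qed
 then obtain s where s: "s \<in> Mor (coh p q) F.F K.F"
  "Cmp (coh p q) F.F K.F F.F (FF.BE.FE.cls (FF.BE.gph gu)) s = Idm (coh p q) F.F"
  using e unfolding Ext1_zero_def by blast
 from FF.AB.Mor_gph[OF s(1)] obtain t where t: "!!i. i < N ==> t i \<in> K.F.gr (z i)" "s = FF.AB.AB.FE.cls (FF.AB.AB.gph t)" by blast
 have eq: "F.F.MM.cls (F.FF.AB.gph (\<lambda>i. F.F.lc gu (N + N) (t i))) = F.F.MM.cls (F.FF.AB.gph ee)"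
  using s(2) FF.Cmp_gph[of t gu, OF t(1) gg] F.Idm_gph by (simp add: t(2))
 have tg: "F.F.lc gu (N + N) (t i) \<in> F.F.gr (z i)" if "i < N" for i by (rule FF.lc_gr[OF t(1) gg that])
 have "F.F.lc gu (N + N) (t j) = ee j"
  using F.FF.cls_gph_eq_iff[of "\<lambda>i. F.F.lc gu (N + N) (t i)" ee, OF tg F.ee_gr] eq ij(2) by simp
 \<comment> \<open>A splitting writes 1 as an element of the ideal of \<open>X1 ^ a\<close> and
   \<open>X2 ^ b\<close>, whose members have no constant term because \<open>a\<close> and
   \<open>b\<close> are positive.\<close>
 then have "X1 ^ a * t j i + X2 ^ b * t j (N + j) = 1" using lcgj[of "t j"] by (simp add: ee_def)
 then have "cf (X1 ^ a * t j i + X2 ^ b * t j (N + j)) 0 0 = (1 :: 'k)" by (simp add: cf_one)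
 then show False using ab(3,4) by simp
qed

section \<open>Tilting bundles as sets of degrees\<close>

lemma degrees_iso:
 assumes inj: "inj_on (\<lambda>i. D (z i)) {..<n}" "inj_on (\<lambda>i. D (w i)) {..<n}"
  and eq: "(\<lambda>i. D (z i)) ` {..<n} = (\<lambda>i. D (w i)) ` {..<n}"
 shows "isomorphic (cohX p q) (FM n z :: ('k::field) sheaf) (FM n w)"
proof -
 interpret C: category "cohX p q :: ('k sheaf, _) cat" by (rule coh_category)
 \<comment> \<open>Matches each index with the one at which \<open>w\<close> has the same degree; by
   injectivity this is a permutation.\<close>
 define \<sigma> where "\<sigma> = inv_into {..<n} (\<lambda>i. D (w i)) \<circ> (\<lambda>i. D (z i))"
 have \<sigma>: "bij_betw \<sigma> {..<n} {..<n}" unfolding \<sigma>_def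
  by (rule bij_betw_trans[OF bij_betw_imageI[OF inj(1) refl]])
   (unfold eq, rule bij_betw_inv_into[OF bij_betw_imageI[OF inj(2) refl]])
 have D\<sigma>: "D (w (\<sigma> i)) = D (z i)" if "i < n" for i
 proof -
  have "D (z i) \<in> (\<lambda>i. D (w i)) ` {..<n}" using that eq by blast
  from f_inv_into_f[OF this] show ?thesis by (simp add: \<sigma>_def)
 qed
 have "direct_sum (cohX p q) {..<n} (\<lambda>i. FM 1 (\<lambda>_. w (\<sigma> i))) (FM n z :: 'k sheaf)"
 proof (rule C.coprod_iso_summands[OF direct_sum_FM])
  fix i assume "i \<in> {..<n}"
  then have "FM 1 (\<lambda>_. w (\<sigma> i)) = (FM 1 (\<lambda>_. z i) :: 'k sheaf)" using D\<sigma> by (intro FM_cong) simp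
  then show "isomorphic (cohX p q) (FM 1 (\<lambda>_. w (\<sigma> i)) :: 'k sheaf) (FM 1 (\<lambda>_. z i))"
   using C.iso_refl[OF FM_Ob] by simp
 qed (rule FM_Ob)
 then have "direct_sum (cohX p q) {..<n} (\<lambda>i. FM 1 (\<lambda>_. w i)) (FM n z :: 'k sheaf)"
  using C.coprod_reindex[OF _ \<sigma>, of "\<lambda>i. FM 1 (\<lambda>_. w i)"] by blast
 then show ?thesis by (rule C.coprod_unique[OF _ direct_sum_FM])
qed

text \<open>Summands of a bundle are bundles because the injections are split monomorphisms, and an
  indecomposable bundle has rank one. Pairwise non-isomorphic summands then mean distinct degrees,
  and vanishing self-extensions mean \<open>compat\<close>.\<close>

lemma tilting_bundle_iff:
 fixes T :: "('k::alg_closed_field) sheaf"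
 shows "T \<in> tilting_bundles p q \<longleftrightarrow> T \<in> Ob (cohX p q) \<and>
  (\<exists>z. isomorphic (cohX p q) T (FM (p + q) z) \<and> inj_on (\<lambda>i. D (z i)) {..<p + q} \<and> compat (p + q) z)"
proof -
 interpret C: category "cohX p q :: ('k sheaf, _) cat" by (rule coh_category)
 interpret Z: category_zero "cohX p q :: ('k sheaf, _) cat" "FM 0 undefined" by (rule cohX_category_zero)
 let ?n = "p + q"
 show ?thesis
 proof (intro iffI conjI)
  assume "T \<in> tilting_bundles p q"
  then have T: "T \<in> Ob (cohX p q)" and e: "Ext1_zero (cohX p q) T T" and v: "vector_bundle p q T"
   and "\<exists>U. direct_sum (cohX p q) {..<?n} U T \<and> (\<forall>i<?n. indecomposable (cohX p q) (U i)) \<and>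
    (\<forall>i<?n. \<forall>j<?n. i \<noteq> j --> \<not> isomorphic (cohX p q) (U i) (U j))"
   unfolding tilting_bundles_def tilting_sheaf_def by blast+
  then obtain U where U: "direct_sum (cohX p q) {..<?n} U T" "!!i. i < ?n ==> indecomposable (cohX p q) (U i)"
   "!!i j. i < ?n ==> j < ?n ==> i \<noteq> j ==> \<not> isomorphic (cohX p q) (U i) (U j)" by blast
  show "T \<in> Ob (cohX p q)" by (rule T)
  have UO: "U i \<in> Ob (cohX p q)" if "i < ?n" for i using U(2)[OF that] by (simp add: indecomposable_def)
  obtain \<iota> where \<iota>: "C.coprod {..<?n} U T \<iota>" using U(1) C.direct_sum_iff by blast
  have "\<exists>z. isomorphic (cohX p q) (U i) (FM 1 (\<lambda>_. z))" if i: "i < ?n" for i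
  proof -
   have "i \<in> {..<?n}" using i by simp
   from Z.coprod_projection[OF \<iota> this] obtain \<pi> where \<pi>: "\<pi> \<in> Mor (cohX p q) T (U i)"
    "Cmp (cohX p q) (U i) T (U i) \<pi> (\<iota> i) = Idm (cohX p q) (U i)" by blast
   have im: "mono_mor (cohX p q) (U i) T (\<iota> i)"
    using Z.split_mono[OF UO[OF i] T C.coprodD(3)[OF \<iota>] \<pi>] i by simp
   have "vector_bundle p q (U i)"
    unfolding vector_bundle_def
   proof (intro conjI notI)
    assume "\<exists>Y f. simple_object (cohX p q) Y \<and> mono_mor (cohX p q) Y (U i) f"
    then obtain Y f where Y: "simple_object (cohX p q) Y" "mono_mor (cohX p q) Y (U i) f" by blast
    then have "Y \<in> Ob (cohX p q)" by (simp add: simple_object_def)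
    from Z.mono_comp[OF this UO[OF i] T Y(2) im] show False using v Y(1) unfolding vector_bundle_def by blast
   qed (rule UO[OF i])
   then obtain m w where mw: "isomorphic (cohX p q) (U i) (FM m w)" unfolding vector_bundle_iff by blast
   have "indecomposable (cohX p q) (FM m w :: 'k sheaf)" by (rule C.iso_indecomposable[OF U(2)[OF i] mw FM_Ob])
   then have "m = 1" by (rule FM_indecomposable)
   moreover have "FM 1 w = (FM 1 (\<lambda>_. w 0) :: 'k sheaf)" by (rule FM_cong) simp
   ultimately show ?thesis using mw by (intro exI[of _ "w 0"]) simp
  qed
  then obtain z where z: "!!i. i < ?n ==> isomorphic (cohX p q) (U i) (FM 1 (\<lambda>_. z i))" by metis
  have "direct_sum (cohX p q) {..<?n} (\<lambda>i. FM 1 (\<lambda>_. z i)) T"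
  proof (rule C.coprod_iso_summands[OF U(1)])
   fix i assume "i \<in> {..<?n}"
   then show "isomorphic (cohX p q) (FM 1 (\<lambda>_. z i)) (U i)" using C.iso_sym[OF z] by simp
  qed (rule FM_Ob)
  then have iso: "isomorphic (cohX p q) T (FM ?n z)" by (rule C.coprod_unique[OF _ direct_sum_FM])
  moreover have "inj_on (\<lambda>i. D (z i)) {..<?n}"
  proof (rule inj_onI, rule ccontr)
   fix i j assume ij: "i \<in> {..<?n}" "j \<in> {..<?n}" "D (z i) = D (z j)" "i \<noteq> j"
   then have "FM 1 (\<lambda>_. z i) = (FM 1 (\<lambda>_. z j) :: 'k sheaf)" by (intro FM_cong) simp
   then have "isomorphic (cohX p q) (U i) (U j)"
    using ij C.iso_trans[OF UO FM_Ob UO z, of i j] C.iso_sym[OF z, of j] by simp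
   then show False using U(3) ij by simp
  qed
  moreover have "compat ?n z" by (rule Ext1_zero_compat[OF Z.Ext1_zero_iso[OF e iso T FM_Ob]])
  ultimately show "\<exists>z. isomorphic (cohX p q) T (FM ?n z) \<and> inj_on (\<lambda>i. D (z i)) {..<?n} \<and> compat ?n z" by blast
 next
  assume "T \<in> Ob (cohX p q) \<and> (\<exists>z. isomorphic (cohX p q) T (FM ?n z) \<and> inj_on (\<lambda>i. D (z i)) {..<?n} \<and> compat ?n z)"
  then obtain z where T: "T \<in> Ob (cohX p q)" and iso: "isomorphic (cohX p q) T (FM ?n z)"
   and inj: "inj_on (\<lambda>i. D (z i)) {..<?n}" and c: "compat ?n z" by blast
  have v: "vector_bundle p q T" using T iso unfolding vector_bundle_iff by blast
  have e: "Ext1_zero (cohX p q) T T" by (rule Z.Ext1_zero_iso[OF compat_Ext1_zero[OF c] C.iso_sym[OF iso] FM_Ob T])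
  have ds: "direct_sum (cohX p q) {..<?n} (\<lambda>i. FM 1 (\<lambda>_. z i)) T" by (rule C.coprod_iso_sum[OF direct_sum_FM T C.iso_sym[OF iso]])
  have ni: "\<not> isomorphic (cohX p q) (FM 1 (\<lambda>_. z i) :: 'k sheaf) (FM 1 (\<lambda>_. z j))" if ij: "i < ?n" "j < ?n" "i \<noteq> j" for i j
  proof
   assume "isomorphic (cohX p q) (FM 1 (\<lambda>_. z i) :: 'k sheaf) (FM 1 (\<lambda>_. z j))"
   from iso_free_degrees[OF this, of 0] have "D (z i) = D (z j)" by auto
   then show False using inj_onD[OF inj, of i j] ij by simp
  qed
  show "T \<in> tilting_bundles p q"
   unfolding tilting_bundles_def tilting_sheaf_def
   using T e v ds ni line_indecomposable by blast
 qed
qed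

end

section \<open>Shifts of modules, of relations, and of isomorphisms\<close>

lemma gshift_simps [simp]: "carrier (gshift p q x M) = carrier M" "ring.add (gshift p q x M) = ring.add M"
 "ring.zero (gshift p q x M) = ring.zero M" "module.smult (gshift p q x M) = module.smult M"
 by (simp_all add: gshift_def)

context graded_mod
begin

lemma gshift_grade: "grade (gshift p q (D u) M) (D v) = gr (u + v)"
 by (simp add: gshift_def gr_def)

lemma gshift_module: "module (SS :: 'k poly poly ring) (gshift p q x M)"
proof (rule moduleI)
 show "abelian_group (gshift p q x M)"
 proof (rule abelian_groupI)
  fix m assume "m \<in> carrier (gshift p q x M)"
  then show "\<exists>n\<in>carrier (gshift p q x M). n \<oplus>\<^bsub>gshift p q x M\<^esub> m = \<zero>\<^bsub>gshift p q x M\<^esub>"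
   by (intro bexI[of _ "\<ominus> m"]) (simp_all add: M.l_neg)
 qed (simp_all add: M.a_ac)
qed (simp_all add: SS_cring sm_ladd sm_radd sm_assoc)

lemma gshift_graded: "graded_module p q (gshift p q (D u) M)"
 unfolding graded_module_def
proof (intro conjI ballI)
 let ?S = "gshift p q (D u) M"
 have fs: "finsum ?S f A = finsum M f A" for f :: "degree => 'b" and A by (simp add: finsum_def)
 show "module SS ?S" by (rule gshift_module)
 show "subgroup (grade ?S x) (add_monoid ?S)" if "x \<in> carrier L" for x
  using that gr_subgroup by (elim L_cases) (simp add: gshift_grade)
 show "s \<odot>\<^bsub>?S\<^esub> m \<in> grade ?S (x \<otimes>\<^bsub>L\<^esub> y)"
  if x: "x \<in> carrier L" and y: "y \<in> carrier L" and s: "s \<in> S_grade p q x" and m: "m \<in> grade ?S y" for x y s m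
 proof -
  obtain v w where vw: "x = D v" "y = D w" using x y L_cases by metis
  have "s \<odot> m \<in> gr (v + (u + w))" using gr_smult[of s v m "u + w"] s m by (simp add: vw Sg_eq gshift_grade)
  then show ?thesis by (simp add: vw gshift_grade add_ac)
 qed
 fix m assume "m \<in> carrier ?S"
 then have m: "m \<in> carrier M" by simp
 \<comment> \<open>\<open>h\<close> and its inverse \<open>k\<close> translate the degree group;
   decompositions for the shifted grading are those of \<open>M\<close> reindexed along
   them.\<close>
 define h where "h y = D u \<otimes>\<^bsub>L\<^esub> y" for y
 define k where "k y = D (- u) \<otimes>\<^bsub>L\<^esub> y" for y
 have hk: "h y \<in> carrier L" "k y \<in> carrier L" "h (k y) = y" "k (h y) = y" if "y \<in> carrier L" for y
  using that by (auto elim!: L_cases simp: h_def k_def)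
 have inj: "inj_on h A" if "A \<subseteq> carrier L" for A using hk(4) that by (metis inj_on_inverseI subsetD)
 show "\<exists>!c. c \<in> (\<Pi>\<^sub>E x\<in>carrier L. grade ?S x) \<and> finite {x \<in> carrier L. c x \<noteq> \<zero>\<^bsub>?S\<^esub>} \<and>
   m = finsum ?S c {x \<in> carrier L. c x \<noteq> \<zero>\<^bsub>?S\<^esub>}"
 proof (rule ex1I[of _ "\<lambda>y\<in>carrier L. comp (h y) m"])
  let ?c = "\<lambda>y\<in>carrier L. comp (h y) m"
  let ?A = "{x \<in> carrier L. ?c x \<noteq> \<zero>\<^bsub>?S\<^esub>}"
  have "comp (h y) m \<in> grade ?S y" if "y \<in> carrier L" for y
   using that comp_gr[OF m] by (elim L_cases) (simp add: h_def gshift_grade)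
  then have 1: "?c \<in> (\<Pi>\<^sub>E x\<in>carrier L. grade ?S x)" by auto
  have im: "h ` ?A = supp m"
  proof (intro equalityI subsetI)
   fix x assume "x \<in> supp m"
   then have "x = h (k x)" "k x \<in> ?A" using hk[of x] by auto
   then show "x \<in> h ` ?A" by blast
  qed (use hk in auto)
  then have 2: "finite ?A" using finite_supp[OF m] finite_imageD[OF _ inj[of ?A]] by auto
  have "m = finsum M (\<lambda>x. comp x m) (h ` ?A)" unfolding im using comp_all[OF m] by simp
  also have "\<dots> = finsum M (\<lambda>y. comp (h y) m) ?A"
   by (rule M.finsum_reindex) (use hk m inj[of ?A] in auto)
  also have "\<dots> = finsum M ?c ?A" by (rule M.finsum_cong') (use hk m in auto)
  finally show "?c \<in> (\<Pi>\<^sub>E x\<in>carrier L. grade ?S x) \<and> finite ?A \<and> m = finsum ?S ?c ?A" using 1 2 fs by simp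
 next
  fix c assume c: "c \<in> (\<Pi>\<^sub>E x\<in>carrier L. grade ?S x) \<and> finite {x \<in> carrier L. c x \<noteq> \<zero>\<^bsub>?S\<^esub>} \<and>
   m = finsum ?S c {x \<in> carrier L. c x \<noteq> \<zero>\<^bsub>?S\<^esub>}"
  let ?A = "{x \<in> carrier L. c x \<noteq> \<zero>}"
  have cg: "c (D v) \<in> gr (u + v)" for v using c gshift_grade by (metis (no_types, lifting) D_in_L PiE_mem)
  have cc: "c y \<in> carrier M" if "y \<in> carrier L" for y using that gr_closed(1)[OF cg] by (metis L_cases)
  have un: "comp x m = c (k x)" if x: "x \<in> carrier L" for x
  proof (rule comp_unique[where c = "\<lambda>x. c (k x)" and F = "h ` ?A"])
   show "c (k (D v)) \<in> gr v" for v using cg[of "v - u"] by (simp add: k_def)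
   show "finite (h ` ?A)" using c by simp
   show "h ` ?A \<subseteq> carrier L" using hk by auto
   show "c (k x) = \<zero>" if "x \<in> carrier L" "x \<notin> h ` ?A" for x
   proof (rule ccontr)
    assume "c (k x) \<noteq> \<zero>"
    then have "h (k x) \<in> h ` ?A" using hk[OF that(1)] by (intro imageI) simp
    then show False using that hk by simp
   qed
   have "m = finsum M c ?A" using c fs by simp
   also have "\<dots> = finsum M (\<lambda>y. c (k (h y))) ?A" by (rule M.finsum_cong') (use hk cc in auto)
   also have "\<dots> = finsum M (\<lambda>x. c (k x)) (h ` ?A)"
    by (rule M.finsum_reindex[symmetric]) (use hk cc inj[of ?A] in auto)
   finally show "m = finsum M (\<lambda>x. c (k x)) (h ` ?A)" .
  qed (rule x)
  show "c = (\<lambda>y\<in>carrier L. comp (h y) m)"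
  proof
   fix y show "c y = (\<lambda>y\<in>carrier L. comp (h y) m) y"
   proof (cases "y \<in> carrier L")
    case True
    then show ?thesis using un[OF hk(1)[OF True]] hk(4)[OF True] by simp
   next
    case False
    then show ?thesis using PiE_arb[OF conjunct1[OF c] False] by simp
   qed
  qed
 qed
qed

lemma gshift_comp:
 assumes m: "m \<in> carrier M"
 shows "graded_mod.comp p q (gshift p q (D u) M) (D v) m = comp (D (u + v)) m"
proof -
 interpret S: graded_mod p q "gshift p q (D u) M" by unfold_locales (rule gshift_graded)
 have Sgr: "S.gr w = gr (u + w)" for w unfolding S.gr_def gshift_grade ..
 show ?thesis
 proof (rule hom_induct[OF m, where T = "\<lambda>m. S.comp (D v) m = comp (D (u + v)) m"])
  fix w h assume h: "h \<in> gr w"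
  then have "h \<in> S.gr (w - u)" by (simp add: Sgr)
  moreover have "D v = D (w - u) \<longleftrightarrow> D (u + v) = D w" using D_diff_eq[of w u v] by (metis add.commute)
  ultimately show "S.comp (D v) h = comp (D (u + v)) h" using S.comp_hom[of h "w - u" "D v"] comp_hom[OF h, of "D (u + v)"] by simp
 next
  fix a b assume "a \<in> carrier M" "b \<in> carrier M" "S.comp (D v) a = comp (D (u + v)) a" "S.comp (D v) b = comp (D (u + v)) b"
  then show "S.comp (D v) (a \<oplus> b) = comp (D (u + v)) (a \<oplus> b)" using S.comp_add[of a b "D v"] comp_add[of a b "D (u + v)"] by simp
 qed
qed

end

lemma (in obj) gshift_obj: "obj p q (gshift p q (D u) M)"
proof -
 interpret S: graded_mod p q "gshift p q (D u) M" by unfold_locales (rule gshift_graded)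
 from fg_lc[OF fg] obtain n g d where g: "!!i. i < n ==> g i \<in> gr (d i)" "carrier M = range (lc g n)" by blast
 have "S.lc g n v = lc g n v" for n v by (induction n) simp_all
 then have "finitely_generated (gshift p q (D u) M)"
  using S.lc_fg[of n g] g gr_closed(1)[OF g(1)] by simp
 then show ?thesis by unfold_locales
qed

context two
begin

text \<open>Saturation and torsion do not refer to the grading, and components are merely
  relabelled, so one and the same relation represents the shifted morphism.\<close>

lemma gshift_rel:
 assumes R: "rel R"
 shows "two.rel p q (gshift p q (M.D u) M) (gshift p q (M.D u) N) R"
proof -
 interpret S: two p q "gshift p q (M.D u) M" "gshift p q (M.D u) N" by (rule two.intro[OF M.gshift_obj N.gshift_obj])
 note r = rel_rsub[OF R]
 have "S.M.sat A = M.sat A" "S.N.tors = N.tors" for A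
  by (simp_all add: S.M.sat_def M.sat_def S.N.tors_def N.tors_def S.N.sat_def N.sat_def)
 moreover have "(S.M.comp (M.D v) m, S.N.comp (M.D v) n) \<in> R" if mn: "(m, n) \<in> R" for m n v
  using rsubD(6)[OF r mn, of "M.D (u + v)"]
  by (simp add: M.gshift_comp[OF rsubD(1)[OF r mn]] N.gshift_comp[OF rsubD(2)[OF r mn]])
 ultimately show ?thesis
  unfolding S.rel_def S.rsub_def using R by (auto simp: rel_def rsub_def)
qed

lemma gshift_eqv:
 "two.eqv (gshift p q (M.D u) N) R R' \<longleftrightarrow> eqv R R'"
proof -
 interpret S: two p q "gshift p q (M.D u) M" "gshift p q (M.D u) N" by (rule two.intro[OF M.gshift_obj N.gshift_obj])
 have "S.N.tors = N.tors" by (simp add: S.N.tors_def N.tors_def S.N.sat_def N.sat_def)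
 then show ?thesis by (simp add: S.eqv_def eqv_def a_minus_def a_inv_def)
qed

end

context weight_type
begin

lemma gshift_isomorphic:
 assumes M: "M \<in> Ob (cohX p q)" and N: "N \<in> Ob (cohX p q)" and i: "isomorphic (cohX p q) M (N :: ('k::field) sheaf)"
 shows "isomorphic (cohX p q) (gshift p q (D u) M) (gshift p q (D u) N)"
proof -
 interpret M: obj p q M using M by (simp add: Ob_iff)
 interpret N: obj p q N using N by (simp add: Ob_iff)
 interpret SM: obj p q "gshift p q (D u) M" by (rule M.gshift_obj)
 interpret SN: obj p q "gshift p q (D u) N" by (rule N.gshift_obj)
 interpret MN: two p q M N by unfold_locales
 interpret NM: two p q N M by unfold_locales
 interpret sMN: two p q "gshift p q (D u) M" "gshift p q (D u) N" by unfold_locales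
 interpret sNM: two p q "gshift p q (D u) N" "gshift p q (D u) M" by unfold_locales
 interpret MNM: three p q M N M by unfold_locales
 interpret NMN: three p q N M N by unfold_locales
 interpret sMNM: three p q "gshift p q (D u) M" "gshift p q (D u) N" "gshift p q (D u) M" by unfold_locales
 interpret sNMN: three p q "gshift p q (D u) N" "gshift p q (D u) M" "gshift p q (D u) N" by unfold_locales
 interpret C: category "cohX p q :: ('k sheaf, _) cat" by (rule coh_category)
 from i obtain f g where fg: "f \<in> Mor (coh p q) M N" "g \<in> Mor (coh p q) N M"
  "Cmp (coh p q) M N M g f = Idm (coh p q) M" "Cmp (coh p q) N M N f g = Idm (coh p q) N" by (rule C.isoE)
 obtain R where R: "MN.rel R" "f = MN.cls R" using fg(1)[unfolded MN.Mor_iff] by blast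
 obtain T where T: "NM.rel T" "g = NM.cls T" using fg(2)[unfolded NM.Mor_iff] by blast
 have e1: "M.MM.eqv (R O T) (Id_on (carrier M))"
  using fg(3) MNM.Cmp_cls[OF R(1) T(1)] M.MM.cls_eq_iff[OF MNM.comp_rel[OF R(1) T(1)] M.Id_rel] by (simp add: R(2) T(2) M.Idm_eq)
 have e2: "N.MM.eqv (T O R) (Id_on (carrier N))"
  using fg(4) NMN.Cmp_cls[OF T(1) R(1)] N.MM.cls_eq_iff[OF NMN.comp_rel[OF T(1) R(1)] N.Id_rel] by (simp add: R(2) T(2) N.Idm_eq)
 note sR = MN.gshift_rel[OF R(1), of u] and sT = NM.gshift_rel[OF T(1), of u]
 show ?thesis
 proof (rule C.isoI)
  show "sMN.cls R \<in> Mor (coh p q) (gshift p q (D u) M) (gshift p q (D u) N)" unfolding sMN.Mor_iff using sR by blast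
  show "sNM.cls T \<in> Mor (coh p q) (gshift p q (D u) N) (gshift p q (D u) M)" unfolding sNM.Mor_iff using sT by blast
  show "Cmp (coh p q) (gshift p q (D u) M) (gshift p q (D u) N) (gshift p q (D u) M) (sNM.cls T) (sMN.cls R) = Idm (coh p q) (gshift p q (D u) M)"
   unfolding sMNM.Cmp_cls[OF sR sT] SM.Idm_eq SM.MM.cls_eq_iff[OF sMNM.comp_rel[OF sR sT] SM.Id_rel]
   using e1 M.MM.gshift_eqv by simp
  show "Cmp (coh p q) (gshift p q (D u) N) (gshift p q (D u) M) (gshift p q (D u) N) (sMN.cls R) (sNM.cls T) = Idm (coh p q) (gshift p q (D u) N)"
   unfolding sNMN.Cmp_cls[OF sT sR] SN.Idm_eq SN.MM.cls_eq_iff[OF sNMN.comp_rel[OF sT sR] SN.Id_rel]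
   using e2 N.MM.gshift_eqv by simp
 qed
qed

lemma gshift_FM: "gshift p q (D u) (FM n z) = FM n (\<lambda>i. z i - u)"
proof -
 \<comment> \<open>An equality of records also concerns the values of \<open>grade\<close> outside
   the degree group, where the group laws do not apply. The product is therefore treated as a sum of
   arbitrary subsets of \<open>Z^2\<close>, which is commutative and associative without
   restriction.\<close>
 have set: "A \<otimes>\<^bsub>L\<^esub> B = {x. \<exists>a\<in>A. \<exists>b\<in>B. x = a + b}" for A B
  by (auto simp: LL_def FactGroup_def set_mult_def)
 have comm: "A \<otimes>\<^bsub>L\<^esub> B = B \<otimes>\<^bsub>L\<^esub> A" for A B
  unfolding set by (rule Collect_cong) (metis add.commute)
 have assoc: "A \<otimes>\<^bsub>L\<^esub> B \<otimes>\<^bsub>L\<^esub> C = A \<otimes>\<^bsub>L\<^esub> (B \<otimes>\<^bsub>L\<^esub> C)" for A B C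
 proof (intro equalityI subsetI)
  fix x assume "x \<in> A \<otimes>\<^bsub>L\<^esub> B \<otimes>\<^bsub>L\<^esub> C"
  then obtain a b c where "a \<in> A" "b \<in> B" "c \<in> C" "x = (a + b) + c" unfolding set by blast
  then show "x \<in> A \<otimes>\<^bsub>L\<^esub> (B \<otimes>\<^bsub>L\<^esub> C)" unfolding set add.assoc by blast
 next
  fix x assume "x \<in> A \<otimes>\<^bsub>L\<^esub> (B \<otimes>\<^bsub>L\<^esub> C)"
  then obtain a b c where "a \<in> A" "b \<in> B" "c \<in> C" "x = a + (b + c)" unfolding set by blast
  then show "x \<in> A \<otimes>\<^bsub>L\<^esub> B \<otimes>\<^bsub>L\<^esub> C" unfolding set add.assoc[symmetric] by blast
 qed
 have "(D u \<otimes>\<^bsub>L\<^esub> x) \<otimes>\<^bsub>L\<^esub> D (- z i) = x \<otimes>\<^bsub>L\<^esub> D (- (z i - u))" for x i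
 proof -
  have "(D u \<otimes>\<^bsub>L\<^esub> x) \<otimes>\<^bsub>L\<^esub> D (- z i) = x \<otimes>\<^bsub>L\<^esub> (D u \<otimes>\<^bsub>L\<^esub> D (- z i))" unfolding comm[of "D u" x] by (rule assoc)
  then show ?thesis by simp
 qed
 then show ?thesis unfolding gshift_def FM_def by simp
qed

end

section \<open>Lattice paths\<close>

lemma lattice_paths_Nil [simp]: "[] \<notin> lattice_paths a b"
 by (simp add: lattice_paths_def)

lemma lattice_paths_Cons:
 "a # ps \<in> lattice_paths c b \<longleftrightarrow> a = c \<and>
  (ps = [] \<and> a = b \<or> ps \<in> lattice_paths (fst a, snd a + 1) b \<or> ps \<in> lattice_paths (fst a + 1, snd a) b)"
proof (cases ps)
 case (Cons a' ps')
 have "(\<forall>i. Suc i < length (a # ps) --> (a # ps) ! Suc i \<in> {(fst ((a # ps) ! i), snd ((a # ps) ! i) + 1), (fst ((a # ps) ! i) + 1, snd ((a # ps) ! i))}) \<longleftrightarrow>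
   a' \<in> {(fst a, snd a + 1), (fst a + 1, snd a)} \<and>
   (\<forall>i. Suc i < length ps --> ps ! Suc i \<in> {(fst (ps ! i), snd (ps ! i) + 1), (fst (ps ! i) + 1, snd (ps ! i))})" (is "(\<forall>i. ?P i) \<longleftrightarrow> _")
 proof (intro iffI conjI allI impI)
  assume H: "\<forall>i. ?P i"
  show "a' \<in> {(fst a, snd a + 1), (fst a + 1, snd a)}" using H[rule_format, of 0] Cons by simp
  fix i assume "Suc i < length ps"
  then show "ps ! Suc i \<in> {(fst (ps ! i), snd (ps ! i) + 1), (fst (ps ! i) + 1, snd (ps ! i))}" using H[rule_format, of "Suc i"] by simp
 next
  fix i assume H: "a' \<in> {(fst a, snd a + 1), (fst a + 1, snd a)} \<and>
   (\<forall>i. Suc i < length ps --> ps ! Suc i \<in> {(fst (ps ! i), snd (ps ! i) + 1), (fst (ps ! i) + 1, snd (ps ! i))})"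
   and i: "Suc i < length (a # ps)"
  show "(a # ps) ! Suc i \<in> {(fst ((a # ps) ! i), snd ((a # ps) ! i) + 1), (fst ((a # ps) ! i) + 1, snd ((a # ps) ! i))}"
  proof (cases i)
   case 0
   then show ?thesis using conjunct1[OF H] Cons by simp
  next
   case (Suc k)
   then show ?thesis using conjunct2[OF H, rule_format, of k] i by simp
  qed
 qed
 then show ?thesis using Cons by (auto simp: lattice_paths_def)
qed (auto simp: lattice_paths_def)

lemma lattice_paths_le: "ps \<in> lattice_paths a b ==> fst a \<le> fst b \<and> snd a \<le> snd b"
 by (induction ps arbitrary: a) (fastforce simp: lattice_paths_Cons)+

lemma lattice_paths_refl: "lattice_paths a a = {[a]}"
proof -
 have "ps = [a]" if "ps \<in> lattice_paths a a" for ps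
  using that lattice_paths_le[of _ "(fst a, snd a + 1)" a] lattice_paths_le[of _ "(fst a + 1, snd a)" a]
  by (cases ps) (auto simp: lattice_paths_Cons)
 then show ?thesis by (auto simp: lattice_paths_Cons)
qed

text \<open>Pascal's rule, splitting by the first step. The endpoint is written relative to the
  start so that the induction can move the starting point.\<close>

lemma card_lattice_paths:
 "finite (lattice_paths a (a + (int i, int j))) \<and> card (lattice_paths a (a + (int i, int j))) = (i + j) choose i"
proof (induction "i + j" arbitrary: i j a)
 case 0
 then show ?case by (simp add: lattice_paths_refl zero_prod_def[symmetric])
next
 case (Suc n)
 let ?b = "a + (int i, int j)"
 let ?U = "lattice_paths (fst a, snd a + 1) ?b" and ?R = "lattice_paths (fst a + 1, snd a) ?b"
 have "a \<noteq> ?b" using Suc.hyps(2) by (cases a) auto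
 then have eq: "lattice_paths a ?b = (#) a ` (?U \<union> ?R)"
 proof (intro equalityI subsetI)
  fix ps assume "ps \<in> lattice_paths a ?b" "a \<noteq> ?b"
  then show "ps \<in> (#) a ` (?U \<union> ?R)" by (cases ps) (auto simp: lattice_paths_Cons)
 qed (auto simp: lattice_paths_Cons)
 have disj: "?U \<inter> ?R = {}" by (auto simp: lattice_paths_def)
 have U: "finite ?U \<and> card ?U = (if j = 0 then 0 else (i + (j - 1)) choose i)"
 proof (cases j)
  case 0
  then have "?U = {}" using lattice_paths_le[of _ "(fst a, snd a + 1)" ?b] by fastforce
  then show ?thesis using 0 by simp
 next
  case (Suc j')
  then have "(fst a, snd a + 1) + (int i, int j') = ?b" by (cases a) simp
  then show ?thesis using Suc.hyps(1)[of i j' "(fst a, snd a + 1)"] Suc \<open>Suc n = i + j\<close> by simp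
 qed
 have R: "finite ?R \<and> card ?R = (if i = 0 then 0 else ((i - 1) + j) choose (i - 1))"
 proof (cases i)
  case 0
  then have "?R = {}" using lattice_paths_le[of _ "(fst a + 1, snd a)" ?b] by fastforce
  then show ?thesis using 0 by simp
 next
  case (Suc i')
  then have "(fst a + 1, snd a) + (int i', int j) = ?b" by (cases a) simp
  then show ?thesis using Suc.hyps(1)[of i' j "(fst a + 1, snd a)"] Suc \<open>Suc n = i + j\<close> by simp
 qed
 have "card (lattice_paths a ?b) = card ?U + card ?R"
  unfolding eq using U R disj by (simp add: card_image card_Un_disjoint)
 also have "\<dots> = (i + j) choose i"
  using U R Suc.hyps(2) by (cases i; cases j) (auto simp: add.commute)
 finally show ?case using U R by (simp add: eq)
qed

text \<open>Every step raises the sum of the coordinates by one. This fixes the length of a path and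
  recovers the second coordinates from the first ones.\<close>

lemma lattice_paths_sum:
 "ps \<in> lattice_paths a b ==> k < length ps ==> fst (ps ! k) + snd (ps ! k) = fst a + snd a + int k"
proof (induction k)
 case 0
 then show ?case by (auto simp: lattice_paths_def hd_conv_nth)
next
 case (Suc k)
 then have "ps ! Suc k \<in> {(fst (ps ! k), snd (ps ! k) + 1), (fst (ps ! k) + 1, snd (ps ! k))}"
  by (simp add: lattice_paths_def)
 then show ?case using Suc by auto
qed

section \<open>Ladders: compatible sets of degrees on the covering lattice\<close>

context weight_type
begin

text \<open>A compatible set of \<open>p + q\<close> degrees, seen as a subset of \<open>Z^2\<close> that is invariant under
 \<open>(p, -q)\<close>, has exactly one point \<open>(a m, a m - m)\<close> on each diagonal. Compatibility says that
 \<open>a\<close> increases by 0 or 1 in each step, and the translation \<open>\<tau>\<close> adds a constant to \<open>a\<close>.\<close>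

definition ladder :: "(int => int) => bool" where
 "ladder a \<longleftrightarrow> (\<forall>m. a (m + int (p + q)) = a m + int p \<and> (a (m + 1) = a m \<or> a (m + 1) = a m + 1))"

text \<open>The point of the ladder on the diagonal where the coordinates differ by
  \<open>i\<close>. Since the relator changes that difference by \<open>p + q\<close>, the indices
  below \<open>p + q\<close> represent all diagonals.\<close>

definition rung :: "(int => int) => nat => int \<times> int" where
 "rung a i = (a (int i), a (int i) - int i)"

lemma ladder_period: assumes a: "ladder a" shows "a (m + k * int (p + q)) = a m + k * int p"
proof (induction k rule: int_induct[where k = 0])
 case (step1 k)
 have "a (m + (k + 1) * int (p + q)) = a ((m + k * int (p + q)) + int (p + q))" by (simp add: algebra_simps)
 also have "\<dots> = a (m + k * int (p + q)) + int p" using a unfolding ladder_def by blast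
 finally show ?case using step1 by (simp add: algebra_simps)
next
 case (step2 k)
 have "a ((m + (k - 1) * int (p + q)) + int (p + q)) = a (m + (k - 1) * int (p + q)) + int p" using a unfolding ladder_def by blast
 moreover have "(m + (k - 1) * int (p + q)) + int (p + q) = m + k * int (p + q)" by (simp add: algebra_simps)
 ultimately show ?case using step2 by (simp add: algebra_simps)
qed simp

lemma ladder_diff: assumes a: "ladder a" and m: "m \<le> m'" shows "a m \<le> a m' \<and> a m' - a m \<le> m' - m"
 using m
proof (induction m' rule: int_ge_induct)
 case (step i)
 then show ?case using a unfolding ladder_def by (smt (verit))
qed simp

text \<open>Reducing the diagonal of \<open>u\<close> modulo \<open>p + q\<close> subtracts a
  multiple of the relator, and by \<open>ladder_period\<close> the set of points on the ladder is
  invariant under this.\<close>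

lemma ladder_mem:
 assumes a: "ladder a"
 shows "(\<exists>i<p + q. D u = D (rung a i)) \<longleftrightarrow> fst u = a (fst u - snd u)"
proof
 assume "\<exists>i<p + q. D u = D (rung a i)"
 then obtain i k where u: "u = rung a i + (k * int p, - (k * int q))" unfolding D_eq_iff by blast
 then have e: "fst u - snd u = int i + k * int (p + q)" by (simp add: rung_def algebra_simps)
 show "fst u = a (fst u - snd u)" unfolding e ladder_period[OF a] using u by (simp add: rung_def)
next
 let ?n = "int (p + q)" and ?m = "fst u - snd u"
 assume u: "fst u = a ?m"
 have n: "?n > 0" using p_pos by simp
 define i where "i = nat (?m mod ?n)"
 have i: "int i = ?m mod ?n" "i < p + q" using n pos_mod_bound[OF n, of ?m] by (simp_all add: i_def nat_less_iff)
 have "?m = int i + (?m div ?n) * ?n" unfolding i(1) by (simp only: mod_div_mult_eq)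
 then have "a ?m = a (int i) + (?m div ?n) * int p" "snd u = fst u - (int i + (?m div ?n) * ?n)"
  using ladder_period[OF a, of "int i" "?m div ?n"] by simp_all
 then have "u = rung a i + ((?m div ?n) * int p, - ((?m div ?n) * int q))"
  using u by (simp add: prod_eq_iff rung_def algebra_simps)
 then show "\<exists>i<p + q. D u = D (rung a i)" using i(2) unfolding D_eq_iff by blast
qed

lemma ladder_inj: assumes a: "ladder a" shows "inj_on (\<lambda>i. D (rung a i)) {..<p + q}"
proof (rule inj_onI)
 fix i j assume ij: "i \<in> {..<p + q}" "j \<in> {..<p + q}" "D (rung a i) = D (rung a j)"
 then obtain k where k: "rung a i = rung a j + (k * int p, - (k * int q))" unfolding D_eq_iff by blast
 then have e: "int i = int j + k * int (p + q)" by (simp add: rung_def algebra_simps)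
 have "int i mod int (p + q) = int j mod int (p + q)" unfolding e by simp
 then show "i = j" using ij by (simp flip: zmod_int)
qed

text \<open>From diagonal \<open>m\<close> to diagonal \<open>m + s - t\<close> a ladder grows by at
  most \<open>s - t\<close> if this is non-negative, and does not grow otherwise; it never grows by
  the full \<open>s\<close>.\<close>

lemma ladder_compat: assumes a: "ladder a" shows "compat (p + q) (rung a)"
 unfolding compat_def
proof (intro allI impI notI)
 fix i j and s t :: int assume st: "s > 0" "t > 0" and "D (rung a i) = D (rung a j + (s, t))"
 then obtain k where k: "rung a i = rung a j + (s, t) + (k * int p, - (k * int q))" unfolding D_eq_iff by blast
 let ?m = "int j + k * int (p + q)"
 have "a (int i) = a ?m + s" "int i = ?m + s - t"
  using k ladder_period[OF a, of "int j" k] by (simp_all add: rung_def algebra_simps)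
 then show False using st ladder_diff[OF a, of "int i" ?m] ladder_diff[OF a, of ?m "int i"] by linarith
qed

text \<open>Two points on one diagonal differ by a multiple of (1, 1), which \<open>compat\<close>
  excludes unless they coincide, so distinct degrees lie on diagonals that differ modulo
  \<open>p + q\<close>. By counting, every residue occurs, which gives exactly one point on each
  diagonal.\<close>

lemma compat_ladder:
 assumes inj: "inj_on (\<lambda>i. D (z i)) {..<p + q}" and c: "compat (p + q) z"
 shows "\<exists>a. ladder a \<and> (\<lambda>i. D (z i)) ` {..<p + q} = (\<lambda>i. D (rung a i)) ` {..<p + q}"
proof -
 let ?n = "p + q"
 let ?v = "\<lambda>k :: int. (k * int p, - (k * int q))"
 define A where "A u \<longleftrightarrow> (\<exists>i<?n. D u = D (z i))" for u
 define d where "d u = fst u - snd u" for u :: "int \<times> int"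
 have cp: "\<not> (s > 0 \<and> t > 0)" if uv: "A u" "A (u + (s, t))" for u s t
 proof
  assume st: "s > 0 \<and> t > 0"
  obtain i j where ij: "i < ?n" "j < ?n" "D u = D (z i)" "D (u + (s, t)) = D (z j)" using uv A_def by blast
  have "D (u + (s, t)) = D (z i + (s, t))" using ij(3) D_add_cancel by blast
  then have "D (z j) = D (z i + (s, t))" using ij(4) by simp
  then show False using c ij(1,2) st unfolding compat_def by blast
 qed
 have uniq: "u = v" if "A u" "A v" "d u = d v" for u v
 proof -
  define t where "t = fst v - fst u"
  have e: "v = u + (t, t)" "u = v + (- t, - t)" using that(3) by (auto simp: d_def t_def prod_eq_iff)
  have "\<not> t > 0" using cp[OF that(1), of t t] that(2) unfolding e(1)[symmetric] by blast
  moreover have "\<not> - t > 0" using cp[OF that(2), of "- t" "- t"] that(1) unfolding e(2)[symmetric] by blast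
  ultimately show ?thesis using e(1) by (simp add: prod_eq_iff)
 qed
 have dv: "d (u + ?v k) = d u + k * int ?n" for u k by (simp add: d_def algebra_simps)
 have per: "A (u + ?v k)" if "A u" for u k
 proof -
  have "D (u + ?v k) = D u" unfolding D_eq_iff by blast
  then show ?thesis using that unfolding A_def by simp
 qed
 have Az: "A (z i)" if "i < ?n" for i using that A_def by blast
 have n: "int ?n > 0" using p_pos by simp
 let ?f = "\<lambda>i. d (z i) mod int ?n"
 have "inj_on ?f {..<?n}"
 proof (rule inj_onI)
  fix i j assume ij: "i \<in> {..<?n}" "j \<in> {..<?n}" "?f i = ?f j"
  then obtain k where "d (z i) = d (z j) + k * int ?n"
   using mod_eqE[of "d (z i)" "int ?n" "d (z j)"] by (metis mult.commute add_diff_cancel_left' diff_add_cancel minus_diff_eq mult_minus_left uminus_add_conv_diff)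
  then have "z i = z j + ?v k" using uniq[OF Az per[OF Az], of i j k] dv ij by simp
  then have "D (z i) = D (z j)" unfolding D_eq_iff by blast
  then show "i = j" using inj_onD[OF inj] ij by blast
 qed
 then have "card (?f ` {..<?n}) = card {0..<int ?n}" by (simp add: card_image)
 moreover have "?f ` {..<?n} \<subseteq> {0..<int ?n}" using n by auto
 ultimately have surj: "?f ` {..<?n} = {0..<int ?n}" by (intro card_subset_eq) simp_all
 have "\<exists>u. A u \<and> d u = m" for m
 proof -
  have "m mod int ?n \<in> ?f ` {..<?n}" unfolding surj using n by simp
  then obtain i where i: "i < ?n" "m mod int ?n = d (z i) mod int ?n" by auto
  have "m = d (z i) + (m div int ?n - d (z i) div int ?n) * int ?n"
   using i(2) div_mult_mod_eq[of m "int ?n"] div_mult_mod_eq[of "d (z i)" "int ?n"] by (simp add: left_diff_distrib)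
  then show ?thesis using per[OF Az[OF i(1)]] dv by metis
 qed
 then obtain U where U: "!!m. A (U m)" "!!m. d (U m) = m" by metis
 define a where "a m = fst (U m)" for m
 have Ua: "U m = (a m, a m - m)" for m using U(2)[of m] by (simp add: a_def d_def prod_eq_iff)
 have AU: "A u \<longleftrightarrow> fst u = a (d u)" for u
 proof
  assume "A u"
  then have "u = U (d u)" using uniq U by metis
  then show "fst u = a (d u)" unfolding a_def by metis
 next
  assume "fst u = a (d u)"
  then have "u = U (d u)" unfolding Ua by (simp add: d_def prod_eq_iff)
  then show "A u" using U(1) by metis
 qed
 have lad: "ladder a"
  unfolding ladder_def
 proof (intro allI conjI)
  fix m
  have "A (U m + ?v 1)" by (rule per[OF U(1)])
  then have "fst (U m + ?v 1) = a (d (U m + ?v 1))" using AU by blast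
  then show "a (m + int ?n) = a m + int p" unfolding dv U(2) by (simp add: Ua)
  define t where "t = a (m + 1) - a m"
  \<comment> \<open>Points on neighbouring diagonals differ by \<open>(t, t - 1)\<close>; the
    directions that \<open>compat\<close> forbids leave \<open>t = 0\<close> and
    \<open>t = 1\<close>.\<close>
  have e: "U (m + 1) = U m + (t, t - 1)" "U m = U (m + 1) + (- t, - t + 1)" by (simp_all add: Ua t_def prod_eq_iff)
  have "\<not> (t > 0 \<and> t - 1 > 0)" using cp[OF U(1)[of m], of t "t - 1"] U(1)[of "m + 1"] unfolding e(1)[symmetric] by blast
  moreover have "\<not> (- t > 0 \<and> - t + 1 > 0)" using cp[OF U(1)[of "m + 1"], of "- t" "- t + 1"] U(1)[of m] unfolding e(2)[symmetric] by blast
  ultimately have "t = 0 \<or> t = 1" by linarith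
  then show "a (m + 1) = a m \<or> a (m + 1) = a m + 1" by (auto simp: t_def)
 qed
 have "D (z i) \<in> (\<lambda>i. D (rung a i)) ` {..<?n}" if "i < ?n" for i
  using ladder_mem[OF lad, of "z i"] AU[of "z i"] Az[OF that] by (auto simp: d_def)
 moreover have "D (rung a i) \<in> (\<lambda>i. D (z i)) ` {..<?n}" if "i < ?n" for i
  using AU[of "rung a i"] by (auto simp: A_def d_def rung_def)
 ultimately show ?thesis using lad by blast
qed

text \<open>The set of degrees of a free module is an isomorphism invariant, and by
  \<open>ladder_mem\<close> it determines the ladder.\<close>

lemma rung_unique:
 assumes a: "ladder a" and b: "ladder b" and i: "isomorphic (cohX p q) (FM (p + q) (rung a) :: ('k::field) sheaf) (FM (p + q) (rung b))"
 shows "a = b"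
proof
 fix m
 let ?u = "(a m, a m - m)"
 obtain i where "i < p + q" "D ?u = D (rung a i)" using ladder_mem[OF a, of ?u] by auto
 moreover from iso_free_degrees[OF i this(1)] obtain j where "j < p + q" "D (rung a i) = D (rung b j)" by blast
 ultimately have "fst ?u = b (fst ?u - snd ?u)" using ladder_mem[OF b, of ?u] by metis
 then show "a m = b m" by simp
qed

text \<open>One period of the ladder in coordinates adapted to lattice paths: an increase of
  \<open>a\<close> becomes a step to the right, a constant stretch a step upwards. Subtracting
  \<open>a 0\<close> moves the start to the origin.\<close>

definition path :: "(int => int) => (int \<times> int) list" where
 "path a = map (\<lambda>k. (a (int k) - a 0, int k - (a (int k) - a 0))) [0..<Suc (p + q)]"

lemma length_path: "length (path a) = Suc (p + q)" and
 path_nth: "k \<le> p + q ==> path a ! k = (a (int k) - a 0, int k - (a (int k) - a 0))"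
 by (simp_all add: path_def del: upt_Suc)

lemma path_in: assumes a: "ladder a" shows "path a \<in> lattice_paths (0, 0) (int p, int q)"
proof -
 have ne: "path a \<noteq> []" using length_path[of a] by auto
 have "a (0 + 1 * int (p + q)) = a 0 + 1 * int p" by (rule ladder_period[OF a])
 then have "last (path a) = (int p, int q)" using ne by (simp add: last_conv_nth length_path path_nth)
 moreover have "hd (path a) = (0, 0)" using ne by (simp add: hd_conv_nth path_nth)
 moreover have "path a ! Suc i \<in> {(fst (path a ! i), snd (path a ! i) + 1), (fst (path a ! i) + 1, snd (path a ! i))}"
  if "Suc i < length (path a)" for i
  using a that unfolding length_path ladder_def by (auto simp: path_nth add.commute[of 1] dest!: spec[of _ "int i"])
 ultimately show ?thesis using ne by (simp add: lattice_paths_def)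
qed

text \<open>A ladder is determined by the increments over one period together with its value at 0,
  and \<open>path\<close> forgets just that value.\<close>

lemma path_eq_iff:
 assumes a: "ladder a" and b: "ladder b"
 shows "path a = path b \<longleftrightarrow> (\<exists>c. b = (\<lambda>m. a m - c))"
proof
 assume e: "path a = path b"
 have "b m = a m - (a 0 - b 0)" for m
 proof -
  let ?n = "int (p + q)"
  have n: "?n > 0" using p_pos by simp
  define i where "i = nat (m mod ?n)"
  have i: "int i = m mod ?n" "i < p + q" using n pos_mod_bound[OF n, of m] by (simp_all add: i_def nat_less_iff)
  have "a (int i) - a 0 = b (int i) - b 0" using arg_cong[OF e, of "\<lambda>ps. fst (ps ! i)"] i(2) by (simp add: path_nth)
  moreover have "m = int i + (m div ?n) * ?n" unfolding i(1) by (simp only: mod_div_mult_eq)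
  ultimately show ?thesis
   using ladder_period[OF a, of "int i" "m div ?n"] ladder_period[OF b, of "int i" "m div ?n"] by simp
 qed
 then show "\<exists>c. b = (\<lambda>m. a m - c)" by blast
qed (auto simp: path_def)

lemma path_surj:
 assumes ps: "ps \<in> lattice_paths (0, 0) (int p, int q)"
 shows "\<exists>a. ladder a \<and> path a = ps"
proof -
 let ?n = "int (p + q)"
 have n: "?n > 0" using p_pos by simp
 have ne: "ps \<noteq> []" and h: "ps ! 0 = (0, 0)" and l: "ps ! (length ps - 1) = (int p, int q)"
  and st: "!!i. Suc i < length ps ==> fst (ps ! Suc i) = fst (ps ! i) \<or> fst (ps ! Suc i) = fst (ps ! i) + 1"
  using ps by (auto simp: lattice_paths_def hd_conv_nth last_conv_nth)
 have sm: "fst (ps ! k) + snd (ps ! k) = int k" if "k < length ps" for k using lattice_paths_sum[OF ps that] by simp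
 have len: "length ps = Suc (p + q)" using sm[of "length ps - 1"] l ne by (cases ps) auto
 then have l: "ps ! (p + q) = (int p, int q)" using l by simp
 \<comment> \<open>The periodic continuation of the first coordinates of the path. At
   \<open>m = p + q\<close> it takes point 0 and adds one period, in agreement with the endpoint of
   the path.\<close>
 define a where "a m = fst (ps ! nat (m mod ?n)) + (m div ?n) * int p" for m
 have al: "a (int k) = fst (ps ! k)" if "k \<le> p + q" for k
 proof (cases "k = p + q")
  case True
  then show ?thesis using n h l by (simp add: a_def)
 next
  case False
  then have "int k mod ?n = int k" "int k div ?n = 0" using that by simp_all
  then show ?thesis by (simp add: a_def)
 qed
 have "ladder a"
  unfolding ladder_def
 proof (intro allI conjI)
  fix m
  have "(m + ?n) mod ?n = m mod ?n" "(m + ?n) div ?n = m div ?n + 1" using n by simp_all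
  then show "a (m + ?n) = a m + int p" unfolding a_def by (simp add: distrib_right)
  define r where "r = nat (m mod ?n)"
  have r: "int r = m mod ?n" "r < p + q" using n pos_mod_bound[OF n, of m] by (simp_all add: r_def nat_less_iff)
  have am: "a m = fst (ps ! r) + (m div ?n) * int p" by (simp add: a_def r_def)
  have "m = int r + (m div ?n) * ?n" unfolding r(1) by (simp only: mod_div_mult_eq)
  then have m1: "m + 1 = int (Suc r) + (m div ?n) * ?n" unfolding of_nat_Suc by linarith
  have s: "fst (ps ! Suc r) = fst (ps ! r) \<or> fst (ps ! Suc r) = fst (ps ! r) + 1" using st[of r] r(2) len by simp
  have per: "a (x + k * ?n) = a x + k * int p" for x k using n by (simp add: a_def distrib_right)
  have "a (m + 1) = a (int (Suc r)) + (m div ?n) * int p" unfolding m1 by (rule per)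
  then have "a (m + 1) = fst (ps ! Suc r) + (m div ?n) * int p" using al[of "Suc r"] r(2) by simp
  then show "a (m + 1) = a m \<or> a (m + 1) = a m + 1" using s am by auto
 qed
 moreover have "path a = ps"
 proof (rule nth_equalityI)
  fix k assume "k < length (path a)"
  then have k: "k \<le> p + q" by (simp add: length_path)
  have "a 0 = 0" using al[of 0] h by simp
  then show "path a ! k = ps ! k" using sm[of k] len k al[OF k] by (simp add: path_nth prod_eq_iff)
 qed (simp add: length_path len)
 ultimately show ?thesis by blast
qed

section \<open>Classes of tilting bundles and their lattice paths\<close>

definition ladder_of :: "('k::field) sheaf => int => int" where
 "ladder_of T = (SOME a. ladder a \<and> isomorphic (cohX p q) T (FM (p + q) (rung a)))"

lemma ladder_of:
 assumes T: "T \<in> tilting_bundles p q"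
 shows "ladder (ladder_of (T :: ('k::alg_closed_field) sheaf)) \<and> isomorphic (cohX p q) T (FM (p + q) (rung (ladder_of T)))"
proof -
 interpret C: category "cohX p q :: ('k sheaf, _) cat" by (rule coh_category)
 from T obtain z where TO: "T \<in> Ob (cohX p q)" and z: "isomorphic (cohX p q) T (FM (p + q) z)"
  "inj_on (\<lambda>i. D (z i)) {..<p + q}" "compat (p + q) z" unfolding tilting_bundle_iff by blast
 obtain a where a: "ladder a" "(\<lambda>i. D (z i)) ` {..<p + q} = (\<lambda>i. D (rung a i)) ` {..<p + q}" using compat_ladder[OF z(2,3)] by blast
 have "isomorphic (cohX p q) T (FM (p + q) (rung a))"
  by (rule C.iso_trans[OF TO FM_Ob FM_Ob z(1) degrees_iso[OF z(2) ladder_inj[OF a(1)] a(2)]])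
 then have "\<exists>a. ladder a \<and> isomorphic (cohX p q) T (FM (p + q) (rung a))" using a(1) by blast
 then show ?thesis unfolding ladder_of_def by (rule someI_ex)
qed

lemma ladder_of_eq:
 assumes T: "T \<in> tilting_bundles p q" and a: "ladder a" and i: "isomorphic (cohX p q) (T :: ('k::alg_closed_field) sheaf) (FM (p + q) (rung a))"
 shows "ladder_of T = a"
proof -
 interpret C: category "cohX p q :: ('k sheaf, _) cat" by (rule coh_category)
 have TO: "T \<in> Ob (cohX p q)" using T tilting_bundle_iff by blast
 note l = ladder_of[OF T]
 show ?thesis
  by (rule rung_unique[OF conjunct1[OF l] a C.iso_trans[OF FM_Ob TO FM_Ob C.iso_sym[OF conjunct2[OF l]] i]])
qed

lemma ladder_tilting: "ladder a ==> (FM (p + q) (rung a) :: ('k::alg_closed_field) sheaf) \<in> tilting_bundles p q"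
 using category.iso_refl[OF coh_category FM_Ob] ladder_inj ladder_compat FM_Ob unfolding tilting_bundle_iff by blast

text \<open>The k-th power of the inverse translation subtracts \<open>(k, k)\<close> from all
  degrees. This preserves every diagonal and lowers the ladder by the constant \<open>k\<close>, and
  \<open>path\<close> is blind to exactly such constants.\<close>

lemma tau_equiv_iff:
 "(T, T') \<in> tau_equiv p q \<longleftrightarrow> T \<in> tilting_bundles p q \<and> (T' :: ('k::alg_closed_field) sheaf) \<in> tilting_bundles p q \<and>
  path (ladder_of T) = path (ladder_of T')"
proof -
 interpret C: category "cohX p q :: ('k sheaf, _) cat" by (rule coh_category)
 have iso: "isomorphic (cohX p q) T' (tau_power p q (- k) T) \<longleftrightarrow> ladder_of T' = (\<lambda>m. ladder_of T m - k)"
  if T: "T \<in> tilting_bundles p q" and T': "T' \<in> tilting_bundles p q" for k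
 proof -
  let ?a = "\<lambda>m. ladder_of T m - k"
  have O: "T \<in> Ob (cohX p q)" "T' \<in> Ob (cohX p q)" using T T' tilting_bundle_iff by blast+
  note l = ladder_of[OF T] and l' = ladder_of[OF T']
  have tp: "tau_power p q (- k) M = gshift p q (D (k, k)) M" for M :: "'k sheaf"
   by (simp add: tau_power_def vomega_pow)
  interpret T: obj p q T using O(1) by (simp add: Ob_iff)
  have sO: "tau_power p q (- k) T \<in> Ob (cohX p q)" unfolding tp Ob_iff by (rule T.gshift_obj)
  have "(\<lambda>i. rung (ladder_of T) i - (k, k)) = rung ?a" by (auto simp: rung_def)
  then have s: "isomorphic (cohX p q) (tau_power p q (- k) T) (FM (p + q) (rung ?a))"
   using gshift_isomorphic[OF O(1) FM_Ob conjunct2[OF l], of "(k, k)"] unfolding tp gshift_FM by simp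
  have la: "ladder ?a" using conjunct1[OF l] by (auto simp: ladder_def)
  show ?thesis
  proof
   assume "isomorphic (cohX p q) T' (tau_power p q (- k) T)"
   from ladder_of_eq[OF T' la C.iso_trans[OF O(2) sO FM_Ob this s]] show "ladder_of T' = ?a" .
  next
   assume "ladder_of T' = ?a"
   then have "isomorphic (cohX p q) T' (FM (p + q) (rung ?a))" using l' by simp
   then show "isomorphic (cohX p q) T' (tau_power p q (- k) T)" by (rule C.iso_trans[OF O(2) FM_Ob sO _ C.iso_sym[OF s]])
  qed
 qed
 show ?thesis
 proof (cases "T \<in> tilting_bundles p q \<and> T' \<in> tilting_bundles p q")
  case True
  note t = conjunct1[OF True] conjunct2[OF True]
  have "(T, T') \<in> tau_equiv p q \<longleftrightarrow> (\<exists>k. isomorphic (cohX p q) T' (tau_power p q (- k) T))"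
   using t by (simp add: tau_equiv_def)
  also have "\<dots> \<longleftrightarrow> path (ladder_of T) = path (ladder_of T')"
   unfolding iso[OF t] path_eq_iff[OF conjunct1[OF ladder_of[OF t(1)]] conjunct1[OF ladder_of[OF t(2)]]] ..
  finally show ?thesis using t by simp
 next
  case False
  then show ?thesis unfolding tau_equiv_def by blast
 qed
qed

text \<open>The path is constant on classes and separates them, so it can be evaluated on an
  arbitrary representative. Surjectivity comes from the free module whose degrees are the rungs of a
  given ladder.\<close>

lemma bij_tau_classes:
 "bij_betw (\<lambda>c. path (ladder_of (SOME T. T \<in> c))) (tau_classes p q :: ('k::alg_closed_field) sheaf set set)
  (lattice_paths (0, 0) (int p, int q))" (is "bij_betw ?g ?A ?B")
proof -
 let ?f = "\<lambda>T :: 'k sheaf. path (ladder_of T)"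
 have cl: "\<exists>T\<in>tilting_bundles p q. c = {T' \<in> tilting_bundles p q. ?f T' = ?f T} \<and> ?f (SOME T. T \<in> c) = ?f T"
  if c: "c \<in> tau_classes p q" for c
 proof -
  from c[unfolded tau_classes_def] obtain T where T: "c = tau_equiv p q `` {T}" "T \<in> tilting_bundles p q" by (rule quotientE)
  then have c': "c = {T' \<in> tilting_bundles p q. ?f T' = ?f T}" by (auto simp: tau_equiv_iff)
  then have "(SOME T. T \<in> c) \<in> c" using T(2) someI[of "\<lambda>T. T \<in> c" T] by simp
  then show ?thesis using T(2) c' by blast
 qed
 show ?thesis
 proof (rule bij_betw_imageI)
  show "inj_on ?g ?A"
  proof (rule inj_onI)
   fix c c' assume c: "c \<in> ?A" "c' \<in> ?A" "?g c = ?g c'"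
   from cl[OF c(1)] obtain T where T: "c = {T' \<in> tilting_bundles p q. ?f T' = ?f T}" "?g c = ?f T" by (elim bexE conjE)
   from cl[OF c(2)] obtain T1 where T1: "c' = {T' \<in> tilting_bundles p q. ?f T' = ?f T1}" "?g c' = ?f T1" by (elim bexE conjE)
   have "?f T = ?f T1" using c(3) unfolding T(2) T1(2) .
   then show "c = c'" by (subst T(1), subst T1(1)) simp
  qed
  show "?g ` ?A = ?B"
 proof (intro equalityI subsetI)
  fix ps assume "ps \<in> ?g ` ?A"
  then obtain c where "ps = ?g c" "c \<in> ?A" by (rule imageE)
  from cl[OF this(2)] obtain T where T: "T \<in> tilting_bundles p q" "?g c = ?f T" by (elim bexE conjE)
  have "ps = ?f T" unfolding \<open>ps = ?g c\<close> by (rule T(2))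
  then show "ps \<in> lattice_paths (0, 0) (int p, int q)" using path_in[OF conjunct1[OF ladder_of[OF T(1)]]] by simp
 next
  fix ps assume "ps \<in> lattice_paths (0, 0) (int p, int q)"
  then obtain a where a: "ladder a" "path a = ps" using path_surj by blast
  let ?T = "FM (p + q) (rung a) :: 'k sheaf"
  have T: "?T \<in> tilting_bundles p q" by (rule ladder_tilting[OF a(1)])
  have lT: "ladder_of ?T = a" by (rule ladder_of_eq[OF T a(1) category.iso_refl[OF coh_category FM_Ob]])
  let ?c = "tau_equiv p q `` {?T}"
  have c: "?c \<in> tau_classes p q" unfolding tau_classes_def by (rule quotientI[OF T])
  have "?T \<in> ?c" using T by (simp add: tau_equiv_iff)
  then have "(SOME T. T \<in> ?c) \<in> ?c" by (rule someI)
  then have "?f ?T = ?g ?c" unfolding Image_singleton_iff tau_equiv_iff by (elim conjE)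
  then have "ps = ?g ?c" unfolding lT a(2) .
  then show "ps \<in> ?g ` ?A" using c by (rule image_eqI)
 qed
 qed
qed

end

theorem theorem1p3:
  fixes p q :: nat
  assumes "p > 0" and "q > 0"
  shows "(\<exists>\<Phi>. bij_betw \<Phi> (tau_classes p q :: ('k::alg_closed_field) sheaf set set)
                (lattice_paths (0, 0) (int p, int q))) \<and>
         card (tau_classes p q :: 'k sheaf set set) = (p + q) choose p"
proof -
  interpret weight_type p q using assms by unfold_locales
  have b: "bij_betw (\<lambda>c. path (ladder_of (SOME T. T \<in> c))) (tau_classes p q :: 'k sheaf set set)
      (lattice_paths (0, 0) (int p, int q))" by (rule bij_tau_classes)
  have "card (lattice_paths (0, 0) (int p, int q)) = (p + q) choose p"
    using card_lattice_paths[of "(0, 0)" p q] by simp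
  then show ?thesis using b bij_betw_same_card[OF b] by metis
qed

end
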